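(* (1) Let $(\mathcal{A},\mathcal{M})$ be a $\mathbb{Z}_2$-monoidal pair. Any two parallel structural isomorphisms in $\mathcal{A}$ (or in $\mathcal{M}$) are equal; i.e. every coherence diagram commutes. (2) Let $(\mathcal{A},\mathcal{M})$ be a $\mathbb{Z}_2$-braided pair, and let $f,g:T_1\Rightarrow T_2$ be parallel structural isomorphisms in $\mathcal{A}$ (respectively in $\mathcal{M}$) with underlying braids $\beta_f,\beta_g$ (respectively underlying cylinder braids). If $\beta_f=\beta_g$ then $f=g$. (3) Let $(\mathcal{A},\mathcal{M})$ be a $\mathbb{Z}_2$-symmetric pair. Any two parallel structural isomorphisms in $\mathcal{A}$ (or in $\mathcal{M}$) are equal.
   Context: **Pairs.** Conventions: in a monoidal category $\alpha_{X,Y,Z}:(X\otimes Y)\otimes Z\cong X\otimes(Y\otimes Z)$, $\lambda_X:\mathbf 1\otimes X\cong X$, $\rho_X:X\otimes\mathbf 1\cong X$; a monoidal functor $\Psi$ carries isomorphisms $\Psi_2:\Psi(X)\otimes\Psi(Y)\cong\Psi(X\otimes Y)$, $\Psi_0:\Psi(\mathbf 1)\cong\mathbf 1$; $\mathcal{A}^{\otimes\text{-op}}$ is $\mathcal{A}$ with reversed tensor product; a right $\mathcal{A}$-module category $\mathcal{M}$ has action functor $\mathrm{act}:(M,X)\mapsto M\otimes X$ and isomorphisms $a_{M,X,Y}:(M\otimes X)\otimes Y\cong M\otimes(X\otimes Y)$, $r_M:M\otimes\mathbf 1\cong M$ with the usual axioms. An *anti-involution* of $\mathcal{A}$ is a monoidal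 functor $\Phi:\mathcal{A}\to\mathcal{A}^{\otimes\text{-op}}$ (so $\Phi_2:\Phi(Y)\otimes\Phi(X)\cong\Phi(X\otimes Y)$) with a monoidal isomorphism $t:\Phi^2\Rightarrow\mathrm{id}_{\mathcal{A}}$ with $\Phi(t_X)=t_{\Phi(X)}$. A *$\mathbb{Z}_2$-monoidal pair* $(\mathcal{A},\mathcal{M})$: a monoidal category $\mathcal{A}$ with an anti-involution, and a right $\mathcal{A}$-module category $\mathcal{M}$ with a distinguished object. A *$\mathbb{Z}_2$-braided pair*: a $\mathbb{Z}_2$-monoidal pair with a braiding $\sigma_{X,Y}:X\otimes Y\to Y\otimes X$ on $\mathcal{A}$ such that $\Phi$ is braided, i.e. $\Phi(\sigma_{X,Y})\circ\Phi_2=\Phi_2\circ\sigma_{\Phi(Y),\Phi(X)}$, and natural isomorphisms $\kappa_{M,X}:M\otimes X\to M\otimes\Phi(X)$ satisfying (associativity isomorphisms suppressed): (BP1) $\kappa_{M\otimes X,Y}=(\mathrm{id}_M\otimes\sigma_{\Phi(Y),X})\circ(\kappa_{M,Y}\otimes\mathrm{id}_X)\circ(\mathrm{id}_M\otimes\sigma_{X,Y})$; (BP2) $\kappa_{M,X\otimes Y}=(\mathrm{id}_M\otimes\Phi_2)\circ(\kappa_{M,Y}\otimes\mathrm{id}_{\Phi(X)})\circ(\mathrm{id}_M\otimes\sigma_{\Phi(X),Y})\circ(\kappa_{M,X}\otimes\mathrm{id}_Y)$. A *$\mathbb{Z}_2$-symmetric pair*: a $\mathbb{Z}_2$-braided pair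 with $\sigma_{Y,X}\circ\sigma_{X,Y}=\mathrm{id}$ and $\kappa_{M,\Phi(X)}\circ\kappa_{M,X}=\mathrm{id}$ (identifying $\Phi^2(X)$ with $X$ by $t$). **Structural isomorphisms.** A structural isomorphism in $\mathcal{A}$ is a natural isomorphism presented as a (formal) vertical and horizontal composition of $\mathrm{id}_{\mathrm{id}_{\mathcal{A}}},\mathrm{id}_\otimes,\mathrm{id}_\Phi,\alpha,\lambda,\rho,\Phi_2,\Phi_0,t$, in the braided and symmetric cases also $\sigma$, and their inverses; one in $\mathcal{M}$ may in addition use $\mathrm{id}_{\mathrm{id}_{\mathcal{M}}},\mathrm{id}_{\mathrm{act}},a,r$ and, in the braided and symmetric cases, $\kappa$, and inverses. Its source and target are functors $\mathcal{A}^{\times n}\to\mathcal{A}$ (resp. $\mathcal{M}\times\mathcal{A}^{\times n}\to\mathcal{M}$) given as formal composites of $\otimes,\Phi,\mathbf 1$ (and $\mathrm{act}$), each variable occurring once. Two structural isomorphisms are parallel if they have the same source and the same target as formal composites. **Underlying braids.** $B_n$ is Artin's braid group with generators $\sigma_1,\dots,\sigma_{n-1}$. The cylinder braid group $B_n^{\mathrm{cyl}}$ has generators $\sigma_1,\dots,\sigma_{n-1},\kappa$, the braid relations for the $\sigma_i$, $\sigma_1\kappa\sigma_1\kappa=\kappa\sigma_1\kappa\sigma_1$, and $\sigma_i\kappa=\kappa\sigma_i$ for $i>1$. The underlying braid $\beta_f\in B_n$ (resp. $\in B_n^{\mathrm{cyl}}$) of a presented structural isomorphism in $\mathcal{A}$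 (resp. $\mathcal{M}$) is obtained by reading instances of $\sigma$ as simple braids and of $\kappa$ as the generator $\kappa$ (strand 1 being the one next to $M$), all other constituents as trivial, and doubling strands for instances of $\id_\otimes$, where $\id_\otimes$ denotes the identity transformation of $\otimes$ (and deleting strands for units). Strand positions are read after distributing $\Phi$ over $\otimes$ with reversal of order, and cabling is such that the two sides of the hexagon axioms, BP1 and BP2 have the same underlying braid (e.g. $\kappa_{M,X\otimes Y}$ has underlying braid $\kappa\sigma_1\kappa$). *)

theory Defs
  imports Main
begin

section \<open>Categories, functors, natural isomorphisms\<close>

record ('o, 'a) cat =
  Ob  :: "'o set"
  Ar  :: "'a set"
  dm  :: "'a \<Rightarrow> 'o"
  cd  :: "'a \<Rightarrow> 'o"
  ide :: "'o \<Rightarrow> 'a"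
  cmp :: "'a \<Rightarrow> 'a \<Rightarrow> 'a"  (infixr "\<cdot>\<index>" 55)

definition hom :: "('o, 'a, 'z) cat_scheme \<Rightarrow> 'o \<Rightarrow> 'o \<Rightarrow> 'a set" where
  "hom C X Y = {f \<in> Ar C. dm C f = X \<and> cd C f = Y}"

locale category =
  fixes C :: "('o, 'a, 'z) cat_scheme" (structure)
  assumes dm_cd: "f \<in> Ar C \<Longrightarrow> dm C f \<in> Ob C \<and> cd C f \<in> Ob C"
    and ide_hom: "X \<in> Ob C \<Longrightarrow> ide C X \<in> hom C X X"
    and cmp_hom: "\<lbrakk>f \<in> hom C X Y; g \<in> hom C Y Z\<rbrakk> \<Longrightarrow> g \<cdot> f \<in> hom C X Z"
    and cmp_ide: "f \<in> hom C X Y \<Longrightarrow> f \<cdot> ide C X = f \<and> ide C Y \<cdot> f = f"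
    and cmp_assoc: "\<lbrakk>f \<in> hom C X Y; g \<in> hom C Y Z; h \<in> hom C Z W\<rbrakk>
                    \<Longrightarrow> (h \<cdot> g) \<cdot> f = h \<cdot> (g \<cdot> f)"

definition inverse_arrows :: "('o, 'a, 'z) cat_scheme \<Rightarrow> 'a \<Rightarrow> 'a \<Rightarrow> bool" where
  "inverse_arrows C f g \<longleftrightarrow> f \<in> Ar C \<and> g \<in> hom C (cd C f) (dm C f) \<and>
     g \<cdot>\<^bsub>C\<^esub> f = ide C (dm C f) \<and> f \<cdot>\<^bsub>C\<^esub> g = ide C (cd C f)"

definition iso :: "('o, 'a, 'z) cat_scheme \<Rightarrow> 'a \<Rightarrow> bool" where
  "iso C f \<longleftrightarrow> (\<exists>g. inverse_arrows C f g)"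

definition inv_arrow :: "('o, 'a, 'z) cat_scheme \<Rightarrow> 'a \<Rightarrow> 'a" where
  "inv_arrow C f = (THE g. inverse_arrows C f g)"

definition prod_cat :: "('o, 'a, 'y) cat_scheme \<Rightarrow> ('p, 'b, 'z) cat_scheme \<Rightarrow>
    ('o \<times> 'p, 'a \<times> 'b) cat"  (infixr "\<times>\<^sub>c" 80) where
  "C \<times>\<^sub>c D = \<lparr>Ob = Ob C \<times> Ob D, Ar = Ar C \<times> Ar D,
     dm = map_prod (dm C) (dm D), cd = map_prod (cd C) (cd D),
     ide = map_prod (ide C) (ide D),
     cmp = (\<lambda>(g, g') (f, f'). (g \<cdot>\<^bsub>C\<^esub> f, g' \<cdot>\<^bsub>D\<^esub> f'))\<rparr>"

definition is_functor :: "('o, 'a, 'y) cat_scheme \<Rightarrow> ('p, 'b, 'z) cat_scheme \<Rightarrow>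
    ('o \<Rightarrow> 'p) \<Rightarrow> ('a \<Rightarrow> 'b) \<Rightarrow> bool" where
  "is_functor C D Fo Fa \<longleftrightarrow>
     (\<forall>X \<in> Ob C. Fo X \<in> Ob D \<and> Fa (ide C X) = ide D (Fo X)) \<and>
     (\<forall>X Y. \<forall>f \<in> hom C X Y. Fa f \<in> hom D (Fo X) (Fo Y)) \<and>
     (\<forall>X Y Z. \<forall>f \<in> hom C X Y. \<forall>g \<in> hom C Y Z. Fa (g \<cdot>\<^bsub>C\<^esub> f) = Fa g \<cdot>\<^bsub>D\<^esub> Fa f)"

definition nat_iso :: "('o, 'a, 'y) cat_scheme \<Rightarrow> ('p, 'b, 'z) cat_scheme \<Rightarrow>
    ('o \<Rightarrow> 'p) \<Rightarrow> ('a \<Rightarrow> 'b) \<Rightarrow> ('o \<Rightarrow> 'p) \<Rightarrow> ('a \<Rightarrow> 'b) \<Rightarrow> ('o \<Rightarrow> 'b) \<Rightarrow> bool" where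
  "nat_iso C D Fo Fa Go Ga \<eta> \<longleftrightarrow>
     (\<forall>X \<in> Ob C. \<eta> X \<in> hom D (Fo X) (Go X) \<and> iso D (\<eta> X)) \<and>
     (\<forall>X Y. \<forall>f \<in> hom C X Y. \<eta> Y \<cdot>\<^bsub>D\<^esub> Fa f = Ga f \<cdot>\<^bsub>D\<^esub> \<eta> X)"


section \<open>Monoidal categories and monoidal functors\<close>

record ('o, 'a) moncat = "('o, 'a) cat" +
  ten_ob :: "'o \<Rightarrow> 'o \<Rightarrow> 'o"  (infixr "\<otimes>\<index>" 70)
  ten_ar :: "'a \<Rightarrow> 'a \<Rightarrow> 'a"  (infixr "\<boxtimes>\<index>" 70)
  unit :: "'o"  ("\<one>\<index>")
  asc :: "'o \<Rightarrow> 'o \<Rightarrow> 'o \<Rightarrow> 'a"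
  lun :: "'o \<Rightarrow> 'a"
  run :: "'o \<Rightarrow> 'a"

locale monoidal_category = category A
  for A :: "('o, 'a, 'z) moncat_scheme" (structure) +
  assumes ten_functor: "is_functor (A \<times>\<^sub>c A) A (\<lambda>(X, Y). X \<otimes> Y) (\<lambda>(f, g). f \<boxtimes> g)"
    and unit_ob: "\<one> \<in> Ob A"
    and asc_nat_iso: "nat_iso (A \<times>\<^sub>c A \<times>\<^sub>c A) A
          (\<lambda>(X, Y, Z). (X \<otimes> Y) \<otimes> Z) (\<lambda>(f, g, h). (f \<boxtimes> g) \<boxtimes> h)
          (\<lambda>(X, Y, Z). X \<otimes> (Y \<otimes> Z)) (\<lambda>(f, g, h). f \<boxtimes> (g \<boxtimes> h))
          (\<lambda>(X, Y, Z). asc A X Y Z)"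
    and lun_nat_iso: "nat_iso A A (\<lambda>X. \<one> \<otimes> X) (\<lambda>f. ide A \<one> \<boxtimes> f) (\<lambda>X. X) (\<lambda>f. f) (lun A)"
    and run_nat_iso: "nat_iso A A (\<lambda>X. X \<otimes> \<one>) (\<lambda>f. f \<boxtimes> ide A \<one>) (\<lambda>X. X) (\<lambda>f. f) (run A)"
    and pentagon: "\<lbrakk>X \<in> Ob A; Y \<in> Ob A; Z \<in> Ob A; W \<in> Ob A\<rbrakk> \<Longrightarrow>
          asc A X Y (Z \<otimes> W) \<cdot> asc A (X \<otimes> Y) Z W
          = (ide A X \<boxtimes> asc A Y Z W) \<cdot> asc A X (Y \<otimes> Z) W \<cdot> (asc A X Y Z \<boxtimes> ide A W)"
    and triangle: "\<lbrakk>X \<in> Ob A; Y \<in> Ob A\<rbrakk> \<Longrightarrow>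
          (ide A X \<boxtimes> lun A Y) \<cdot> asc A X \<one> Y = run A X \<boxtimes> ide A Y"

definition tensor_op :: "('o, 'a, 'z) moncat_scheme \<Rightarrow> ('o, 'a, 'z) moncat_scheme" where
  "tensor_op A = A\<lparr>ten_ob := (\<lambda>X Y. Y \<otimes>\<^bsub>A\<^esub> X), ten_ar := (\<lambda>f g. g \<boxtimes>\<^bsub>A\<^esub> f),
     asc := (\<lambda>X Y Z. inv_arrow A (asc A Z Y X)), lun := run A, run := lun A\<rparr>"

record ('o, 'a, 'p, 'b) mfun =
  F_ob :: "'o \<Rightarrow> 'p"
  F_ar :: "'a \<Rightarrow> 'b"
  F_two :: "'o \<Rightarrow> 'o \<Rightarrow> 'b"
  F_zero :: "'b"

text \<open>Note the direction \<open>F(\<one>) \<rightarrow> \<one>\<close> of the unit constraint \<open>F_zero\<close>.\<close>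

locale monoidal_functor =
  fixes A :: "('o, 'a, 'y) moncat_scheme" and B :: "('p, 'b, 'z) moncat_scheme"
    and F :: "('o, 'a, 'p, 'b) mfun"
  assumes F_functor: "is_functor A B (F_ob F) (F_ar F)"
    and F_two_nat_iso: "nat_iso (A \<times>\<^sub>c A) B
          (\<lambda>(X, Y). F_ob F X \<otimes>\<^bsub>B\<^esub> F_ob F Y) (\<lambda>(f, g). F_ar F f \<boxtimes>\<^bsub>B\<^esub> F_ar F g)
          (\<lambda>(X, Y). F_ob F (X \<otimes>\<^bsub>A\<^esub> Y)) (\<lambda>(f, g). F_ar F (f \<boxtimes>\<^bsub>A\<^esub> g))
          (\<lambda>(X, Y). F_two F X Y)"
    and F_zero_iso: "F_zero F \<in> hom B (F_ob F \<one>\<^bsub>A\<^esub>) \<one>\<^bsub>B\<^esub>" "iso B (F_zero F)"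
    and F_asc: "\<lbrakk>X \<in> Ob A; Y \<in> Ob A; Z \<in> Ob A\<rbrakk> \<Longrightarrow>
          F_ar F (asc A X Y Z) \<cdot>\<^bsub>B\<^esub> F_two F (X \<otimes>\<^bsub>A\<^esub> Y) Z
            \<cdot>\<^bsub>B\<^esub> (F_two F X Y \<boxtimes>\<^bsub>B\<^esub> ide B (F_ob F Z))
          = F_two F X (Y \<otimes>\<^bsub>A\<^esub> Z) \<cdot>\<^bsub>B\<^esub> (ide B (F_ob F X) \<boxtimes>\<^bsub>B\<^esub> F_two F Y Z)
            \<cdot>\<^bsub>B\<^esub> asc B (F_ob F X) (F_ob F Y) (F_ob F Z)"
    and F_lun: "X \<in> Ob A \<Longrightarrow>
          F_ar F (lun A X) \<cdot>\<^bsub>B\<^esub> F_two F \<one>\<^bsub>A\<^esub> X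
          = lun B (F_ob F X) \<cdot>\<^bsub>B\<^esub> (F_zero F \<boxtimes>\<^bsub>B\<^esub> ide B (F_ob F X))"
    and F_run: "X \<in> Ob A \<Longrightarrow>
          F_ar F (run A X) \<cdot>\<^bsub>B\<^esub> F_two F X \<one>\<^bsub>A\<^esub>
          = run B (F_ob F X) \<cdot>\<^bsub>B\<^esub> (ide B (F_ob F X) \<boxtimes>\<^bsub>B\<^esub> F_zero F)"

definition id_mfun :: "('o, 'a, 'z) moncat_scheme \<Rightarrow> ('o, 'a, 'o, 'a) mfun" where
  "id_mfun A = \<lparr>F_ob = (\<lambda>X. X), F_ar = (\<lambda>f. f),
     F_two = (\<lambda>X Y. ide A (X \<otimes>\<^bsub>A\<^esub> Y)), F_zero = ide A \<one>\<^bsub>A\<^esub>\<rparr>"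

text \<open>The composite \<open>G \<circ> F\<close>, for \<open>G\<close> with values in the monoidal category \<open>D\<close>.\<close>

definition comp_mfun :: "('q, 'c, 'z) moncat_scheme \<Rightarrow> ('p, 'b, 'q, 'c) mfun \<Rightarrow>
    ('o, 'a, 'p, 'b) mfun \<Rightarrow> ('o, 'a, 'q, 'c) mfun" where
  "comp_mfun D G F = \<lparr>F_ob = F_ob G \<circ> F_ob F, F_ar = F_ar G \<circ> F_ar F,
     F_two = (\<lambda>X Y. F_ar G (F_two F X Y) \<cdot>\<^bsub>D\<^esub> F_two G (F_ob F X) (F_ob F Y)),
     F_zero = F_zero G \<cdot>\<^bsub>D\<^esub> F_ar G (F_zero F)\<rparr>"

text \<open>A monoidal functor \<open>A \<rightarrow> B\<close>, seen as a monoidal functor between the categories with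
  reversed tensor products.\<close>

definition op_mfun :: "('o, 'a, 'p, 'b) mfun \<Rightarrow> ('o, 'a, 'p, 'b) mfun" where
  "op_mfun F = F\<lparr>F_two := (\<lambda>X Y. F_two F Y X)\<rparr>"

definition monoidal_nat_iso :: "('o, 'a, 'y) moncat_scheme \<Rightarrow> ('p, 'b, 'z) moncat_scheme \<Rightarrow>
    ('o, 'a, 'p, 'b) mfun \<Rightarrow> ('o, 'a, 'p, 'b) mfun \<Rightarrow> ('o \<Rightarrow> 'b) \<Rightarrow> bool" where
  "monoidal_nat_iso A B F G \<eta> \<longleftrightarrow>
     nat_iso A B (F_ob F) (F_ar F) (F_ob G) (F_ar G) \<eta> \<and>
     (\<forall>X \<in> Ob A. \<forall>Y \<in> Ob A.
        \<eta> (X \<otimes>\<^bsub>A\<^esub> Y) \<cdot>\<^bsub>B\<^esub> F_two F X Y = F_two G X Y \<cdot>\<^bsub>B\<^esub> (\<eta> X \<boxtimes>\<^bsub>B\<^esub> \<eta> Y)) \<and>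
     F_zero G \<cdot>\<^bsub>B\<^esub> \<eta> \<one>\<^bsub>A\<^esub> = F_zero F"


section \<open>Pairs\<close>

record ('o, 'a) inv_moncat = "('o, 'a) moncat" +
  Phi :: "('o, 'a, 'o, 'a) mfun"
  tinv :: "'o \<Rightarrow> 'a"

abbreviation Phi_ob :: "('o, 'a, 'z) inv_moncat_scheme \<Rightarrow> 'o \<Rightarrow> 'o" ("\<Phi>\<index>") where
  "Phi_ob A \<equiv> F_ob (Phi A)"
abbreviation Phi_ar :: "('o, 'a, 'z) inv_moncat_scheme \<Rightarrow> 'a \<Rightarrow> 'a" where
  "Phi_ar A \<equiv> F_ar (Phi A)"
abbreviation Phi_two :: "('o, 'a, 'z) inv_moncat_scheme \<Rightarrow> 'o \<Rightarrow> 'o \<Rightarrow> 'a" where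
  "Phi_two A \<equiv> F_two (Phi A)"
abbreviation Phi_zero :: "('o, 'a, 'z) inv_moncat_scheme \<Rightarrow> 'a" where
  "Phi_zero A \<equiv> F_zero (Phi A)"

text \<open>\<open>\<Phi>\<^sup>2\<close> is the composite of \<open>\<Phi> : A \<rightarrow> A\<^sup>o\<^sup>p\<close> and \<open>\<Phi> : A\<^sup>o\<^sup>p \<rightarrow> A\<close>, where \<open>op\<close> reverses the
  tensor product only.\<close>

locale anti_involution = monoidal_category A
  for A :: "('o, 'a, 'z) inv_moncat_scheme" (structure) +
  assumes Phi_monoidal: "monoidal_functor A (tensor_op A) (Phi A)"
    and t_monoidal: "monoidal_nat_iso A A (comp_mfun A (op_mfun (Phi A)) (Phi A)) (id_mfun A) (tinv A)"
    and Phi_t: "X \<in> Ob A \<Longrightarrow> Phi_ar A (tinv A X) = tinv A (\<Phi> X)"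

record ('p, 'b, 'o, 'a) modcat = "('p, 'b) cat" +
  act_ob :: "'p \<Rightarrow> 'o \<Rightarrow> 'p"  (infixl "\<triangleleft>\<index>" 70)
  act_ar :: "'b \<Rightarrow> 'a \<Rightarrow> 'b"  (infixl "\<unlhd>\<index>" 70)
  mas :: "'p \<Rightarrow> 'o \<Rightarrow> 'o \<Rightarrow> 'b"
  mun :: "'p \<Rightarrow> 'b"
  pt :: "'p"

locale right_module_category = monoidal_category A + M: category M
  for A :: "('o, 'a, 'y) moncat_scheme" (structure)
    and M :: "('p, 'b, 'o, 'a, 'z) modcat_scheme" +
  assumes act_functor: "is_functor (M \<times>\<^sub>c A) M
          (\<lambda>(P, X). P \<triangleleft>\<^bsub>M\<^esub> X) (\<lambda>(u, f). u \<unlhd>\<^bsub>M\<^esub> f)"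
    and mas_nat_iso: "nat_iso (M \<times>\<^sub>c A \<times>\<^sub>c A) M
          (\<lambda>(P, X, Y). (P \<triangleleft>\<^bsub>M\<^esub> X) \<triangleleft>\<^bsub>M\<^esub> Y) (\<lambda>(u, f, g). (u \<unlhd>\<^bsub>M\<^esub> f) \<unlhd>\<^bsub>M\<^esub> g)
          (\<lambda>(P, X, Y). P \<triangleleft>\<^bsub>M\<^esub> (X \<otimes> Y)) (\<lambda>(u, f, g). u \<unlhd>\<^bsub>M\<^esub> (f \<boxtimes> g))
          (\<lambda>(P, X, Y). mas M P X Y)"
    and mun_nat_iso: "nat_iso M M (\<lambda>P. P \<triangleleft>\<^bsub>M\<^esub> \<one>) (\<lambda>u. u \<unlhd>\<^bsub>M\<^esub> ide A \<one>) (\<lambda>P. P) (\<lambda>u. u) (mun M)"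
    and module_pentagon: "\<lbrakk>P \<in> Ob M; X \<in> Ob A; Y \<in> Ob A; Z \<in> Ob A\<rbrakk> \<Longrightarrow>
          mas M P X (Y \<otimes> Z) \<cdot>\<^bsub>M\<^esub> mas M (P \<triangleleft>\<^bsub>M\<^esub> X) Y Z
          = (ide M P \<unlhd>\<^bsub>M\<^esub> asc A X Y Z) \<cdot>\<^bsub>M\<^esub> mas M P (X \<otimes> Y) Z
            \<cdot>\<^bsub>M\<^esub> (mas M P X Y \<unlhd>\<^bsub>M\<^esub> ide A Z)"
    and module_triangle: "\<lbrakk>P \<in> Ob M; X \<in> Ob A\<rbrakk> \<Longrightarrow>
          (ide M P \<unlhd>\<^bsub>M\<^esub> lun A X) \<cdot>\<^bsub>M\<^esub> mas M P \<one> X = mun M P \<unlhd>\<^bsub>M\<^esub> ide A X"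

locale Z2_monoidal_pair = anti_involution A + right_module_category A M
  for A :: "('o, 'a, 'y) inv_moncat_scheme" (structure)
    and M :: "('p, 'b, 'o, 'a, 'z) modcat_scheme" +
  assumes pt_ob: "pt M \<in> Ob M"

locale Z2_braided_pair = Z2_monoidal_pair A M
  for A :: "('o, 'a, 'y) inv_moncat_scheme" (structure)
    and M :: "('p, 'b, 'o, 'a, 'z) modcat_scheme" +
  fixes \<sigma> :: "'o \<Rightarrow> 'o \<Rightarrow> 'a" and \<kappa> :: "'p \<Rightarrow> 'o \<Rightarrow> 'b"
  assumes \<sigma>_nat_iso: "nat_iso (A \<times>\<^sub>c A) A
          (\<lambda>(X, Y). X \<otimes> Y) (\<lambda>(f, g). f \<boxtimes> g) (\<lambda>(X, Y). Y \<otimes> X) (\<lambda>(f, g). g \<boxtimes> f)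
          (\<lambda>(X, Y). \<sigma> X Y)"
    and hexagon1: "\<lbrakk>X \<in> Ob A; Y \<in> Ob A; Z \<in> Ob A\<rbrakk> \<Longrightarrow>
          asc A Y Z X \<cdot> \<sigma> X (Y \<otimes> Z) \<cdot> asc A X Y Z
          = (ide A Y \<boxtimes> \<sigma> X Z) \<cdot> asc A Y X Z \<cdot> (\<sigma> X Y \<boxtimes> ide A Z)"
    and hexagon2: "\<lbrakk>X \<in> Ob A; Y \<in> Ob A; Z \<in> Ob A\<rbrakk> \<Longrightarrow>
          inv_arrow A (asc A Z X Y) \<cdot> \<sigma> (X \<otimes> Y) Z \<cdot> inv_arrow A (asc A X Y Z)
          = (\<sigma> X Z \<boxtimes> ide A Y) \<cdot> inv_arrow A (asc A X Z Y) \<cdot> (ide A X \<boxtimes> \<sigma> Y Z)"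
    and Phi_braided: "\<lbrakk>X \<in> Ob A; Y \<in> Ob A\<rbrakk> \<Longrightarrow>
          Phi_ar A (\<sigma> X Y) \<cdot> Phi_two A X Y = Phi_two A Y X \<cdot> \<sigma> (\<Phi> Y) (\<Phi> X)"
    and \<kappa>_nat_iso: "nat_iso (M \<times>\<^sub>c A) M
          (\<lambda>(P, X). P \<triangleleft>\<^bsub>M\<^esub> X) (\<lambda>(u, f). u \<unlhd>\<^bsub>M\<^esub> f)
          (\<lambda>(P, X). P \<triangleleft>\<^bsub>M\<^esub> \<Phi> X) (\<lambda>(u, f). u \<unlhd>\<^bsub>M\<^esub> Phi_ar A f)
          (\<lambda>(P, X). \<kappa> P X)"
    and BP1: "\<lbrakk>P \<in> Ob M; X \<in> Ob A; Y \<in> Ob A\<rbrakk> \<Longrightarrow>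
          \<kappa> (P \<triangleleft>\<^bsub>M\<^esub> X) Y
          = inv_arrow M (mas M P X (\<Phi> Y)) \<cdot>\<^bsub>M\<^esub> (ide M P \<unlhd>\<^bsub>M\<^esub> \<sigma> (\<Phi> Y) X) \<cdot>\<^bsub>M\<^esub> mas M P (\<Phi> Y) X
            \<cdot>\<^bsub>M\<^esub> (\<kappa> P Y \<unlhd>\<^bsub>M\<^esub> ide A X)
            \<cdot>\<^bsub>M\<^esub> inv_arrow M (mas M P Y X) \<cdot>\<^bsub>M\<^esub> (ide M P \<unlhd>\<^bsub>M\<^esub> \<sigma> X Y) \<cdot>\<^bsub>M\<^esub> mas M P X Y"
    and BP2: "\<lbrakk>P \<in> Ob M; X \<in> Ob A; Y \<in> Ob A\<rbrakk> \<Longrightarrow>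
          \<kappa> P (X \<otimes> Y)
          = (ide M P \<unlhd>\<^bsub>M\<^esub> Phi_two A X Y) \<cdot>\<^bsub>M\<^esub> mas M P (\<Phi> Y) (\<Phi> X)
            \<cdot>\<^bsub>M\<^esub> (\<kappa> P Y \<unlhd>\<^bsub>M\<^esub> ide A (\<Phi> X))
            \<cdot>\<^bsub>M\<^esub> inv_arrow M (mas M P Y (\<Phi> X)) \<cdot>\<^bsub>M\<^esub> (ide M P \<unlhd>\<^bsub>M\<^esub> \<sigma> (\<Phi> X) Y) \<cdot>\<^bsub>M\<^esub> mas M P (\<Phi> X) Y
            \<cdot>\<^bsub>M\<^esub> (\<kappa> P X \<unlhd>\<^bsub>M\<^esub> ide A Y) \<cdot>\<^bsub>M\<^esub> inv_arrow M (mas M P X Y)"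

locale Z2_symmetric_pair = Z2_braided_pair +
  assumes \<sigma>_symmetric: "\<lbrakk>X \<in> Ob A; Y \<in> Ob A\<rbrakk> \<Longrightarrow> \<sigma> Y X \<cdot> \<sigma> X Y = ide A (X \<otimes> Y)"
    and \<kappa>_symmetric: "\<lbrakk>P \<in> Ob M; X \<in> Ob A\<rbrakk> \<Longrightarrow>
          (ide M P \<unlhd>\<^bsub>M\<^esub> tinv A X) \<cdot>\<^bsub>M\<^esub> \<kappa> P (\<Phi> X) \<cdot>\<^bsub>M\<^esub> \<kappa> P X = ide M (P \<triangleleft>\<^bsub>M\<^esub> X)"


section \<open>Formal composites of functors\<close>

text \<open>Formal composites \<open>A\<^sup>n \<rightarrow> A\<close> and \<open>M \<times> A\<^sup>n \<rightarrow> M\<close>; \<open>AVar i\<close> is the argument number \<open>i\<close>, and \<open>MVar\<close>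
  the argument from \<open>M\<close>.\<close>

datatype aterm = AVar nat | AOne | ATen aterm aterm | APhi aterm
datatype mterm = MVar | MAct mterm aterm

primrec avars :: "aterm \<Rightarrow> nat list" where
  "avars (AVar i) = [i]"
| "avars AOne = []"
| "avars (ATen s t) = avars s @ avars t"
| "avars (APhi s) = avars s"

primrec mvars :: "mterm \<Rightarrow> nat list" where
  "mvars MVar = []"
| "mvars (MAct s t) = mvars s @ avars t"

definition linear :: "nat \<Rightarrow> nat list \<Rightarrow> bool" where
  "linear n xs \<longleftrightarrow> distinct xs \<and> set xs = {..<n}"

primrec asubst :: "(nat \<Rightarrow> aterm) \<Rightarrow> aterm \<Rightarrow> aterm" where
  "asubst \<theta> (AVar i) = \<theta> i"
| "asubst \<theta> AOne = AOne"
| "asubst \<theta> (ATen s t) = ATen (asubst \<theta> s) (asubst \<theta> t)"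
| "asubst \<theta> (APhi s) = APhi (asubst \<theta> s)"

primrec msubst :: "mterm \<Rightarrow> (nat \<Rightarrow> aterm) \<Rightarrow> mterm \<Rightarrow> mterm" where
  "msubst \<mu> \<theta> MVar = \<mu>"
| "msubst \<mu> \<theta> (MAct s t) = MAct (msubst \<mu> \<theta> s) (asubst \<theta> t)"

primrec aob :: "('o, 'a, 'y) inv_moncat_scheme \<Rightarrow> (nat \<Rightarrow> 'o) \<Rightarrow> aterm \<Rightarrow> 'o" where
  "aob A X (AVar i) = X i"
| "aob A X AOne = \<one>\<^bsub>A\<^esub>"
| "aob A X (ATen s t) = aob A X s \<otimes>\<^bsub>A\<^esub> aob A X t"
| "aob A X (APhi s) = Phi_ob A (aob A X s)"

primrec aar :: "('o, 'a, 'y) inv_moncat_scheme \<Rightarrow> (nat \<Rightarrow> 'a) \<Rightarrow> aterm \<Rightarrow> 'a" where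
  "aar A f (AVar i) = f i"
| "aar A f AOne = ide A \<one>\<^bsub>A\<^esub>"
| "aar A f (ATen s t) = aar A f s \<boxtimes>\<^bsub>A\<^esub> aar A f t"
| "aar A f (APhi s) = Phi_ar A (aar A f s)"

primrec mob :: "('o, 'a, 'y) inv_moncat_scheme \<Rightarrow> ('p, 'b, 'o, 'a, 'z) modcat_scheme \<Rightarrow>
    'p \<Rightarrow> (nat \<Rightarrow> 'o) \<Rightarrow> mterm \<Rightarrow> 'p" where
  "mob A M P X MVar = P"
| "mob A M P X (MAct s t) = mob A M P X s \<triangleleft>\<^bsub>M\<^esub> aob A X t"

primrec mar :: "('o, 'a, 'y) inv_moncat_scheme \<Rightarrow> ('p, 'b, 'o, 'a, 'z) modcat_scheme \<Rightarrow>
    'b \<Rightarrow> (nat \<Rightarrow> 'a) \<Rightarrow> mterm \<Rightarrow> 'b" where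
  "mar A M u f MVar = u"
| "mar A M u f (MAct s t) = mar A M u f s \<unlhd>\<^bsub>M\<^esub> aar A f t"


section \<open>Presentations of structural isomorphisms\<close>

text \<open>\<open>AIdId i\<close> is the identity transformation of the identity functor in the argument number \<open>i\<close>; the
  other constituents are transformations of functors in the arguments \<open>0, \<dots>, k - 1\<close>.  An instance
  such as \<open>\<sigma>\<^bsub>X\<^sub>1,X\<^sub>0\<^esub>\<close> is the horizontal composite \<open>AHor (AGen Sigma) [AIdId 1, AIdId 0]\<close>.  The identity
  of the constant functor \<open>\<one>\<close> is presented by \<open>\<Phi>\<^sub>0\<close> composed with its inverse.\<close>

datatype agen = IdTen | IdPhi | Alpha | Lambda | Rho | PhiTwo | PhiZero | Tee | Sigma
datatype mgen = IdAct | ModAssoc | ModUnit | Kappa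

datatype apres =
    AIdId nat
  | AGen agen
  | AGenInv agen
  | AVert apres apres          \<comment> \<open>\<open>AVert g f\<close> is \<open>g \<circ> f\<close>\<close>
  | AHor apres "apres list"    \<comment> \<open>\<open>AHor \<eta> [\<theta>\<^sub>0, \<dots>]\<close> puts \<open>\<theta>\<^sub>i\<close> into the argument \<open>i\<close> of \<open>\<eta>\<close>\<close>

datatype mpres =
    MIdId
  | MGen mgen
  | MGenInv mgen
  | MVert mpres mpres
  | MHor mpres mpres "apres list"

datatype setting = Monoidal | Braided

primrec agen_src :: "agen \<Rightarrow> aterm" where
  "agen_src IdTen = ATen (AVar 0) (AVar 1)"
| "agen_src IdPhi = APhi (AVar 0)"
| "agen_src Alpha = ATen (ATen (AVar 0) (AVar 1)) (AVar 2)"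
| "agen_src Lambda = ATen AOne (AVar 0)"
| "agen_src Rho = ATen (AVar 0) AOne"
| "agen_src PhiTwo = ATen (APhi (AVar 1)) (APhi (AVar 0))"
| "agen_src PhiZero = APhi AOne"
| "agen_src Tee = APhi (APhi (AVar 0))"
| "agen_src Sigma = ATen (AVar 0) (AVar 1)"

primrec agen_tgt :: "agen \<Rightarrow> aterm" where
  "agen_tgt IdTen = ATen (AVar 0) (AVar 1)"
| "agen_tgt IdPhi = APhi (AVar 0)"
| "agen_tgt Alpha = ATen (AVar 0) (ATen (AVar 1) (AVar 2))"
| "agen_tgt Lambda = AVar 0"
| "agen_tgt Rho = AVar 0"
| "agen_tgt PhiTwo = APhi (ATen (AVar 0) (AVar 1))"
| "agen_tgt PhiZero = AOne"
| "agen_tgt Tee = AVar 0"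
| "agen_tgt Sigma = ATen (AVar 1) (AVar 0)"

primrec mgen_src :: "mgen \<Rightarrow> mterm" where
  "mgen_src IdAct = MAct MVar (AVar 0)"
| "mgen_src ModAssoc = MAct (MAct MVar (AVar 0)) (AVar 1)"
| "mgen_src ModUnit = MAct MVar AOne"
| "mgen_src Kappa = MAct MVar (AVar 0)"

primrec mgen_tgt :: "mgen \<Rightarrow> mterm" where
  "mgen_tgt IdAct = MAct MVar (AVar 0)"
| "mgen_tgt ModAssoc = MAct MVar (ATen (AVar 0) (AVar 1))"
| "mgen_tgt ModUnit = MVar"
| "mgen_tgt Kappa = MAct MVar (APhi (AVar 0))"

fun asrc :: "apres \<Rightarrow> aterm" where
  "asrc (AIdId i) = AVar i"
| "asrc (AGen c) = agen_src c"
| "asrc (AGenInv c) = agen_tgt c"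
| "asrc (AVert g f) = asrc f"
| "asrc (AHor \<eta> \<theta>s) = asubst (\<lambda>i. map asrc \<theta>s ! i) (asrc \<eta>)"

fun atgt :: "apres \<Rightarrow> aterm" where
  "atgt (AIdId i) = AVar i"
| "atgt (AGen c) = agen_tgt c"
| "atgt (AGenInv c) = agen_src c"
| "atgt (AVert g f) = atgt g"
| "atgt (AHor \<eta> \<theta>s) = asubst (\<lambda>i. map atgt \<theta>s ! i) (atgt \<eta>)"

fun msrc :: "mpres \<Rightarrow> mterm" where
  "msrc MIdId = MVar"
| "msrc (MGen c) = mgen_src c"
| "msrc (MGenInv c) = mgen_tgt c"
| "msrc (MVert g f) = msrc f"
| "msrc (MHor \<eta> \<mu> \<theta>s) = msubst (msrc \<mu>) (\<lambda>i. map asrc \<theta>s ! i) (msrc \<eta>)"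

fun mtgt :: "mpres \<Rightarrow> mterm" where
  "mtgt MIdId = MVar"
| "mtgt (MGen c) = mgen_tgt c"
| "mtgt (MGenInv c) = mgen_src c"
| "mtgt (MVert g f) = mtgt g"
| "mtgt (MHor \<eta> \<mu> \<theta>s) = msubst (mtgt \<mu>) (\<lambda>i. map atgt \<theta>s ! i) (mtgt \<eta>)"

text \<open>Well-formed presentations: vertical composites are composable as formal composites, the
  arguments of a horizontal composite match the arity, and their variables are disjoint.\<close>

fun avalid :: "setting \<Rightarrow> apres \<Rightarrow> bool" where
  "avalid b (AIdId i) \<longleftrightarrow> True"
| "avalid b (AGen c) \<longleftrightarrow> (c = Sigma \<longrightarrow> b = Braided)"
| "avalid b (AGenInv c) \<longleftrightarrow> (c = Sigma \<longrightarrow> b = Braided)"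
| "avalid b (AVert g f) \<longleftrightarrow> avalid b g \<and> avalid b f \<and> asrc g = atgt f"
| "avalid b (AHor \<eta> \<theta>s) \<longleftrightarrow> avalid b \<eta> \<and> (\<forall>\<theta> \<in> set \<theta>s. avalid b \<theta>) \<and>
     linear (length \<theta>s) (avars (asrc \<eta>)) \<and> distinct (concat (map (\<lambda>\<theta>. avars (asrc \<theta>)) \<theta>s))"

fun mvalid :: "setting \<Rightarrow> mpres \<Rightarrow> bool" where
  "mvalid b MIdId \<longleftrightarrow> True"
| "mvalid b (MGen c) \<longleftrightarrow> (c = Kappa \<longrightarrow> b = Braided)"
| "mvalid b (MGenInv c) \<longleftrightarrow> (c = Kappa \<longrightarrow> b = Braided)"
| "mvalid b (MVert g f) \<longleftrightarrow> mvalid b g \<and> mvalid b f \<and> msrc g = mtgt f"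
| "mvalid b (MHor \<eta> \<mu> \<theta>s) \<longleftrightarrow> mvalid b \<eta> \<and> mvalid b \<mu> \<and> (\<forall>\<theta> \<in> set \<theta>s. avalid b \<theta>) \<and>
     linear (length \<theta>s) (mvars (msrc \<eta>)) \<and>
     distinct (mvars (msrc \<mu>) @ concat (map (\<lambda>\<theta>. avars (asrc \<theta>)) \<theta>s))"

text \<open>Structural isomorphisms \<open>f : S \<Rightarrow> T\<close> of functors \<open>A\<^sup>n \<rightarrow> A\<close>, respectively \<open>M \<times> A\<^sup>n \<rightarrow> M\<close>.\<close>

definition a_structural :: "setting \<Rightarrow> nat \<Rightarrow> apres \<Rightarrow> aterm \<Rightarrow> aterm \<Rightarrow> bool" where
  "a_structural b n f S T \<longleftrightarrow> avalid b f \<and> asrc f = S \<and> atgt f = T \<and>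
     linear n (avars S) \<and> linear n (avars T)"

definition m_structural :: "setting \<Rightarrow> nat \<Rightarrow> mpres \<Rightarrow> mterm \<Rightarrow> mterm \<Rightarrow> bool" where
  "m_structural b n f S T \<longleftrightarrow> mvalid b f \<and> msrc f = S \<and> mtgt f = T \<and>
     linear n (mvars S) \<and> linear n (mvars T)"


section \<open>The natural isomorphisms presented\<close>

primrec agen_eval :: "('o, 'a, 'y) inv_moncat_scheme \<Rightarrow> ('o \<Rightarrow> 'o \<Rightarrow> 'a) \<Rightarrow>
    (nat \<Rightarrow> 'o) \<Rightarrow> agen \<Rightarrow> 'a" where
  "agen_eval A \<sigma> X IdTen = ide A (X 0 \<otimes>\<^bsub>A\<^esub> X 1)"
| "agen_eval A \<sigma> X IdPhi = ide A (Phi_ob A (X 0))"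
| "agen_eval A \<sigma> X Alpha = asc A (X 0) (X 1) (X 2)"
| "agen_eval A \<sigma> X Lambda = lun A (X 0)"
| "agen_eval A \<sigma> X Rho = run A (X 0)"
| "agen_eval A \<sigma> X PhiTwo = Phi_two A (X 0) (X 1)"
| "agen_eval A \<sigma> X PhiZero = Phi_zero A"
| "agen_eval A \<sigma> X Tee = tinv A (X 0)"
| "agen_eval A \<sigma> X Sigma = \<sigma> (X 0) (X 1)"

primrec mgen_eval :: "('o, 'a, 'y) inv_moncat_scheme \<Rightarrow> ('p, 'b, 'o, 'a, 'z) modcat_scheme \<Rightarrow>
    ('p \<Rightarrow> 'o \<Rightarrow> 'b) \<Rightarrow> 'p \<Rightarrow> (nat \<Rightarrow> 'o) \<Rightarrow> mgen \<Rightarrow> 'b" where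
  "mgen_eval A M \<kappa> P X IdAct = ide M (P \<triangleleft>\<^bsub>M\<^esub> X 0)"
| "mgen_eval A M \<kappa> P X ModAssoc = mas M P (X 0) (X 1)"
| "mgen_eval A M \<kappa> P X ModUnit = mun M P"
| "mgen_eval A M \<kappa> P X Kappa = \<kappa> P (X 0)"

text \<open>Component at the objects \<open>X\<^sub>0, X\<^sub>1, \<dots>\<close> (respectively \<open>P; X\<^sub>0, X\<^sub>1, \<dots>\<close>).  The horizontal composite of
  \<open>\<eta> : F \<Rightarrow> G\<close> with \<open>\<theta>\<^sub>i : S\<^sub>i \<Rightarrow> T\<^sub>i\<close> is \<open>\<eta>\<^bsub>T(X)\<^esub> \<circ> F(\<theta>\<^bsub>X\<^esub>)\<close>.\<close>

fun aeval :: "('o, 'a, 'y) inv_moncat_scheme \<Rightarrow> ('o \<Rightarrow> 'o \<Rightarrow> 'a) \<Rightarrow> apres \<Rightarrow> (nat \<Rightarrow> 'o) \<Rightarrow> 'a" where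
  "aeval A \<sigma> (AIdId i) X = ide A (X i)"
| "aeval A \<sigma> (AGen c) X = agen_eval A \<sigma> X c"
| "aeval A \<sigma> (AGenInv c) X = inv_arrow A (agen_eval A \<sigma> X c)"
| "aeval A \<sigma> (AVert g f) X = aeval A \<sigma> g X \<cdot>\<^bsub>A\<^esub> aeval A \<sigma> f X"
| "aeval A \<sigma> (AHor \<eta> \<theta>s) X =
     aeval A \<sigma> \<eta> (\<lambda>i. map (\<lambda>\<theta>. aob A X (atgt \<theta>)) \<theta>s ! i)
     \<cdot>\<^bsub>A\<^esub> aar A (\<lambda>i. map (\<lambda>\<theta>. aeval A \<sigma> \<theta> X) \<theta>s ! i) (asrc \<eta>)"

fun meval :: "('o, 'a, 'y) inv_moncat_scheme \<Rightarrow> ('p, 'b, 'o, 'a, 'z) modcat_scheme \<Rightarrow>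
    ('o \<Rightarrow> 'o \<Rightarrow> 'a) \<Rightarrow> ('p \<Rightarrow> 'o \<Rightarrow> 'b) \<Rightarrow> mpres \<Rightarrow> 'p \<Rightarrow> (nat \<Rightarrow> 'o) \<Rightarrow> 'b" where
  "meval A M \<sigma> \<kappa> MIdId P X = ide M P"
| "meval A M \<sigma> \<kappa> (MGen c) P X = mgen_eval A M \<kappa> P X c"
| "meval A M \<sigma> \<kappa> (MGenInv c) P X = inv_arrow M (mgen_eval A M \<kappa> P X c)"
| "meval A M \<sigma> \<kappa> (MVert g f) P X = meval A M \<sigma> \<kappa> g P X \<cdot>\<^bsub>M\<^esub> meval A M \<sigma> \<kappa> f P X"
| "meval A M \<sigma> \<kappa> (MHor \<eta> \<mu> \<theta>s) P X =
     meval A M \<sigma> \<kappa> \<eta> (mob A M P X (mtgt \<mu>)) (\<lambda>i. map (\<lambda>\<theta>. aob A X (atgt \<theta>)) \<theta>s ! i)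
     \<cdot>\<^bsub>M\<^esub> mar A M (meval A M \<sigma> \<kappa> \<mu> P X) (\<lambda>i. map (\<lambda>\<theta>. aeval A \<sigma> \<theta> X) \<theta>s ! i) (msrc \<eta>)"

definition a_equal :: "('o, 'a, 'y) inv_moncat_scheme \<Rightarrow> ('o \<Rightarrow> 'o \<Rightarrow> 'a) \<Rightarrow>
    nat \<Rightarrow> apres \<Rightarrow> apres \<Rightarrow> bool" where
  "a_equal A \<sigma> n f g \<longleftrightarrow> (\<forall>X. (\<forall>i<n. X i \<in> Ob A) \<longrightarrow> aeval A \<sigma> f X = aeval A \<sigma> g X)"

definition m_equal :: "('o, 'a, 'y) inv_moncat_scheme \<Rightarrow> ('p, 'b, 'o, 'a, 'z) modcat_scheme \<Rightarrow>
    ('o \<Rightarrow> 'o \<Rightarrow> 'a) \<Rightarrow> ('p \<Rightarrow> 'o \<Rightarrow> 'b) \<Rightarrow> nat \<Rightarrow> mpres \<Rightarrow> mpres \<Rightarrow> bool" where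
  "m_equal A M \<sigma> \<kappa> n f g \<longleftrightarrow>
     (\<forall>P X. P \<in> Ob M \<and> (\<forall>i<n. X i \<in> Ob A) \<longrightarrow> meval A M \<sigma> \<kappa> f P X = meval A M \<sigma> \<kappa> g P X)"


section \<open>Braid groups\<close>

text \<open>A letter \<open>(x, True)\<close> stands for the generator \<open>x\<close> and \<open>(x, False)\<close> for its inverse.  The group
  presented by generators \<open>G\<close> and relations \<open>R\<close> consists of the classes of words under \<open>word_eq G R\<close>.\<close>

type_synonym 'g word = "('g \<times> bool) list"

inductive word_eq :: "'g set \<Rightarrow> ('g word \<times> 'g word) set \<Rightarrow> 'g word \<Rightarrow> 'g word \<Rightarrow> bool"
  for G R where
  refl: "set w \<subseteq> G \<times> UNIV \<Longrightarrow> word_eq G R w w"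
| sym: "word_eq G R u v \<Longrightarrow> word_eq G R v u"
| trans: "word_eq G R u v \<Longrightarrow> word_eq G R v w \<Longrightarrow> word_eq G R u w"
| mult: "word_eq G R u u' \<Longrightarrow> word_eq G R v v' \<Longrightarrow> word_eq G R (u @ v) (u' @ v')"
| cancel: "x \<in> G \<Longrightarrow> word_eq G R [(x, b), (x, \<not> b)] []"
| rel: "(u, v) \<in> R \<Longrightarrow> word_eq G R u v"

definition group_elem :: "'g set \<Rightarrow> ('g word \<times> 'g word) set \<Rightarrow> 'g word \<Rightarrow> 'g word set" where
  "group_elem G R w = {v. word_eq G R w v}"

abbreviation pos :: "'g list \<Rightarrow> 'g word" where
  "pos xs \<equiv> map (\<lambda>x. (x, True)) xs"

definition inv_word :: "'g word \<Rightarrow> 'g word" where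
  "inv_word w = rev (map (\<lambda>(x, b). (x, \<not> b)) w)"

definition braid_rels :: "nat \<Rightarrow> (nat word \<times> nat word) set" where
  "braid_rels n =
     {(pos [i, j], pos [j, i]) | i j. {i, j} \<subseteq> {1..<n} \<and> i + 2 \<le> j} \<union>
     {(pos [i, Suc i, i], pos [Suc i, i, Suc i]) | i. {i, Suc i} \<subseteq> {1..<n}}"

text \<open>The class in \<open>B\<^sub>n\<close> of a word in the generators \<open>\<sigma>\<^sub>i\<close>, where \<open>0 < i < n\<close>.\<close>

definition braid :: "nat \<Rightarrow> nat word \<Rightarrow> nat word set" where
  "braid n w = group_elem {1..<n} (braid_rels n) w"

datatype cyl_gen = Sig nat | Kap

definition cyl_rels :: "nat \<Rightarrow> (cyl_gen word \<times> cyl_gen word) set" where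
  "cyl_rels n =
     map_prod (map (map_prod Sig id)) (map (map_prod Sig id)) ` braid_rels n \<union>
     (if 1 < n then {(pos [Sig 1, Kap, Sig 1, Kap], pos [Kap, Sig 1, Kap, Sig 1])} else {}) \<union>
     {(pos [Sig i, Kap], pos [Kap, Sig i]) | i. 1 < i \<and> i < n}"

definition cyl_braid :: "nat \<Rightarrow> cyl_gen word \<Rightarrow> cyl_gen word set" where
  "cyl_braid n w = group_elem (insert Kap (Sig ` {1..<n})) (cyl_rels n) w"


section \<open>Underlying braids\<close>

text \<open>The strands of a formal composite, after distributing \<open>\<Phi>\<close> over \<open>\<otimes>\<close> with reversal of order: the list
  of its variables, each with the parity of the number of \<open>\<Phi>\<close>'s applied to it.\<close>

primrec astrands :: "aterm \<Rightarrow> (nat \<times> bool) list" where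
  "astrands (AVar i) = [(i, False)]"
| "astrands AOne = []"
| "astrands (ATen s t) = astrands s @ astrands t"
| "astrands (APhi s) = rev (map (\<lambda>(i, e). (i, \<not> e)) (astrands s))"

primrec mstrands :: "mterm \<Rightarrow> (nat \<times> bool) list" where
  "mstrands MVar = []"
| "mstrands (MAct s t) = mstrands s @ astrands t"

definition shift_word :: "nat \<Rightarrow> nat word \<Rightarrow> nat word" where
  "shift_word p w = map (\<lambda>(i, b). (p + i, b)) w"

text \<open>The effect of \<open>\<Phi>\<close> on a braid with \<open>n\<close> strands.\<close>

definition flip_word :: "nat \<Rightarrow> nat word \<Rightarrow> nat word" where
  "flip_word n w = map (\<lambda>(i, b). (n - i, b)) w"

text \<open>Words are read like composites of morphisms: the rightmost letter acts first, and strands are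
  numbered from the left.  \<open>cross a b\<close> is the positive crossing of \<open>a\<close> strands with the \<open>b\<close> strands to
  their right, \<open>\<sigma>\<^bsub>X,Y\<^esub>\<close> with \<open>a\<close> variables in \<open>X\<close> and \<open>b\<close> in \<open>Y\<close>, as given by the hexagon axioms.\<close>

definition cross :: "nat \<Rightarrow> nat \<Rightarrow> nat word" where
  "cross a b = concat (map (\<lambda>j. pos (rev [j..<j + b])) [1..<Suc a])"

text \<open>Replacing the strands of a braid by parallel strands; \<open>ws\<close> lists the numbers of strands in the
  source.  The second component lists them in the target.\<close>

definition cross_at :: "nat list \<Rightarrow> nat \<Rightarrow> bool \<Rightarrow> nat word" where
  "cross_at ws i b = shift_word (sum_list (take (i - 1) ws))
     (if b then cross (ws ! (i - 1)) (ws ! i) else inv_word (cross (ws ! i) (ws ! (i - 1))))"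

definition swap_at :: "nat \<Rightarrow> nat list \<Rightarrow> nat list" where
  "swap_at i ws = ws[i - 1 := ws ! i, i := ws ! (i - 1)]"

fun cable :: "nat list \<Rightarrow> nat word \<Rightarrow> nat word \<times> nat list" where
  "cable ws [] = ([], ws)"
| "cable ws ((i, b) # w) =
     (let (v, ws') = cable ws w in (cross_at ws' i b @ v, swap_at i ws'))"

abbreviation sig :: "nat word \<Rightarrow> cyl_gen word" where
  "sig w \<equiv> map (map_prod Sig id) w"

text \<open>The braid of \<open>\<kappa>\<^bsub>M,X\<^esub>\<close> with \<open>w\<close> variables in \<open>X\<close> (BP2), and of \<open>\<kappa>\<^bsub>M\<otimes>Z,X\<^esub>\<close> with \<open>m\<close> variables in
  \<open>Z\<close> (BP1).\<close>

primrec kappa_block :: "nat \<Rightarrow> cyl_gen word" where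
  "kappa_block 0 = []"
| "kappa_block (Suc w) = (Kap, True) # sig (pos [1..<Suc w]) @ kappa_block w"

definition kappa_behind :: "nat \<Rightarrow> nat \<Rightarrow> cyl_gen word" where
  "kappa_behind m w = sig (cross w m) @ kappa_block w @ sig (cross m w)"

text \<open>Cabling of a cylinder braid whose strands lie behind \<open>m\<close> additional strands next to the pole.\<close>

fun mcable :: "nat \<Rightarrow> nat list \<Rightarrow> cyl_gen word \<Rightarrow> cyl_gen word \<times> nat list" where
  "mcable m ws [] = ([], ws)"
| "mcable m ws ((Sig i, b) # w) =
     (let (v, ws') = mcable m ws w in (sig (shift_word m (cross_at ws' i b)) @ v, swap_at i ws'))"
| "mcable m ws ((Kap, b) # w) =
     (let (v, ws') = mcable m ws w; k = kappa_behind m (ws' ! 0)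
      in ((if b then k else inv_word k) @ v, ws'))"

text \<open>Juxtaposition of braids with given numbers of strands, starting after the first \<open>p\<close> strands.\<close>

fun juxtapose :: "nat \<Rightarrow> (nat \<times> nat word) list \<Rightarrow> nat word" where
  "juxtapose p [] = []"
| "juxtapose p ((n, w) # bs) = shift_word p w @ juxtapose (p + n) bs"

text \<open>The braids \<open>bs ! i\<close> of the \<open>\<theta>\<^sub>i\<close>, placed at the strands \<open>es\<close> of the functor they are put into.\<close>

definition place :: "(nat \<times> nat word) list \<Rightarrow> (nat \<times> bool) list \<Rightarrow> (nat \<times> nat word) list" where
  "place bs es = map (\<lambda>(i, e). let (n, w) = bs ! i in (n, if e then flip_word n w else w)) es"

fun abraid :: "apres \<Rightarrow> nat word" where
  "abraid (AIdId i) = []"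
| "abraid (AGen c) = (if c = Sigma then [(1, True)] else [])"
| "abraid (AGenInv c) = (if c = Sigma then [(1, False)] else [])"
| "abraid (AVert g f) = abraid g @ abraid f"
| "abraid (AHor \<eta> \<theta>s) =
     (let ps = place (map (\<lambda>\<theta>. (length (avars (asrc \<theta>)), abraid \<theta>)) \<theta>s) (astrands (asrc \<eta>))
      in fst (cable (map fst ps) (abraid \<eta>)) @ juxtapose 0 ps)"

fun mbraid :: "mpres \<Rightarrow> cyl_gen word" where
  "mbraid MIdId = []"
| "mbraid (MGen c) = (if c = Kappa then [(Kap, True)] else [])"
| "mbraid (MGenInv c) = (if c = Kappa then [(Kap, False)] else [])"
| "mbraid (MVert g f) = mbraid g @ mbraid f"
| "mbraid (MHor \<eta> \<mu> \<theta>s) =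
     (let m = length (mvars (msrc \<mu>));
          ps = place (map (\<lambda>\<theta>. (length (avars (asrc \<theta>)), abraid \<theta>)) \<theta>s) (mstrands (msrc \<eta>))
      in fst (mcable m (map fst ps) (mbraid \<eta>)) @ mbraid \<mu> @ sig (juxtapose m ps))"

definition underlying_braid :: "nat \<Rightarrow> apres \<Rightarrow> nat word set" where
  "underlying_braid n f = braid n (abraid f)"

definition underlying_cyl_braid :: "nat \<Rightarrow> mpres \<Rightarrow> cyl_gen word set" where
  "underlying_cyl_braid n f = cyl_braid n (mbraid f)"

end

theory Submission imports Defs begin

text \<open>The theorem is proved by strictification.  The category \<open>A\<close> acts on \<open>M\<close>, so lists of signed objects
  \<open>(X, e)\<close>, standing for \<open>X\<close> or \<open>\<Phi>(X)\<close>, act on \<open>M\<close> as well, and the natural transformations between these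
  iterated actions form a strict monoidal category.  There \<open>\<alpha>, \<lambda>, \<rho>, \<Phi>\<^sub>2, \<Phi>\<^sub>0, t\<close> are absorbed into canonical
  isomorphisms from the value of a formal composite to the list of its signed variables, \<open>\<sigma>\<close> satisfies the
  braid relations, and \<open>\<kappa>\<close>, acting on the strand next to \<open>M\<close>, those of the cylinder braid group, because BP1
  identifies \<open>\<kappa>\<close> on a further strand, a mere whiskering, with a conjugate of \<open>\<kappa>\<close> on the first one.  Conjugating a
  structural isomorphism by the canonical isomorphisms yields the value of its underlying word, by
  induction on the presentation; horizontal composites need cabling, for which the canonical
  isomorphisms have to commute with crossings and twists of blocks.  Hence parallel structural
  isomorphisms with equal braids agree.  For statements about \<open>A\<close> take \<open>M = A\<close>.  In the symmetric case the
  value of a word depends only on its signed permutation: all twists can be moved to the individual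
  strands and cancelled, and what is left is sorting.\<close>

section \<open>Strict monoidal categories\<close>

text \<open>The obstacle is \<kappa>: its component depends on the object of \<open>M\<close>, and a
  twist does not slide through crossings the way a morphism of \<open>A\<close> does. Two kinds of
  arrows are therefore kept apart: those that come from \<open>A\<close>, which are natural for
  crossings and have a dual, and the twists themselves. A presentation may stand under any number of
  \<Phi>'s, which reverse the strands and exchange signs; hence each statement on \<open>A\<close>
  is proved for both signs at once. Cabling and reflection produce words that differ from the
  expected ones by braid relations, so it is the values of words that are compared, not the words.
  That crossings and twists are compatible with units is not among the axioms; it is derived by
  whiskering with a unit strand, which is faithful. The regular module comes without a twist, which
  is why the presence of a braiding and that of twists are governed by two separate flags.\<close>

text \<open>Both compositions are total, and their associativity is required without side conditions (composites
  that are not defined have to be absorbing), so that composites can be reassociated freely.\<close>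

locale strict_moncat =
  fixes ok :: "'c \<Rightarrow> bool" and arr :: "'e \<Rightarrow> bool" and src tgt :: "'e \<Rightarrow> 'c list"
    and cm :: "'e \<Rightarrow> 'e \<Rightarrow> 'e" (infixr "\<bullet>" 55)
    and I :: "'c list \<Rightarrow> 'e"
    and hz :: "'e \<Rightarrow> 'e \<Rightarrow> 'e" (infixr "\<odot>" 65)
  assumes arr_ok: "arr f \<Longrightarrow> list_all ok (src f) \<and> list_all ok (tgt f)"
    and cm_assoc: "(h \<bullet> g) \<bullet> f = h \<bullet> g \<bullet> f"
    and cm_typ: "\<lbrakk>arr g; arr f; src g = tgt f\<rbrakk> \<Longrightarrow> arr (g \<bullet> f) \<and> src (g \<bullet> f) = src f \<and> tgt (g \<bullet> f) = tgt g"
    and I_typ: "list_all ok a \<Longrightarrow> arr (I a) \<and> src (I a) = a \<and> tgt (I a) = a"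
    and hz_typ: "\<lbrakk>arr g; arr f\<rbrakk> \<Longrightarrow> arr (g \<odot> f) \<and> src (g \<odot> f) = src g @ src f \<and> tgt (g \<odot> f) = tgt g @ tgt f"
    and I_left: "\<lbrakk>arr f; tgt f = a\<rbrakk> \<Longrightarrow> I a \<bullet> f = f"
    and I_right: "\<lbrakk>arr f; src f = a\<rbrakk> \<Longrightarrow> f \<bullet> I a = f"
    and hz_assoc: "(h \<odot> g) \<odot> f = h \<odot> g \<odot> f"
    and hz_I: "\<lbrakk>list_all ok a; list_all ok b\<rbrakk> \<Longrightarrow> I a \<odot> I b = I (a @ b)"
    and hz_nil: "arr f \<Longrightarrow> I [] \<odot> f = f \<and> f \<odot> I [] = f"
    and interchange: "\<lbrakk>arr f; arr g; arr f'; arr g'; src g = tgt f; src g' = tgt f'\<rbrakk>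
        \<Longrightarrow> (g \<odot> g') \<bullet> (f \<odot> f') = (g \<bullet> f) \<odot> (g' \<bullet> f')"
begin

lemma cm_simps [simp]:
  assumes "arr g" "arr f" "src g = tgt f"
  shows "arr (g \<bullet> f)" "src (g \<bullet> f) = src f" "tgt (g \<bullet> f) = tgt g"
  using cm_typ[OF assms] by auto

lemma I_simps [simp]:
  assumes "list_all ok a"
  shows "arr (I a)" "src (I a) = a" "tgt (I a) = a"
  using I_typ[OF assms] by auto

lemma hz_simps [simp]:
  assumes "arr g" "arr f"
  shows "arr (g \<odot> f)" "src (g \<odot> f) = src g @ src f" "tgt (g \<odot> f) = tgt g @ tgt f"
  using hz_typ[OF assms] by auto

lemma ok_simps [simp]:
  assumes "arr f"
  shows "list_all ok (src f)" "list_all ok (tgt f)"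
  using arr_ok[OF assms] by auto

lemmas unit_simps [simp] = I_left I_right hz_nil[THEN conjunct1] hz_nil[THEN conjunct2]

lemma cm_cong: "g \<bullet> f = k \<Longrightarrow> g \<bullet> f \<bullet> h = k \<bullet> h"
  by (metis cm_assoc)

definition T where "T f a b \<longleftrightarrow> arr f \<and> src f = a \<and> tgt f = b"

lemma T_I: "list_all ok a \<Longrightarrow> T (I a) a a"
  by (simp add: T_def)
lemma T_cm: "T f a b \<Longrightarrow> T g b c \<Longrightarrow> T (g \<bullet> f) a c"
  by (simp add: T_def)
lemma T_hz: "T f a b \<Longrightarrow> T g c d \<Longrightarrow> T (f \<odot> g) (a @ c) (b @ d)"
  by (simp add: T_def)
lemma T_D: "T f a b \<Longrightarrow> arr f" "T f a b \<Longrightarrow> src f = a" "T f a b \<Longrightarrow> tgt f = b"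
  by (simp_all add: T_def)
lemma T_okD: "T f a b \<Longrightarrow> list_all ok a" "T f a b \<Longrightarrow> list_all ok b"
  using arr_ok by (auto simp: T_def)

text \<open>The canonical arrows are cancelled on the left only, so a one-sided inverse is enough,
  and it is the only equation that has to be carried through their construction.\<close>

definition left_inv where "left_inv f \<longleftrightarrow> arr f \<and> (\<exists>g. T g (tgt f) (src f) \<and> g \<bullet> f = I (src f))"

lemma left_inv_cancel:
  assumes "left_inv f" "f \<bullet> g = f \<bullet> h" "arr g" "arr h" "tgt g = src f" "tgt h = src f"
  shows "g = h"
proof -
  obtain k where k: "T k (tgt f) (src f)" "k \<bullet> f = I (src f)" using assms(1) left_inv_def by auto
  have "k \<bullet> f \<bullet> g = k \<bullet> f \<bullet> h" using assms(2) by simp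
  then show ?thesis using assms(3-) by (simp add: cm_cong[OF k(2)])
qed

lemma left_inv_I: "list_all ok a \<Longrightarrow> left_inv (I a)"
  unfolding left_inv_def by (auto simp: T_def intro!: exI[of _ "I a"])

lemma left_inv_cm:
  assumes "left_inv f" "left_inv g" "src g = tgt f"
  shows "left_inv (g \<bullet> f)"
proof -
  obtain k where k: "T k (tgt f) (src f)" "k \<bullet> f = I (src f)" using assms(1) left_inv_def by auto
  obtain h where h: "T h (tgt g) (src g)" "h \<bullet> g = I (src g)" using assms(2) left_inv_def by auto
  have a: "arr f" "arr g" using assms left_inv_def by auto
  have "(k \<bullet> h) \<bullet> g \<bullet> f = I (src f)"
    using cm_cong[OF h(2)] k h assms(3) a by (simp add: T_def cm_assoc)
  moreover have "T (k \<bullet> h) (tgt g) (src f)" using k h assms(3) by (auto intro: T_cm)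
  ultimately show ?thesis unfolding left_inv_def using a assms(3) by auto
qed

lemma left_inv_hz:
  assumes "left_inv f" "left_inv g"
  shows "left_inv (g \<odot> f)"
proof -
  obtain k where k: "T k (tgt f) (src f)" "k \<bullet> f = I (src f)" using assms(1) left_inv_def by auto
  obtain h where h: "T h (tgt g) (src g)" "h \<bullet> g = I (src g)" using assms(2) left_inv_def by auto
  have a: "arr f" "arr g" using assms left_inv_def by auto
  have "(h \<odot> k) \<bullet> (g \<odot> f) = I (src (g \<odot> f))"
    using k h a by (simp add: T_def interchange hz_I)
  moreover have "T (h \<odot> k) (tgt (g \<odot> f)) (src (g \<odot> f))" using k h a by (auto intro: T_hz)
  ultimately show ?thesis unfolding left_inv_def using a by auto
qed

fun hl :: "('v \<Rightarrow> 'e) \<Rightarrow> 'v list \<Rightarrow> 'e" where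
  "hl f [] = I []"
| "hl f (v # vs) = f v \<odot> hl f vs"

lemma T_hl: "(\<And>v. v \<in> set vs \<Longrightarrow> T (f v) (a v) (b v)) \<Longrightarrow> T (hl f vs) (concat (map a vs)) (concat (map b vs))"
  by (induction vs) (auto intro: T_I T_hz)

lemma hl_append: "(\<And>v. v \<in> set us \<union> set vs \<Longrightarrow> arr (f v)) \<Longrightarrow> hl f (us @ vs) = hl f us \<odot> hl f vs"
proof (induction us)
  case Nil
  then have "T (hl f vs) (concat (map (\<lambda>v. src (f v)) vs)) (concat (map (\<lambda>v. tgt (f v)) vs))"
    by (intro T_hl) (auto simp: T_def)
  then show ?case by (simp add: T_def)
qed (simp add: hz_assoc)

lemma hl_cm: "(\<And>v. v \<in> set vs \<Longrightarrow> T (f v) (a v) (b v) \<and> T (g v) (b v) (c v)) \<Longrightarrow>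
   hl (\<lambda>v. g v \<bullet> f v) vs = hl g vs \<bullet> hl f vs"
proof (induction vs)
  case (Cons v vs)
  have "T (hl f vs) (concat (map a vs)) (concat (map b vs))" using Cons by (intro T_hl) auto
  moreover have "T (hl g vs) (concat (map b vs)) (concat (map c vs))" using Cons by (intro T_hl) auto
  ultimately show ?case using Cons by (auto simp: T_def interchange)
qed simp

lemma hl_cong: "(\<And>v. v \<in> set vs \<Longrightarrow> f v = g v) \<Longrightarrow> hl f vs = hl g vs"
  by (induction vs) auto

lemma hl_map: "hl f (map h vs) = hl (\<lambda>v. f (h v)) vs"
  by (induction vs) auto

lemma hl_I: "(\<And>v. v \<in> set vs \<Longrightarrow> list_all ok (a v)) \<Longrightarrow> hl (\<lambda>v. I (a v)) vs = I (concat (map a vs))"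
proof (induction vs)
  case (Cons v vs)
  then have "list_all ok (concat (map a vs))" by (auto simp: list_all_iff)
  then show ?case using Cons by (simp add: hz_I)
qed simp

lemma left_inv_hl: "(\<And>v. v \<in> set vs \<Longrightarrow> left_inv (f v)) \<Longrightarrow> left_inv (hl f vs)"
  by (induction vs) (auto simp: left_inv_I left_inv_hz)

end

section \<open>Words acting on lists of strands\<close>

definition swap_strands :: "nat \<Rightarrow> 'v list \<Rightarrow> 'v list" where
  "swap_strands i l = l[i - 1 := l ! i, i := l ! (i - 1)]"

text \<open>\<open>s\<close> is the change of sign that a twist causes on the strand next to the
  pole. A letter and its inverse have the same effect, which is consistent because \<open>s\<close>
  is an involution wherever inverses are formed.\<close>

fun perm_letter :: "('v \<Rightarrow> 'v) \<Rightarrow> cyl_gen \<times> bool \<Rightarrow> 'v list \<Rightarrow> 'v list" where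
  "perm_letter s (Sig i, b) l = swap_strands i l"
| "perm_letter s (Kap, b) l = (case l of [] \<Rightarrow> [] | c # r \<Rightarrow> s c # r)"

definition perm :: "('v \<Rightarrow> 'v) \<Rightarrow> cyl_gen word \<Rightarrow> 'v list \<Rightarrow> 'v list" where
  "perm s w l = foldr (perm_letter s) w l"

lemma perm_simps [simp]: "perm s [] l = l" "perm s (x # w) l = perm_letter s x (perm s w l)"
    "perm s (u @ v) l = perm s u (perm s v l)"
  by (simp_all add: perm_def)

lemma swap_strands_at: "i = Suc (length p) \<Longrightarrow> swap_strands i (p @ c # d # r) = p @ d # c # r"
  by (simp add: swap_strands_def nth_append list_update_append)

lemma split_at:
  assumes "1 \<le> i" "i < length l"
  obtains p c d r where "l = p @ c # d # r" "i = Suc (length p)"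
proof
  show "l = take (i - 1) l @ l ! (i - 1) # l ! i # drop (Suc i) l"
    using assms by (metis Cons_nth_drop_Suc Suc_diff_1 append_take_drop_id less_eq_Suc_le less_imp_diff_less One_nat_def)
  show "i = Suc (length (take (i - 1) l))" using assms by simp
qed

lemma length_perm_letter [simp]: "length (perm_letter s x l) = length l"
  by (cases "(s, x, l)" rule: perm_letter.cases) (auto simp: swap_strands_def split: list.split)

lemma length_perm [simp]: "length (perm s w l) = length l"
  by (induction w) auto

definition cgens :: "bool \<Rightarrow> nat \<Rightarrow> cyl_gen set" where
  "cgens k n = (if k \<and> 0 < n then {Kap} else {}) \<union> Sig ` {1..<n}"

definition wfw :: "bool \<Rightarrow> nat \<Rightarrow> cyl_gen word \<Rightarrow> bool" where
  "wfw k n w \<longleftrightarrow> fst ` set w \<subseteq> cgens k n"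

lemma wfw_simps [simp]: "wfw k n []" "wfw k n (x # w) \<longleftrightarrow> fst x \<in> cgens k n \<and> wfw k n w"
    "wfw k n (u @ v) \<longleftrightarrow> wfw k n u \<and> wfw k n v"
  by (auto simp: wfw_def)

lemma cgens_cases:
  assumes "fst x \<in> cgens k (length l)"
  obtains (Sig) p c d r b where "l = p @ c # d # r" "x = (Sig (Suc (length p)), b)"
  | (Kap) c r b where "k" "l = c # r" "x = (Kap, b)"
proof (cases "fst x")
  case (Sig i)
  then have "1 \<le> i" "i < length l" using assms by (auto simp: cgens_def split: if_splits)
  then show thesis using that(1) split_at[of i l] Sig by (metis prod.collapse)
next
  case Kap
  then have "k" "l \<noteq> []" using assms by (auto simp: cgens_def split: if_splits)
  then show thesis using that(2) Kap by (metis neq_Nil_conv prod.collapse)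
qed

lemma inv_word_simps [simp]: "inv_word [] = []" "inv_word (x # w) = inv_word w @ [(fst x, \<not> snd x)]"
   "inv_word (u @ v) = inv_word v @ inv_word u"
  by (auto simp: inv_word_def split_beta)

lemma inv_inv_word [simp]: "inv_word (inv_word w) = w"
  by (induction w) auto

lemma wfw_inv [simp]: "wfw k n (inv_word w) \<longleftrightarrow> wfw k n w"
  by (induction w) auto

lemma wfw_sig_mono: "wfw k n w \<Longrightarrow> n \<le> m \<Longrightarrow> wfw k m w"
  by (fastforce simp: wfw_def cgens_def image_iff subset_iff split: if_splits)

text \<open>Words only move positions and apply the change of sign, so they commute with every
  relabelling that intertwines the two changes of sign on \<open>V\<close>. This passes from signed
  variables, or from the strands to be cabled, to their colours.\<close>

lemma perm_map:
  assumes "wfw k (length l) w" "\<And>v. v \<in> V \<Longrightarrow> h (s v) = s' (h v) \<and> s v \<in> V" "set l \<subseteq> V"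
  shows "map h (perm s w l) = perm s' w (map h l) \<and> set (perm s w l) \<subseteq> V"
  using assms(1)
proof (induction w)
  case Nil then show ?case using assms by simp
next
  case (Cons x w)
  let ?l = "perm s w l"
  have "fst x \<in> cgens k (length ?l)" using Cons by simp
  then show ?case
  proof (cases rule: cgens_cases)
    case (Sig p c d r b)
    have "perm s' w (map h l) = map h p @ h c # h d # map h r" using Cons Sig by auto
    then show ?thesis using Sig Cons by (auto simp: swap_strands_at)
  next
    case (Kap c r b)
    have "perm s' w (map h l) = h c # map h r" using Cons Kap by auto
    then show ?thesis using Kap Cons assms(2) by auto
  qed
qed

lemma perm_inv:
  assumes "wfw k (length l) w" "\<And>v. s (s v) = v"
  shows "perm s (inv_word w) (perm s w l) = l"
  using assms(1)
proof (induction w)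
  case (Cons x w)
  let ?l = "perm s w l"
  have "fst x \<in> cgens k (length ?l)" using Cons by simp
  then have "perm_letter s (fst x, \<not> snd x) (perm_letter s x ?l) = ?l"
    by (cases rule: cgens_cases) (auto simp: swap_strands_at assms(2))
  then show ?case using Cons by simp
qed simp

text \<open>The function behind the abbreviation \<open>sig\<close>, made a constant so that
  rewriting can recognise words without twists.\<close>

definition sgw :: "nat word \<Rightarrow> cyl_gen word" where "sgw w = map (\<lambda>x. (Sig (fst x), snd x)) w"

lemma sig_sgw: "map (map_prod Sig id) w = sgw w"
  by (simp add: sgw_def map_prod_def split_beta)

lemma sgw_simps [simp]: "sgw [] = []" "sgw (x # w) = (Sig (fst x), snd x) # sgw w" "sgw (u @ v) = sgw u @ sgw v"
  by (simp_all add: sgw_def)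

lemma sgw_inv [simp]: "sgw (inv_word w) = inv_word (sgw w)"
  by (induction w) simp_all

lemma wfw_sgw: "wfw k n (sgw w) \<longleftrightarrow> fst ` set w \<subseteq> {1..<n}"
  by (induction w) (auto simp: cgens_def)

lemma shift_word_simps [simp]: "shift_word p [] = []" "shift_word p (x # w) = (p + fst x, snd x) # shift_word p w"
    "shift_word p (u @ v) = shift_word p u @ shift_word p v"
  by (simp_all add: shift_word_def case_prod_unfold)

lemma shift_shift_word [simp]: "shift_word 0 w = w" "shift_word p (shift_word q w) = shift_word (p + q) w"
  by (induction w) simp_all

lemma wfw_Kap_nil: "wfw k 0 w \<Longrightarrow> w = []"
  by (cases w) (auto simp: cgens_def)

section \<open>Values of words in a strict braided category\<close>

locale strict_words = strict_moncat ok arr src tgt cm I hz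
  for ok :: "'c \<Rightarrow> bool" and arr :: "'e \<Rightarrow> bool" and src tgt
    and cm :: "'e \<Rightarrow> 'e \<Rightarrow> 'e" (infixr "\<bullet>" 55) and I :: "'c list \<Rightarrow> 'e"
    and hz :: "'e \<Rightarrow> 'e \<Rightarrow> 'e" (infixr "\<odot>" 65) +
  fixes st :: "'c \<Rightarrow> 'c" and sg sgi :: "'c \<Rightarrow> 'c \<Rightarrow> 'e" and kp kpi :: "'c \<Rightarrow> 'e"
begin

text \<open>The inverse data are typed like the positive ones: \<open>sgi c d\<close> starts at
  \<open>[c, d]\<close> and is meant to invert \<open>sg d c\<close>, and \<open>kpi c\<close> is
  meant to invert \<open>kp (st c)\<close>. A letter and its inverse thus start at the same strands
  and change them in the same way.\<close>

fun letter :: "'c list \<Rightarrow> cyl_gen \<times> bool \<Rightarrow> 'e" where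
  "letter l (Sig i, b) = I (take (i - 1) l) \<odot> (if b then sg else sgi) (l ! (i - 1)) (l ! i) \<odot> I (drop (Suc i) l)"
| "letter l (Kap, b) = (case l of [] \<Rightarrow> I [] | c # r \<Rightarrow> (if b then kp c else kpi c) \<odot> I r)"

primrec bw :: "'c list \<Rightarrow> cyl_gen word \<Rightarrow> 'e" where
  "bw l [] = I l"
| "bw l (x # w) = letter (perm st w l) x \<bullet> bw l w"

lemma letter_at: "i = Suc (length p) \<Longrightarrow>
   letter (p @ c # d # r) (Sig i, b) = I p \<odot> (if b then sg c d else sgi c d) \<odot> I r"
  by (simp add: nth_append)

declare letter.simps(1) [simp del]

end

text \<open>The flags \<open>bs\<close> and \<open>bk\<close> tell whether a braiding \<open>sg\<close> and twists \<open>kp\<close> are present; \<open>st\<close> is the effect of \<open>\<Phi>\<close>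
  on strands.  The axiom \<open>kp_behind\<close> is BP1.\<close>

locale strict_braided = strict_words +
  fixes bs bk :: bool
  assumes sg_T: "\<lbrakk>bs; ok c; ok d\<rbrakk> \<Longrightarrow> T (sg c d) [c, d] [d, c] \<and> T (sgi c d) [c, d] [d, c]"
    and sg_inv: "\<lbrakk>bs; ok c; ok d\<rbrakk> \<Longrightarrow> sgi d c \<bullet> sg c d = I [c, d] \<and> sg d c \<bullet> sgi c d = I [c, d]"
    and yang_baxter: "\<lbrakk>bs; ok c; ok d; ok e\<rbrakk> \<Longrightarrow>
      (sg d e \<odot> I [c]) \<bullet> (I [d] \<odot> sg c e) \<bullet> (sg c d \<odot> I [e])
      = (I [e] \<odot> sg c d) \<bullet> (sg c e \<odot> I [d]) \<bullet> (I [c] \<odot> sg d e)"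
    and st_st: "st (st c) = c"
    and st_ok: "ok (st c) = ok c"
    and bk_bs: "bk \<Longrightarrow> bs"
    and kp_T: "\<lbrakk>bk; ok c\<rbrakk> \<Longrightarrow> T (kp c) [c] [st c] \<and> T (kpi c) [c] [st c]"
    and kp_inv: "\<lbrakk>bk; ok c\<rbrakk> \<Longrightarrow> kpi (st c) \<bullet> kp c = I [c] \<and> kp (st c) \<bullet> kpi c = I [c]"
    and kp_behind: "\<lbrakk>bk; ok c; ok d\<rbrakk> \<Longrightarrow>
      I [d] \<odot> kp c = sg (st c) d \<bullet> (kp c \<odot> I [d]) \<bullet> sg d c"
begin

abbreviation "oks l \<equiv> list_all ok l"
abbreviation "wfb n w \<equiv> wfw bk n w"

lemma st_simps [simp]: "st (st c) = c" "ok (st c) = ok c"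
  using st_st st_ok by auto

context assumes bs: bs begin

lemma sg_simps [simp]:
  assumes "ok c" "ok d"
  shows "arr (sg c d)" "src (sg c d) = [c, d]" "tgt (sg c d) = [d, c]"
    "arr (sgi c d)" "src (sgi c d) = [c, d]" "tgt (sgi c d) = [d, c]"
    "sgi d c \<bullet> sg c d = I [c, d]" "sg d c \<bullet> sgi c d = I [c, d]"
  using sg_T[OF bs assms] sg_inv[OF bs assms] by (auto simp: T_def)

lemma kp_simps [simp]:
  assumes "bk" "ok c"
  shows "arr (kp c)" "src (kp c) = [c]" "tgt (kp c) = [st c]"
    "arr (kpi c)" "src (kpi c) = [c]" "tgt (kpi c) = [st c]"
    "kpi (st c) \<bullet> kp c = I [c]" "kp (st c) \<bullet> kpi c = I [c]"
  using kp_T[OF assms] kp_inv[OF assms] by (auto simp: T_def)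

lemma kp_simps' [simp]:
  assumes "bk" "ok c"
  shows "kpi c \<bullet> kp (st c) = I [st c]" "kp c \<bullet> kpi (st c) = I [st c]"
  using kp_simps(7,8)[of "st c"] assms by auto

lemma T_letter:
  assumes "fst x \<in> cgens bk (length l)" "oks l"
  shows "T (letter l x) l (perm_letter st x l) \<and> oks (perm_letter st x l)"
  using assms(1)
proof (cases rule: cgens_cases)
  case (Sig p c d r b)
  then show ?thesis using assms(2) by (auto simp: letter_at swap_strands_at T_def)
next
  case (Kap c r b)
  then show ?thesis using assms(2) by (auto simp: T_def)
qed

lemma T_bw: "wfb (length l) w \<Longrightarrow> oks l \<Longrightarrow> T (bw l w) l (perm st w l) \<and> oks (perm st w l)"
proof (induction w)
  case (Cons x w)
  then have "T (letter (perm st w l) x) (perm st w l) (perm_letter st x (perm st w l)) \<and> oks (perm_letter st x (perm st w l))"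
    by (intro T_letter) auto
  then show ?case using Cons by (auto intro: T_cm)
qed (simp add: T_I)

lemma bw_simps [simp]:
  assumes "wfb (length l) w" "oks l"
  shows "arr (bw l w)" "src (bw l w) = l" "tgt (bw l w) = perm st w l" "oks (perm st w l)"
  using T_bw[OF assms] by (auto simp: T_def)

lemma bw_append:
  assumes "wfb (length l) v" "wfb (length l) u" "oks l"
  shows "bw l (u @ v) = bw (perm st v l) u \<bullet> bw l v"
  using assms(2)
  by (induction u) (simp_all add: cm_assoc assms)

lemma letter_inv:
  assumes "fst x \<in> cgens bk (length l)" "oks l"
  shows "letter (perm_letter st x l) (fst x, \<not> snd x) \<bullet> letter l x = I l"
  using assms(1)
proof (cases rule: cgens_cases)
  case (Sig p c d r b)
  then show ?thesis using assms(2) by (auto simp: letter_at swap_strands_at interchange hz_I)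
next
  case (Kap c r b)
  then show ?thesis using assms(2) by (auto simp: interchange hz_I)
qed

lemma bw_inv:
  assumes "wfb (length l) w" "oks l"
  shows "bw (perm st w l) (inv_word w) \<bullet> bw l w = I l" "perm st (inv_word w) (perm st w l) = l"
proof -
  show "perm st (inv_word w) (perm st w l) = l" using assms by (intro perm_inv) auto
  show "bw (perm st w l) (inv_word w) \<bullet> bw l w = I l" using assms(1)
  proof (induction w)
    case (Cons x w)
    let ?l = "perm st w l" and ?x = "(fst x, \<not> snd x)"
    have f: "fst x \<in> cgens bk (length ?l)" using Cons by simp
    have l: "oks ?l" using Cons assms by simp
    note t = T_letter[OF f l]
    have e: "perm_letter st ?x (perm_letter st x ?l) = ?l" using perm_inv[of bk ?l "[x]" st] f by simp
    have t': "T (letter (perm_letter st x ?l) ?x) (perm_letter st x ?l) ?l" using T_letter[of ?x "perm_letter st x ?l"] f t e by auto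
    have "bw (perm st (x # w) l) (inv_word (x # w)) = bw ?l (inv_word w) \<bullet> letter (perm_letter st x ?l) ?x"
      using bw_append[of "perm_letter st x ?l" "[?x]" "inv_word w"] Cons f t e t' by (simp add: T_def)
    then have "bw (perm st (x # w) l) (inv_word (x # w)) \<bullet> bw l (x # w)
      = bw ?l (inv_word w) \<bullet> (letter (perm_letter st x ?l) ?x \<bullet> letter ?l x) \<bullet> bw l w"
      by (simp add: cm_assoc)
    also have "\<dots> = I l" using letter_inv[OF f l] Cons assms by simp
    finally show ?case .
  qed (simp add: assms)
qed

lemma bw_inv':
  assumes "wfb (length l) w" "oks l"
  shows "bw l w \<bullet> bw (perm st w l) (inv_word w) = I (perm st w l)"
  using bw_inv[of "perm st w l" "inv_word w"] assms bw_inv(2)[OF assms] by simp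

text \<open>Inverses of equal isomorphisms are equal. This transfers the agreement of two positive
  crossing words to the negative ones.\<close>

lemma bw_inv_cong:
  assumes "wfb (length l) w" "wfb (length l) v" "oks l" "bw l w = bw l v" "perm st w l = perm st v l"
  shows "bw (perm st w l) (inv_word w) = bw (perm st w l) (inv_word v)"
proof -
  let ?l = "perm st w l"
  have [simp]: "oks ?l" using assms by simp
  have [simp]: "tgt (bw ?l (inv_word v)) = l"
    using bw_inv(2)[OF assms(2,3)] assms(2) by (simp add: assms(5)[symmetric])
  have [simp]: "tgt (bw ?l (inv_word w)) = l" using bw_inv(2)[OF assms(1,3)] assms(1) by simp
  have "bw ?l (inv_word w) = bw ?l (inv_word w) \<bullet> I ?l"
    by (rule I_right[symmetric]) (use assms(1) in simp_all)
  also have "\<dots> = bw ?l (inv_word w) \<bullet> (bw l v \<bullet> bw ?l (inv_word v))"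
    using bw_inv'[OF assms(2,3)] by (simp only: assms(5))
  also have "\<dots> = (bw ?l (inv_word w) \<bullet> bw l w) \<bullet> bw ?l (inv_word v)"
    using assms(4) by (simp add: cm_assoc)
  also have "\<dots> = bw ?l (inv_word v)" using bw_inv(1)[OF assms(1,3)] assms(2) by simp
  finally show ?thesis .
qed

lemma letter_ext:
  assumes "fst x \<in> cgens bk (length l)" "oks l" "oks r"
  shows "letter (l @ r) x = letter l x \<odot> I r \<and> perm_letter st x (l @ r) = perm_letter st x l @ r"
  using assms(1)
proof (cases rule: cgens_cases)
  case (Sig p c d q b)
  then show ?thesis using assms(2,3) by (auto simp: letter_at swap_strands_at hz_assoc hz_I)
next
  case (Kap c q b)
  then show ?thesis using assms(2,3) by (auto simp: hz_assoc hz_I)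
qed

text \<open>Positions are counted from the pole, so strands appended at the far end stay untouched,
  even by twists.\<close>

lemma bw_ext:
  assumes "wfb (length l) w" "oks l" "oks r"
  shows "bw (l @ r) w = bw l w \<odot> I r" "perm st w (l @ r) = perm st w l @ r"
proof -
  have "bw (l @ r) w = bw l w \<odot> I r \<and> perm st w (l @ r) = perm st w l @ r" using assms(1)
  proof (induction w)
    case (Cons x w)
    then have f: "fst x \<in> cgens bk (length (perm st w l))" by simp
    have l: "oks (perm st w l)" using Cons assms by simp
    show ?case using Cons assms letter_ext[OF f l assms(3)] T_letter[OF f l]
      by (simp add: interchange T_def)
  qed (simp add: hz_I assms)
  then show "bw (l @ r) w = bw l w \<odot> I r" "perm st w (l @ r) = perm st w l @ r" by auto
qed

lemma letter_shift:
  assumes "Sig j \<in> cgens bk (length l)" "oks l" "oks p" "k = length p"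
  shows "letter (p @ l) (Sig (k + j), b) = I p \<odot> letter l (Sig j, b)
    \<and> perm_letter st (Sig (k + j), b) (p @ l) = p @ perm_letter st (Sig j, b) l"
proof -
  have "fst (Sig j, b) \<in> cgens bk (length l)" using assms by simp
  then show ?thesis
  proof (cases rule: cgens_cases)
    case (Sig q c d r b')
    then show ?thesis
      using letter_at[of "k + j" "p @ q" c d r] letter_at[of j q c d r] swap_strands_at[of "k + j" "p @ q" c d r]
        swap_strands_at[of j q c d r] assms by (simp add: hz_I[symmetric] hz_assoc)
  qed auto
qed

text \<open>Only words without twists can be moved away from the pole, since \<open>Kap\<close>
  always acts on the first strand. Twists behind further strands need \<open>kappa_behind\<close>
  instead.\<close>

lemma bw_shift:
  assumes "wfb (length l) (sgw w)" "oks l" "oks p" "k = length p"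
  shows "bw (p @ l) (sgw (shift_word k w)) = I p \<odot> bw l (sgw w)"
        "perm st (sgw (shift_word k w)) (p @ l) = p @ perm st (sgw w) l"
proof -
  have "bw (p @ l) (sgw (shift_word k w)) = I p \<odot> bw l (sgw w) \<and>
        perm st (sgw (shift_word k w)) (p @ l) = p @ perm st (sgw w) l" using assms(1)
  proof (induction w)
    case (Cons x w)
    let ?l = "perm st (sgw w) l"
    have w: "wfb (length l) (sgw w)" using Cons by simp
    have f: "Sig (fst x) \<in> cgens bk (length ?l)" using Cons by simp
    have l: "oks ?l" using w assms by simp
    have t: "T (letter ?l (Sig (fst x), snd x)) ?l (perm_letter st (Sig (fst x), snd x) ?l)"
      using T_letter[of "(Sig (fst x), snd x)"] f l by simp
    have "arr (bw l (sgw w))" "tgt (bw l (sgw w)) = ?l" using w assms by simp_all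
    then have "(I p \<odot> letter ?l (Sig (fst x), snd x)) \<bullet> (I p \<odot> bw l (sgw w))
       = I p \<odot> (letter ?l (Sig (fst x), snd x) \<bullet> bw l (sgw w))"
      using t assms(3) by (simp add: interchange T_def)
    then show ?case
      using Cons.IH[OF w] letter_shift[OF f l assms(3,4)] by (simp del: perm_letter.simps)
  qed (simp add: hz_I assms)
  then show "bw (p @ l) (sgw (shift_word k w)) = I p \<odot> bw l (sgw w)"
        "perm st (sgw (shift_word k w)) (p @ l) = p @ perm st (sgw w) l" by auto
qed

end
end

section \<open>Crossings of blocks and naturality\<close>

context strict_moncat begin

lemma whisker_left: "\<lbrakk>arr g; arr f; src g = tgt f; list_all ok a\<rbrakk> \<Longrightarrow> I a \<odot> (g \<bullet> f) = (I a \<odot> g) \<bullet> (I a \<odot> f)"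
  by (simp add: interchange)

lemma whisker_right: "\<lbrakk>arr g; arr f; src g = tgt f; list_all ok a\<rbrakk> \<Longrightarrow> (g \<bullet> f) \<odot> I a = (g \<odot> I a) \<bullet> (f \<odot> I a)"
  by (simp add: interchange)

lemma hz_I2: "\<lbrakk>list_all ok a; list_all ok b\<rbrakk> \<Longrightarrow> I a \<odot> I b \<odot> f = I (a @ b) \<odot> f"
  by (simp add: hz_assoc[symmetric] hz_I)

lemmas strict_simps = whisker_left whisker_right hz_assoc cm_assoc hz_I hz_I2

text \<open>Arrows with disjoint supports, separated by the strands \<open>x\<close>, commute by the
  interchange law. This is the source of the commutation of distant generators.\<close>

lemma slide:
  assumes "arr f" "arr g" "src f = a" "tgt f = b" "src g = c" "tgt g = d" "list_all ok x" "list_all ok p" "list_all ok q"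
  shows "(I p \<odot> f \<odot> I (x @ d @ q)) \<bullet> (I (p @ a @ x) \<odot> g \<odot> I q)
    = (I (p @ b @ x) \<odot> g \<odot> I q) \<bullet> (I p \<odot> f \<odot> I (x @ c @ q))"
proof -
  have k: "list_all ok a" "list_all ok b" "list_all ok c" "list_all ok d" using assms by auto
  have "(f \<odot> I (x @ d)) \<bullet> (I a \<odot> I x \<odot> g) = (I b \<odot> I x \<odot> g) \<bullet> (f \<odot> I (x @ c))"
    using assms k by (simp add: interchange)
  then have "I p \<odot> ((f \<odot> I (x @ d)) \<bullet> (I a \<odot> I x \<odot> g)) \<odot> I q = I p \<odot> ((I b \<odot> I x \<odot> g) \<bullet> (f \<odot> I (x @ c))) \<odot> I q"
    by simp
  then show ?thesis using assms k by (simp add: strict_simps)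
qed

lemma slide0:
  assumes "arr f" "arr g" "src f = a" "tgt f = b" "src g = c" "tgt g = d"
  shows "(f \<odot> I d) \<bullet> (I a \<odot> g) = (I b \<odot> g) \<bullet> (f \<odot> I c)" "f \<odot> g = (f \<odot> I d) \<bullet> (I a \<odot> g)"
  using assms by (auto simp: interchange)

end

context strict_words begin

text \<open>\<open>Xr\<close> carries one strand across a list from left to right, and
  \<open>X\<close> does so with the strands of a block, the last one first. This order is that of
  the word \<open>cross\<close>.\<close>

primrec Xr :: "'c \<Rightarrow> 'c list \<Rightarrow> 'e" where
  "Xr c [] = I [c]"
| "Xr c (d # m) = (I [d] \<odot> Xr c m) \<bullet> (sg c d \<odot> I m)"

primrec X :: "'c list \<Rightarrow> 'c list \<Rightarrow> 'e" where
  "X [] m = I m"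
| "X (c # l) m = (Xr c m \<odot> I l) \<bullet> (I [c] \<odot> X l m)"

text \<open>Crossings of blocks are natural for arrows coming from \<open>A\<close>, but not for \<open>kp\<close>; so naturality is a property
  of single arrows here.\<close>

definition natural :: "'e \<Rightarrow> bool" where
  "natural f \<longleftrightarrow> arr f \<and> (\<forall>m. list_all ok m \<longrightarrow>
     X (tgt f) m \<bullet> (f \<odot> I m) = (I m \<odot> f) \<bullet> X (src f) m \<and>
     X m (tgt f) \<bullet> (I m \<odot> f) = (f \<odot> I m) \<bullet> X m (src f))"

text \<open>The strands of \<Phi> of a tensor product.\<close>

definition du :: "'c list \<Rightarrow> 'c list" where "du l = rev (map st l)"

end

text \<open>The leftmost factor of a nonempty \<open>cross\<close>. Its letter \<open>1\<close> acts
  first, so the first strand is carried across \<open>b\<close> strands.\<close>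

definition down :: "nat \<Rightarrow> nat word" where "down b = pos (rev [1..<Suc b])"

lemma down_simps [simp]: "down 0 = []" "down (Suc b) = shift_word 1 (down b) @ [(1, True)]"
proof -
  have "[1..<Suc (Suc b)] = 1 # map Suc [1..<Suc b]" by (simp add: map_Suc_upt upt_conv_Cons del: upt_Suc)
  then show "down (Suc b) = shift_word 1 (down b) @ [(1, True)]"
    by (simp add: down_def shift_word_def rev_map comp_def del: upt_Suc)
qed (simp add: down_def)

lemma cross_simps [simp]: "cross 0 b = []" "cross (Suc a) b = down b @ shift_word 1 (cross a b)"
proof -
  have e: "[1..<Suc (Suc a)] = 1 # map Suc [1..<Suc a]" by (simp add: map_Suc_upt upt_conv_Cons del: upt_Suc)
  have s: "pos (rev [Suc j..<Suc j + b]) = shift_word 1 (pos (rev [j..<j + b]))" for j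
    by (simp add: map_Suc_upt[symmetric] shift_word_def rev_map comp_def del: upt_Suc)
  have c: "concat (map (\<lambda>j. shift_word 1 (f j)) xs) = shift_word 1 (concat (map f xs))" for f :: "nat \<Rightarrow> nat word" and xs
    by (induction xs) auto
  show "cross (Suc a) b = down b @ shift_word 1 (cross a b)"
    unfolding cross_def e using s c[of "\<lambda>j. pos (rev [j..<j + b])" "[1..<Suc a]"]
    by (simp add: down_def comp_def del: upt_Suc)
qed (simp add: cross_def)

context strict_braided begin

lemma oks_du [simp]: "oks (du l) = oks l"
  by (simp add: du_def list_all_iff)

lemma du_simps [simp]: "du [] = []" "du (c # l) = du l @ [st c]" "du (l @ m) = du m @ du l" "du (du l) = l"
  "length (du l) = length l"
  by (auto simp: du_def rev_map comp_def)

context assumes bs: bs begin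

lemmas bsimps [simp] = sg_simps[OF bs] kp_simps[OF bs] bw_simps[OF bs]

lemma Xr_typ: "ok c \<Longrightarrow> oks m \<Longrightarrow> arr (Xr c m) \<and> src (Xr c m) = c # m \<and> tgt (Xr c m) = m @ [c]"
  by (induction m) auto

lemma Xr_simps [simp]: assumes "ok c" "oks m"
  shows "arr (Xr c m)" "src (Xr c m) = c # m" "tgt (Xr c m) = m @ [c]"
  using Xr_typ[OF assms] by auto

lemma X_typ: "oks l \<Longrightarrow> oks m \<Longrightarrow> arr (X l m) \<and> src (X l m) = l @ m \<and> tgt (X l m) = m @ l"
  by (induction l) auto

lemma X_simps [simp]: assumes "oks l" "oks m"
  shows "arr (X l m)" "src (X l m) = l @ m" "tgt (X l m) = m @ l"
  using X_typ[OF assms] by auto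

lemma X_nil [simp]: "oks l \<Longrightarrow> X l [] = I l"
  by (induction l) (auto simp: strict_simps)

lemma X_single [simp]: "ok c \<Longrightarrow> ok d \<Longrightarrow> X [c] [d] = sg c d"
  by (simp add: strict_simps)

lemma X_app1: "oks l \<Longrightarrow> oks l' \<Longrightarrow> oks m \<Longrightarrow> X (l @ l') m = (X l m \<odot> I l') \<bullet> (I l \<odot> X l' m)"
  by (induction l) (auto simp: strict_simps)

lemma Xr_app: "ok c \<Longrightarrow> oks m \<Longrightarrow> oks m' \<Longrightarrow> Xr c (m @ m') = (I m \<odot> Xr c m') \<bullet> (Xr c m \<odot> I m')"
  by (induction m) (auto simp: strict_simps)

text \<open>Unlike the splitting of the left block, this does not follow the recursion: the crossing
  of \<open>c\<close> with \<open>m\<close> has to slide past that of \<open>l\<close> with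
  \<open>m'\<close>.\<close>

lemma X_app2: "oks l \<Longrightarrow> oks m \<Longrightarrow> oks m' \<Longrightarrow> X l (m @ m') = (I m \<odot> X l m') \<bullet> (X l m \<odot> I m')"
proof (induction l)
  case (Cons c l)
  have s: "(Xr c m \<odot> I (m' @ l)) \<bullet> (I (c # m) \<odot> X l m') = (I (m @ [c]) \<odot> X l m') \<bullet> (Xr c m \<odot> I (l @ m'))"
    using Cons by (intro slide0(1)) auto
  show ?case using Cons by (simp add: Xr_app strict_simps cm_cong[OF s])
qed (simp add: strict_simps)

text \<open>A crossing with a block is a composite of crossings with its strands, so naturality
  against a single strand propagates by induction.\<close>

lemma ntI:
  assumes "arr f"
    "\<And>y. ok y \<Longrightarrow> X (tgt f) [y] \<bullet> (f \<odot> I [y]) = (I [y] \<odot> f) \<bullet> X (src f) [y]"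
    "\<And>y. ok y \<Longrightarrow> X [y] (tgt f) \<bullet> (I [y] \<odot> f) = (f \<odot> I [y]) \<bullet> X [y] (src f)"
  shows "natural f"
proof -
  have "X (tgt f) m \<bullet> (f \<odot> I m) = (I m \<odot> f) \<bullet> X (src f) m \<and>
     X m (tgt f) \<bullet> (I m \<odot> f) = (f \<odot> I m) \<bullet> X m (src f)" if "oks m" for m
    using that
  proof (induction m)
    case (Cons y m)
    then have k: "ok y" "oks m" by auto
    have IH: "X (tgt f) m \<bullet> (f \<odot> I m) = (I m \<odot> f) \<bullet> X (src f) m"
     "X m (tgt f) \<bullet> (I m \<odot> f) = (f \<odot> I m) \<bullet> X m (src f)" using Cons by auto
    have 1: "(X (tgt f) [y] \<odot> I m) \<bullet> (f \<odot> I (y # m)) = (I [y] \<odot> f \<odot> I m) \<bullet> (X (src f) [y] \<odot> I m)"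
      using arg_cong[OF assms(2)[OF k(1)], of "\<lambda>g. g \<odot> I m"] k assms(1) by (simp add: strict_simps del: X.simps)
    have 2: "(I [y] \<odot> X (tgt f) m) \<bullet> (I [y] \<odot> f \<odot> I m) = (I (y # m) \<odot> f) \<bullet> (I [y] \<odot> X (src f) m)"
      using arg_cong[OF IH(1), of "\<lambda>g. I [y] \<odot> g"] k assms(1) by (simp add: strict_simps del: X.simps)
    have 3: "(X [y] (tgt f) \<odot> I m) \<bullet> (I [y] \<odot> f \<odot> I m) = (f \<odot> I (y # m)) \<bullet> (X [y] (src f) \<odot> I m)"
      using arg_cong[OF assms(3)[OF k(1)], of "\<lambda>g. g \<odot> I m"] k assms(1) by (simp add: strict_simps del: X.simps)
    have 4: "(I [y] \<odot> X m (tgt f)) \<bullet> (I (y # m) \<odot> f) = (I [y] \<odot> f \<odot> I m) \<bullet> (I [y] \<odot> X m (src f))"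
      using arg_cong[OF IH(2), of "\<lambda>g. I [y] \<odot> g"] k assms(1) by (simp add: strict_simps del: X.simps)
    have a: "X l (y # m) = (I [y] \<odot> X l m) \<bullet> (X l [y] \<odot> I m)" "X (y # m) l = (X [y] l \<odot> I m) \<bullet> (I [y] \<odot> X m l)"
      if "oks l" for l using X_app2[of l "[y]" m] X_app1[of "[y]" m l] k that by auto
    have o: "oks (src f)" "oks (tgt f)" using assms(1) by simp_all
    show ?case
      by (simp only: a(1)[OF o(1)] a(2)[OF o(1)] a(1)[OF o(2)] a(2)[OF o(2)] cm_assoc 1 cm_cong[OF 2] 4 cm_cong[OF 3])
  qed (use assms(1) in simp)
  then show ?thesis using assms(1) unfolding natural_def by blast
qed

lemma natural_arr: "natural f \<Longrightarrow> arr f"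
  unfolding natural_def by blast

lemma natural_D:
  assumes "natural f" "oks m" "src f = a" "tgt f = b"
  shows "arr f" "X b m \<bullet> (f \<odot> I m) = (I m \<odot> f) \<bullet> X a m" "X m b \<bullet> (I m \<odot> f) = (f \<odot> I m) \<bullet> X m a"
  using assms(1,2) unfolding natural_def assms(3)[symmetric] assms(4)[symmetric] by blast+

lemma natural_I: "oks l \<Longrightarrow> natural (I l)"
  by (simp add: natural_def strict_simps)

lemma natural_cm:
  assumes "natural g" "natural f" "src g = tgt f"
  shows "natural (g \<bullet> f)"
proof -
  have a: "arr f" "arr g" using assms natural_arr by blast+
  { fix m assume m: "oks m"
    note G = natural_D(2,3)[OF assms(1) m HOL.refl HOL.refl] and F = natural_D(2,3)[OF assms(2) m HOL.refl HOL.refl]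
    have "X (tgt g) m \<bullet> ((g \<bullet> f) \<odot> I m) = X (tgt g) m \<bullet> (g \<odot> I m) \<bullet> (f \<odot> I m)"
      using a m assms(3) by (simp add: whisker_right)
    also have "\<dots> = (I m \<odot> g) \<bullet> (I m \<odot> f) \<bullet> X (src f) m"
      by (simp only: cm_cong[OF G(1)] assms(3) F(1) cm_assoc)
    finally have 1: "X (tgt g) m \<bullet> ((g \<bullet> f) \<odot> I m) = (I m \<odot> (g \<bullet> f)) \<bullet> X (src f) m"
      using a m assms(3) by (simp add: whisker_left cm_assoc)
    have "X m (tgt g) \<bullet> (I m \<odot> (g \<bullet> f)) = X m (tgt g) \<bullet> (I m \<odot> g) \<bullet> (I m \<odot> f)"
      using a m assms(3) by (simp add: whisker_left)
    also have "\<dots> = (g \<odot> I m) \<bullet> (f \<odot> I m) \<bullet> X m (src f)"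
      by (simp only: cm_cong[OF G(2)] assms(3) F(2) cm_assoc)
    finally have "X m (tgt g) \<bullet> (I m \<odot> (g \<bullet> f)) = ((g \<bullet> f) \<odot> I m) \<bullet> X m (src f)"
      using a m assms(3) by (simp add: whisker_right cm_assoc)
    note 1 this }
  moreover have "arr (g \<bullet> f)" "src (g \<bullet> f) = src f" "tgt (g \<bullet> f) = tgt g" using a assms(3) by simp_all
  ultimately show ?thesis unfolding natural_def by simp
qed

lemma natural_whisker_right:
  assumes "natural f" "oks l"
  shows "natural (f \<odot> I l)"
proof -
  let ?a = "src f" and ?b = "tgt f"
  have f: "arr f" using assms natural_arr by blast
  { fix m assume m: "oks m"
    note D = natural_D(2,3)[OF assms(1) m HOL.refl HOL.refl]
    have 1: "(X ?b m \<odot> I l) \<bullet> (f \<odot> I (m @ l)) = (I m \<odot> f \<odot> I l) \<bullet> (X ?a m \<odot> I l)"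
      using arg_cong[OF D(1), of "\<lambda>g. g \<odot> I l"] f m assms(2) by (simp add: strict_simps)
    have 2: "(I ?b \<odot> X l m) \<bullet> (f \<odot> I (l @ m)) = (f \<odot> I (m @ l)) \<bullet> (I ?a \<odot> X l m)"
      using f m assms(2) by (intro slide0(1)[symmetric]) auto
    have 3: "(X m ?b \<odot> I l) \<bullet> (I m \<odot> f \<odot> I l) = (f \<odot> I (m @ l)) \<bullet> (X m ?a \<odot> I l)"
      using arg_cong[OF D(2), of "\<lambda>g. g \<odot> I l"] f m assms(2) by (simp add: strict_simps)
    have 4: "(I ?b \<odot> X m l) \<bullet> (f \<odot> I (m @ l)) = (f \<odot> I (l @ m)) \<bullet> (I ?a \<odot> X m l)"
      using f m assms(2) by (intro slide0(1)[symmetric]) auto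
    have "X (?b @ l) m \<bullet> (f \<odot> I (l @ m)) = (I m \<odot> f \<odot> I l) \<bullet> X (?a @ l) m"
      using f m assms(2) by (simp add: X_app1 cm_assoc 2 cm_cong[OF 1])
    moreover have "X m (?b @ l) \<bullet> (I m \<odot> f \<odot> I l) = (f \<odot> I (l @ m)) \<bullet> X m (?a @ l)"
      using f m assms(2) by (simp add: X_app2 cm_assoc 3 cm_cong[OF 4])
    ultimately have "X (?b @ l) m \<bullet> (f \<odot> I (l @ m)) = (I m \<odot> f \<odot> I l) \<bullet> X (?a @ l) m \<and>
       X m (?b @ l) \<bullet> (I m \<odot> f \<odot> I l) = (f \<odot> I (l @ m)) \<bullet> X m (?a @ l)" by simp }
  moreover have "arr (f \<odot> I l)" "src (f \<odot> I l) = ?a @ l" "tgt (f \<odot> I l) = ?b @ l"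
    "\<And>m. oks m \<Longrightarrow> (f \<odot> I l) \<odot> I m = f \<odot> I (l @ m)" using f assms(2) by (simp_all add: hz_assoc hz_I)
  ultimately show ?thesis unfolding natural_def by simp
qed

lemma natural_whisker_left:
  assumes "natural f" "oks l"
  shows "natural (I l \<odot> f)"
proof -
  let ?a = "src f" and ?b = "tgt f"
  have f: "arr f" using assms natural_arr by blast
  { fix m assume m: "oks m"
    note D = natural_D(2,3)[OF assms(1) m HOL.refl HOL.refl]
    have 1: "(I l \<odot> X ?b m) \<bullet> (I l \<odot> f \<odot> I m) = (I (l @ m) \<odot> f) \<bullet> (I l \<odot> X ?a m)"
      using arg_cong[OF D(1), of "\<lambda>g. I l \<odot> g"] f m assms(2) by (simp add: strict_simps)
    have 2: "(X l m \<odot> I ?b) \<bullet> (I (l @ m) \<odot> f) = (I (m @ l) \<odot> f) \<bullet> (X l m \<odot> I ?a)"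
      using f m assms(2) by (intro slide0(1)) auto
    have 3: "(I l \<odot> X m ?b) \<bullet> (I (l @ m) \<odot> f) = (I l \<odot> f \<odot> I m) \<bullet> (I l \<odot> X m ?a)"
      using arg_cong[OF D(2), of "\<lambda>g. I l \<odot> g"] f m assms(2) by (simp add: strict_simps)
    have 4: "(X m l \<odot> I ?b) \<bullet> (I (m @ l) \<odot> f) = (I (l @ m) \<odot> f) \<bullet> (X m l \<odot> I ?a)"
      using f m assms(2) by (intro slide0(1)) auto
    have "X (l @ ?b) m \<bullet> (I l \<odot> f \<odot> I m) = (I (m @ l) \<odot> f) \<bullet> X (l @ ?a) m"
      using f m assms(2) by (simp add: X_app1 cm_assoc 1 cm_cong[OF 2])
    moreover have "X m (l @ ?b) \<bullet> (I (m @ l) \<odot> f) = (I l \<odot> f \<odot> I m) \<bullet> X m (l @ ?a)"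
      using f m assms(2) by (simp add: X_app2 cm_assoc 4 cm_cong[OF 3])
    ultimately have "X (l @ ?b) m \<bullet> (I l \<odot> f \<odot> I m) = (I (m @ l) \<odot> f) \<bullet> X (l @ ?a) m \<and>
       X m (l @ ?b) \<bullet> (I (m @ l) \<odot> f) = (I l \<odot> f \<odot> I m) \<bullet> X m (l @ ?a)" by simp }
  moreover have "arr (I l \<odot> f)" "src (I l \<odot> f) = l @ ?a" "tgt (I l \<odot> f) = l @ ?b"
    "\<And>m. oks m \<Longrightarrow> I m \<odot> I l \<odot> f = I (m @ l) \<odot> f" "\<And>m. (I l \<odot> f) \<odot> I m = I l \<odot> f \<odot> I m"
    using f assms(2) by (simp_all add: hz_assoc hz_I2)
  ultimately show ?thesis unfolding natural_def by simp
qed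

text \<open>The interchange law factors \<open>f \<odot> g\<close> into two whiskered arrows, each
  of which inherits naturality.\<close>

lemma natural_hz:
  assumes "natural f" "natural g"
  shows "natural (f \<odot> g)"
proof -
  have a: "arr f" "arr g" using assms natural_arr by blast+
  have "natural ((f \<odot> I (tgt g)) \<bullet> (I (src f) \<odot> g))"
    using assms a by (intro natural_cm natural_whisker_left natural_whisker_right) auto
  then show ?thesis using slide0(2)[OF a] by simp
qed

text \<open>For one crossing and a third strand, on either side, naturality is the Yang-Baxter
  equation.\<close>

lemma natural_sg: "ok c \<Longrightarrow> ok d \<Longrightarrow> natural (sg c d)"
  using yang_baxter[OF bs] by (intro ntI) (auto simp: strict_simps)

lemma natural_X: "oks l \<Longrightarrow> oks m \<Longrightarrow> natural (X l m)"
proof -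
  have r: "ok c \<Longrightarrow> oks m \<Longrightarrow> natural (Xr c m)" for c m
    by (induction m) (auto intro!: natural_cm natural_whisker_left natural_whisker_right natural_sg natural_I)
  show "oks l \<Longrightarrow> oks m \<Longrightarrow> natural (X l m)"
    by (induction l) (auto intro!: natural_cm natural_whisker_left natural_whisker_right natural_I r)
qed

lemma letter_Suc0:
  assumes "ok c" "ok d" "oks m"
  shows "letter (c # d # m) (Sig (Suc 0), True) = sg c d \<odot> I m"
  using letter_at[of "Suc 0" "[]" c d m] assms by simp

lemma swap_strands_Suc0 [simp]: "swap_strands (Suc 0) (c # d # m) = d # c # m"
  using swap_strands_at[of "Suc 0" "[]"] by simp

lemma bw_down: "ok c \<Longrightarrow> oks m \<Longrightarrow> wfb (Suc (length m)) (sgw (down (length m))) \<and>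
   bw (c # m) (sgw (down (length m))) = Xr c m \<and> perm st (sgw (down (length m))) (c # m) = m @ [c]"
proof (induction m)
  case (Cons d m)
  then have IH: "wfb (length (c # m)) (sgw (down (length m)))" "bw (c # m) (sgw (down (length m))) = Xr c m"
     "perm st (sgw (down (length m))) (c # m) = m @ [c]" by auto
  have k: "ok c" "ok d" "oks m" "oks (c # m)" "oks [d]" using Cons by auto
  note s = bw_shift[OF bs IH(1) k(4,5), of 1, simplified]
  have w: "wfb (length (c # d # m)) (sgw (shift_word 1 (down (length m))))"
    using IH(1) by (auto simp: wfw_sgw shift_word_def)
  have w1: "wfb (length (c # d # m)) [(Sig (Suc 0), True)]" by (simp add: cgens_def)
  have o: "oks (c # d # m)" using k by simp
  have e: "sgw (down (length (d # m))) = sgw (shift_word 1 (down (length m))) @ [(Sig (Suc 0), True)]" by simp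
  have p1: "perm st [(Sig (Suc 0), True)] (c # d # m) = d # c # m" by simp
  have b1: "bw (c # d # m) [(Sig (Suc 0), True)] = sg c d \<odot> I m"
    using k by (simp add: letter_Suc0)
  have s1: "bw (d # c # m) (sgw (shift_word 1 (down (length m)))) = I [d] \<odot> Xr c m"
    "perm st (sgw (shift_word 1 (down (length m)))) (d # c # m) = d # m @ [c]" using s IH by simp_all
  show ?case
    unfolding e bw_append[OF bs w1 w o] p1 b1 s1 using w w1 s1(2) by simp
qed simp

text \<open>The recursion \<open>cross (Suc a) b = down b @ shift_word 1 (cross a b)\<close> mirrors
  that of \<open>X\<close>: the block \<open>l\<close> behind \<open>c\<close> crosses
  \<open>m\<close> before \<open>c\<close> does.\<close>

lemma bw_cross: "oks l \<Longrightarrow> oks m \<Longrightarrow> wfb (length l + length m) (sgw (cross (length l) (length m))) \<and>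
   bw (l @ m) (sgw (cross (length l) (length m))) = X l m \<and> perm st (sgw (cross (length l) (length m))) (l @ m) = m @ l"
proof (induction l)
  case (Cons c l)
  let ?u = "sgw (cross (length l) (length m))" and ?d = "sgw (down (length m))"
  have k: "ok c" "oks [c]" "oks m" "oks l" "oks (l @ m)" "oks (c # m)" using Cons by auto
  then have IH: "wfb (length (l @ m)) ?u" "bw (l @ m) ?u = X l m" "perm st ?u (l @ m) = m @ l"
    using Cons by auto
  note s = bw_shift[OF bs IH(1) k(5,2), of 1, simplified]
  have w: "wfb (length (c # l @ m)) (sgw (shift_word 1 (cross (length l) (length m))))"
    using IH(1) by (auto simp: wfw_sgw shift_word_def)
  note d = bw_down[OF k(1,3)]
  have dw: "wfb (length (c # m)) ?d" using d by simp
  have dw': "wfb (length (c # l @ m)) ?d" using wfw_sig_mono[OF dw] by simp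
  note e = bw_ext[OF bs dw k(6,4)]
  have o: "oks (c # l @ m)" using k by simp
  let ?s = "sgw (shift_word 1 (cross (length l) (length m)))"
  have c: "sgw (cross (length (c # l)) (length m)) = ?d @ ?s" by simp
  have s1: "bw (c # l @ m) ?s = I [c] \<odot> X l m" "perm st ?s (c # l @ m) = c # m @ l" using s IH by simp_all
  have e1: "bw (c # m @ l) ?d = Xr c m \<odot> I l" "perm st ?d (c # m @ l) = m @ c # l" using e d by simp_all
  have "bw (c # l @ m) (?d @ ?s) = bw (perm st ?s (c # l @ m)) ?d \<bullet> bw (c # l @ m) ?s"
    by (rule bw_append[OF bs w dw' o])
  then show ?case
    unfolding c using w dw' by (simp only: s1 e1 X.simps perm_simps append_Cons wfw_simps) simp
qed (simp)

lemma bw_cross_simps [simp]: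
  assumes "oks l" "oks m" "a = length l" "b = length m"
  shows "bw (l @ m) (sgw (cross a b)) = X l m" "perm st (sgw (cross a b)) (l @ m) = m @ l"
  using bw_cross[OF assms(1,2)] assms(3-) by auto

end
end

section \<open>Reflection of braid words\<close>

lemma flip_word_simps [simp]: "flip_word n [] = []" "flip_word n (x # w) = (n - fst x, snd x) # flip_word n w"
    "flip_word n (u @ v) = flip_word n u @ flip_word n v"
  by (simp_all add: flip_word_def case_prod_unfold)

lemma flip_shift_word: "flip_word (p + n) (shift_word p w) = flip_word n w"
  by (induction w) auto

text \<open>The bound on the letters keeps the truncated subtraction \<open>n - i\<close> exact, so
  that \<open>p\<close> can be split off.\<close>

lemma flip_word_add: "fst ` set w \<subseteq> {1..<n} \<Longrightarrow> flip_word (p + n) w = shift_word p (flip_word n w)"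
  by (induction w) auto

lemma fst_down: "fst ` set (down a) = {1..<Suc a}"
  by (force simp: down_def)

lemma cross_1: "cross a (Suc 0) = pos [Suc 0..<Suc a]"
proof -
  have "concat (map (\<lambda>j. [(j, True)]) xs) = pos xs" for xs :: "nat list" by (induction xs) auto
  moreover have "rev [j..<j + Suc 0] = [j]" for j by simp
  ultimately show ?thesis by (simp add: cross_def del: upt_Suc)
qed

text \<open>Reflection turns the letters \<open>a, ..., 1\<close> into \<open>1, ..., a\<close>:
  instead of the first strand moving right, the last one moves left.\<close>

lemma flip_down: "flip_word (Suc a) (down a) = cross a (Suc 0)"
proof -
  have "map (\<lambda>i. Suc a - i) (rev [1..<Suc a]) = [1..<Suc a]"
    by (rule nth_equalityI) (auto simp: rev_nth nth_append simp del: upt_Suc)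
  then have "pos (map (\<lambda>i. Suc a - i) (rev [1..<Suc a])) = pos [1..<Suc a]" by (rule arg_cong)
  then show ?thesis
    by (simp add: cross_1 down_def flip_word_def comp_def del: upt_Suc)
qed

lemma wfw_shift: "wfw k n (sgw w) \<Longrightarrow> p + n \<le> q \<Longrightarrow> wfw k q (sgw (shift_word p w))"
  by (fastforce simp: wfw_sgw shift_word_def)

text \<open>A commuting square with invertible sides yields the square of the inverses. Negative
  letters and inverted constituents are reduced to positive ones in this way.\<close>

lemma (in strict_moncat) conj_inverse:
  assumes "Z \<bullet> F = G \<bullet> z" "Zi \<bullet> Z = I (src Z)" "z \<bullet> zi = I (src zi)"
    "arr Z" "arr F" "arr G" "arr zi" "src Z = tgt F" "src G = src zi" "src F = tgt zi"
  shows "Zi \<bullet> G = F \<bullet> zi"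
proof -
  have "Zi \<bullet> G = Zi \<bullet> (G \<bullet> z) \<bullet> zi" using assms(3,6,9) by (simp add: cm_assoc)
  also have "\<dots> = (Zi \<bullet> Z) \<bullet> F \<bullet> zi" by (simp only: assms(1)[symmetric] cm_assoc)
  also have "\<dots> = F \<bullet> zi" using assms(2,4,5,7,8,10) by simp
  finally show ?thesis .
qed

context strict_braided begin

section \<open>Dual arrows and cabling\<close>

definition K :: "'a list \<Rightarrow> 'b" where "K l = bw l (kappa_block (length l))"

text \<open>\<open>f'\<close> plays the role of \<open>\<Phi>(f)\<close>, and \<open>K\<close> that of \<open>\<kappa>\<close> on a block.\<close>

definition dual :: "'b \<Rightarrow> 'b \<Rightarrow> bool" where
  "dual f f' \<longleftrightarrow> natural f \<and> natural f' \<and> src f' = du (src f) \<and> tgt f' = du (tgt f) \<and>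
     (bk \<longrightarrow> K (tgt f) \<bullet> f = f' \<bullet> K (src f))"

text \<open>The strand \<open>v\<close>, coloured by \<open>cb v\<close>, is to be replaced by the block \<open>tb v\<close> along \<open>fb v\<close>; \<open>s\<close> changes signs.\<close>

definition cabled :: "'v set \<Rightarrow> ('v \<Rightarrow> 'v) \<Rightarrow> ('v \<Rightarrow> 'a) \<Rightarrow> ('v \<Rightarrow> 'a list) \<Rightarrow> ('v \<Rightarrow> 'b) \<Rightarrow> bool" where
  "cabled V s cb tb fb \<longleftrightarrow> (\<forall>v\<in>V. s v \<in> V \<and> s (s v) = v \<and> cb (s v) = st (cb v) \<and> tb (s v) = du (tb v) \<and>
     src (fb v) = [cb v] \<and> tgt (fb v) = tb v \<and> dual (fb v) (fb (s v)))"

context assumes bs: bs begin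

lemmas csimps [simp] = sg_simps[OF bs] kp_simps[OF bs] kp_simps'[OF bs] bw_simps[OF bs] X_simps[OF bs] Xr_simps[OF bs]
  bw_cross_simps[OF bs] X_nil[OF bs] X_single[OF bs]

declare X.simps [simp del]

lemma wf_cross: "oks l \<Longrightarrow> oks m \<Longrightarrow> length l = a \<Longrightarrow> length m = b \<Longrightarrow> n = a + b \<Longrightarrow> wfb n (sgw (cross a b))"
  using bw_cross[OF bs] by auto

lemma bw_at:
  assumes "wfb (length l) (sgw u)" "oks p" "oks l" "oks r" "k = length p"
  shows "wfb (length (p @ l @ r)) (sgw (shift_word k u))"
    "bw (p @ l @ r) (sgw (shift_word k u)) = I p \<odot> bw l (sgw u) \<odot> I r"
    "perm st (sgw (shift_word k u)) (p @ l @ r) = p @ perm st (sgw u) l @ r"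
proof -
  have w: "wfb (length (l @ r)) (sgw u)" using wfw_sig_mono[OF assms(1)] by simp
  have o: "oks (l @ r)" using assms by simp
  show "wfb (length (p @ l @ r)) (sgw (shift_word k u))" using wfw_shift[OF w] assms(5) by simp
  show "bw (p @ l @ r) (sgw (shift_word k u)) = I p \<odot> bw l (sgw u) \<odot> I r"
    "perm st (sgw (shift_word k u)) (p @ l @ r) = p @ perm st (sgw u) l @ r"
    using bw_shift[OF bs w o assms(2,5)] bw_ext[OF bs assms(1,3,4)] by simp_all
qed

text \<open>The reflected word and \<open>cross (length l) (length m)\<close> contain the same
  crossings in different orders, for two blocks of length two \<open>2, 3, 1, 2\<close> against
  \<open>2, 1, 3, 2\<close>, so it is the values that agree. Splitting off the last strand
  \<open>d\<close> of \<open>m\<close> fits the recursion of \<open>cross\<close>: reflection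
  cancels its shift, and its leading factor becomes the crossing of \<open>l\<close> with
  \<open>d\<close>.\<close>

lemma bw_flip_cross: "oks m \<Longrightarrow> oks l \<Longrightarrow>
   wfb (length l + length m) (sgw (flip_word (length l + length m) (cross (length m) (length l)))) \<and>
   bw (l @ m) (sgw (flip_word (length l + length m) (cross (length m) (length l)))) = X l m \<and>
   perm st (sgw (flip_word (length l + length m) (cross (length m) (length l)))) (l @ m) = m @ l"
proof (induction m rule: rev_induct)
  case (snoc d m)
  let ?a = "length l" and ?b = "length m"
  let ?f = "flip_word (?a + ?b) (cross ?b ?a)"
  have k: "oks m" "oks l" "ok d" "oks [d]" "oks (l @ m)" "oks (l @ [d])" using snoc by auto
  have IH: "wfb (length (l @ m)) (sgw ?f)" "bw (l @ m) (sgw ?f) = X l m" "perm st (sgw ?f) (l @ m) = m @ l"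
    using snoc by auto
  have "flip_word (?a + length (m @ [d])) (down ?a) = flip_word (?b + Suc ?a) (down ?a)" by (simp add: ac_simps)
  also have "\<dots> = shift_word ?b (cross ?a 1)"
    using flip_word_add[of "down ?a" "Suc ?a" ?b] by (simp add: flip_down fst_down)
  finally have e: "sgw (flip_word (?a + length (m @ [d])) (cross (length (m @ [d])) ?a))
     = sgw (shift_word ?b (cross ?a 1)) @ sgw ?f"
    using flip_shift_word[of 1 "?a + ?b" "cross ?b ?a"] by simp
  have wc: "wfb (length (l @ [d])) (sgw (cross ?a 1))" using k by (intro wf_cross[of l "[d]"]) auto
  note b = bw_at[OF wc k(1,6) list.pred_inject(1) HOL.refl, simplified]
  note x = bw_ext[OF bs IH(1) k(5,4), simplified]
  have wf1: "wfb (length (l @ m @ [d])) (sgw ?f)" using wfw_sig_mono[OF IH(1)] by simp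
  have wf2: "wfb (length (l @ m @ [d])) (sgw (shift_word ?b (cross ?a 1)))"
    using wfw_shift[OF wc, of ?b "length (l @ m @ [d])"] by simp
  have o: "oks (l @ m @ [d])" using k by simp
  have 1: "bw (l @ m @ [d]) (sgw ?f) = X l m \<odot> I [d]" "perm st (sgw ?f) (l @ m @ [d]) = m @ l @ [d]"
    using x IH by simp_all
  have 2: "bw (m @ l @ [d]) (sgw (shift_word ?b (cross ?a 1))) = I m \<odot> X l [d]"
     "perm st (sgw (shift_word ?b (cross ?a 1))) (m @ l @ [d]) = m @ [d] @ l"
    using b k bw_cross_simps[OF bs, of l "[d]" ?a 1] by simp_all
  show ?case
    unfolding e bw_append[OF bs wf1 wf2 o] 1 2 perm_simps X_app2[OF bs k(2,1,4)]
    using wf1 wf2 by simp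
qed simp

lemma kappa_block_Suc: "kappa_block (Suc w) = (Kap, True) # sgw (cross w 1) @ kappa_block w"
  using sig_sgw[of "pos [1..<Suc w]"] by (simp add: cross_1 del: upt_Suc map_map)

section \<open>Twists of blocks\<close>

context assumes bk: bk begin

lemma kappa_block_wf: "oks l \<Longrightarrow> wfb (length l) (kappa_block (length l)) \<and> perm st (kappa_block (length l)) l = du l"
proof (induction l rule: rev_induct)
  case (snoc c l)
  then have IH: "wfb (length l) (kappa_block (length l))" "perm st (kappa_block (length l)) l = du l" by auto
  have "oks l" "oks [c]" using snoc by auto
  note e = bw_ext[OF bs IH(1) this] IH(2)
  have "wfb (Suc (length l)) (sgw (cross (length l) 1))"
    using snoc by (intro wf_cross[of l "[c]"]) auto
  moreover have "wfb (Suc (length l)) (kappa_block (length l))"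
    using wfw_sig_mono[OF IH(1)] by simp
  moreover have "perm st (sgw (cross (length l) 1)) (du l @ [c]) = c # du l"
    using bw_cross_simps(2)[OF bs, of "du l" "[c]"] snoc by simp
  ultimately show ?case
    using e bk by (simp add: kappa_block_Suc cgens_def del: kappa_block.simps)
qed simp

lemma K_simps [simp]: assumes "oks l"
  shows "arr (K l)" "src (K l) = l" "tgt (K l) = du l" "wfb (length l) (kappa_block (length l))"
    "perm st (kappa_block (length l)) l = du l"
  using kappa_block_wf[OF assms] assms unfolding K_def by auto

lemma K_nil [simp]: "K [] = I []"
  by (simp add: K_def)

text \<open>The recursion of \<open>kappa_block\<close> in terms of arrows: the old block is twisted
  and reversed, then the new strand is brought to the pole and twisted there.\<close>

lemma K_snoc:
  assumes "oks l" "ok c"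
  shows "K (l @ [c]) = (kp c \<odot> I (du l)) \<bullet> X (du l) [c] \<bullet> (K l \<odot> I [c])"
proof -
  let ?k = "kappa_block (length l)" and ?x = "sgw (cross (length l) 1)"
  have w: "wfb (length l) ?k" using assms by simp
  have o: "oks [c]" "oks (l @ [c])" using assms by auto
  note e = bw_ext[OF bs w assms(1) o(1)]
  have wk: "wfb (length (l @ [c])) ?k" using wfw_sig_mono[OF w] by simp
  have wx: "wfb (length (l @ [c])) ?x" using assms by (intro wf_cross[of l "[c]"]) auto
  have x: "bw (du l @ [c]) ?x = X (du l) [c]" "perm st ?x (du l @ [c]) = c # du l"
    using bw_cross_simps[OF bs, of "du l" "[c]"] assms by simp_all
  have "K (l @ [c]) = letter (perm st (?x @ ?k) (l @ [c])) (Kap, True) \<bullet> bw (l @ [c]) (?x @ ?k)"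
    by (simp add: K_def kappa_block_Suc del: kappa_block.simps)
  also have "\<dots> = (kp c \<odot> I (du l)) \<bullet> X (du l) [c] \<bullet> (K l \<odot> I [c])"
    unfolding bw_append[OF bs wk wx o(2)] using x e assms by (simp add: K_def)
  finally show ?thesis .
qed

lemma K_single [simp]: "ok c \<Longrightarrow> K [c] = kp c"
  using K_snoc[of "[]" c] bk by (simp add: X.simps)

text \<open>BP2 for blocks. In the induction the crossing of \<open>du l\<close> with the new strand
  slides past the twist of \<open>m\<close>, which takes place on other strands.\<close>

lemma K_app: "oks m \<Longrightarrow> oks l \<Longrightarrow> K (l @ m) = (K m \<odot> I (du l)) \<bullet> X (du l) m \<bullet> (K l \<odot> I m)"
proof (induction m rule: rev_induct)
  case (snoc c m)
  have s: "(I (du m) \<odot> X (du l) [c]) \<bullet> (K m \<odot> I (du l @ [c])) = (K m \<odot> I (c # du l)) \<bullet> (I m \<odot> X (du l) [c])"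
    using snoc bk by (intro slide0(1)[symmetric]) auto
  have IH: "K (l @ m) = (K m \<odot> I (du l)) \<bullet> X (du l) m \<bullet> (K l \<odot> I m)" using snoc by auto
  have "K (l @ m @ [c]) = (kp c \<odot> I (du (l @ m))) \<bullet> X (du (l @ m)) [c] \<bullet> (K (l @ m) \<odot> I [c])"
    using K_snoc[of "l @ m" c] snoc by simp
  also have "\<dots> = (K (m @ [c]) \<odot> I (du l)) \<bullet> X (du l) (m @ [c]) \<bullet> (K l \<odot> I (m @ [c]))"
    using snoc bk by (simp add: K_snoc X_app1[OF bs] X_app2[OF bs] IH strict_simps cm_cong[OF s])
  finally show ?case .
qed (simp add: X.simps)

text \<open>BP1 iterated over the strands of \<open>m\<close>: the strand is brought to the pole,
  twisted there, and brought back.\<close>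

lemma behind1: "oks m \<Longrightarrow> ok c \<Longrightarrow> I m \<odot> kp c = X [st c] m \<bullet> (kp c \<odot> I m) \<bullet> X m [c]"
proof (induction m)
  case (Cons d m)
  have k: "ok d" "oks m" "ok c" using Cons by auto
  have IH: "I m \<odot> kp c = X [st c] m \<bullet> (kp c \<odot> I m) \<bullet> X m [c]" using Cons by auto
  have "I (d # m) \<odot> kp c = I [d] \<odot> I m \<odot> kp c" using k by (simp add: hz_I2)
  also have "\<dots> = (I [d] \<odot> X [st c] m) \<bullet> ((I [d] \<odot> kp c) \<odot> I m) \<bullet> (I [d] \<odot> X m [c])"
    unfolding IH using k bk by (simp add: strict_simps)
  also have "\<dots> = X [st c] (d # m) \<bullet> (kp c \<odot> I (d # m)) \<bullet> X (d # m) [c]"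
    unfolding kp_behind[OF bk k(3) k(1)] using k bk X_app2[OF bs, of "[st c]" "[d]" m] X_app1[OF bs, of "[d]" m "[c]"]
    by (simp add: strict_simps)
  finally show ?case .
qed (simp add: X.simps bk)

text \<open>BP1 for two blocks. The last strand is handled by BP1 for a single strand and the others
  by induction; what remains is a rearrangement of crossings, due to the naturality of the block
  crossing \<open>X (du l) m\<close>.\<close>

lemma behind: "oks l \<Longrightarrow> oks m \<Longrightarrow> I m \<odot> K l = X (du l) m \<bullet> (K l \<odot> I m) \<bullet> X m l"
proof (induction l rule: rev_induct)
  case (snoc c l)
  then have k: "oks l" "ok c" "oks m" by auto
  then have IH: "I m \<odot> K l = X (du l) m \<bullet> (K l \<odot> I m) \<bullet> X m l" using snoc by auto
  \<comment> \<open>The Yang-Baxter equation for the blocks \<open>du l\<close> and \<open>m\<close>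
    and the strand \<open>c\<close>.\<close>
  have n: "X (m @ du l) [c] \<bullet> (X (du l) m \<odot> I [c]) = (I [c] \<odot> X (du l) m) \<bullet> X (du l @ m) [c]"
    using natural_D(2)[OF bs natural_X[OF bs], of "du l" m "[c]"] k by simp
  have s: "(I (du l) \<odot> X m [c]) \<bullet> (K l \<odot> I (m @ [c])) = (K l \<odot> I (c # m)) \<bullet> (I l \<odot> X m [c])"
    using k bk by (intro slide0(1)[symmetric]) auto
  have n': "(X m [c] \<odot> I (du l)) \<bullet> (I m \<odot> X (du l) [c]) \<bullet> (X (du l) m \<odot> I [c])
    = (I [c] \<odot> X (du l) m) \<bullet> (X (du l) [c] \<odot> I m) \<bullet> (I (du l) \<odot> X m [c])"
    using n k by (simp add: X_app1[OF bs] strict_simps)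
  have n'': "(X m [c] \<odot> I (du l)) \<bullet> (I m \<odot> X (du l) [c]) \<bullet> (X (du l) m \<odot> I [c]) \<bullet> h
    = (I [c] \<odot> X (du l) m) \<bullet> (X (du l) [c] \<odot> I m) \<bullet> (I (du l) \<odot> X m [c]) \<bullet> h" for h
    using cm_cong[OF n', of h] by (simp only: cm_assoc)
  have s2: "(kp c \<odot> I (m @ du l)) \<bullet> (I [c] \<odot> X (du l) m) = (I [st c] \<odot> X (du l) m) \<bullet> (kp c \<odot> I (du l @ m))"
    using k bk by (intro slide0(1)) auto
  have "I m \<odot> K (l @ [c]) = ((I m \<odot> kp c) \<odot> I (du l)) \<bullet> (I m \<odot> X (du l) [c]) \<bullet> ((I m \<odot> K l) \<odot> I [c])"
    using k bk by (simp add: K_snoc strict_simps)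
  also have "\<dots> = (X [st c] m \<odot> I (du l)) \<bullet> (kp c \<odot> I (m @ du l)) \<bullet> (X m [c] \<odot> I (du l))
     \<bullet> (I m \<odot> X (du l) [c]) \<bullet> (X (du l) m \<odot> I [c]) \<bullet> (K l \<odot> I (m @ [c])) \<bullet> (X m l \<odot> I [c])"
    unfolding behind1[OF k(3,2)] IH using k bk by (simp add: strict_simps)
  also have "\<dots> = (X [st c] m \<odot> I (du l)) \<bullet> (I [st c] \<odot> X (du l) m) \<bullet> (kp c \<odot> I (du l @ m)) \<bullet>
     (X (du l) [c] \<odot> I m) \<bullet> (K l \<odot> I (c # m)) \<bullet> (I l \<odot> X m [c]) \<bullet> (X m l \<odot> I [c])"
    by (simp only: n'' cm_cong[OF s] cm_cong[OF s2] cm_assoc)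
  also have "\<dots> = X (du (l @ [c])) m \<bullet> (K (l @ [c]) \<odot> I m) \<bullet> X m (l @ [c])"
    using k bk X_app1[OF bs, of "[st c]" "du l" m] by (simp add: K_snoc X_app2[OF bs] X_app1[OF bs] strict_simps)
  finally show ?case .
qed (simp add: X.simps)

lemma bw_kappa_behind:
  assumes "oks l" "oks m" "a = length m" "b = length l"
  shows "wfb (a + b) (kappa_behind a b)" "bw (m @ l) (kappa_behind a b) = I m \<odot> K l"
    "perm st (kappa_behind a b) (m @ l) = m @ du l"
proof -
  let ?k = "kappa_block b" and ?x = "sgw (cross a b)" and ?y = "sgw (cross b a)"
  have e: "kappa_behind a b = ?y @ ?k @ ?x" by (simp add: kappa_behind_def sig_sgw)
  have w: "wfb (length l) ?k" using assms by simp
  have n: "length (m @ l) = a + b" using assms by simp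
  have w1: "wfb (length (m @ l)) ?k" using wfw_sig_mono[OF w] by simp
  have w2: "wfb (length (m @ l)) ?x" using assms by (intro wf_cross[of m l]) auto
  have w3: "wfb (length (m @ l)) ?y" using assms by (intro wf_cross[of l m]) auto
  note x = bw_ext[OF bs w assms(1,2)]
  have o: "oks (m @ l)" using assms by simp
  have w4: "wfb (length (m @ l)) (?k @ ?x)" using w1 w2 by simp
  show "wfb (a + b) (kappa_behind a b)" unfolding e using w1 w2 w3 n by simp
  show "perm st (kappa_behind a b) (m @ l) = m @ du l"
    unfolding e using x assms by simp
  show "bw (m @ l) (kappa_behind a b) = I m \<odot> K l"
    unfolding e bw_append[OF bs w4 w3 o] bw_append[OF bs w2 w1 o] behind[OF assms(1,2)]
    using x assms by (simp add: K_def)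
qed

end

lemma dual_I: "oks l \<Longrightarrow> dual (I l) (I (du l))"
  by (simp add: dual_def natural_I[OF bs])

lemma dualD:
  assumes "dual f f'"
  shows "arr f" "arr f'" "natural f" "natural f'" "src f' = du (src f)" "tgt f' = du (tgt f)" "bk \<Longrightarrow> K (tgt f) \<bullet> f = f' \<bullet> K (src f)"
  using assms natural_arr[OF bs] unfolding dual_def by blast+

lemma dual_cm:
  assumes "dual g g'" "dual f f'" "src g = tgt f"
  shows "dual (g \<bullet> f) (g' \<bullet> f')"
proof -
  note F = dualD[OF assms(2)] and G = dualD[OF assms(1)]
  have "K (tgt g) \<bullet> g \<bullet> f = (g' \<bullet> f') \<bullet> K (src f)" if bk
    by (simp only: cm_cong[OF G(7)[OF that]] assms(3) F(7)[OF that] cm_assoc)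
  moreover have "natural (g \<bullet> f)" "natural (g' \<bullet> f')" using F G assms(3) by (auto intro!: natural_cm[OF bs])
  ultimately show ?thesis using F(1,2,5,6) G(1,2,5,6) assms(3) unfolding dual_def by simp
qed

text \<open>The factors change places because \<Phi> reverses the order. The twist of a
  concatenation consists of the twists of the blocks and a crossing between them: the twists pass by
  duality of the factors, the crossing by naturality of \<open>f'\<close> and
  \<open>g\<close>.\<close>

lemma dual_hz:
  assumes "dual f f'" "dual g g'"
  shows "dual (f \<odot> g) (g' \<odot> f')"
proof -
  note F = dualD[OF assms(1)] and G = dualD[OF assms(2)]
  let ?a = "src f" and ?b = "tgt f" and ?c = "src g" and ?d = "tgt g"
  have k: "oks ?a" "oks ?b" "oks ?c" "oks ?d" using F(1) G(1) by auto
  have "K (?b @ ?d) \<bullet> (f \<odot> g) = (g' \<odot> f') \<bullet> K (?a @ ?c)" if b: bk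
  proof -
    note KF = F(7)[OF b] and KG = G(7)[OF b]
    have 1: "(K ?b \<odot> I ?d) \<bullet> (f \<odot> g) = (f' \<odot> g) \<bullet> (K ?a \<odot> I ?c)"
      using F(1,2,5) G(1) k b KF by (simp add: interchange)
    have 2: "X (du ?b) ?d \<bullet> (f' \<odot> g) = (g \<odot> f') \<bullet> X (du ?a) ?c"
    proof -
      have "X (du ?b) ?d \<bullet> (f' \<odot> g) = X (du ?b) ?d \<bullet> (f' \<odot> I ?d) \<bullet> (I (du ?a) \<odot> g)"
        using slide0(2)[OF F(2) G(1)] F(5,6) by simp
      also have "\<dots> = (I ?d \<odot> f') \<bullet> X (du ?a) ?d \<bullet> (I (du ?a) \<odot> g)"
        using natural_D(2)[OF bs F(4) k(4)] F(5,6) cm_assoc by (metis)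
      also have "\<dots> = (I ?d \<odot> f') \<bullet> (g \<odot> I (du ?a)) \<bullet> X (du ?a) ?c"
        using natural_D(3)[OF bs G(3), of "du ?a"] k by simp
      also have "\<dots> = (g \<odot> f') \<bullet> X (du ?a) ?c"
        using F(2,5) G(1) k by (simp add: cm_assoc[symmetric] interchange)
      finally show ?thesis .
    qed
    have 3: "(K ?d \<odot> I (du ?b)) \<bullet> (g \<odot> f') = (g' \<odot> f') \<bullet> (K ?c \<odot> I (du ?a))"
      using F(2,5,6) G(1,2,5) k b KG by (simp add: interchange)
    show ?thesis
      unfolding K_app[OF b k(4,2)] K_app[OF b k(3,1)]
      by (simp only: cm_assoc 1 cm_cong[OF 2] cm_cong[OF 3])
  qed
  moreover have "natural (f \<odot> g)" "natural (g' \<odot> f')" using F G by (auto intro!: natural_hz[OF bs])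
  ultimately show ?thesis using F(1,2,5,6) G(1,2,5,6) unfolding dual_def by simp
qed

end
end

section \<open>Cabled letters and words\<close>

fun letter_cable :: "nat \<Rightarrow> nat list \<Rightarrow> cyl_gen \<times> bool \<Rightarrow> cyl_gen word" where
  "letter_cable m ws (Sig i, b) = sgw (shift_word m (cross_at ws i b))"
| "letter_cable m ws (Kap, b) = (if b then kappa_behind m (ws ! 0) else inv_word (kappa_behind m (ws ! 0)))"

text \<open>A uniform recursion, so that crossings and twists share one induction. The widths are
  permuted with the identity as change of sign, because a block and its dual have the same
  width.\<close>

lemma mcable_Cons: "mcable m ws (x # w) = (letter_cable m (snd (mcable m ws w)) x @ fst (mcable m ws w), perm_letter (\<lambda>n. n) x (snd (mcable m ws w)))"
  by (cases x rule: prod.exhaust; cases "fst x") (auto simp: Let_def split_beta sig_sgw swap_at_def swap_strands_def split: list.split)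

text \<open>Ordinary cabling is cylinder cabling without twists and without strands in front, so
  only \<open>mcable\<close> has to be analysed.\<close>

lemma mcable_0: "mcable 0 ws (sgw w) = (sgw (fst (cable ws w)), snd (cable ws w))"
proof (induction w)
  case (Cons x w)
  then show ?case
    by (cases x) (simp add: mcable_Cons Let_def split_beta swap_at_def swap_strands_def del: mcable.simps)
qed simp

lemma flip_inv_word: "flip_word m (inv_word w) = inv_word (flip_word m w)"
  by (induction w) auto

lemma cross_at_append:
  assumes "length q = k"
  shows "cross_at (q @ a # b # r) (Suc k) \<beta> = shift_word (sum_list q) (if \<beta> then cross a b else inv_word (cross b a))"
  using assms by (auto simp: cross_at_def nth_append)

lemma juxtapose_shift: "juxtapose (k + m) bs = shift_word k (juxtapose m bs)"
  by (induction bs arbitrary: m) (auto simp: add.assoc)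

text \<open>Reduces a cabled crossing to the two blocks concerned: the arrows \<open>hq\<close> and
  \<open>hr\<close> on the strands on either side move through by the interchange law.\<close>

lemma (in strict_moncat) sandwich:
  assumes "Y \<bullet> F = G \<bullet> y" "arr Y" "arr F" "arr G" "arr y" "arr hq" "arr hr"
    "src Y = tgt F" "src G = tgt y" "src F = src y" "tgt G = tgt Y" "tgt hq = Q" "tgt hr = R" "src hq = q" "src hr = r" "list_all ok p"
  shows "(I (p @ Q) \<odot> Y \<odot> I R) \<bullet> (I p \<odot> hq \<odot> F \<odot> hr) = I p \<odot> ((hq \<odot> G \<odot> hr) \<bullet> (I q \<odot> y \<odot> I r))"
proof -
  have k: "list_all ok Q" "list_all ok R" "list_all ok q" "list_all ok r" using assms by auto
  have "(I (p @ Q) \<odot> Y \<odot> I R) \<bullet> (I p \<odot> hq \<odot> F \<odot> hr) = (I p \<odot> I Q \<odot> Y \<odot> I R) \<bullet> (I p \<odot> hq \<odot> F \<odot> hr)"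
    using assms k by (simp add: hz_I2)
  also have "\<dots> = I p \<odot> hq \<odot> (Y \<bullet> F) \<odot> hr" using assms(2-) k by (simp add: interchange)
  also have "\<dots> = I p \<odot> ((hq \<odot> G \<odot> hr) \<bullet> (I q \<odot> y \<odot> I r))"
    unfolding assms(1) using assms(2-) k by (simp add: interchange)
  finally show ?thesis .
qed

context strict_braided begin

context assumes bs: bs begin

lemmas dsimps [simp] = sg_simps[OF bs] kp_simps[OF bs] kp_simps'[OF bs] bw_simps[OF bs] X_simps[OF bs] Xr_simps[OF bs]
  bw_cross_simps[OF bs] X_nil[OF bs] X_single[OF bs] K_simps[OF bs]

declare X.simps [simp del]

lemma X_nat:
  assumes "natural f" "natural g"
  shows "X (tgt f) (tgt g) \<bullet> (f \<odot> g) = (g \<odot> f) \<bullet> X (src f) (src g)"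
proof -
  let ?a = "src f" and ?b = "tgt f" and ?c = "src g" and ?d = "tgt g"
  have f: "arr f" "arr g" using assms natural_arr[OF bs] by auto
  have "X ?b ?d \<bullet> (f \<odot> g) = X ?b ?d \<bullet> (f \<odot> I ?d) \<bullet> (I ?a \<odot> g)"
    using slide0(2)[OF f] by simp
  also have "\<dots> = (I ?d \<odot> f) \<bullet> (g \<odot> I ?a) \<bullet> X ?a ?c"
    using natural_D(2)[OF bs assms(1), of ?d] natural_D(3)[OF bs assms(2), of ?a] f by (metis cm_assoc ok_simps)
  also have "\<dots> = (g \<odot> f) \<bullet> X ?a ?c"
    using f by (simp add: cm_assoc[symmetric] interchange)
  finally show ?thesis .
qed

lemma bw_inv_word_cross:
  assumes "oks l" "oks m" "a = length m" "b = length l"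
  shows "bw (l @ m) (sgw (inv_word (cross a b))) \<bullet> X m l = I (m @ l)"
    "perm st (sgw (inv_word (cross a b))) (l @ m) = m @ l"
  using bw_inv[OF bs, of "m @ l" "sgw (cross a b)"] bw_cross[OF bs assms(2,1)] assms by simp_all

lemma cabledD:
  assumes "cabled V s cb tb fb" "v \<in> V"
  shows "s v \<in> V" "s (s v) = v" "cb (s v) = st (cb v)" "tb (s v) = du (tb v)" "src (fb v) = [cb v]" "tgt (fb v) = tb v"
    "dual (fb v) (fb (s v))" "arr (fb v)" "natural (fb v)" "ok (cb v)" "oks (tb v)"
proof -
  show a: "s v \<in> V" "s (s v) = v" "cb (s v) = st (cb v)" "tb (s v) = du (tb v)" "src (fb v) = [cb v]" "tgt (fb v) = tb v"
    "dual (fb v) (fb (s v))" using assms unfolding cabled_def by blast+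
  show f: "arr (fb v)" "natural (fb v)" using dualD[OF bs a(7)] by blast+
  show "ok (cb v)" "oks (tb v)" using ok_simps[OF f(1)] a(5,6) by auto
qed

lemma cabled_hl:
  assumes "cabled V s cb tb fb" "set vs \<subseteq> V"
  shows "arr (hl fb vs)" "src (hl fb vs) = map cb vs" "tgt (hl fb vs) = concat (map tb vs)"
    "oks (map cb vs)" "oks (concat (map tb vs))"
proof -
  have "T (hl fb vs) (concat (map (\<lambda>v. [cb v]) vs)) (concat (map tb vs))"
    using cabledD[OF assms(1)] assms(2) by (intro T_hl) (auto simp: T_def)
  moreover have "concat (map (\<lambda>v. [cb v]) vs) = map cb vs" by (induction vs) auto
  ultimately show "arr (hl fb vs)" "src (hl fb vs) = map cb vs" "tgt (hl fb vs) = concat (map tb vs)"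
    "oks (map cb vs)" "oks (concat (map tb vs))" using T_okD[of "hl fb vs"] by (auto simp: T_def)
qed

text \<open>A crossing commutes with the replacement of strands by blocks because the arrows
  \<open>fb v\<close> are natural for block crossings, a twist because \<open>fb v\<close> and
  \<open>fb (s v)\<close> are dual. The strands \<open>p\<close> lie between the pole and the cabled
  ones.\<close>

lemma cable_letter:
  assumes "cabled V s cb tb fb" "set vs \<subseteq> V" "fst x \<in> cgens bk (length vs)" "oks p" "k = length p"
  shows "wfb (length (p @ concat (map tb vs))) (letter_cable k (map (length \<circ> tb) vs) x) \<and>
   perm st (letter_cable k (map (length \<circ> tb) vs) x) (p @ concat (map tb vs)) = p @ concat (map tb (perm_letter s x vs)) \<and>
   bw (p @ concat (map tb vs)) (letter_cable k (map (length \<circ> tb) vs) x) \<bullet> (I p \<odot> hl fb vs)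
     = I p \<odot> (hl fb (perm_letter s x vs) \<bullet> letter (map cb vs) x)"
  using assms(3)
proof (cases rule: cgens_cases)
  case (Sig q v v' r \<beta>)
  let ?P = "p @ concat (map tb q)" and ?R = "concat (map tb r)" and ?a = "tb v" and ?b = "tb v'"
  let ?u = "if \<beta> then cross (length ?a) (length ?b) else inv_word (cross (length ?b) (length ?a))"
  have V: "v \<in> V" "v' \<in> V" "set q \<subseteq> V" "set r \<subseteq> V" using assms(2) Sig by auto
  note D = cabledD[OF assms(1) V(1)] and D' = cabledD[OF assms(1) V(2)]
  note hq = cabled_hl[OF assms(1) V(3)] and hr = cabled_hl[OF assms(1) V(4)]
  have s: "length (concat (map tb q)) = sum_list (map (length \<circ> tb) q)" by (simp add: length_concat comp_def)
  have w: "letter_cable k (map (length \<circ> tb) vs) x = sgw (shift_word (length ?P) ?u)"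
    using Sig cross_at_append[of "map (length \<circ> tb) q" "length q" "length ?a" "length ?b" "map (length \<circ> tb) r" \<beta>] assms(5) s
    by (simp del: cross_simps)
  let ?y = "if \<beta> then sg (cb v) (cb v') else sgi (cb v) (cb v')"
  have X1: "X ?a ?b \<bullet> (fb v \<odot> fb v') = (fb v' \<odot> fb v) \<bullet> sg (cb v) (cb v')"
    using X_nat[OF D(9) D'(9)] D D' by simp
  have X2: "X ?b ?a \<bullet> (fb v' \<odot> fb v) = (fb v \<odot> fb v') \<bullet> sg (cb v') (cb v)"
    using X_nat[OF D'(9) D(9)] D D' by simp
  have uw: "wfb (length (?a @ ?b)) (sgw ?u)" using D D' wf_cross[OF bs, of ?a ?b "length ?a" "length ?b" "length ?a + length ?b"]
    wf_cross[OF bs, of ?b ?a "length ?b" "length ?a" "length ?a + length ?b"] by auto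
  have up: "perm st (sgw ?u) (?a @ ?b) = ?b @ ?a" using D D' bw_inv_word_cross(2)[of ?a ?b] by auto
  have Y: "bw (?a @ ?b) (sgw ?u) \<bullet> (fb v \<odot> fb v') = (fb v' \<odot> fb v) \<bullet> ?y"
  proof (cases \<beta>)
    case False
    \<comment> \<open>A negative crossing inverts the positive one of the blocks in the opposite
      order, so the square \<open>X2\<close> is inverted.\<close>
    have "bw (?a @ ?b) (sgw (inv_word (cross (length ?b) (length ?a)))) \<bullet> (fb v \<odot> fb v') = (fb v' \<odot> fb v) \<bullet> sgi (cb v) (cb v')"
      by (rule conj_inverse[OF X2]) (use D D' bw_inv_word_cross(1)[of ?a ?b] in simp_all)
    then show ?thesis using False by simp
  qed (use X1 D D' in simp)
  note at = bw_at[OF bs uw _ _ hr(5) HOL.refl, of ?P]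
  have o: "oks ?P" "oks (?a @ ?b)" using assms(4) hq D D' by auto
  note at = at[OF o]
  have y: "arr ?y" "src ?y = [cb v, cb v']" "tgt ?y = [cb v', cb v]" using D D' by auto
  have hv: "hl fb vs = hl fb q \<odot> (fb v \<odot> fb v') \<odot> hl fb r" "hl fb (perm_letter s x vs) = hl fb q \<odot> (fb v' \<odot> fb v) \<odot> hl fb r"
    using hl_append[of q "v # v' # r" fb] hl_append[of q "v' # v # r" fb] V Sig cabledD(8)[OF assms(1)]
    by (auto simp: swap_strands_at hz_assoc)
  have l: "letter (map cb vs) x = I (map cb q) \<odot> ?y \<odot> I (map cb r)"
    using Sig letter_at[of "Suc (length q)" "map cb q" "cb v" "cb v'" "map cb r"] by simp
  have L: "p @ concat (map tb vs) = ?P @ (?a @ ?b) @ ?R" "p @ concat (map tb (perm_letter s x vs)) = ?P @ (?b @ ?a) @ ?R"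
    using Sig by (auto simp: swap_strands_at)
  have "(I ?P \<odot> bw (?a @ ?b) (sgw ?u) \<odot> I ?R) \<bullet> (I p \<odot> hl fb q \<odot> (fb v \<odot> fb v') \<odot> hl fb r)
    = I p \<odot> ((hl fb q \<odot> (fb v' \<odot> fb v) \<odot> hl fb r) \<bullet> (I (map cb q) \<odot> ?y \<odot> I (map cb r)))"
    by (rule sandwich[OF Y]) (use hq hr y D D' uw up o assms(4) in simp_all)
  then show ?thesis unfolding w L hv l using at up by simp
next
  case (Kap v r \<beta>)
  let ?R = "concat (map tb r)" and ?a = "tb v"
  let ?k = "kappa_behind k (length ?a)"
  let ?u = "if \<beta> then ?k else inv_word ?k"
  have V: "v \<in> V" "set r \<subseteq> V" using assms(2) Kap by auto
  note D = cabledD[OF assms(1) V(1)]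
  note D' = cabledD[OF assms(1) D(1)]
  note hr = cabled_hl[OF assms(1) V(2)]
  note kb = bw_kappa_behind[OF bs Kap(1) _ assms(4,5) HOL.refl]
  note kv = kb[OF D(11)] and ks = kb[OF D'(11)]
  have w: "letter_cable k (map (length \<circ> tb) vs) x = ?u" using Kap by simp
  have n: "length (tb (s v)) = length ?a" "length (p @ ?a) = k + length ?a" using D assms(5) by simp_all
  have K1: "K ?a \<bullet> fb v = fb (s v) \<bullet> kp (cb v)" and K2: "K (tb (s v)) \<bullet> fb (s v) = fb v \<bullet> kp (cb (s v))"
    using dualD(7)[OF bs D(7) Kap(1)] dualD(7)[OF bs D'(7) Kap(1)] D D' Kap(1) K_single[OF bs Kap(1)] by simp_all
  let ?y = "if \<beta> then kp (cb v) else kpi (cb v)"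
  have uw: "wfb (length (p @ ?a)) ?u" using kv n by simp
  have up: "perm st ?u (p @ ?a) = p @ tb (s v)"
    using kv(3) D bw_inv(2)[OF bs, of "p @ tb (s v)" ?k] ks(1,3) n D' assms(4,5) by auto
  have o: "oks (p @ ?a)" "oks p" using D assms(4) by auto
  have y: "arr ?y" "src ?y = [cb v]" "tgt ?y = [cb (s v)]" using D Kap(1) by auto
  have Y: "bw (p @ ?a) ?u \<bullet> (I p \<odot> fb v) = (I p \<odot> fb (s v)) \<bullet> (I p \<odot> ?y)"
  proof (cases \<beta>)
    case True
    have "(I p \<odot> K ?a) \<bullet> (I p \<odot> fb v) = (I p \<odot> fb (s v)) \<bullet> (I p \<odot> kp (cb v))"
      using D D' Kap(1) assms(4) K1 by (simp add: interchange)
    then show ?thesis using True kv by simp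
  next
    case False
    \<comment> \<open>The inverse twist undoes the positive twist that starts at the dual block, so
      the square is taken at \<open>s v\<close>.\<close>
    have Z: "(I p \<odot> K (tb (s v))) \<bullet> (I p \<odot> fb (s v)) = (I p \<odot> fb v) \<bullet> (I p \<odot> kp (cb (s v)))"
      using D D' Kap(1) assms(4) K2 by (simp add: interchange)
    have i: "bw (p @ ?a) (inv_word ?k) \<bullet> (I p \<odot> K (tb (s v))) = I (p @ tb (s v))"
      using bw_inv(1)[OF bs, of "p @ tb (s v)" ?k] ks n D D' assms(4,5) by simp
    have "bw (p @ ?a) (inv_word ?k) \<bullet> (I p \<odot> fb v) = (I p \<odot> fb (s v)) \<bullet> (I p \<odot> kpi (cb v))"
      by (rule conj_inverse[OF Z]) (use i D D' Kap(1) assms(4) in \<open>simp_all add: interchange hz_I\<close>)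
    then show ?thesis using False by simp
  qed
  have hv: "I p \<odot> hl fb vs = (I p \<odot> fb v) \<odot> hl fb r" "hl fb (perm_letter s x vs) = fb (s v) \<odot> hl fb r"
    using Kap by (auto simp: hz_assoc)
  have l: "letter (map cb vs) x = ?y \<odot> I (map cb r)"
    using Kap by simp
  have L: "p @ concat (map tb vs) = (p @ ?a) @ ?R" "p @ concat (map tb (perm_letter s x vs)) = (p @ tb (s v)) @ ?R"
    using Kap by auto
  note e = bw_ext[OF bs uw o(1) hr(5)]
  have "(bw (p @ ?a) ?u \<odot> I ?R) \<bullet> ((I p \<odot> fb v) \<odot> hl fb r) = (bw (p @ ?a) ?u \<bullet> (I p \<odot> fb v)) \<odot> hl fb r"
    using D uw o hr by (simp add: interchange)
  also have "\<dots> = I p \<odot> ((fb (s v) \<odot> hl fb r) \<bullet> (?y \<odot> I (map cb r)))"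
    unfolding Y using D D' y o hr by (simp add: interchange hz_assoc[symmetric])
  finally have F: "(bw (p @ ?a) ?u \<odot> I ?R) \<bullet> ((I p \<odot> fb v) \<odot> hl fb r) = I p \<odot> ((fb (s v) \<odot> hl fb r) \<bullet> (?y \<odot> I (map cb r)))" .
  have strict_simps: "wfb (length ((p @ ?a) @ ?R)) ?u" using wfw_sig_mono[OF uw] by simp
  show ?thesis unfolding w L hv l e(1) using F strict_simps e(2) up by simp
qed

lemma cable_bw:
  assumes "cabled V s cb tb fb" "set vs \<subseteq> V" "wfb (length vs) w" "oks p" "k = length p" "ws = map (length \<circ> tb) vs"
  shows "wfb (length (p @ concat (map tb vs))) (fst (mcable k ws w)) \<and>
   perm st (fst (mcable k ws w)) (p @ concat (map tb vs)) = p @ concat (map tb (perm s w vs)) \<and>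
   snd (mcable k ws w) = map (length \<circ> tb) (perm s w vs) \<and>
   bw (p @ concat (map tb vs)) (fst (mcable k ws w)) \<bullet> (I p \<odot> hl fb vs) = I p \<odot> (hl fb (perm s w vs) \<bullet> bw (map cb vs) w)"
  using assms(3)
proof (induction w)
  case Nil
  then show ?case using cabled_hl[OF assms(1,2)] assms(4-) by (simp add: hz_I)
next
  case (Cons x w)
  let ?vs = "perm s w vs" and ?L = "p @ concat (map tb vs)" and ?u = "fst (mcable k ws w)" and ?m = "map (length \<circ> tb)"
  let ?L' = "p @ concat (map tb ?vs)" and ?x = "letter_cable k (?m ?vs) x"
  have w: "wfb (length vs) w" using Cons by simp
  note IH = Cons.IH[OF w]
  have pv: "map cb ?vs = perm st w (map cb vs) \<and> set ?vs \<subseteq> V"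
    using cabledD(1,3)[OF assms(1)] by (intro perm_map[OF w _ assms(2)]) auto
  have f: "fst x \<in> cgens bk (length ?vs)" using Cons by simp
  note C = cable_letter[OF assms(1) conjunct2[OF pv] f assms(4,5)]
  note h = cabled_hl[OF assms(1,2)] and h' = cabled_hl[OF assms(1) conjunct2[OF pv]]
  have "set (perm s (x # w) vs) \<subseteq> V"
    using cabledD(1)[OF assms(1)] perm_map[OF Cons.prems, of V "\<lambda>x. x" s s] assms(2) by simp
  note h'' = cabled_hl[OF assms(1) this]
  have o: "oks ?L" "oks ?L'" using h h' assms(4) by simp_all
  have pm': "perm st ?u ?L = ?L'" using IH by simp
  have n: "length ?L' = length ?L" using pm' length_perm[of st ?u ?L] by simp
  have xw: "wfb (length ?L) ?x" using C n by simp
  have uw: "wfb (length ?L) ?u" using IH by simp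
  have s: "snd (mcable k ws w) = ?m ?vs" using IH by simp
  have m: "mcable k ws (x # w) = (?x @ ?u, ?m (perm_letter s x ?vs))"
  proof -
    have "perm_letter (\<lambda>n. n) x (?m ?vs) = ?m (perm_letter s x ?vs)"
      using f
    proof (cases rule: cgens_cases)
      case (Sig q c d r b)
      then show ?thesis using swap_strands_at[of "Suc (length q)" "?m q" "length (tb c)" "length (tb d)" "?m r"]
        by (simp add: swap_strands_at)
    next
      case (Kap c r b)
      have "c \<in> V" using pv Kap by auto
      then show ?thesis using cabledD(4)[OF assms(1)] Kap by simp
    qed
    then show ?thesis unfolding mcable_Cons s by simp
  qed
  have whisker_left: "wfb (length (map cb vs)) w" using w by simp
  have t: "T (letter (map cb ?vs) x) (map cb ?vs) (perm_letter st x (map cb ?vs))" using T_letter[OF bs, of x "map cb ?vs"] f h' by simp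
  have pl: "perm_letter st x (map cb ?vs) = map cb (perm_letter s x ?vs)"
    using perm_map[OF Cons.prems, of V cb s st] cabledD(1,3)[OF assms(1)] assms(2) pv by simp
  have "bw ?L (?x @ ?u) \<bullet> (I p \<odot> hl fb vs) = bw ?L' ?x \<bullet> bw ?L ?u \<bullet> (I p \<odot> hl fb vs)"
    unfolding bw_append[OF bs uw xw o(1)] pm' by (simp add: cm_assoc)
  also have "\<dots> = bw ?L' ?x \<bullet> (I p \<odot> hl fb ?vs) \<bullet> (I p \<odot> bw (map cb vs) w)"
    using IH h h' whisker_left pv assms(4) by (simp add: interchange)
  also have "\<dots> = (I p \<odot> (hl fb (perm_letter s x ?vs) \<bullet> letter (map cb ?vs) x)) \<bullet> (I p \<odot> bw (map cb vs) w)"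
    using C by (simp add: cm_assoc[symmetric])
  also have "\<dots> = I p \<odot> (hl fb (perm_letter s x ?vs) \<bullet> bw (map cb vs) (x # w))"
    using t h h'' whisker_left pv assms(4) pl by (simp add: interchange T_def cm_assoc)
  finally show ?case unfolding m using C IH xw uw pm' by simp
qed

end
end

section \<open>Bounds on the letters of cabled and juxtaposed words\<close>

lemma set_down: "fst ` set (down b) \<subseteq> {1..<a + Suc b}"
  by (auto simp: fst_down)

lemma set_shift: "fst ` set w \<subseteq> {1..<n} \<Longrightarrow> p + n \<le> q \<Longrightarrow> fst ` set (shift_word p w) \<subseteq> {1..<q}"
  by (fastforce simp: shift_word_def)

lemma set_inv_word: "fst ` set (inv_word w) = fst ` set w"
  by (force simp: inv_word_def)

lemma set_flip: "fst ` set w \<subseteq> {1..<n} \<Longrightarrow> fst ` set (flip_word n w) \<subseteq> {1..<n}"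
  by (fastforce simp: flip_word_def)

lemma set_cross: "fst ` set (cross a b) \<subseteq> {1..<a + b}"
proof (induction a)
  case (Suc a)
  then show ?case using set_shift[OF Suc, of 1 "Suc a + b"] set_down[of b a] by auto
qed simp

text \<open>Permuting the widths preserves their sum, so each cabled crossing stays within the
  strands counted at the start.\<close>

lemma cable_set:
  "length ws = n \<Longrightarrow> fst ` set w \<subseteq> {1..<n} \<Longrightarrow>
    length (snd (cable ws w)) = n \<and> sum_list (snd (cable ws w)) = sum_list ws \<and> fst ` set (fst (cable ws w)) \<subseteq> {1..<sum_list ws}"
proof (induction w)
  case (Cons x w)
  then have IH: "length (snd (cable ws w)) = n" "sum_list (snd (cable ws w)) = sum_list ws"
    "fst ` set (fst (cable ws w)) \<subseteq> {1..<sum_list ws}" by auto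
  obtain i \<beta> where x: "x = (i, \<beta>)" by (cases x)
  have "1 \<le> i" "i < length (snd (cable ws w))" using Cons.prems IH x by auto
  then obtain q a b r where q: "snd (cable ws w) = q @ a # b # r" "i = Suc (length q)" by (rule split_at)
  let ?u = "if \<beta> then cross a b else inv_word (cross b a)"
  have c: "cable ws (x # w) = (shift_word (sum_list q) ?u @ fst (cable ws w), q @ b # a # r)"
    using q x cross_at_append[of q "length q" a b r \<beta>] swap_strands_at[of i q a b r]
    by (simp add: split_beta Let_def swap_at_def swap_strands_def)
  have "fst ` set ?u \<subseteq> {1..<a + b}" using set_cross[of a b] set_cross[of b a] by (auto simp: set_inv_word add.commute)
  then have "fst ` set (shift_word (sum_list q) ?u) \<subseteq> {1..<sum_list ws}"
    by (rule set_shift) (use IH q in simp)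
  moreover have "set (fst (cable ws (x # w))) = set (shift_word (sum_list q) ?u) \<union> set (fst (cable ws w))"
    unfolding c by simp
  ultimately have "fst ` set (fst (cable ws (x # w))) \<subseteq> {1..<sum_list ws}"
    using IH(3) by (simp only: image_Un Un_least)
  then show ?case unfolding c using IH q by simp
qed auto

lemma juxtapose_set:
  assumes "\<And>n w. (n, w) \<in> set ps \<Longrightarrow> fst ` set w \<subseteq> {1..<n}"
  shows "fst ` set (juxtapose k ps) \<subseteq> {1..<k + sum_list (map fst ps)}"
  using assms
proof (induction ps arbitrary: k)
  case (Cons p ps)
  obtain n w where p: "p = (n, w)" by (cases p)
  have "fst ` set w \<subseteq> {1..<n}" using Cons.prems[of n w] p by simp
  then have "fst ` set (shift_word k w) \<subseteq> {1..<k + sum_list (map fst (p # ps))}"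
    by (rule set_shift) (simp add: p)
  moreover have "fst ` set (juxtapose (k + n) ps) \<subseteq> {1..<(k + n) + sum_list (map fst ps)}"
    by (rule Cons.IH) (use Cons.prems in auto)
  ultimately show ?case by (auto simp: p)
qed simp

section \<open>Values of juxtaposed and reflected words\<close>

context strict_braided begin
context assumes bs: bs begin

lemmas esimps [simp] = dsimps[OF bs]

lemma bw_juxtapose:
  assumes "\<And>l w. (l, w) \<in> set lws \<Longrightarrow> oks l \<and> wfb (length l) (sgw w)" "oks p" "k = length p"
  shows "wfb (length (p @ concat (map fst lws))) (sgw (juxtapose k (map (\<lambda>(l, w). (length l, w)) lws))) \<and>
   bw (p @ concat (map fst lws)) (sgw (juxtapose k (map (\<lambda>(l, w). (length l, w)) lws))) = I p \<odot> hl (\<lambda>(l, w). bw l (sgw w)) lws \<and>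
   perm st (sgw (juxtapose k (map (\<lambda>(l, w). (length l, w)) lws))) (p @ concat (map fst lws)) = p @ concat (map (\<lambda>(l, w). perm st (sgw w) l) lws)"
  using assms
proof (induction lws arbitrary: p k)
  case (Cons x lws)
  obtain l w where x: "x = (l, w)" by (cases x)
  have l: "oks l" "wfb (length l) (sgw w)" using Cons.prems x by auto
  have lws: "\<And>l w. (l, w) \<in> set lws \<Longrightarrow> oks l \<and> wfb (length l) (sgw w)"
    by (rule Cons.prems(1)) simp
  let ?J = "sgw (juxtapose (k + length l) (map (\<lambda>(l, w). (length l, w)) lws))" and ?R = "concat (map fst lws)"
  let ?R' = "concat (map (\<lambda>(l, w). perm st (sgw w) l) lws)" and ?H = "hl (\<lambda>(l, w). bw l (sgw w)) lws"
  have IH: "wfb (length ((p @ l) @ ?R)) ?J" "bw ((p @ l) @ ?R) ?J = I (p @ l) \<odot> ?H" "perm st ?J ((p @ l) @ ?R) = (p @ l) @ ?R'"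
    using Cons.IH[OF lws, of "p @ l" "k + length l"] l Cons.prems by auto
  have "T ?H (concat (map fst lws)) (concat (map (\<lambda>(l, w). perm st (sgw w) l) lws))"
    using lws by (intro T_hl) (auto simp: T_def)
  then have H: "arr ?H" "src ?H = ?R" "tgt ?H = ?R'" "oks ?R" "oks ?R'"
    using T_okD[of ?H ?R ?R'] by (auto simp: T_def)
  note at = bw_at[OF bs l(2) Cons.prems(2) l(1) H(5) Cons.prems(3)]
  have n: "length (p @ l @ ?R') = length (p @ l @ ?R)" using IH(3) length_perm[of st ?J "(p @ l) @ ?R"] by simp
  have o: "oks (p @ l @ ?R)" using l H Cons.prems by simp
  have w1: "wfb (length (p @ l @ ?R)) ?J" using IH(1) by simp
  have w2: "wfb (length (p @ l @ ?R)) (sgw (shift_word k w))" using at(1) n by simp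
  have p': "perm st ?J (p @ l @ ?R) = p @ l @ ?R'" using IH(3) by simp
  have "bw (p @ l @ ?R) (sgw (shift_word k w) @ ?J) = (I p \<odot> bw l (sgw w) \<odot> I ?R') \<bullet> (I (p @ l) \<odot> ?H)"
    unfolding bw_append[OF bs w1 w2 o] p' at(2) using IH(2) by simp
  also have "\<dots> = I p \<odot> bw l (sgw w) \<odot> ?H"
    using H l Cons.prems(2) by (simp add: hz_I2[symmetric] interchange)
  finally have "bw (p @ l @ ?R) (sgw (shift_word k w) @ ?J) = I p \<odot> bw l (sgw w) \<odot> ?H" .
  then show ?case using x w1 w2 p' at(3) by simp
qed (simp add: hz_I)

text \<open>Reflection reverses the order of the groups and reflects each of them: a reflected
  letter is shifted by the groups that followed it before and precede it now.\<close>

lemma bw_flip_juxtapose: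
  assumes "\<And>l w. (l, w) \<in> set lws \<Longrightarrow> oks l \<and> fst ` set w \<subseteq> {1..<length l}"
    "N = length (concat (map fst lws))"
  shows "bw (concat (map fst (rev lws))) (sgw (flip_word N (juxtapose 0 (map (\<lambda>(l, w). (length l, w)) lws))))
    = hl (\<lambda>(l, w). bw l (sgw (flip_word (length l) w))) (rev lws)"
  using assms
proof (induction lws arbitrary: N)
  case (Cons x lws)
  obtain l w where x: "x = (l, w)" by (cases x)
  have l: "oks l" "fst ` set w \<subseteq> {1..<length l}" using Cons.prems x by auto
  have lws: "\<And>l w. (l, w) \<in> set lws \<Longrightarrow> oks l \<and> fst ` set w \<subseteq> {1..<length l}"
    by (rule Cons.prems(1)) simp
  let ?ps = "map (\<lambda>(l, w). (length l, w)) lws"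
  let ?N = "length (concat (map fst lws))" and ?R = "concat (map fst (rev lws))"
  let ?J = "juxtapose 0 ?ps" and ?H = "hl (\<lambda>(l, w). bw l (sgw (flip_word (length l) w))) (rev lws)"
  have nR: "length ?R = ?N" by (simp add: length_concat rev_map[symmetric] sum_list_rev)
  have "fst ` set ?J \<subseteq> {1..<0 + sum_list (map fst ?ps)}"
    by (rule juxtapose_set) (use lws in auto)
  moreover have "sum_list (map fst ?ps) = ?N" by (simp add: length_concat comp_def split_beta)
  ultimately have J: "fst ` set ?J \<subseteq> {1..<?N}" by simp
  have Jw: "wfb (length ?R) (sgw (flip_word ?N ?J))" unfolding nR wfw_sgw using set_flip[OF J] .
  have o: "oks ?R" using lws by (force simp: list_all_iff)
  have lw: "wfb (length l) (sgw (flip_word (length l) w))" unfolding wfw_sgw using set_flip[OF l(2)] .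
  have "flip_word N (juxtapose 0 (map (\<lambda>(l, w). (length l, w)) (x # lws)))
    = flip_word (?N + length l) w @ flip_word (length l + ?N) (shift_word (length l) ?J)"
    using Cons.prems(2) x juxtapose_shift[of "length l" 0 ?ps] by (simp add: add.commute)
  also have "\<dots> = shift_word ?N (flip_word (length l) w) @ flip_word ?N ?J"
    using flip_word_add[OF l(2)] flip_shift_word by simp
  finally have e: "sgw (flip_word N (juxtapose 0 (map (\<lambda>(l, w). (length l, w)) (x # lws))))
     = sgw (shift_word ?N (flip_word (length l) w)) @ sgw (flip_word ?N ?J)" by simp
  note ex = bw_ext[OF bs Jw o l(1)]
  let ?R' = "perm st (sgw (flip_word ?N ?J)) ?R"
  have o': "oks ?R'" using Jw o by simp
  note at = bw_at[OF bs lw o' l(1), of "[]" ?N, simplified]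
  have w1: "wfb (length (?R @ l)) (sgw (flip_word ?N ?J))" using wfw_sig_mono[OF Jw] by simp
  have w2: "wfb (length (?R @ l)) (sgw (shift_word ?N (flip_word (length l) w)))"
    using wfw_shift[OF lw] nR by simp
  have ol: "oks (?R @ l)" using o l by simp
  have IH: "bw ?R (sgw (flip_word ?N ?J)) = ?H" using Cons.IH[OF lws HOL.refl] .
  have at2: "bw (?R' @ l) (sgw (shift_word ?N (flip_word (length l) w))) = I ?R' \<odot> bw l (sgw (flip_word (length l) w))"
    using bw_shift[OF bs lw l(1) o', of ?N] nR by simp
  have H: "arr ?H" "tgt ?H = ?R'" "src ?H = ?R" unfolding IH[symmetric] using Jw o by simp_all
  have "bw (?R @ l) (sgw (shift_word ?N (flip_word (length l) w)) @ sgw (flip_word ?N ?J))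
     = ?H \<odot> bw l (sgw (flip_word (length l) w))"
    unfolding bw_append[OF bs w1 w2 ol] ex at2 IH using H l lw o' by (simp add: interchange)
  also have "\<dots> = hl (\<lambda>(l, w). bw l (sgw (flip_word (length l) w))) (rev (x # lws))"
  proof -
    have "arr (case v of (l, w) \<Rightarrow> bw l (sgw (flip_word (length l) w)))" if v: "v \<in> set (rev lws) \<union> set [(l, w)]" for v
    proof -
      obtain l' w' where v': "v = (l', w')" by (cases v)
      then have "(l', w') \<in> set lws \<or> (l', w') = (l, w)" using v by auto
      then have o: "oks l'" "fst ` set w' \<subseteq> {1..<length l'}" using lws l by auto
      have "wfb (length l') (sgw (flip_word (length l') w'))" unfolding wfw_sgw using set_flip[OF o(2)] .
      then show ?thesis using o v' by simp
    qed
    then show ?thesis using hl_append[of "rev lws" "[(l, w)]" "\<lambda>(l, w). bw l (sgw (flip_word (length l) w))"] l lw x by simp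
  qed
  finally show ?case unfolding e using x by simp
qed simp

text \<open>Cabling and reflection commute only up to braid relations, because a reflected block
  crossing is another word for the same arrow; hence the equality of values. With it, a horizontal
  composite under \<Phi> is reduced to cabling along the reversed list of blocks.\<close>

lemma bw_flip_cable:
  assumes "length ws = n" "fst ` set w \<subseteq> {1..<n}" "length L = sum_list ws" "oks L" "N = sum_list ws"
  shows "snd (cable (rev ws) (flip_word n w)) = rev (snd (cable ws w)) \<and>
     bw L (sgw (flip_word N (fst (cable ws w)))) = bw L (sgw (fst (cable (rev ws) (flip_word n w)))) \<and>
     perm st (sgw (flip_word N (fst (cable ws w)))) L = perm st (sgw (fst (cable (rev ws) (flip_word n w)))) L"
  using assms(2)
proof (induction w)
  case (Cons x w)
  let ?ws = "snd (cable ws w)" and ?F = "flip_word n w"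
  have w: "fst ` set w \<subseteq> {1..<n}" using Cons.prems by simp
  note IH = Cons.IH[OF w]
  note C = cable_set[OF assms(1) w]
  have C': "fst ` set (fst (cable (rev ws) ?F)) \<subseteq> {1..<sum_list ws}"
    using cable_set[of "rev ws" n ?F] set_flip[OF w] assms(1) by (simp add: sum_list_rev)
  obtain i \<beta> where x: "x = (i, \<beta>)" by (cases x)
  have "1 \<le> i" "i < length ?ws" using Cons.prems C x by auto
  then obtain q a b r where q: "?ws = q @ a # b # r" "i = Suc (length q)" by (rule split_at)
  let ?u = "if \<beta> then cross a b else inv_word (cross b a)" and ?v = "if \<beta> then cross b a else inv_word (cross a b)"
  have i: "n - i = Suc (length (rev r))" using C q by auto
  have s: "sum_list ws = sum_list q + (sum_list r + (a + b))" using C q by simp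
  have c1: "cable ws (x # w) = (shift_word (sum_list q) ?u @ fst (cable ws w), q @ b # a # r)"
    using q x cross_at_append[of q "length q" a b r \<beta>] swap_strands_at[of i q a b r]
    by (simp add: split_beta Let_def swap_at_def swap_strands_def)
  have c2: "cable (rev ws) (flip_word n (x # w)) = (shift_word (sum_list r) ?v @ fst (cable (rev ws) ?F), rev r @ a # b # rev q)"
    using q x i cross_at_append[of "rev r" "length r" b a "rev q" \<beta>] swap_strands_at[of "n - i" "rev r" b a "rev q"] IH
    by (simp add: split_beta Let_def swap_at_def swap_strands_def sum_list_rev)
  have u: "fst ` set ?u \<subseteq> {1..<a + b}" "fst ` set ?v \<subseteq> {1..<b + a}"
    using set_cross[of a b] set_cross[of b a] by (auto simp: set_inv_word add.commute)
  have f: "flip_word N (shift_word (sum_list q) ?u) = shift_word (sum_list r) (flip_word (a + b) ?u)"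
    unfolding assms(5) s flip_shift_word by (rule flip_word_add[OF u(1)])
  let ?A = "sgw (flip_word N (fst (cable ws w)))" and ?B = "sgw (fst (cable (rev ws) ?F))"
  let ?L = "perm st ?B L"
  have wA: "wfb (length L) ?A" unfolding wfw_sgw using set_flip[of _ N] C assms(3,5) by simp
  have wB: "wfb (length L) ?B" unfolding wfw_sgw using C' assms(3) by (simp add: sum_list_rev)
  have oL: "oks ?L" using wB assms(4) by simp
  \<comment> \<open>The current strands are cut along the reversed widths: those of
    \<open>rev r\<close>, then \<open>b\<close>, then \<open>a\<close>, then those of
    \<open>rev q\<close>.\<close>
  define P where "P = take (sum_list r) ?L"
  define l2 where "l2 = take b (drop (sum_list r) ?L)"
  define l1 where "l1 = take a (drop (sum_list r + b) ?L)"
  define R where "R = drop (sum_list r + b + a) ?L"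
  have "drop (sum_list r) ?L = l2 @ drop b (drop (sum_list r) ?L)" 
    unfolding l2_def by (rule append_take_drop_id[symmetric])
  moreover have "drop (sum_list r + b) ?L = l1 @ drop a (drop (sum_list r + b) ?L)" 
    unfolding l1_def by (rule append_take_drop_id[symmetric])
  ultimately have L: "?L = P @ (l2 @ l1) @ R" unfolding P_def R_def
    by (metis append.assoc append_take_drop_id drop_drop add.commute)
  have len: "length P = sum_list r" "length l2 = b" "length l1 = a"
    using s assms(3) by (auto simp: P_def l1_def l2_def)
  have o: "oks P" "oks (l2 @ l1)" "oks R" "oks l1" "oks l2" using oL unfolding L by auto
  have wu: "wfb (length (l2 @ l1)) (sgw (flip_word (a + b) ?u))" unfolding wfw_sgw using set_flip[OF u(1)] len by (simp add: add.commute)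
  have wv: "wfb (length (l2 @ l1)) (sgw ?v)" unfolding wfw_sgw using u(2) len by simp
  have X1: "bw (l2 @ l1) (sgw (flip_word (a + b) (cross a b))) = X l2 l1" "perm st (sgw (flip_word (a + b) (cross a b))) (l2 @ l1) = l1 @ l2"
    using bw_flip_cross[OF bs o(4,5)] len by (simp_all add: add.commute)
  have X2: "bw (l1 @ l2) (sgw (flip_word (a + b) (cross b a))) = X l1 l2" "perm st (sgw (flip_word (a + b) (cross b a))) (l1 @ l2) = l2 @ l1"
    using bw_flip_cross[OF bs o(5,4)] len by simp_all
  have wX: "wfb (length (l1 @ l2)) (sgw (flip_word (a + b) (cross b a)))" "wfb (length (l1 @ l2)) (sgw (cross a b))"
    unfolding wfw_sgw using set_flip[of "cross b a" "a + b"] set_cross[of b a] set_cross[of a b] len by (simp_all add: add.commute)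
  have UV: "bw (l2 @ l1) (sgw (flip_word (a + b) ?u)) = bw (l2 @ l1) (sgw ?v) \<and>
      perm st (sgw (flip_word (a + b) ?u)) (l2 @ l1) = perm st (sgw ?v) (l2 @ l1)"
  proof (cases \<beta>)
    case True
    then show ?thesis using X1 len o by simp
  next
    case False
    have o12: "oks (l1 @ l2)" using o by simp
    \<comment> \<open>The two positive words agree on \<open>l1 @ l2\<close>, hence so do their
      inverses, which start at \<open>l2 @ l1\<close>.\<close>
    have "bw (l2 @ l1) (inv_word (sgw (flip_word (a + b) (cross b a)))) = bw (l2 @ l1) (inv_word (sgw (cross a b)))"
      using bw_inv_cong[OF bs wX o12] X2 len o by simp
    moreover have "perm st (inv_word (sgw (flip_word (a + b) (cross b a)))) (l2 @ l1) = l1 @ l2"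
      using bw_inv(2)[OF bs wX(1) o12] X2 by simp
    moreover have "perm st (inv_word (sgw (cross a b))) (l2 @ l1) = l1 @ l2"
      using bw_inv(2)[OF bs wX(2) o12] len o by simp
    ultimately show ?thesis using False by (simp add: flip_inv_word)
  qed
  note at1 = bw_at[OF bs wu o(1,2,3) len(1)[symmetric]] and at2 = bw_at[OF bs wv o(1,2,3) len(1)[symmetric]]
  have n: "length (P @ (l2 @ l1) @ R) = length L" using L[symmetric] by simp
  have w1: "wfb (length L) (sgw (shift_word (sum_list r) (flip_word (a + b) ?u)))"
    and w2: "wfb (length L) (sgw (shift_word (sum_list r) ?v))" using at1(1) at2(1) unfolding n .
  have pA: "perm st ?A L = ?L" using IH by simp
  have "bw L (sgw (flip_word N (fst (cable ws (x # w))))) = bw L (sgw (fst (cable (rev ws) (flip_word n (x # w)))))"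
    unfolding c1 c2 unfolding fst_conv flip_word_simps f sgw_simps bw_append[OF bs wA w1 assms(4)] bw_append[OF bs wB w2 assms(4)] pA L
      at1(2) at2(2) using IH UV by simp
  moreover have "perm st (sgw (flip_word N (fst (cable ws (x # w))))) L = perm st (sgw (fst (cable (rev ws) (flip_word n (x # w))))) L"
    unfolding c1 c2 unfolding fst_conv flip_word_simps f sgw_simps perm_simps pA L at1(3) at2(3) using UV by simp
  ultimately show ?case unfolding c1 c2 using q by simp
qed simp

section \<open>Invariance of values under the relations of the braid groups\<close>

lemma word_eq_bw:
  assumes "word_eq G R u v"
    "\<And>u v. (u, v) \<in> R \<Longrightarrow> wfb n u \<and> wfb n v \<and> (\<forall>l. length l = n \<and> oks l \<longrightarrow> bw l u = bw l v \<and> perm st u l = perm st v l)"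
    "G \<subseteq> cgens bk n"
  shows "wfb n u \<and> wfb n v \<and> (\<forall>l. length l = n \<and> oks l \<longrightarrow> bw l u = bw l v \<and> perm st u l = perm st v l)"
  using assms(1)
proof induction
  case (refl w)
  then show ?case using assms(3) by (force simp: wfw_def)
next
  \<comment> \<open>The value of the left factor depends on the strands that the right factor leaves
    behind; this is why permutations are compared along with values.\<close>
  case (mult u u' v v')
  then show ?case by (auto simp: bw_append[OF bs])
next
  case (cancel x b)
  then have x: "x \<in> cgens bk n" using assms(3) by auto
  have "bw l [(x, b), (x, \<not> b)] = bw l [] \<and> perm st [(x, b), (x, \<not> b)] l = perm st [] l" if l: "length l = n" "oks l" for l
    using bw_inv[OF bs, of l "[(x, \<not> b)]"] letter_inv[OF bs, of "(x, \<not> b)" l] T_letter[OF bs, of "(x, \<not> b)" l] x l by (simp add: T_def)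
  then show ?case using x by simp
qed (use assms(2) in auto)

text \<open>Distant generators commute by the interchange law, and the relation of length three is
  the Yang-Baxter equation padded with identities.\<close>

lemma braid_rels_bw:
  assumes "(u, v) \<in> braid_rels n"
  shows "wfb n (sgw u) \<and> wfb n (sgw v) \<and> (\<forall>l. length l = n \<and> oks l \<longrightarrow> bw l (sgw u) = bw l (sgw v) \<and> perm st (sgw u) l = perm st (sgw v) l)"
proof -
  consider (far) i j where "{i, j} \<subseteq> {1..<n}" "i + 2 \<le> j" "u = pos [i, j]" "v = pos [j, i]"
    | (near) i where "{i, Suc i} \<subseteq> {1..<n}" "u = pos [i, Suc i, i]" "v = pos [Suc i, i, Suc i]"
    using assms unfolding braid_rels_def by blast
  then show ?thesis
  proof cases
    case far
    have "bw l (sgw u) = bw l (sgw v) \<and> perm st (sgw u) l = perm st (sgw v) l" if l: "length l = n" "oks l" for l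
    proof -
      obtain p c d r where p: "l = p @ c # d # r" "i = Suc (length p)"
        by (rule split_at[of i l]) (use far l in auto)
      \<comment> \<open>The list \<open>r\<close> starts at index \<open>i + 1\<close>, so the
        generator \<open>j\<close> becomes \<open>j - i - 1\<close> on it.\<close>
      obtain q e f t where q: "r = q @ e # f # t" "j - i - 1 = Suc (length q)"
        by (rule split_at[of "j - i - 1" r]) (use far l p in auto)
      have j: "j = Suc (length (p @ c # d # q))" "j = Suc (length (p @ d # c # q))" using p q far by auto
      have o: "oks p" "ok c" "ok d" "oks q" "ok e" "ok f" "oks t" using l p q by auto
      have t: "letter (p @ c # d # r) (Sig i, True) = I p \<odot> sg c d \<odot> I (q @ e # f # t)"
        "letter (p @ c # d # q @ f # e # t) (Sig i, True) = I p \<odot> sg c d \<odot> I (q @ f # e # t)"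
        "letter (p @ c # d # q @ e # f # t) (Sig j, True) = I (p @ c # d # q) \<odot> sg e f \<odot> I t"
        "letter (p @ d # c # q @ e # f # t) (Sig j, True) = I (p @ d # c # q) \<odot> sg e f \<odot> I t"
        using letter_at[OF p(2), of c d _ True] letter_at[OF j(1), of e f t True] letter_at[OF j(2), of e f t True] q by simp_all
      have s: "swap_strands i (p @ c # d # r) = p @ d # c # r" "swap_strands i (p @ c # d # q @ f # e # t) = p @ d # c # q @ f # e # t"
        "swap_strands j (p @ c # d # q @ e # f # t) = p @ c # d # q @ f # e # t" "swap_strands j (p @ d # c # q @ e # f # t) = p @ d # c # q @ f # e # t"
        using swap_strands_at[OF p(2)] swap_strands_at[OF j(1), of e f t] swap_strands_at[OF j(2), of e f t] by simp_all
      show ?thesis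
        using far p q t s o slide[of "sg c d" "sg e f" "[c, d]" "[d, c]" "[e, f]" "[f, e]" q p t] by simp
    qed
    then show ?thesis using far by (auto simp: cgens_def)
  next
    case near
    have "bw l (sgw u) = bw l (sgw v) \<and> perm st (sgw u) l = perm st (sgw v) l" if l: "length l = n" "oks l" for l
    proof -
      obtain p c d r where p: "l = p @ c # d # r" "i = Suc (length p)"
        by (rule split_at[of i l]) (use near l in auto)
      obtain e t where q: "r = e # t" using p l near by (cases r) auto
      have o: "oks p" "ok c" "ok d" "ok e" "oks t" using l p q by auto
      have i': "Suc i = Suc (length (p @ [x]))" for x using p by simp
      have t: "letter (p @ x # y # z # t) (Sig i, True) = I p \<odot> sg x y \<odot> I (z # t)"
        "letter (p @ x # y # z # t) (Sig (Suc i), True) = I (p @ [x]) \<odot> sg y z \<odot> I t" for x y z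
        using letter_at[OF p(2), of x y "z # t" True] letter_at[OF i', of x y z t True] by simp_all
      have s: "swap_strands i (p @ x # y # z # t) = p @ y # x # z # t" "swap_strands (Suc i) (p @ x # y # z # t) = p @ x # z # y # t" for x y z
        using swap_strands_at[OF p(2), of x y "z # t"] swap_strands_at[OF i', of x y z t] by simp_all
      have "I p \<odot> ((sg d e \<odot> I [c]) \<bullet> (I [d] \<odot> sg c e) \<bullet> (sg c d \<odot> I [e])) \<odot> I t
       = I p \<odot> ((I [e] \<odot> sg c d) \<bullet> (sg c e \<odot> I [d]) \<bullet> (I [c] \<odot> sg d e)) \<odot> I t"
        using yang_baxter[OF bs o(2-4)] by simp
      then show ?thesis using near p(1) q t s o by (simp add: strict_simps)
    qed
    then show ?thesis using near by (auto simp: cgens_def)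
  qed
qed

text \<open>By BP1 the word \<sigma> \<kappa> \<sigma> twists the second strand alone, so the
  relation of length four says that the twists of the first and of the second strand commute, which
  they do by the interchange law. A twist commutes with crossings further out for the same
  reason.\<close>

lemma cyl_rels_bw:
  assumes "(u, v) \<in> cyl_rels n" bk "0 < n"
  shows "wfb n u \<and> wfb n v \<and> (\<forall>l. length l = n \<and> oks l \<longrightarrow> bw l u = bw l v \<and> perm st u l = perm st v l)"
proof -
  consider (br) u' v' where "(u', v') \<in> braid_rels n" "u = sgw u'" "v = sgw v'"
    | (four) "1 < n" "u = pos [Sig 1, Kap, Sig 1, Kap]" "v = pos [Kap, Sig 1, Kap, Sig 1]"
    | (far) i where "1 < i" "i < n" "u = pos [Sig i, Kap]" "v = pos [Kap, Sig i]"
    using assms(1) unfolding cyl_rels_def by (fastforce simp: sig_sgw simp del: One_nat_def split: if_splits)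
  then show ?thesis
  proof cases
    case br then show ?thesis using braid_rels_bw by blast
  next
    case four
    have "bw l u = bw l v \<and> perm st u l = perm st v l" if l: "length l = n" "oks l" for l
    proof -
      obtain c d r where p: "l = c # d # r"
        using l four by (metis One_nat_def Suc_lessE length_Suc_conv less_imp_Suc_add list.size(3) not_less_zero neq_Nil_conv)
      have o: "ok c" "ok d" "oks r" using l p by auto
      have 1: "I [c] \<odot> kp d = sg (st d) c \<bullet> (kp d \<odot> I [c]) \<bullet> sg c d"
        using kp_behind[OF assms(2), of d c] o by simp
      have 2: "I [st c] \<odot> kp d = sg (st d) (st c) \<bullet> (kp d \<odot> I [st c]) \<bullet> sg (st c) d"
        using kp_behind[OF assms(2), of d "st c"] o by simp
      have "(kp c \<odot> I [st d]) \<bullet> (I [c] \<odot> kp d) = (I [st c] \<odot> kp d) \<bullet> (kp c \<odot> I [d])"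
        using o assms(2) by (intro slide0(1)) simp_all
      then have "((kp c \<odot> I [st d]) \<bullet> sg (st d) c \<bullet> (kp d \<odot> I [c]) \<bullet> sg c d) \<odot> I r
        = (sg (st d) (st c) \<bullet> (kp d \<odot> I [st c]) \<bullet> sg (st c) d \<bullet> (kp c \<odot> I [d])) \<odot> I r"
        unfolding 1 2 by (simp only: cm_assoc)
      then show ?thesis using p o four assms(2) by (simp add: letter_Suc0[OF bs] swap_strands_Suc0[OF bs] whisker_right hz_assoc hz_I)
    qed
    then show ?thesis using four assms by (auto simp: cgens_def)
  next
    case far
    have "bw l u = bw l v \<and> perm st u l = perm st v l" if l: "length l = n" "oks l" for l
    proof -
      obtain p c d r where p: "l = p @ c # d # r" "i = Suc (length p)"
        by (rule split_at[of i l]) (use far l in auto)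
      obtain e q where q: "p = e # q" using p far by (cases p) auto
      have o: "oks q" "ok c" "ok d" "ok e" "oks r" using l p q by auto
      have i: "i = Suc (length (x # q))" for x using p q by simp
      have t: "letter (x # q @ c # d # r) (Sig i, True) = I (x # q) \<odot> sg c d \<odot> I r" for x
        using letter_at[OF i, of x c d r True] by simp
      have s: "swap_strands i (x # q @ c # d # r) = x # q @ d # c # r" for x
        using swap_strands_at[OF i, of x c d r] by simp
      show ?thesis using far p(1) q t s o assms(2) slide[of "kp e" "sg c d" "[e]" "[st e]" "[c, d]" "[d, c]" q "[]" r]
        by simp
    qed
    then show ?thesis using far assms by (auto simp: cgens_def)
  qed
qed

end
end

section \<open>Pairs and their strictification\<close>

context category begin

lemma homD: "f \<in> hom C X Y \<Longrightarrow> f \<in> Ar C" "f \<in> hom C X Y \<Longrightarrow> dm C f = X" "f \<in> hom C X Y \<Longrightarrow> cd C f = Y"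
    "f \<in> hom C X Y \<Longrightarrow> X \<in> Ob C" "f \<in> hom C X Y \<Longrightarrow> Y \<in> Ob C"
  using dm_cd by (auto simp: hom_def)

lemma inverse_arrows_unique: "inverse_arrows C f g \<Longrightarrow> inverse_arrows C f h \<Longrightarrow> g = h"
proof -
  assume g: "inverse_arrows C f g" and h: "inverse_arrows C f h"
  have f: "f \<in> hom C (dm C f) (cd C f)" using g by (simp add: inverse_arrows_def hom_def)
  have g': "g \<in> hom C (cd C f) (dm C f)" and h': "h \<in> hom C (cd C f) (dm C f)"
    using g h by (auto simp: inverse_arrows_def)
  have "(g \<cdot> f) \<cdot> h = g \<cdot> (f \<cdot> h)" using cmp_assoc[OF h' f g'] .
  then show "g = h" using g h cmp_ide[OF g'] cmp_ide[OF h'] by (simp add: inverse_arrows_def)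
qed

lemma inv_arrow_eq: "inverse_arrows C f g \<Longrightarrow> inv_arrow C f = g"
  unfolding inv_arrow_def using inverse_arrows_unique by blast

lemma inv_arrow_props:
  assumes "f \<in> hom C X Y" "iso C f"
  shows "inv_arrow C f \<in> hom C Y X" "inv_arrow C f \<cdot> f = ide C X" "f \<cdot> inv_arrow C f = ide C Y"
proof -
  obtain g where g: "inverse_arrows C f g" using assms(2) by (auto simp: iso_def)
  have d: "dm C f = X" "cd C f = Y" using assms(1) by (auto simp: hom_def)
  show "inv_arrow C f \<in> hom C Y X" "inv_arrow C f \<cdot> f = ide C X" "f \<cdot> inv_arrow C f = ide C Y"
    unfolding inv_arrow_eq[OF g] using g d by (auto simp: inverse_arrows_def)
qed

lemma iso_ide: "X \<in> Ob C \<Longrightarrow> iso C (ide C X)"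
  using ide_hom[of X] cmp_ide[OF ide_hom[of X]] unfolding iso_def inverse_arrows_def
  by (intro exI[of _ "ide C X"]) (auto simp: hom_def)

lemma inv_ide: "X \<in> Ob C \<Longrightarrow> inv_arrow C (ide C X) = ide C X"
  using ide_hom[of X] cmp_ide[OF ide_hom[of X]] by (intro inv_arrow_eq) (auto simp: inverse_arrows_def hom_def)

end

lemma is_functorD:
  assumes "is_functor C D Fo Fa"
  shows "X \<in> Ob C \<Longrightarrow> Fo X \<in> Ob D" "X \<in> Ob C \<Longrightarrow> Fa (ide C X) = ide D (Fo X)"
    "f \<in> hom C X Y \<Longrightarrow> Fa f \<in> hom D (Fo X) (Fo Y)"
    "f \<in> hom C X Y \<Longrightarrow> g \<in> hom C Y Z \<Longrightarrow> Fa (g \<cdot>\<^bsub>C\<^esub> f) = Fa g \<cdot>\<^bsub>D\<^esub> Fa f"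
  using assms unfolding is_functor_def by blast+

lemma nat_isoD:
  assumes "nat_iso C D Fo Fa Go Ga \<eta>"
  shows "X \<in> Ob C \<Longrightarrow> \<eta> X \<in> hom D (Fo X) (Go X)" "X \<in> Ob C \<Longrightarrow> iso D (\<eta> X)"
    "f \<in> hom C X Y \<Longrightarrow> \<eta> Y \<cdot>\<^bsub>D\<^esub> Fa f = Ga f \<cdot>\<^bsub>D\<^esub> \<eta> X"
  using assms unfolding nat_iso_def by blast+

lemma hom_prod: "(f, g) \<in> hom (C \<times>\<^sub>c D) (X, X') (Y, Y') \<longleftrightarrow> f \<in> hom C X Y \<and> g \<in> hom D X' Y'"
  by (auto simp: hom_def prod_cat_def)

lemma prod_cat_simps: "Ob (C \<times>\<^sub>c D) = Ob C \<times> Ob D" "ide (C \<times>\<^sub>c D) (X, Y) = (ide C X, ide D Y)"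
   "(g, g') \<cdot>\<^bsub>C \<times>\<^sub>c D\<^esub> (f, f') = (g \<cdot>\<^bsub>C\<^esub> f, g' \<cdot>\<^bsub>D\<^esub> f')"
  by (simp_all add: prod_cat_def)

lemma tensor_op_simps: "Ob (tensor_op A) = Ob A" "hom (tensor_op A) X Y = hom A X Y" "ide (tensor_op A) = ide A"
   "g \<cdot>\<^bsub>tensor_op A\<^esub> f = g \<cdot>\<^bsub>A\<^esub> f" "iso (tensor_op A) f = iso A f" "X \<otimes>\<^bsub>tensor_op A\<^esub> Y = Y \<otimes>\<^bsub>A\<^esub> X"
   "f \<boxtimes>\<^bsub>tensor_op A\<^esub> g = g \<boxtimes>\<^bsub>A\<^esub> f" "\<one>\<^bsub>tensor_op A\<^esub> = \<one>\<^bsub>A\<^esub>"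
   "asc (tensor_op A) X Y Z = inv_arrow A (asc A Z Y X)" "lun (tensor_op A) = run A" "run (tensor_op A) = lun A"
  by (simp_all add: tensor_op_def hom_def iso_def inverse_arrows_def)

section \<open>Structure morphisms of \<open>A\<close> and of \<Phi>\<close>

context monoidal_category begin

lemma ten_Ob [simp]: "X \<in> Ob A \<Longrightarrow> Y \<in> Ob A \<Longrightarrow> X \<otimes> Y \<in> Ob A"
  using is_functorD(1)[OF ten_functor, of "(X, Y)"] by (simp add: prod_cat_simps)

lemma unit_Ob [simp]: "\<one> \<in> Ob A"
  by (rule unit_ob)

lemma ide_homs [simp]: "X \<in> Ob A \<Longrightarrow> ide A X \<in> hom A X X"
  by (rule ide_hom)

lemma ten_hom [simp]: "f \<in> hom A X Y \<Longrightarrow> g \<in> hom A X' Y' \<Longrightarrow> f \<boxtimes> g \<in> hom A (X \<otimes> X') (Y \<otimes> Y')"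
  using is_functorD(3)[OF ten_functor, of "(f, g)" "(X, X')" "(Y, Y')"] by (simp add: hom_prod)

lemma ten_cmp: "\<lbrakk>f \<in> hom A X Y; g \<in> hom A Y Z; f' \<in> hom A X' Y'; g' \<in> hom A Y' Z'\<rbrakk> \<Longrightarrow>
    (g \<cdot> f) \<boxtimes> (g' \<cdot> f') = (g \<boxtimes> g') \<cdot> (f \<boxtimes> f')"
  using is_functorD(4)[OF ten_functor, of "(f, f')" "(X, X')" "(Y, Y')" "(g, g')" "(Z, Z')"] by (simp add: hom_prod prod_cat_simps)

lemma ten_ide: "X \<in> Ob A \<Longrightarrow> Y \<in> Ob A \<Longrightarrow> ide A X \<boxtimes> ide A Y = ide A (X \<otimes> Y)"
  using is_functorD(2)[OF ten_functor, of "(X, Y)"] by (simp add: prod_cat_simps)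

lemma asc_hom [simp]: "\<lbrakk>X \<in> Ob A; Y \<in> Ob A; Z \<in> Ob A\<rbrakk> \<Longrightarrow> asc A X Y Z \<in> hom A ((X \<otimes> Y) \<otimes> Z) (X \<otimes> Y \<otimes> Z)"
  using nat_isoD(1)[OF asc_nat_iso, of "(X, Y, Z)"] by (simp add: prod_cat_simps)

lemma asc_iso [simp]: "\<lbrakk>X \<in> Ob A; Y \<in> Ob A; Z \<in> Ob A\<rbrakk> \<Longrightarrow> iso A (asc A X Y Z)"
  using nat_isoD(2)[OF asc_nat_iso, of "(X, Y, Z)"] by (simp add: prod_cat_simps)

lemma lun_hom [simp]: "X \<in> Ob A \<Longrightarrow> lun A X \<in> hom A (\<one> \<otimes> X) X"
  and lun_iso [simp]: "X \<in> Ob A \<Longrightarrow> iso A (lun A X)"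
  and run_hom [simp]: "X \<in> Ob A \<Longrightarrow> run A X \<in> hom A (X \<otimes> \<one>) X"
  and run_iso [simp]: "X \<in> Ob A \<Longrightarrow> iso A (run A X)"
  using nat_isoD(1,2)[OF lun_nat_iso] nat_isoD(1,2)[OF run_nat_iso] by auto

end

context anti_involution begin

interpretation P: monoidal_functor A "tensor_op A" "Phi A" by (rule Phi_monoidal)

lemma Phi_Ob [simp]: "X \<in> Ob A \<Longrightarrow> \<Phi> X \<in> Ob A"
  and Phi_hom [simp]: "f \<in> hom A X Y \<Longrightarrow> Phi_ar A f \<in> hom A (\<Phi> X) (\<Phi> Y)"
  and Phi_ide: "X \<in> Ob A \<Longrightarrow> Phi_ar A (ide A X) = ide A (\<Phi> X)"
  and Phi_cmp: "f \<in> hom A X Y \<Longrightarrow> g \<in> hom A Y Z \<Longrightarrow> Phi_ar A (g \<cdot> f) = Phi_ar A g \<cdot> Phi_ar A f"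
  using is_functorD[OF P.F_functor] by (auto simp: tensor_op_simps)

lemma Phi_two_hom [simp]: "\<lbrakk>X \<in> Ob A; Y \<in> Ob A\<rbrakk> \<Longrightarrow> Phi_two A X Y \<in> hom A (\<Phi> Y \<otimes> \<Phi> X) (\<Phi> (X \<otimes> Y))"
  and Phi_two_iso [simp]: "\<lbrakk>X \<in> Ob A; Y \<in> Ob A\<rbrakk> \<Longrightarrow> iso A (Phi_two A X Y)"
  using nat_isoD(1,2)[OF P.F_two_nat_iso, of "(X, Y)"] by (simp_all add: tensor_op_simps prod_cat_simps)

lemma Phi_two_nat: "\<lbrakk>f \<in> hom A X X'; g \<in> hom A Y Y'\<rbrakk> \<Longrightarrow>
    Phi_two A X' Y' \<cdot> (Phi_ar A g \<boxtimes> Phi_ar A f) = Phi_ar A (f \<boxtimes> g) \<cdot> Phi_two A X Y"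
  using nat_isoD(3)[OF P.F_two_nat_iso, of "(f, g)" "(X, Y)" "(X', Y')"] by (simp add: tensor_op_simps hom_prod)

lemma Phi_zero_hom [simp]: "Phi_zero A \<in> hom A (\<Phi> \<one>) \<one>" and Phi_zero_iso [simp]: "iso A (Phi_zero A)"
  using P.F_zero_iso by (simp_all add: tensor_op_simps)

lemma Phi_asc: "\<lbrakk>X \<in> Ob A; Y \<in> Ob A; Z \<in> Ob A\<rbrakk> \<Longrightarrow>
   Phi_ar A (asc A X Y Z) \<cdot> Phi_two A (X \<otimes> Y) Z \<cdot> (ide A (\<Phi> Z) \<boxtimes> Phi_two A X Y)
    = Phi_two A X (Y \<otimes> Z) \<cdot> (Phi_two A Y Z \<boxtimes> ide A (\<Phi> X)) \<cdot> inv_arrow A (asc A (\<Phi> Z) (\<Phi> Y) (\<Phi> X))"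
  using P.F_asc[of X Y Z] by (simp add: tensor_op_simps)

lemma Phi_lun: "X \<in> Ob A \<Longrightarrow> Phi_ar A (lun A X) \<cdot> Phi_two A \<one> X = run A (\<Phi> X) \<cdot> (ide A (\<Phi> X) \<boxtimes> Phi_zero A)"
  and Phi_run: "X \<in> Ob A \<Longrightarrow> Phi_ar A (run A X) \<cdot> Phi_two A X \<one> = lun A (\<Phi> X) \<cdot> (Phi_zero A \<boxtimes> ide A (\<Phi> X))"
  using P.F_lun[of X] P.F_run[of X] by (simp_all add: tensor_op_simps)

lemma tinv_hom [simp]: "X \<in> Ob A \<Longrightarrow> tinv A X \<in> hom A (\<Phi> (\<Phi> X)) X"
  and tinv_iso [simp]: "X \<in> Ob A \<Longrightarrow> iso A (tinv A X)"
  and tinv_nat: "f \<in> hom A X Y \<Longrightarrow> tinv A Y \<cdot> Phi_ar A (Phi_ar A f) = f \<cdot> tinv A X"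
  and tinv_ten: "\<lbrakk>X \<in> Ob A; Y \<in> Ob A\<rbrakk> \<Longrightarrow>
     tinv A (X \<otimes> Y) \<cdot> Phi_ar A (Phi_two A X Y) \<cdot> Phi_two A (\<Phi> Y) (\<Phi> X) = ide A (X \<otimes> Y) \<cdot> (tinv A X \<boxtimes> tinv A Y)"
  and tinv_unit: "ide A \<one> \<cdot> tinv A \<one> = Phi_zero A \<cdot> Phi_ar A (Phi_zero A)"
proof -
  note m = t_monoidal[unfolded monoidal_nat_iso_def]
  have n: "nat_iso A A (\<lambda>X. \<Phi> (\<Phi> X)) (\<lambda>f. Phi_ar A (Phi_ar A f)) (\<lambda>X. X) (\<lambda>f. f) (tinv A)"
    using m by (simp add: comp_mfun_def op_mfun_def id_mfun_def comp_def)
  show "X \<in> Ob A \<Longrightarrow> tinv A X \<in> hom A (\<Phi> (\<Phi> X)) X" "X \<in> Ob A \<Longrightarrow> iso A (tinv A X)"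
    "f \<in> hom A X Y \<Longrightarrow> tinv A Y \<cdot> Phi_ar A (Phi_ar A f) = f \<cdot> tinv A X"
    using nat_isoD[OF n] by auto
  show "\<lbrakk>X \<in> Ob A; Y \<in> Ob A\<rbrakk> \<Longrightarrow>
     tinv A (X \<otimes> Y) \<cdot> Phi_ar A (Phi_two A X Y) \<cdot> Phi_two A (\<Phi> Y) (\<Phi> X) = ide A (X \<otimes> Y) \<cdot> (tinv A X \<boxtimes> tinv A Y)"
    "ide A \<one> \<cdot> tinv A \<one> = Phi_zero A \<cdot> Phi_ar A (Phi_zero A)"
    using m by (simp_all add: comp_mfun_def op_mfun_def id_mfun_def)
qed

definition ob :: "'o \<times> bool \<Rightarrow> 'o" where "ob c = (if snd c then \<Phi> (fst c) else fst c)"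

lemma ob_simps [simp]: "ob (x, True) = \<Phi> x" "ob (x, False) = x"
  by (simp_all add: ob_def)

lemma ob_Ob [simp]: "fst c \<in> Ob A \<Longrightarrow> ob c \<in> Ob A"
  by (simp add: ob_def)

end

text \<open>The part of a braided pair that concerns \<open>A\<close> alone. It can be required
  where the module carries no twist, as for the regular module.\<close>

definition braiding :: "('o, 'a, 'y) inv_moncat_scheme \<Rightarrow> ('o \<Rightarrow> 'o \<Rightarrow> 'a) \<Rightarrow> bool" where
  "braiding A \<sigma> \<longleftrightarrow>
    nat_iso (A \<times>\<^sub>c A) A (\<lambda>(X, Y). X \<otimes>\<^bsub>A\<^esub> Y) (\<lambda>(f, g). f \<boxtimes>\<^bsub>A\<^esub> g) (\<lambda>(X, Y). Y \<otimes>\<^bsub>A\<^esub> X) (\<lambda>(f, g). g \<boxtimes>\<^bsub>A\<^esub> f)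
          (\<lambda>(X, Y). \<sigma> X Y) \<and>
    (\<forall>X \<in> Ob A. \<forall>Y \<in> Ob A. \<forall>Z \<in> Ob A.
          asc A Y Z X \<cdot>\<^bsub>A\<^esub> \<sigma> X (Y \<otimes>\<^bsub>A\<^esub> Z) \<cdot>\<^bsub>A\<^esub> asc A X Y Z
          = (ide A Y \<boxtimes>\<^bsub>A\<^esub> \<sigma> X Z) \<cdot>\<^bsub>A\<^esub> asc A Y X Z \<cdot>\<^bsub>A\<^esub> (\<sigma> X Y \<boxtimes>\<^bsub>A\<^esub> ide A Z)) \<and>
    (\<forall>X \<in> Ob A. \<forall>Y \<in> Ob A. \<forall>Z \<in> Ob A.
          inv_arrow A (asc A Z X Y) \<cdot>\<^bsub>A\<^esub> \<sigma> (X \<otimes>\<^bsub>A\<^esub> Y) Z \<cdot>\<^bsub>A\<^esub> inv_arrow A (asc A X Y Z)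
          = (\<sigma> X Z \<boxtimes>\<^bsub>A\<^esub> ide A Y) \<cdot>\<^bsub>A\<^esub> inv_arrow A (asc A X Z Y) \<cdot>\<^bsub>A\<^esub> (ide A X \<boxtimes>\<^bsub>A\<^esub> \<sigma> Y Z)) \<and>
    (\<forall>X \<in> Ob A. \<forall>Y \<in> Ob A.
          Phi_ar A (\<sigma> X Y) \<cdot>\<^bsub>A\<^esub> Phi_two A X Y = Phi_two A Y X \<cdot>\<^bsub>A\<^esub> \<sigma> (Phi_ob A Y) (Phi_ob A X))"

text \<open>\<open>(x, e)\<close> stands for \<open>\<Phi>(x)\<close> if \<open>e\<close>, and for \<open>x\<close> otherwise.  \<open>ar c d f\<close> is the action of a morphism \<open>f\<close>, \<open>mu\<close> the
  inverse of the module associativity, \<open>un\<close> the module unit and \<open>kq\<close> the twist \<open>\<kappa>\<close>; the axioms \<open>kq_behind\<close> and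
  \<open>kq_ten\<close> are BP1 and BP2.\<close>

locale strict_pair = anti_involution A + strict_moncat "\<lambda>c. fst c \<in> Ob A" arr src tgt cm I hz
  for A :: "('o, 'a, 'y) inv_moncat_scheme" (structure)
    and arr :: "'e \<Rightarrow> bool" and src tgt :: "'e \<Rightarrow> ('o \<times> bool) list" and cm :: "'e \<Rightarrow> 'e \<Rightarrow> 'e" (infixr "\<bullet>" 55)
    and I :: "('o \<times> bool) list \<Rightarrow> 'e" and hz :: "'e \<Rightarrow> 'e \<Rightarrow> 'e" (infixr "\<odot>" 65) +
  fixes ar :: "'o \<times> bool \<Rightarrow> 'o \<times> bool \<Rightarrow> 'a \<Rightarrow> 'e" and mu mui :: "'o \<times> bool \<Rightarrow> 'o \<times> bool \<Rightarrow> 'e"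
    and un uni :: 'e and kq kqi :: "'o \<times> bool \<Rightarrow> 'e" and \<sigma> :: "'o \<Rightarrow> 'o \<Rightarrow> 'a" and bs bk :: bool
  assumes ar_T: "\<lbrakk>fst c \<in> Ob A; fst d \<in> Ob A; f \<in> hom A (ob c) (ob d)\<rbrakk> \<Longrightarrow> T (ar c d f) [c] [d]"
    and ar_cm: "\<lbrakk>fst b \<in> Ob A; fst c \<in> Ob A; fst d \<in> Ob A; f \<in> hom A (ob b) (ob c); g \<in> hom A (ob c) (ob d)\<rbrakk>
        \<Longrightarrow> ar c d g \<bullet> ar b c f = ar b d (g \<cdot> f)"
    and ar_ide: "fst c \<in> Ob A \<Longrightarrow> ar c c (ide A (ob c)) = I [c]"
    and mu_T: "\<lbrakk>fst c \<in> Ob A; fst d \<in> Ob A\<rbrakk> \<Longrightarrow> T (mu c d) [(ob c \<otimes> ob d, False)] [c, d] \<and>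
        T (mui c d) [c, d] [(ob c \<otimes> ob d, False)] \<and> mui c d \<bullet> mu c d = I [(ob c \<otimes> ob d, False)] \<and> mu c d \<bullet> mui c d = I [c, d]"
    and mu_nat: "\<lbrakk>fst c \<in> Ob A; fst d \<in> Ob A; fst c' \<in> Ob A; fst d' \<in> Ob A; f \<in> hom A (ob c) (ob c'); g \<in> hom A (ob d) (ob d')\<rbrakk> \<Longrightarrow>
        mu c' d' \<bullet> ar (ob c \<otimes> ob d, False) (ob c' \<otimes> ob d', False) (f \<boxtimes> g) = (ar c c' f \<odot> ar d d' g) \<bullet> mu c d"
    and mu_asc: "\<lbrakk>fst c \<in> Ob A; fst d \<in> Ob A; fst e \<in> Ob A\<rbrakk> \<Longrightarrow>
        (mu c d \<odot> I [e]) \<bullet> mu (ob c \<otimes> ob d, False) e = (I [c] \<odot> mu d e) \<bullet> mu c (ob d \<otimes> ob e, False)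
          \<bullet> ar ((ob c \<otimes> ob d) \<otimes> ob e, False) (ob c \<otimes> ob d \<otimes> ob e, False) (asc A (ob c) (ob d) (ob e))"
    and un_T: "T un [(\<one>, False)] [] \<and> T uni [] [(\<one>, False)] \<and> uni \<bullet> un = I [(\<one>, False)] \<and> un \<bullet> uni = I []"
    and un_lun: "fst c \<in> Ob A \<Longrightarrow> (un \<odot> I [c]) \<bullet> mu (\<one>, False) c = ar (\<one> \<otimes> ob c, False) c (lun A (ob c))"
    and bk_bs: "bk \<Longrightarrow> bs"
    and sigma: "bs \<Longrightarrow> braiding A \<sigma>"
    and kq_T: "\<lbrakk>bk; fst c \<in> Ob A\<rbrakk> \<Longrightarrow> T (kq c) [c] [(\<Phi> (ob c), False)] \<and> T (kqi c) [(\<Phi> (ob c), False)] [c] \<and>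
        kqi c \<bullet> kq c = I [c] \<and> kq c \<bullet> kqi c = I [(\<Phi> (ob c), False)]"
    and kq_nat: "\<lbrakk>bk; fst c \<in> Ob A; fst d \<in> Ob A; f \<in> hom A (ob c) (ob d)\<rbrakk> \<Longrightarrow>
        kq d \<bullet> ar c d f = ar (\<Phi> (ob c), False) (\<Phi> (ob d), False) (Phi_ar A f) \<bullet> kq c"
    and kq_behind: "\<lbrakk>bk; fst c \<in> Ob A; fst d \<in> Ob A\<rbrakk> \<Longrightarrow>
        I [d] \<odot> kq c = (mu d (\<Phi> (ob c), False) \<bullet> ar (\<Phi> (ob c) \<otimes> ob d, False) (ob d \<otimes> \<Phi> (ob c), False) (\<sigma> (\<Phi> (ob c)) (ob d))
            \<bullet> mui (\<Phi> (ob c), False) d) \<bullet> (kq c \<odot> I [d]) \<bullet>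
          (mu c d \<bullet> ar (ob d \<otimes> ob c, False) (ob c \<otimes> ob d, False) (\<sigma> (ob d) (ob c)) \<bullet> mui d c)"
    and kq_ten: "\<lbrakk>bk; fst c \<in> Ob A; fst d \<in> Ob A\<rbrakk> \<Longrightarrow>
        kq (ob c \<otimes> ob d, False) = ar (\<Phi> (ob d) \<otimes> \<Phi> (ob c), False) (\<Phi> (ob c \<otimes> ob d), False) (Phi_two A (ob c) (ob d))
          \<bullet> mui (\<Phi> (ob d), False) (\<Phi> (ob c), False) \<bullet> (kq d \<odot> I [(\<Phi> (ob c), False)]) \<bullet>
          (mu d (\<Phi> (ob c), False) \<bullet> ar (\<Phi> (ob c) \<otimes> ob d, False) (ob d \<otimes> \<Phi> (ob c), False) (\<sigma> (\<Phi> (ob c)) (ob d))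
            \<bullet> mui (\<Phi> (ob c), False) d) \<bullet> (kq c \<odot> I [d]) \<bullet> mu c d"
begin

abbreviation "okc c \<equiv> fst c \<in> Ob A"

lemma ar_simps [simp]:
  assumes "okc c" "okc d" "f \<in> hom A (ob c) (ob d)"
  shows "arr (ar c d f)" "src (ar c d f) = [c]" "tgt (ar c d f) = [d]"
  using ar_T[OF assms] by (auto simp: T_def)

lemma mu_simps [simp]:
  assumes "okc c" "okc d"
  shows "arr (mu c d)" "src (mu c d) = [(ob c \<otimes> ob d, False)]" "tgt (mu c d) = [c, d]"
    "arr (mui c d)" "src (mui c d) = [c, d]" "tgt (mui c d) = [(ob c \<otimes> ob d, False)]"
    "mui c d \<bullet> mu c d = I [(ob c \<otimes> ob d, False)]" "mu c d \<bullet> mui c d = I [c, d]"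
  using mu_T[OF assms] by (auto simp: T_def)

lemma un_simps [simp]:
  "arr un" "src un = [(\<one>, False)]" "tgt un = []" "arr uni" "src uni = []" "tgt uni = [(\<one>, False)]"
  "uni \<bullet> un = I [(\<one>, False)]" "un \<bullet> uni = I []"
  using un_T by (auto simp: T_def)

lemma ar_sq:
  assumes "g \<cdot> f = k \<cdot> h" "okc b" "okc c" "okc c'" "okc d" "f \<in> hom A (ob b) (ob c)" "g \<in> hom A (ob c) (ob d)"
    "h \<in> hom A (ob b) (ob c')" "k \<in> hom A (ob c') (ob d)"
  shows "ar c d g \<bullet> ar b c f = ar c' d k \<bullet> ar b c' h"
  using assms by (simp add: ar_cm)

lemma ar_inv:
  assumes "f \<in> hom A (ob c) (ob d)" "iso A f" "okc c" "okc d"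
  shows "ar d c (inv_arrow A f) \<bullet> ar c d f = I [c]" "ar c d f \<bullet> ar d c (inv_arrow A f) = I [d]"
    "inv_arrow A f \<in> hom A (ob d) (ob c)"
  using inv_arrow_props[OF assms(1,2)] assms by (simp_all add: ar_cm ar_ide)

text \<open>An arrow is recovered from its whiskering by creating a unit strand with
  \<open>uni\<close> and removing it with \<open>un\<close>.\<close>

lemma unit_faithful:
  assumes "f \<odot> I [(\<one>, False)] = g \<odot> I [(\<one>, False)]" "arr f" "arr g" "src f = src g" "tgt f = tgt g"
  shows "f = g"
proof -
  have r: "h = (I (tgt h) \<odot> un) \<bullet> (h \<odot> I [(\<one>, False)]) \<bullet> (I (src h) \<odot> uni)" if "arr h" for h
    using that by (simp add: interchange)
  show ?thesis using r[OF assms(2)] r[OF assms(3)] assms by simp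
qed

text \<open>The module triangle provides the left unit law only. The right one follows as in Kelly's
  reduction of the unit axioms: whiskered with a unit strand, the two sides agree by
  \<open>mu_asc\<close>, the triangle of \<open>A\<close> and \<open>un_lun\<close> at the
  unit.\<close>

lemma un_run:
  assumes c: "okc c"
  shows "(I [c] \<odot> un) \<bullet> mu c (\<one>, False) = ar (ob c \<otimes> \<one>, False) c (run A (ob c))"
proof (rule unit_faithful)
  let ?o = "(\<one>, False)" and ?x = "ob c"
  have x: "?x \<in> Ob A" using c by simp
  have k: "inv_arrow A (asc A X Y Z) \<in> hom A X Y" if "iso A (asc A X Y Z)" "asc A X Y Z \<in> hom A Y X" for X Y Z
    using that inv_arrow_props by blast
  have m: "(mu c ?o \<odot> I [?o]) \<bullet> mu (?x \<otimes> \<one>, False) ?o = (I [c] \<odot> mu ?o ?o) \<bullet> mu c (\<one> \<otimes> \<one>, False)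
     \<bullet> ar ((?x \<otimes> \<one>) \<otimes> \<one>, False) (?x \<otimes> \<one> \<otimes> \<one>, False) (asc A ?x \<one> \<one>)"
    using mu_asc[of c ?o ?o] c by simp
  have n: "(ar c c (ide A ?x) \<odot> ar (\<one> \<otimes> \<one>, False) ?o (lun A \<one>)) \<bullet> mu c (\<one> \<otimes> \<one>, False)
     = mu c ?o \<bullet> ar (?x \<otimes> \<one> \<otimes> \<one>, False) (?x \<otimes> \<one>, False) (ide A ?x \<boxtimes> lun A \<one>)"
    using mu_nat[of c "(\<one> \<otimes> \<one>, False)" c ?o "ide A ?x" "lun A \<one>"] c by simp
  have t: "ar (?x \<otimes> \<one> \<otimes> \<one>, False) (?x \<otimes> \<one>, False) (ide A ?x \<boxtimes> lun A \<one>)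
      \<bullet> ar ((?x \<otimes> \<one>) \<otimes> \<one>, False) (?x \<otimes> \<one> \<otimes> \<one>, False) (asc A ?x \<one> \<one>)
     = ar ((?x \<otimes> \<one>) \<otimes> \<one>, False) (?x \<otimes> \<one>, False) (run A ?x \<boxtimes> ide A \<one>)"
    using triangle[of ?x \<one>] c x ar_cm by simp
  have n2: "mu c ?o \<bullet> ar ((?x \<otimes> \<one>) \<otimes> \<one>, False) (?x \<otimes> \<one>, False) (run A ?x \<boxtimes> ide A \<one>)
     = (ar (?x \<otimes> \<one>, False) c (run A ?x) \<odot> ar ?o ?o (ide A \<one>)) \<bullet> mu (?x \<otimes> \<one>, False) ?o"
    using mu_nat[of "(?x \<otimes> \<one>, False)" ?o c ?o "run A ?x" "ide A \<one>"] c by simp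
  have io: "ar ?o ?o (ide A \<one>) = I [?o]" "ar c c (ide A ?x) = I [c]" using ar_ide[of ?o] ar_ide[of c] c by simp_all
  have "(((I [c] \<odot> un) \<bullet> mu c ?o) \<odot> I [?o]) \<bullet> mu (?x \<otimes> \<one>, False) ?o
     = (I [c] \<odot> un \<odot> I [?o]) \<bullet> (mu c ?o \<odot> I [?o]) \<bullet> mu (?x \<otimes> \<one>, False) ?o"
    using c by (simp add: whisker_right hz_assoc cm_assoc)
  also have "\<dots> = (I [c] \<odot> ((un \<odot> I [?o]) \<bullet> mu ?o ?o)) \<bullet> mu c (\<one> \<otimes> \<one>, False)
     \<bullet> ar ((?x \<otimes> \<one>) \<otimes> \<one>, False) (?x \<otimes> \<one> \<otimes> \<one>, False) (asc A ?x \<one> \<one>)"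
    unfolding m using c by (simp add: whisker_left cm_assoc)
  also have "\<dots> = (ar (?x \<otimes> \<one>, False) c (run A ?x) \<odot> I [?o]) \<bullet> mu (?x \<otimes> \<one>, False) ?o"
    using un_lun[of ?o] n2 t cm_cong[OF n[unfolded io]] io by (simp add: cm_assoc)
  finally have "((((I [c] \<odot> un) \<bullet> mu c ?o) \<odot> I [?o]) \<bullet> mu (?x \<otimes> \<one>, False) ?o) \<bullet> mui (?x \<otimes> \<one>, False) ?o
    = ((ar (?x \<otimes> \<one>, False) c (run A ?x) \<odot> I [?o]) \<bullet> mu (?x \<otimes> \<one>, False) ?o) \<bullet> mui (?x \<otimes> \<one>, False) ?o" by simp
  then show "((I [c] \<odot> un) \<bullet> mu c ?o) \<odot> I [?o] = ar (?x \<otimes> \<one>, False) c (run A ?x) \<odot> I [?o]"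
    using c x by (simp add: cm_assoc)
qed (use c in simp_all)

end

section \<open>Crossings and twists of signed strands\<close>

context strict_pair begin

definition stt :: "'o \<times> bool \<Rightarrow> 'o \<times> bool" where "stt c = (fst c, \<not> snd c)"

definition sgm :: "'o \<times> bool \<Rightarrow> 'o \<times> bool \<Rightarrow> 'e" where
  "sgm c d = mu d c \<bullet> ar (ob c \<otimes> ob d, False) (ob d \<otimes> ob c, False) (\<sigma> (ob c) (ob d)) \<bullet> mui c d"

definition sgmi :: "'o \<times> bool \<Rightarrow> 'o \<times> bool \<Rightarrow> 'e" where
  "sgmi c d = mu d c \<bullet> ar (ob c \<otimes> ob d, False) (ob d \<otimes> ob c, False) (inv_arrow A (\<sigma> (ob d) (ob c))) \<bullet> mui c d"

text \<open>Compares \<Phi> of a strand with the strand of opposite sign: by \<open>t\<close> if the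
  strand carries \<Phi> already, by the identity otherwise. Composed with it, \<kappa> becomes a
  twist that merely toggles the sign.\<close>

definition kar :: "'o \<times> bool \<Rightarrow> 'a" where "kar c = (if snd c then tinv A (fst c) else ide A (\<Phi> (fst c)))"

definition kap :: "'o \<times> bool \<Rightarrow> 'e" where "kap c = ar (\<Phi> (ob c), False) (stt c) (kar c) \<bullet> kq c"

definition kapi :: "'o \<times> bool \<Rightarrow> 'e" where
  "kapi c = kqi (stt c) \<bullet> ar c (\<Phi> (ob (stt c)), False) (inv_arrow A (kar (stt c)))"

lemma stt_simps [simp]: "fst (stt c) = fst c" "stt (stt c) = c" "stt (x, e) = (x, \<not> e)"
  by (simp_all add: stt_def)

lemma kar_hom [simp]: "okc c \<Longrightarrow> kar c \<in> hom A (\<Phi> (ob c)) (ob (stt c))"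
  and kar_iso [simp]: "okc c \<Longrightarrow> iso A (kar c)"
  by (auto simp: kar_def ob_def stt_def iso_ide)

lemma cmp_homs [simp]: "f \<in> hom A X Y \<Longrightarrow> g \<in> hom A Y Z \<Longrightarrow> g \<cdot> f \<in> hom A X Z"
  by (rule cmp_hom)

lemma ar_sq3:
  assumes "h \<cdot> g \<cdot> f = h' \<cdot> g' \<cdot> f'" "okc b" "okc c" "okc d" "okc e" "okc c'" "okc d'"
    "f \<in> hom A (ob b) (ob c)" "g \<in> hom A (ob c) (ob d)" "h \<in> hom A (ob d) (ob e)"
    "f' \<in> hom A (ob b) (ob c')" "g' \<in> hom A (ob c') (ob d')" "h' \<in> hom A (ob d') (ob e)"
  shows "ar d e h \<bullet> ar c d g \<bullet> ar b c f = ar d' e h' \<bullet> ar c' d' g' \<bullet> ar b c' f'"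
proof -
  have "g \<cdot> f \<in> hom A (ob b) (ob d)" "g' \<cdot> f' \<in> hom A (ob b) (ob d')"
    using assms by (auto intro: cmp_hom)
  then show ?thesis using assms by (simp add: ar_cm)
qed

lemma mu_asc_inv:
  assumes "okc c" "okc d" "okc e"
  shows "(I [c] \<odot> mu d e) \<bullet> mu c (ob d \<otimes> ob e, False) = (mu c d \<odot> I [e]) \<bullet> mu (ob c \<otimes> ob d, False) e
     \<bullet> ar (ob c \<otimes> ob d \<otimes> ob e, False) ((ob c \<otimes> ob d) \<otimes> ob e, False) (inv_arrow A (asc A (ob c) (ob d) (ob e)))"
proof -
  let ?s = "((ob c \<otimes> ob d) \<otimes> ob e, False)" and ?t = "(ob c \<otimes> ob d \<otimes> ob e, False)" and ?a = "asc A (ob c) (ob d) (ob e)"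
  have i: "ar ?s ?t ?a \<bullet> ar ?t ?s (inv_arrow A ?a) = I [?t]" "inv_arrow A ?a \<in> hom A (ob ?t) (ob ?s)"
    using ar_inv[of ?a ?s ?t] assms by simp_all
  show ?thesis using cm_cong[OF mu_asc[OF assms], of "ar ?t ?s (inv_arrow A ?a)"] i assms
    by (simp add: cm_assoc)
qed

lemma mu_natL:
  assumes "okc c" "okc d" "okc c'" "f \<in> hom A (ob c) (ob c')"
  shows "(ar c c' f \<odot> I [d]) \<bullet> mu c d = mu c' d \<bullet> ar (ob c \<otimes> ob d, False) (ob c' \<otimes> ob d, False) (f \<boxtimes> ide A (ob d))"
  using mu_nat[of c d c' d f "ide A (ob d)"] assms by (simp add: ar_ide)

lemma mu_natR:
  assumes "okc c" "okc d" "okc d'" "g \<in> hom A (ob d) (ob d')"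
  shows "(I [c] \<odot> ar d d' g) \<bullet> mu c d = mu c d' \<bullet> ar (ob c \<otimes> ob d, False) (ob c \<otimes> ob d', False) (ide A (ob c) \<boxtimes> g)"
  using mu_nat[of c d c d' "ide A (ob c)" g] assms by (simp add: ar_ide)

lemma mu_epi:
  assumes "f \<bullet> mu c d = g \<bullet> mu c d" "okc c" "okc d" "arr f" "arr g" "src f = [c, d]" "src g = [c, d]"
  shows "f = g"
proof -
  have "(f \<bullet> mu c d) \<bullet> mui c d = (g \<bullet> mu c d) \<bullet> mui c d" using assms(1) by simp
  then show ?thesis using assms(2-) by (simp add: cm_assoc)
qed

context assumes bs: bs begin

lemma sigma_hom [simp]: "X \<in> Ob A \<Longrightarrow> Y \<in> Ob A \<Longrightarrow> \<sigma> X Y \<in> hom A (X \<otimes> Y) (Y \<otimes> X)"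
  and sigma_iso [simp]: "X \<in> Ob A \<Longrightarrow> Y \<in> Ob A \<Longrightarrow> iso A (\<sigma> X Y)"
  and sigma_nat: "f \<in> hom A X X' \<Longrightarrow> g \<in> hom A Y Y' \<Longrightarrow> \<sigma> X' Y' \<cdot> (f \<boxtimes> g) = (g \<boxtimes> f) \<cdot> \<sigma> X Y"
proof -
  have n: "nat_iso (A \<times>\<^sub>c A) A (\<lambda>(X, Y). X \<otimes> Y) (\<lambda>(f, g). f \<boxtimes> g) (\<lambda>(X, Y). Y \<otimes> X) (\<lambda>(f, g). g \<boxtimes> f) (\<lambda>(X, Y). \<sigma> X Y)"
    using sigma[OF bs] by (simp add: braiding_def)
  show "X \<in> Ob A \<Longrightarrow> Y \<in> Ob A \<Longrightarrow> \<sigma> X Y \<in> hom A (X \<otimes> Y) (Y \<otimes> X)" "X \<in> Ob A \<Longrightarrow> Y \<in> Ob A \<Longrightarrow> iso A (\<sigma> X Y)"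
    "f \<in> hom A X X' \<Longrightarrow> g \<in> hom A Y Y' \<Longrightarrow> \<sigma> X' Y' \<cdot> (f \<boxtimes> g) = (g \<boxtimes> f) \<cdot> \<sigma> X Y"
    using nat_isoD(1,2)[OF n, of "(X, Y)"] nat_isoD(3)[OF n, of "(f, g)" "(X, Y)" "(X', Y')"]
    by (simp_all add: prod_cat_simps hom_prod)
qed

lemma sgm_simps [simp]:
  assumes "okc c" "okc d"
  shows "arr (sgm c d)" "src (sgm c d) = [c, d]" "tgt (sgm c d) = [d, c]"
    "arr (sgmi c d)" "src (sgmi c d) = [c, d]" "tgt (sgmi c d) = [d, c]"
    "sgmi d c \<bullet> sgm c d = I [c, d]" "sgm d c \<bullet> sgmi c d = I [c, d]"
    "sgm c d \<bullet> mu c d = mu d c \<bullet> ar (ob c \<otimes> ob d, False) (ob d \<otimes> ob c, False) (\<sigma> (ob c) (ob d))"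
proof -
  let ?cd = "(ob c \<otimes> ob d, False)" and ?dc = "(ob d \<otimes> ob c, False)"
  have i: "ar ?dc ?cd (inv_arrow A (\<sigma> (ob c) (ob d))) \<bullet> ar ?cd ?dc (\<sigma> (ob c) (ob d)) = I [?cd]"
    "inv_arrow A (\<sigma> (ob c) (ob d)) \<in> hom A (ob ?dc) (ob ?cd)"
    and j: "ar ?dc ?cd (\<sigma> (ob d) (ob c)) \<bullet> ar ?cd ?dc (inv_arrow A (\<sigma> (ob d) (ob c))) = I [?cd]"
    "inv_arrow A (\<sigma> (ob d) (ob c)) \<in> hom A (ob ?cd) (ob ?dc)"
    using ar_inv[of "\<sigma> (ob c) (ob d)" ?cd ?dc] ar_inv[of "\<sigma> (ob d) (ob c)" ?dc ?cd] assms by simp_all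
  show "arr (sgm c d)" "src (sgm c d) = [c, d]" "tgt (sgm c d) = [d, c]"
    "arr (sgmi c d)" "src (sgmi c d) = [c, d]" "tgt (sgmi c d) = [d, c]"
    "sgm c d \<bullet> mu c d = mu d c \<bullet> ar ?cd ?dc (\<sigma> (ob c) (ob d))"
    using assms j by (simp_all add: sgm_def sgmi_def cm_assoc)
  have m: "mui d c \<bullet> mu d c \<bullet> h = h" if "arr h" "tgt h = [?dc]" for h
    using cm_cong[of "mui d c" "mu d c" "I [?dc]" h] that assms by simp
  show "sgmi d c \<bullet> sgm c d = I [c, d]" "sgm d c \<bullet> sgmi c d = I [c, d]"
    using assms i j cm_cong[OF i(1)] cm_cong[OF j(1)] by (simp_all add: sgm_def sgmi_def cm_assoc m)
qed

lemma sgm_nat: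
  assumes "okc c" "okc d" "okc c'" "okc d'" "f \<in> hom A (ob c) (ob c')" "g \<in> hom A (ob d) (ob d')"
  shows "sgm c' d' \<bullet> (ar c c' f \<odot> ar d d' g) = (ar d d' g \<odot> ar c c' f) \<bullet> sgm c d"
proof (rule mu_epi)
  note m = mu_nat[OF assms(1-4) assms(5,6)] and m' = mu_nat[OF assms(2,1,4,3) assms(6,5)]
  have s: "ar (ob c' \<otimes> ob d', False) (ob d' \<otimes> ob c', False) (\<sigma> (ob c') (ob d')) \<bullet> ar (ob c \<otimes> ob d, False) (ob c' \<otimes> ob d', False) (f \<boxtimes> g)
    = ar (ob d \<otimes> ob c, False) (ob d' \<otimes> ob c', False) (g \<boxtimes> f) \<bullet> ar (ob c \<otimes> ob d, False) (ob d \<otimes> ob c, False) (\<sigma> (ob c) (ob d))"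
    using assms by (intro ar_sq sigma_nat) auto
  show "(sgm c' d' \<bullet> (ar c c' f \<odot> ar d d' g)) \<bullet> mu c d = ((ar d d' g \<odot> ar c c' f) \<bullet> sgm c d) \<bullet> mu c d"
    using assms cm_cong[OF sgm_simps(9)[OF assms(3,4)]] cm_cong[OF m'] by (simp add: cm_assoc m[symmetric] s)
qed (use assms in simp_all)

text \<open>A hexagon axiom without associativity constraints. Both sides are compared after the
  invertible \<open>mu\<close>, where \<open>mu_asc\<close> supplies the constraints that occur in
  the axiom.\<close>

lemma hexL:
  assumes "okc c" "okc d" "okc e"
  shows "(sgm c e \<odot> I [d]) \<bullet> (I [c] \<odot> sgm d e) \<bullet> (mu c d \<odot> I [e]) = (I [e] \<odot> mu c d) \<bullet> sgm (ob c \<otimes> ob d, False) e"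
proof (rule mu_epi)
  let ?x = "ob c" and ?y = "ob d" and ?z = "ob e"
  have X: "?x \<in> Ob A" "?y \<in> Ob A" "?z \<in> Ob A" using assms by auto
  have i: "inv_arrow A (asc A a b c) \<in> hom A (a \<otimes> b \<otimes> c) ((a \<otimes> b) \<otimes> c)" if "a \<in> Ob A" "b \<in> Ob A" "c \<in> Ob A" for a b c
    using inv_arrow_props(1)[OF asc_hom asc_iso] that by blast
  have h: "inv_arrow A (asc A ?z ?x ?y) \<cdot> \<sigma> (?x \<otimes> ?y) ?z \<cdot> inv_arrow A (asc A ?x ?y ?z)
          = (\<sigma> ?x ?z \<boxtimes> ide A ?y) \<cdot> inv_arrow A (asc A ?x ?z ?y) \<cdot> (ide A ?x \<boxtimes> \<sigma> ?y ?z)"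
    using sigma[OF bs] X unfolding braiding_def by blast
  let ?xy_z = "((?x \<otimes> ?y) \<otimes> ?z, False)" and ?x_yz = "(?x \<otimes> ?y \<otimes> ?z, False)" and ?zx_y = "((?z \<otimes> ?x) \<otimes> ?y, False)"
    and ?x_zy = "(?x \<otimes> ?z \<otimes> ?y, False)" and ?xz_y = "((?x \<otimes> ?z) \<otimes> ?y, False)" and ?z_xy = "(?z \<otimes> ?x \<otimes> ?y, False)"
  have H: "ar ?z_xy ?zx_y (inv_arrow A (asc A ?z ?x ?y)) \<bullet> ar ?xy_z ?z_xy (\<sigma> (?x \<otimes> ?y) ?z) \<bullet> ar ?x_yz ?xy_z (inv_arrow A (asc A ?x ?y ?z))
    = ar ?xz_y ?zx_y (\<sigma> ?x ?z \<boxtimes> ide A ?y) \<bullet> ar ?x_zy ?xz_y (inv_arrow A (asc A ?x ?z ?y)) \<bullet> ar ?x_yz ?x_zy (ide A ?x \<boxtimes> \<sigma> ?y ?z)"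
    by (rule ar_sq3[OF h]) (use X i in simp_all)
  have a: "ar ?x_yz ?xy_z (inv_arrow A (asc A ?x ?y ?z)) \<bullet> ar ?xy_z ?x_yz (asc A ?x ?y ?z) = I [?xy_z]"
    using ar_inv(1)[of "asc A ?x ?y ?z" ?xy_z ?x_yz] X by simp
  have H': "ar ?z_xy ?zx_y (inv_arrow A (asc A ?z ?x ?y)) \<bullet> ar ?xy_z ?z_xy (\<sigma> (?x \<otimes> ?y) ?z)
    = ar ?xz_y ?zx_y (\<sigma> ?x ?z \<boxtimes> ide A ?y) \<bullet> ar ?x_zy ?xz_y (inv_arrow A (asc A ?x ?z ?y)) \<bullet> ar ?x_yz ?x_zy (ide A ?x \<boxtimes> \<sigma> ?y ?z)
       \<bullet> ar ?xy_z ?x_yz (asc A ?x ?y ?z)"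
    using arg_cong[OF H, of "\<lambda>h. h \<bullet> ar ?xy_z ?x_yz (asc A ?x ?y ?z)"] X i a by (simp add: cm_assoc)
  have 1: "(I [c] \<odot> sgm d e) \<bullet> (I [c] \<odot> mu d e) = (I [c] \<odot> mu e d) \<bullet> (I [c] \<odot> ar (?y \<otimes> ?z, False) (?z \<otimes> ?y, False) (\<sigma> ?y ?z))"
    and 2: "(sgm c e \<odot> I [d]) \<bullet> (mu c e \<odot> I [d]) = (mu e c \<odot> I [d]) \<bullet> (ar (?x \<otimes> ?z, False) (?z \<otimes> ?x, False) (\<sigma> ?x ?z) \<odot> I [d])"
    using assms X by (simp_all add: interchange)
  have 3: "(I [c] \<odot> ar (?y \<otimes> ?z, False) (?z \<otimes> ?y, False) (\<sigma> ?y ?z)) \<bullet> mu c (?y \<otimes> ?z, False)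
     = mu c (?z \<otimes> ?y, False) \<bullet> ar ?x_yz ?x_zy (ide A ?x \<boxtimes> \<sigma> ?y ?z)"
    using mu_natR[of c "(?y \<otimes> ?z, False)" "(?z \<otimes> ?y, False)" "\<sigma> ?y ?z"] assms X by simp
  have 4: "(ar (?x \<otimes> ?z, False) (?z \<otimes> ?x, False) (\<sigma> ?x ?z) \<odot> I [d]) \<bullet> mu (?x \<otimes> ?z, False) d
     = mu (?z \<otimes> ?x, False) d \<bullet> ar ?xz_y ?zx_y (\<sigma> ?x ?z \<boxtimes> ide A ?y)"
    using mu_natL[of "(?x \<otimes> ?z, False)" d "(?z \<otimes> ?x, False)" "\<sigma> ?x ?z"] assms X by simp
  have sx: "sgm (?x \<otimes> ?y, False) e \<bullet> mu (?x \<otimes> ?y, False) e = mu e (?x \<otimes> ?y, False) \<bullet> ar ?xy_z ?z_xy (\<sigma> (?x \<otimes> ?y) ?z)"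
    using sgm_simps(9)[of "(?x \<otimes> ?y, False)" e] assms X by simp
  have "((sgm c e \<odot> I [d]) \<bullet> (I [c] \<odot> sgm d e) \<bullet> (mu c d \<odot> I [e])) \<bullet> mu (?x \<otimes> ?y, False) e
    = (mu e c \<odot> I [d]) \<bullet> mu (?z \<otimes> ?x, False) d \<bullet> ar ?xz_y ?zx_y (\<sigma> ?x ?z \<boxtimes> ide A ?y) \<bullet> ar ?x_zy ?xz_y (inv_arrow A (asc A ?x ?z ?y))
       \<bullet> ar ?x_yz ?x_zy (ide A ?x \<boxtimes> \<sigma> ?y ?z) \<bullet> ar ?xy_z ?x_yz (asc A ?x ?y ?z)"
    by (simp only: cm_assoc mu_asc[OF assms] cm_cong[OF 1] cm_cong[OF 3] cm_cong[OF mu_asc_inv[OF assms(1,3,2)]] cm_cong[OF 2] cm_cong[OF 4])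
  also have "\<dots> = ((I [e] \<odot> mu c d) \<bullet> sgm (?x \<otimes> ?y, False) e) \<bullet> mu (?x \<otimes> ?y, False) e"
    by (simp only: cm_assoc sx cm_cong[OF mu_asc_inv[OF assms(3,1,2)]] H')
  finally show "((sgm c e \<odot> I [d]) \<bullet> (I [c] \<odot> sgm d e) \<bullet> (mu c d \<odot> I [e])) \<bullet> mu (?x \<otimes> ?y, False) e
    = ((I [e] \<odot> mu c d) \<bullet> sgm (?x \<otimes> ?y, False) e) \<bullet> mu (?x \<otimes> ?y, False) e" .
qed (use assms in simp_all)

lemma hexR:
  assumes "okc c" "okc d" "okc e"
  shows "(I [d] \<odot> sgm c e) \<bullet> (sgm c d \<odot> I [e]) \<bullet> (I [c] \<odot> mu d e) = (mu d e \<odot> I [c]) \<bullet> sgm c (ob d \<otimes> ob e, False)"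
proof (rule mu_epi)
  let ?x = "ob c" and ?y = "ob d" and ?z = "ob e"
  have X: "?x \<in> Ob A" "?y \<in> Ob A" "?z \<in> Ob A" using assms by auto
  have i: "inv_arrow A (asc A a b c) \<in> hom A (a \<otimes> b \<otimes> c) ((a \<otimes> b) \<otimes> c)" if "a \<in> Ob A" "b \<in> Ob A" "c \<in> Ob A" for a b c
    using inv_arrow_props(1)[OF asc_hom asc_iso] that by blast
  have h: "asc A ?y ?z ?x \<cdot> \<sigma> ?x (?y \<otimes> ?z) \<cdot> asc A ?x ?y ?z
          = (ide A ?y \<boxtimes> \<sigma> ?x ?z) \<cdot> asc A ?y ?x ?z \<cdot> (\<sigma> ?x ?y \<boxtimes> ide A ?z)"
    using sigma[OF bs] X unfolding braiding_def by blast
  let ?xy_z = "((?x \<otimes> ?y) \<otimes> ?z, False)" and ?x_yz = "(?x \<otimes> ?y \<otimes> ?z, False)" and ?yz_x = "((?y \<otimes> ?z) \<otimes> ?x, False)"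
    and ?y_zx = "(?y \<otimes> ?z \<otimes> ?x, False)" and ?yx_z = "((?y \<otimes> ?x) \<otimes> ?z, False)" and ?y_xz = "(?y \<otimes> ?x \<otimes> ?z, False)"
  have H: "ar ?yz_x ?y_zx (asc A ?y ?z ?x) \<bullet> ar ?x_yz ?yz_x (\<sigma> ?x (?y \<otimes> ?z)) \<bullet> ar ?xy_z ?x_yz (asc A ?x ?y ?z)
    = ar ?y_xz ?y_zx (ide A ?y \<boxtimes> \<sigma> ?x ?z) \<bullet> ar ?yx_z ?y_xz (asc A ?y ?x ?z) \<bullet> ar ?xy_z ?yx_z (\<sigma> ?x ?y \<boxtimes> ide A ?z)"
    by (rule ar_sq3[OF h]) (use X i in simp_all)
  have a: "ar ?xy_z ?x_yz (asc A ?x ?y ?z) \<bullet> ar ?x_yz ?xy_z (inv_arrow A (asc A ?x ?y ?z)) = I [?x_yz]"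
    using ar_inv(2)[of "asc A ?x ?y ?z" ?xy_z ?x_yz] X by simp
  have H': "ar ?yz_x ?y_zx (asc A ?y ?z ?x) \<bullet> ar ?x_yz ?yz_x (\<sigma> ?x (?y \<otimes> ?z))
    = ar ?y_xz ?y_zx (ide A ?y \<boxtimes> \<sigma> ?x ?z) \<bullet> ar ?yx_z ?y_xz (asc A ?y ?x ?z) \<bullet> ar ?xy_z ?yx_z (\<sigma> ?x ?y \<boxtimes> ide A ?z)
       \<bullet> ar ?x_yz ?xy_z (inv_arrow A (asc A ?x ?y ?z))"
    using arg_cong[OF H, of "\<lambda>h. h \<bullet> ar ?x_yz ?xy_z (inv_arrow A (asc A ?x ?y ?z))"] X i a by (simp add: cm_assoc)
  have 1: "(I [d] \<odot> sgm c e) \<bullet> (I [d] \<odot> mu c e) = (I [d] \<odot> mu e c) \<bullet> (I [d] \<odot> ar (?x \<otimes> ?z, False) (?z \<otimes> ?x, False) (\<sigma> ?x ?z))"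
    and 2: "(sgm c d \<odot> I [e]) \<bullet> (mu c d \<odot> I [e]) = (mu d c \<odot> I [e]) \<bullet> (ar (?x \<otimes> ?y, False) (?y \<otimes> ?x, False) (\<sigma> ?x ?y) \<odot> I [e])"
    using assms X by (simp_all add: interchange)
  have 3: "(I [d] \<odot> ar (?x \<otimes> ?z, False) (?z \<otimes> ?x, False) (\<sigma> ?x ?z)) \<bullet> mu d (?x \<otimes> ?z, False)
     = mu d (?z \<otimes> ?x, False) \<bullet> ar ?y_xz ?y_zx (ide A ?y \<boxtimes> \<sigma> ?x ?z)"
    using mu_natR[of d "(?x \<otimes> ?z, False)" "(?z \<otimes> ?x, False)" "\<sigma> ?x ?z"] assms X by simp
  have 4: "(ar (?x \<otimes> ?y, False) (?y \<otimes> ?x, False) (\<sigma> ?x ?y) \<odot> I [e]) \<bullet> mu (?x \<otimes> ?y, False) e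
     = mu (?y \<otimes> ?x, False) e \<bullet> ar ?xy_z ?yx_z (\<sigma> ?x ?y \<boxtimes> ide A ?z)"
    using mu_natL[of "(?x \<otimes> ?y, False)" e "(?y \<otimes> ?x, False)" "\<sigma> ?x ?y"] assms X by simp
  have sx: "sgm c (?y \<otimes> ?z, False) \<bullet> mu c (?y \<otimes> ?z, False) = mu (?y \<otimes> ?z, False) c \<bullet> ar ?x_yz ?yz_x (\<sigma> ?x (?y \<otimes> ?z))"
    using sgm_simps(9)[of c "(?y \<otimes> ?z, False)"] assms X by simp
  have "((I [d] \<odot> sgm c e) \<bullet> (sgm c d \<odot> I [e]) \<bullet> (I [c] \<odot> mu d e)) \<bullet> mu c (?y \<otimes> ?z, False)
    = (I [d] \<odot> mu e c) \<bullet> mu d (?z \<otimes> ?x, False) \<bullet> ar ?y_xz ?y_zx (ide A ?y \<boxtimes> \<sigma> ?x ?z) \<bullet> ar ?yx_z ?y_xz (asc A ?y ?x ?z)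
       \<bullet> ar ?xy_z ?yx_z (\<sigma> ?x ?y \<boxtimes> ide A ?z) \<bullet> ar ?x_yz ?xy_z (inv_arrow A (asc A ?x ?y ?z))"
    by (simp only: cm_assoc mu_asc_inv[OF assms] cm_cong[OF 2] cm_cong[OF 4] cm_cong[OF mu_asc[OF assms(2,1,3)]] cm_cong[OF 1] cm_cong[OF 3])
  also have "\<dots> = ((mu d e \<odot> I [c]) \<bullet> sgm c (?y \<otimes> ?z, False)) \<bullet> mu c (?y \<otimes> ?z, False)"
    by (simp only: cm_assoc sx cm_cong[OF mu_asc[OF assms(2,3,1)]] H')
  finally show "((I [d] \<odot> sgm c e) \<bullet> (sgm c d \<odot> I [e]) \<bullet> (I [c] \<odot> mu d e)) \<bullet> mu c (?y \<otimes> ?z, False)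
    = ((mu d e \<odot> I [c]) \<bullet> sgm c (?y \<otimes> ?z, False)) \<bullet> mu c (?y \<otimes> ?z, False)" .
qed (use assms in simp_all)

lemma sgm_natL:
  assumes "okc c" "okc d" "okc c'" "f \<in> hom A (ob c) (ob c')"
  shows "sgm c' d \<bullet> (ar c c' f \<odot> I [d]) = (I [d] \<odot> ar c c' f) \<bullet> sgm c d"
  using sgm_nat[of c d c' d f "ide A (ob d)"] assms by (simp add: ar_ide)

lemma sgm_natR:
  assumes "okc c" "okc d" "okc d'" "g \<in> hom A (ob d) (ob d')"
  shows "sgm c d' \<bullet> (I [c] \<odot> ar d d' g) = (ar d d' g \<odot> I [c]) \<bullet> sgm c d"
  using sgm_nat[of c d c d' "ide A (ob c)" g] assms by (simp add: ar_ide)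

text \<open>The crossing of \<open>d\<close> with \<open>e\<close> comes from a morphism of
  \<open>A\<close>, so it passes through the crossing of \<open>c\<close> with the product of
  \<open>d\<close> and \<open>e\<close> by naturality; the hexagon resolves that crossing into
  single strands on both sides.\<close>

lemma sgm_yb:
  assumes "okc c" "okc d" "okc e"
  shows "(sgm d e \<odot> I [c]) \<bullet> (I [d] \<odot> sgm c e) \<bullet> (sgm c d \<odot> I [e]) = (I [e] \<odot> sgm c d) \<bullet> (sgm c e \<odot> I [d]) \<bullet> (I [c] \<odot> sgm d e)"
proof -
  let ?s = "ar (ob d \<otimes> ob e, False) (ob e \<otimes> ob d, False) (\<sigma> (ob d) (ob e))"
  have 1: "(sgm d e \<odot> I [c]) \<bullet> (mu d e \<odot> I [c]) = (mu e d \<odot> I [c]) \<bullet> (?s \<odot> I [c])"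
    and 2: "(I [c] \<odot> sgm d e) \<bullet> (I [c] \<odot> mu d e) = (I [c] \<odot> mu e d) \<bullet> (I [c] \<odot> ?s)"
    using assms by (simp_all add: interchange)
  have 3: "(?s \<odot> I [c]) \<bullet> sgm c (ob d \<otimes> ob e, False) = sgm c (ob e \<otimes> ob d, False) \<bullet> (I [c] \<odot> ?s)"
    using sgm_natR[of c "(ob d \<otimes> ob e, False)" "(ob e \<otimes> ob d, False)" "\<sigma> (ob d) (ob e)"] assms by simp
  have "((sgm d e \<odot> I [c]) \<bullet> (I [d] \<odot> sgm c e) \<bullet> (sgm c d \<odot> I [e])) \<bullet> (I [c] \<odot> mu d e)
    = ((I [e] \<odot> sgm c d) \<bullet> (sgm c e \<odot> I [d]) \<bullet> (I [c] \<odot> sgm d e)) \<bullet> (I [c] \<odot> mu d e)"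
    by (simp only: cm_assoc hexR[OF assms] cm_cong[OF 1] 3 cm_cong[OF hexR[OF assms(1,3,2), symmetric]] 2)
  then have "(((sgm d e \<odot> I [c]) \<bullet> (I [d] \<odot> sgm c e) \<bullet> (sgm c d \<odot> I [e])) \<bullet> (I [c] \<odot> mu d e)) \<bullet> (I [c] \<odot> mui d e)
    = (((I [e] \<odot> sgm c d) \<bullet> (sgm c e \<odot> I [d]) \<bullet> (I [c] \<odot> sgm d e)) \<bullet> (I [c] \<odot> mu d e)) \<bullet> (I [c] \<odot> mui d e)" by simp
  moreover have "(I [c] \<odot> mu d e) \<bullet> (I [c] \<odot> mui d e) = I [c, d, e]" using assms by (simp add: interchange hz_I)
  ultimately show ?thesis using assms by (simp add: cm_assoc)
qed

end

lemma kq_simps [simp]: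
  assumes "bk" "okc c"
  shows "arr (kq c)" "src (kq c) = [c]" "tgt (kq c) = [(\<Phi> (ob c), False)]"
    "arr (kqi c)" "src (kqi c) = [(\<Phi> (ob c), False)]" "tgt (kqi c) = [c]"
    "kqi c \<bullet> kq c = I [c]" "kq c \<bullet> kqi c = I [(\<Phi> (ob c), False)]"
  using kq_T[OF assms] by (auto simp: T_def)

text \<open>Twists satisfy the required equations because \<open>kq\<close> does: the comparison
  \<open>kar\<close> is invertible, and as a morphism of \<open>A\<close> it moves through the
  crossings of BP1.\<close>

sublocale S: strict_braided "\<lambda>c. fst c \<in> Ob A" arr src tgt cm I hz stt sgm sgmi kap kapi bs bk
proof
  fix c d e :: "'o \<times> bool"
  show "\<lbrakk>bs; okc c; okc d\<rbrakk> \<Longrightarrow> T (sgm c d) [c, d] [d, c] \<and> T (sgmi c d) [c, d] [d, c]"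
    by (simp add: T_def)
  show "\<lbrakk>bs; okc c; okc d\<rbrakk> \<Longrightarrow> sgmi d c \<bullet> sgm c d = I [c, d] \<and> sgm d c \<bullet> sgmi c d = I [c, d]"
    by simp
  show "\<lbrakk>bs; okc c; okc d; okc e\<rbrakk> \<Longrightarrow> (sgm d e \<odot> I [c]) \<bullet> (I [d] \<odot> sgm c e) \<bullet> (sgm c d \<odot> I [e])
     = (I [e] \<odot> sgm c d) \<bullet> (sgm c e \<odot> I [d]) \<bullet> (I [c] \<odot> sgm d e)"
    by (rule sgm_yb)
  show "bk \<Longrightarrow> bs" by (rule bk_bs)
  have J: "ar (\<Phi> (ob c), False) (stt c) (kar c) \<bullet> ar (stt c) (\<Phi> (ob c), False) (inv_arrow A (kar c)) = I [stt c]"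
    "ar (stt c) (\<Phi> (ob c), False) (inv_arrow A (kar c)) \<bullet> ar (\<Phi> (ob c), False) (stt c) (kar c) = I [(\<Phi> (ob c), False)]"
    "inv_arrow A (kar c) \<in> hom A (ob (stt c)) (ob (\<Phi> (ob c), False))"
    if "okc c" for c using that ar_inv[of "kar c" "(\<Phi> (ob c), False)" "stt c"] by simp_all
  show "\<lbrakk>bk; okc c\<rbrakk> \<Longrightarrow> T (kap c) [c] [stt c] \<and> T (kapi c) [c] [stt c]"
    using J[of "stt c"] by (simp add: T_def kap_def kapi_def)
  show "\<lbrakk>bk; okc c\<rbrakk> \<Longrightarrow> kapi (stt c) \<bullet> kap c = I [c] \<and> kap (stt c) \<bullet> kapi c = I [c]"
    using J[of c] J[of "stt c"] cm_cong[OF J(2)[of c]] cm_cong[OF kq_simps(8)[of "stt c"]]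
    by (simp add: kap_def kapi_def cm_assoc)
  assume a: "bk" "okc c" "okc d"
  note bs = bk_bs[OF a(1)]
  let ?p = "(\<Phi> (ob c), False)"
  have q: "I [d] \<odot> kq c = sgm ?p d \<bullet> (kq c \<odot> I [d]) \<bullet> sgm d c"
    using kq_behind[OF a] unfolding sgm_def by simp
  have n: "(I [d] \<odot> ar ?p (stt c) (kar c)) \<bullet> sgm ?p d = sgm (stt c) d \<bullet> (ar ?p (stt c) (kar c) \<odot> I [d])"
    using sgm_natL[OF bs, of ?p d "stt c" "kar c"] a by simp
  have "I [d] \<odot> kap c = (I [d] \<odot> ar ?p (stt c) (kar c)) \<bullet> (I [d] \<odot> kq c)"
    using a by (simp add: kap_def whisker_left)
  also have "\<dots> = sgm (stt c) d \<bullet> (ar ?p (stt c) (kar c) \<odot> I [d]) \<bullet> (kq c \<odot> I [d]) \<bullet> sgm d c"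
    unfolding q using cm_cong[OF n] by (simp only: cm_assoc)
  also have "\<dots> = sgm (stt c) d \<bullet> (kap c \<odot> I [d]) \<bullet> sgm d c"
    using a bs by (simp add: kap_def whisker_right cm_assoc)
  finally show "I [d] \<odot> kap c = sgm (stt c) d \<bullet> (kap c \<odot> I [d]) \<bullet> sgm d c" .
qed simp_all

end

section \<open>Resolution of a single tensor product, unit or \<Phi>\<close>

context strict_pair begin

text \<open>The sign \<open>True\<close> means that everything is read through \<open>\<Phi>\<close>, which reverses the order of tensor factors;
  \<open>tt\<close> absorbs a \<open>\<Phi>\<close> into the sign.\<close>

definition ae :: "'o \<Rightarrow> 'o \<Rightarrow> 'a \<Rightarrow> bool \<Rightarrow> 'e" where
  "ae x y f e = ar (x, e) (y, e) (if e then Phi_ar A f else f)"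

text \<open>Under the sign \<open>True\<close> a product is first split by the inverse of
  \<open>Phi_two\<close>, and then resolved as an ordinary product.\<close>

definition sm :: "'o \<Rightarrow> 'o \<Rightarrow> bool \<Rightarrow> 'e" where
  "sm x y e = (if e then mu (y, True) (x, True) \<bullet> ar (x \<otimes> y, True) (\<Phi> y \<otimes> \<Phi> x, False) (inv_arrow A (Phi_two A x y))
     else mu (x, False) (y, False))"

definition su :: "bool \<Rightarrow> 'e" where
  "su e = (if e then un \<bullet> ar (\<one>, True) (\<one>, False) (Phi_zero A) else un)"

definition tt :: "'o \<Rightarrow> bool \<Rightarrow> 'e" where
  "tt x e = ar (\<Phi> x, e) (x, \<not> e) (if e then tinv A x else ide A (\<Phi> x))"

definition pw :: "bool \<Rightarrow> 'e \<Rightarrow> 'e \<Rightarrow> 'e" where "pw e f g = (if e then g \<odot> f else f \<odot> g)"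

definition pl :: "bool \<Rightarrow> 'x list \<Rightarrow> 'x list \<Rightarrow> 'x list" where "pl e l m = (if e then m @ l else l @ m)"

lemma ae_simps [simp]:
  assumes "x \<in> Ob A" "y \<in> Ob A" "f \<in> hom A x y"
  shows "arr (ae x y f e)" "src (ae x y f e) = [(x, e)]" "tgt (ae x y f e) = [(y, e)]"
  using assms by (auto simp: ae_def)

lemma inv_Phi_two [simp]:
  assumes "x \<in> Ob A" "y \<in> Ob A"
  shows "inv_arrow A (Phi_two A x y) \<in> hom A (\<Phi> (x \<otimes> y)) (\<Phi> y \<otimes> \<Phi> x)"
    "inv_arrow A (Phi_two A x y) \<cdot> Phi_two A x y = ide A (\<Phi> y \<otimes> \<Phi> x)"
    "Phi_two A x y \<cdot> inv_arrow A (Phi_two A x y) = ide A (\<Phi> (x \<otimes> y))"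
  using inv_arrow_props[OF Phi_two_hom Phi_two_iso] assms by auto

lemma sm_simps [simp]:
  assumes "x \<in> Ob A" "y \<in> Ob A"
  shows "arr (sm x y e)" "src (sm x y e) = [(x \<otimes> y, e)]" "tgt (sm x y e) = pl e [(x, e)] [(y, e)]"
  using assms by (auto simp: sm_def pl_def)

lemma su_simps [simp]: "arr (su e)" "src (su e) = [(\<one>, e)]" "tgt (su e) = []"
  by (auto simp: su_def)

lemma tt_simps [simp]:
  assumes "x \<in> Ob A"
  shows "arr (tt x e)" "src (tt x e) = [(\<Phi> x, e)]" "tgt (tt x e) = [(x, \<not> e)]"
  using assms by (auto simp: tt_def)

lemma pw_simps [simp]:
  assumes "arr f" "arr g"
  shows "arr (pw e f g)" "src (pw e f g) = pl e (src f) (src g)" "tgt (pw e f g) = pl e (tgt f) (tgt g)"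
  using assms by (auto simp: pw_def pl_def)

lemma pw_cm: "\<lbrakk>arr f; arr g; arr f'; arr g'; src g = tgt f; src g' = tgt f'\<rbrakk> \<Longrightarrow> pw e (g \<bullet> f) (g' \<bullet> f') = pw e g g' \<bullet> pw e f f'"
  by (simp add: pw_def interchange)

lemma left_inv_ar: "\<lbrakk>okc c; okc d; f \<in> hom A (ob c) (ob d); iso A f\<rbrakk> \<Longrightarrow> left_inv (ar c d f)"
  unfolding left_inv_def using ar_inv[of f c d] by (auto simp: T_def intro!: exI[of _ "ar d c (inv_arrow A f)"])

lemma left_inv_mu: "\<lbrakk>okc c; okc d\<rbrakk> \<Longrightarrow> left_inv (mu c d)"
  unfolding left_inv_def by (auto simp: T_def intro!: exI[of _ "mui c d"])

lemma left_inv_un: "left_inv un"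
  unfolding left_inv_def by (auto simp: T_def intro!: exI[of _ uni])

lemma iso_inv:
  assumes "f \<in> hom A X Y" "iso A f"
  shows "iso A (inv_arrow A f)"
  using inv_arrow_props[OF assms] assms(1) unfolding iso_def inverse_arrows_def
  by (intro exI[of _ f]) (auto simp: hom_def)

lemma left_inv_sm: "\<lbrakk>x \<in> Ob A; y \<in> Ob A\<rbrakk> \<Longrightarrow> left_inv (sm x y e)"
  using iso_inv[OF Phi_two_hom Phi_two_iso, of x y]
  by (auto simp: sm_def intro!: left_inv_mu left_inv_cm left_inv_ar)

lemma left_inv_su: "left_inv (su e)"
  by (auto simp: su_def intro!: left_inv_un left_inv_cm left_inv_ar)

lemma left_inv_tt: "x \<in> Ob A \<Longrightarrow> left_inv (tt x e)"
  by (auto simp: tt_def iso_ide intro!: left_inv_ar)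

lemma left_inv_pw: "left_inv f \<Longrightarrow> left_inv g \<Longrightarrow> left_inv (pw e f g)"
  by (auto simp: pw_def intro: left_inv_hz)

lemma ae_ide: "x \<in> Ob A \<Longrightarrow> ae x x (ide A x) e = I [(x, e)]"
  using ar_ide[of "(x, e)"] by (auto simp: ae_def Phi_ide)

lemma ae_cm: "\<lbrakk>f \<in> hom A x y; g \<in> hom A y z\<rbrakk> \<Longrightarrow> ae y z g e \<bullet> ae x y f e = ae x z (g \<cdot> f) e"
  using homD(4,5)[of f x y] homD(5)[of g y z] by (auto simp: ae_def ar_cm Phi_cmp)

lemma sm_nat:
  assumes "f \<in> hom A x x'" "g \<in> hom A y y'"
  shows "sm x' y' e \<bullet> ae (x \<otimes> y) (x' \<otimes> y') (f \<boxtimes> g) e = pw e (ae x x' f e) (ae y y' g e) \<bullet> sm x y e"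
proof -
  have o: "x \<in> Ob A" "x' \<in> Ob A" "y \<in> Ob A" "y' \<in> Ob A" using homD(4,5) assms by blast+
  show ?thesis
  proof (cases e)
    case True
    have h: "Phi_two A x' y' \<cdot> (Phi_ar A g \<boxtimes> Phi_ar A f) = Phi_ar A (f \<boxtimes> g) \<cdot> Phi_two A x y"
      using Phi_two_nat[OF assms] .
    let ?s = "(x \<otimes> y, True)" and ?t = "(x' \<otimes> y', True)" and ?s' = "(\<Phi> y \<otimes> \<Phi> x, False)" and ?t' = "(\<Phi> y' \<otimes> \<Phi> x', False)"
    have P: "ar ?t' ?t (Phi_two A x' y') \<bullet> ar ?s' ?t' (Phi_ar A g \<boxtimes> Phi_ar A f) = ar ?s ?t (Phi_ar A (f \<boxtimes> g)) \<bullet> ar ?s' ?s (Phi_two A x y)"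
      by (rule ar_sq[OF h]) (use o assms in simp_all)
    note i = ar_inv[of "Phi_two A x y" ?s' ?s] ar_inv[of "Phi_two A x' y'" ?t' ?t]
    have Q: "ar ?t ?t' (inv_arrow A (Phi_two A x' y')) \<bullet> ar ?s ?t (Phi_ar A (f \<boxtimes> g))
      = ar ?s' ?t' (Phi_ar A g \<boxtimes> Phi_ar A f) \<bullet> ar ?s ?s' (inv_arrow A (Phi_two A x y))"
      by (rule conj_inverse[OF P]) (use o assms i in simp_all)
    have N: "mu (y', True) (x', True) \<bullet> ar ?s' ?t' (Phi_ar A g \<boxtimes> Phi_ar A f)
      = (ar (y, True) (y', True) (Phi_ar A g) \<odot> ar (x, True) (x', True) (Phi_ar A f)) \<bullet> mu (y, True) (x, True)"
      using mu_nat[of "(y, True)" "(x, True)" "(y', True)" "(x', True)" "Phi_ar A g" "Phi_ar A f"] o assms by simp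
    show ?thesis using True by (simp add: sm_def ae_def pw_def cm_assoc Q cm_cong[OF N])
  next
    case False
    then show ?thesis using mu_nat[of "(x, False)" "(y, False)" "(x', False)" "(y', False)" f g] o assms
      by (simp add: sm_def ae_def pw_def)
  qed
qed

lemma tt_nat:
  assumes "f \<in> hom A x y"
  shows "tt y e \<bullet> ae (\<Phi> x) (\<Phi> y) (Phi_ar A f) e = ae x y f (\<not> e) \<bullet> tt x e"
proof -
  have o: "x \<in> Ob A" "y \<in> Ob A" using homD(4,5) assms by blast+
  show ?thesis using o assms tinv_nat[OF assms] cmp_ide[OF Phi_hom[OF assms]]
    by (cases e) (simp_all add: tt_def ae_def ar_cm)
qed

text \<open>For the sign \<open>False\<close> this is the axiom \<open>mu_asc\<close>. For
  \<open>True\<close> it combines \<open>mu_asc\<close> at the reversed factors with the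
  compatibility of \<open>Phi_two\<close> with associativity, in which all instances of
  \<open>Phi_two\<close> have to be inverted.\<close>

lemma sm_asc:
  assumes "x \<in> Ob A" "y \<in> Ob A" "z \<in> Ob A"
  shows "pw e (sm x y e) (I [(z, e)]) \<bullet> sm (x \<otimes> y) z e
    = pw e (I [(x, e)]) (sm y z e) \<bullet> sm x (y \<otimes> z) e \<bullet> ae ((x \<otimes> y) \<otimes> z) (x \<otimes> y \<otimes> z) (asc A x y z) e"
proof (cases e)
  case False
  then show ?thesis using mu_asc[of "(x, False)" "(y, False)" "(z, False)"] assms
    by (simp add: sm_def ae_def pw_def)
next
  case True
  let ?X = "(x, True)" and ?Y = "(y, True)" and ?Z = "(z, True)" and ?a = "asc A (\<Phi> z) (\<Phi> y) (\<Phi> x)"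
  let ?yx = "(\<Phi> y \<otimes> \<Phi> x, False)" and ?zy = "(\<Phi> z \<otimes> \<Phi> y, False)" and ?pxy = "(x \<otimes> y, True)" and ?pyz = "(y \<otimes> z, True)"
  let ?z_yx = "(\<Phi> z \<otimes> \<Phi> y \<otimes> \<Phi> x, False)" and ?zy_x = "((\<Phi> z \<otimes> \<Phi> y) \<otimes> \<Phi> x, False)"
  let ?z_p = "(\<Phi> z \<otimes> \<Phi> (x \<otimes> y), False)" and ?p_x = "(\<Phi> (y \<otimes> z) \<otimes> \<Phi> x, False)"
  let ?p1 = "((x \<otimes> y) \<otimes> z, True)" and ?p2 = "(x \<otimes> y \<otimes> z, True)"
  have ia: "inv_arrow A ?a \<in> hom A (\<Phi> z \<otimes> \<Phi> y \<otimes> \<Phi> x) ((\<Phi> z \<otimes> \<Phi> y) \<otimes> \<Phi> x)"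
    using inv_arrow_props(1)[OF asc_hom asc_iso] assms by simp
  have P: "ar ?p1 ?p2 (Phi_ar A (asc A x y z)) \<bullet> ar ?z_p ?p1 (Phi_two A (x \<otimes> y) z) \<bullet> ar ?z_yx ?z_p (ide A (\<Phi> z) \<boxtimes> Phi_two A x y)
    = ar ?p_x ?p2 (Phi_two A x (y \<otimes> z)) \<bullet> ar ?zy_x ?p_x (Phi_two A y z \<boxtimes> ide A (\<Phi> x)) \<bullet> ar ?z_yx ?zy_x (inv_arrow A ?a)"
    by (rule ar_sq3[OF Phi_asc[OF assms]]) (use assms ia in simp_all)
  let ?i1 = "ar ?p1 ?z_p (inv_arrow A (Phi_two A (x \<otimes> y) z))" and ?i2 = "ar ?z_p ?z_yx (ide A (\<Phi> z) \<boxtimes> inv_arrow A (Phi_two A x y))"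
  let ?i3 = "ar ?p2 ?p_x (inv_arrow A (Phi_two A x (y \<otimes> z)))" and ?i4 = "ar ?p_x ?zy_x (inv_arrow A (Phi_two A y z) \<boxtimes> ide A (\<Phi> x))"
  have j1: "ar ?z_p ?p1 (Phi_two A (x \<otimes> y) z) \<bullet> ?i1 = I [?p1]" and j3: "?i3 \<bullet> ar ?p_x ?p2 (Phi_two A x (y \<otimes> z)) = I [?p_x]"
    using ar_inv[of "Phi_two A (x \<otimes> y) z" ?z_p ?p1] ar_inv[of "Phi_two A x (y \<otimes> z)" ?p_x ?p2] assms by simp_all
  have j2: "ar ?z_yx ?z_p (ide A (\<Phi> z) \<boxtimes> Phi_two A x y) \<bullet> ?i2 = I [?z_p]"
    using assms ar_ide[of ?z_p] cmp_ide[OF ide_homs, of "\<Phi> z"]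
      ten_cmp[of "ide A (\<Phi> z)" "\<Phi> z" "\<Phi> z" "ide A (\<Phi> z)" "\<Phi> z" "inv_arrow A (Phi_two A x y)"
        "\<Phi> (x \<otimes> y)" "\<Phi> y \<otimes> \<Phi> x" "Phi_two A x y" "\<Phi> (x \<otimes> y)"] by (simp add: ar_cm ten_ide)
  have j4: "?i4 \<bullet> ar ?zy_x ?p_x (Phi_two A y z \<boxtimes> ide A (\<Phi> x)) = I [?zy_x]"
    using assms ar_ide[of ?zy_x] cmp_ide[OF ide_homs, of "\<Phi> x"]
      ten_cmp[of "Phi_two A y z" "\<Phi> z \<otimes> \<Phi> y" "\<Phi> (y \<otimes> z)" "inv_arrow A (Phi_two A y z)" "\<Phi> z \<otimes> \<Phi> y"
        "ide A (\<Phi> x)" "\<Phi> x" "\<Phi> x" "ide A (\<Phi> x)" "\<Phi> x"] by (simp add: ar_cm ten_ide)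
  \<comment> \<open>Both sides of \<open>P\<close> are surrounded by the inverses of the instances
    of \<open>Phi_two\<close>; on each side a different pair cancels, and the results are the two
    sides of \<open>Q\<close>.\<close>
  have "?i4 \<bullet> ?i3 \<bullet> (ar ?p1 ?p2 (Phi_ar A (asc A x y z)) \<bullet> ar ?z_p ?p1 (Phi_two A (x \<otimes> y) z) \<bullet> ar ?z_yx ?z_p (ide A (\<Phi> z) \<boxtimes> Phi_two A x y)) \<bullet> ?i2 \<bullet> ?i1
    = ?i4 \<bullet> ?i3 \<bullet> ar ?p1 ?p2 (Phi_ar A (asc A x y z))"
    using assms j1 cm_cong[OF j2] by (simp add: cm_assoc)
  moreover have "?i4 \<bullet> ?i3 \<bullet> (ar ?p_x ?p2 (Phi_two A x (y \<otimes> z)) \<bullet> ar ?zy_x ?p_x (Phi_two A y z \<boxtimes> ide A (\<Phi> x)) \<bullet> ar ?z_yx ?zy_x (inv_arrow A ?a)) \<bullet> ?i2 \<bullet> ?i1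
    = ar ?z_yx ?zy_x (inv_arrow A ?a) \<bullet> ?i2 \<bullet> ?i1"
    using assms cm_cong[OF j3] cm_cong[OF j4] ia by (simp add: cm_assoc)
  ultimately have Q: "ar ?z_yx ?zy_x (inv_arrow A ?a) \<bullet> ?i2 \<bullet> ?i1 = ?i4 \<bullet> ?i3 \<bullet> ar ?p1 ?p2 (Phi_ar A (asc A x y z))"
    unfolding P by simp
  have n1: "(I [?Z] \<odot> ar ?pxy ?yx (inv_arrow A (Phi_two A x y))) \<bullet> mu ?Z ?pxy = mu ?Z ?yx \<bullet> ?i2"
    and n2: "(ar ?pyz ?zy (inv_arrow A (Phi_two A y z)) \<odot> I [?X]) \<bullet> mu ?pyz ?X = mu ?zy ?X \<bullet> ?i4"
    using mu_natR[of ?Z ?pxy ?yx "inv_arrow A (Phi_two A x y)"] mu_natL[of ?pyz ?X ?zy "inv_arrow A (Phi_two A y z)"] assms by simp_all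
  have a: "(I [?Z] \<odot> mu ?Y ?X) \<bullet> mu ?Z ?yx = (mu ?Z ?Y \<odot> I [?X]) \<bullet> mu ?zy ?X \<bullet> ar ?z_yx ?zy_x (inv_arrow A ?a)"
    using mu_asc_inv[of ?Z ?Y ?X] assms by simp
  have "pw e (sm x y e) (I [(z, e)]) \<bullet> sm (x \<otimes> y) z e = (I [?Z] \<odot> mu ?Y ?X) \<bullet> (I [?Z] \<odot> ar ?pxy ?yx (inv_arrow A (Phi_two A x y))) \<bullet> mu ?Z ?pxy \<bullet> ?i1"
    using assms True by (simp add: sm_def pw_def whisker_left cm_assoc)
  also have "\<dots> = (mu ?Z ?Y \<odot> I [?X]) \<bullet> mu ?zy ?X \<bullet> ?i4 \<bullet> ?i3 \<bullet> ar ?p1 ?p2 (Phi_ar A (asc A x y z))"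
    by (simp only: cm_cong[OF n1] cm_cong[OF a] cm_assoc Q)
  also have "\<dots> = pw e (I [(x, e)]) (sm y z e) \<bullet> sm x (y \<otimes> z) e \<bullet> ae ((x \<otimes> y) \<otimes> z) (x \<otimes> y \<otimes> z) (asc A x y z) e"
    using assms True cm_cong[OF n2] by (simp add: sm_def pw_def ae_def whisker_right cm_assoc)
  finally show ?thesis .
qed

lemma sm_unit:
  assumes x: "x \<in> Ob A"
  shows "pw e (su e) (I [(x, e)]) \<bullet> sm \<one> x e = ae (\<one> \<otimes> x) x (lun A x) e"
    "pw e (I [(x, e)]) (su e) \<bullet> sm x \<one> e = ae (x \<otimes> \<one>) x (run A x) e"
proof -
  let ?X = "(x, True)" and ?o = "(\<one>, True)" and ?u = "(\<one>, False)"
  have L: "ar (\<one> \<otimes> x, True) ?X (Phi_ar A (lun A x)) \<bullet> ar (\<Phi> x \<otimes> \<Phi> \<one>, False) (\<one> \<otimes> x, True) (Phi_two A \<one> x)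
     = ar (\<Phi> x \<otimes> \<one>, False) ?X (run A (\<Phi> x)) \<bullet> ar (\<Phi> x \<otimes> \<Phi> \<one>, False) (\<Phi> x \<otimes> \<one>, False) (ide A (\<Phi> x) \<boxtimes> Phi_zero A)"
    by (rule ar_sq[OF Phi_lun[OF x]]) (use x in simp_all)
  have R: "ar (x \<otimes> \<one>, True) ?X (Phi_ar A (run A x)) \<bullet> ar (\<Phi> \<one> \<otimes> \<Phi> x, False) (x \<otimes> \<one>, True) (Phi_two A x \<one>)
     = ar (\<one> \<otimes> \<Phi> x, False) ?X (lun A (\<Phi> x)) \<bullet> ar (\<Phi> \<one> \<otimes> \<Phi> x, False) (\<one> \<otimes> \<Phi> x, False) (Phi_zero A \<boxtimes> ide A (\<Phi> x))"
    by (rule ar_sq[OF Phi_run[OF x]]) (use x in simp_all)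
  let ?iL = "ar (\<one> \<otimes> x, True) (\<Phi> x \<otimes> \<Phi> \<one>, False) (inv_arrow A (Phi_two A \<one> x))"
  let ?iR = "ar (x \<otimes> \<one>, True) (\<Phi> \<one> \<otimes> \<Phi> x, False) (inv_arrow A (Phi_two A x \<one>))"
  have i: "ar (\<Phi> x \<otimes> \<Phi> \<one>, False) (\<one> \<otimes> x, True) (Phi_two A \<one> x) \<bullet> ?iL = I [(\<one> \<otimes> x, True)]"
    "ar (\<Phi> \<one> \<otimes> \<Phi> x, False) (x \<otimes> \<one>, True) (Phi_two A x \<one>) \<bullet> ?iR = I [(x \<otimes> \<one>, True)]"
    using ar_inv(2)[of "Phi_two A \<one> x" "(\<Phi> x \<otimes> \<Phi> \<one>, False)" "(\<one> \<otimes> x, True)"]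
      ar_inv(2)[of "Phi_two A x \<one>" "(\<Phi> \<one> \<otimes> \<Phi> x, False)" "(x \<otimes> \<one>, True)"] x by simp_all
  have nL: "(I [?X] \<odot> ar ?o ?u (Phi_zero A)) \<bullet> mu ?X ?o = mu ?X ?u \<bullet> ar (\<Phi> x \<otimes> \<Phi> \<one>, False) (\<Phi> x \<otimes> \<one>, False) (ide A (\<Phi> x) \<boxtimes> Phi_zero A)"
    using mu_natR[of ?X ?o ?u "Phi_zero A"] x by simp
  have nR: "(ar ?o ?u (Phi_zero A) \<odot> I [?X]) \<bullet> mu ?o ?X = mu ?u ?X \<bullet> ar (\<Phi> \<one> \<otimes> \<Phi> x, False) (\<one> \<otimes> \<Phi> x, False) (Phi_zero A \<boxtimes> ide A (\<Phi> x))"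
    using mu_natL[of ?o ?X ?u "Phi_zero A"] x by simp
  have uL: "(I [?X] \<odot> un) \<bullet> mu ?X ?u = ar (\<Phi> x \<otimes> \<one>, False) ?X (run A (\<Phi> x))"
    and uR: "(un \<odot> I [?X]) \<bullet> mu ?u ?X = ar (\<one> \<otimes> \<Phi> x, False) ?X (lun A (\<Phi> x))"
    using un_run[of ?X] un_lun[of ?X] x by simp_all
  have A: "(I [?X] \<odot> (un \<bullet> ar ?o ?u (Phi_zero A))) \<bullet> mu ?X ?o \<bullet> ?iL = ar (\<one> \<otimes> x, True) ?X (Phi_ar A (lun A x))"
  proof -
    have "(I [?X] \<odot> (un \<bullet> ar ?o ?u (Phi_zero A))) \<bullet> mu ?X ?o \<bullet> ?iL
      = (I [?X] \<odot> un) \<bullet> (I [?X] \<odot> ar ?o ?u (Phi_zero A)) \<bullet> mu ?X ?o \<bullet> ?iL" using x by (simp add: whisker_left cm_assoc)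
    also have "\<dots> = ar (\<one> \<otimes> x, True) ?X (Phi_ar A (lun A x)) \<bullet> ar (\<Phi> x \<otimes> \<Phi> \<one>, False) (\<one> \<otimes> x, True) (Phi_two A \<one> x) \<bullet> ?iL"
      by (simp only: cm_cong[OF nL] cm_cong[OF uL] cm_cong[OF L[symmetric]] cm_assoc)
    finally show ?thesis using i x by simp
  qed
  have B: "((un \<bullet> ar ?o ?u (Phi_zero A)) \<odot> I [?X]) \<bullet> mu ?o ?X \<bullet> ?iR = ar (x \<otimes> \<one>, True) ?X (Phi_ar A (run A x))"
  proof -
    have "((un \<bullet> ar ?o ?u (Phi_zero A)) \<odot> I [?X]) \<bullet> mu ?o ?X \<bullet> ?iR
      = (un \<odot> I [?X]) \<bullet> (ar ?o ?u (Phi_zero A) \<odot> I [?X]) \<bullet> mu ?o ?X \<bullet> ?iR" using x by (simp add: whisker_right cm_assoc)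
    also have "\<dots> = ar (x \<otimes> \<one>, True) ?X (Phi_ar A (run A x)) \<bullet> ar (\<Phi> \<one> \<otimes> \<Phi> x, False) (x \<otimes> \<one>, True) (Phi_two A x \<one>) \<bullet> ?iR"
      by (simp only: cm_cong[OF nR] cm_cong[OF uR] cm_cong[OF R[symmetric]] cm_assoc)
    finally show ?thesis using i x by simp
  qed
  show "pw e (su e) (I [(x, e)]) \<bullet> sm \<one> x e = ae (\<one> \<otimes> x) x (lun A x) e"
    using A un_lun[of "(x, False)"] x by (cases e) (simp_all add: sm_def su_def pw_def ae_def cm_assoc)
  show "pw e (I [(x, e)]) (su e) \<bullet> sm x \<one> e = ae (x \<otimes> \<one>) x (run A x) e"
    using B un_run[of "(x, False)"] x by (cases e) (simp_all add: sm_def su_def pw_def ae_def cm_assoc)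
qed

text \<open>For the sign \<open>False\<close> the inverse of \<open>Phi_two\<close> contained in
  \<open>sm\<close> cancels the given one. For \<open>True\<close> this is the monoidality of
  \<open>t\<close>.\<close>

lemma sm_Phi_two:
  assumes "x \<in> Ob A" "y \<in> Ob A"
  shows "sm x y (\<not> e) \<bullet> tt (x \<otimes> y) e \<bullet> ae (\<Phi> y \<otimes> \<Phi> x) (\<Phi> (x \<otimes> y)) (Phi_two A x y) e
     = pw e (tt y e) (tt x e) \<bullet> sm (\<Phi> y) (\<Phi> x) e"
proof (cases e)
  case False
  have "ar (x \<otimes> y, True) (\<Phi> y \<otimes> \<Phi> x, False) (inv_arrow A (Phi_two A x y)) \<bullet> ar (\<Phi> (x \<otimes> y), False) (x \<otimes> y, True) (ide A (\<Phi> (x \<otimes> y)))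
     \<bullet> ar (\<Phi> y \<otimes> \<Phi> x, False) (\<Phi> (x \<otimes> y), False) (Phi_two A x y) = I [(\<Phi> y \<otimes> \<Phi> x, False)]"
    using assms ar_ide[of "(\<Phi> y \<otimes> \<Phi> x, False)"] cmp_ide[OF Phi_two_hom[OF assms]] by (simp add: ar_cm)
  moreover have "(ar (\<Phi> y, False) (y, True) (ide A (\<Phi> y)) \<odot> ar (\<Phi> x, False) (x, True) (ide A (\<Phi> x))) \<bullet> mu (\<Phi> y, False) (\<Phi> x, False) = mu (y, True) (x, True)"
    using assms mu_nat[of "(\<Phi> y, False)" "(\<Phi> x, False)" "(y, True)" "(x, True)" "ide A (\<Phi> y)" "ide A (\<Phi> x)"] ar_ide[of "(\<Phi> y \<otimes> \<Phi> x, False)"]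
    by (simp add: ten_ide)
  ultimately show ?thesis using False assms by (simp add: sm_def tt_def ae_def pw_def cm_assoc)
next
  case True
  let ?P = "Phi_two A (\<Phi> y) (\<Phi> x)" and ?xx = "(\<Phi> (\<Phi> x) \<otimes> \<Phi> (\<Phi> y), False)" and ?yx = "(\<Phi> y \<otimes> \<Phi> x, True)"
  have "tinv A (x \<otimes> y) \<cdot> Phi_ar A (Phi_two A x y) \<cdot> ?P = ide A (x \<otimes> y) \<cdot> (tinv A x \<boxtimes> tinv A y)"
    using tinv_ten[OF assms] .
  also have "\<dots> = tinv A x \<boxtimes> tinv A y" using cmp_ide[OF ten_hom[OF tinv_hom tinv_hom]] assms by blast
  finally have e: "tinv A (x \<otimes> y) \<cdot> Phi_ar A (Phi_two A x y) \<cdot> ?P = tinv A x \<boxtimes> tinv A y" .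
  have h: "Phi_ar A (Phi_two A x y) \<cdot> ?P \<in> hom A (\<Phi> (\<Phi> x) \<otimes> \<Phi> (\<Phi> y)) (\<Phi> (\<Phi> (x \<otimes> y)))"
    by (rule cmp_hom[OF Phi_two_hom Phi_hom[OF Phi_two_hom]]) (use assms in simp_all)
  have E: "ar (\<Phi> (x \<otimes> y), True) (x \<otimes> y, False) (tinv A (x \<otimes> y)) \<bullet> ar ?yx (\<Phi> (x \<otimes> y), True) (Phi_ar A (Phi_two A x y)) \<bullet> ar ?xx ?yx ?P
    = ar ?xx (x \<otimes> y, False) (tinv A x \<boxtimes> tinv A y)"
    using assms e h by (simp add: ar_cm)
  have i: "ar ?xx ?yx ?P \<bullet> ar ?yx ?xx (inv_arrow A ?P) = I [?yx]"
    using ar_inv(2)[of ?P ?xx ?yx] assms by simp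
  have E': "ar (\<Phi> (x \<otimes> y), True) (x \<otimes> y, False) (tinv A (x \<otimes> y)) \<bullet> ar ?yx (\<Phi> (x \<otimes> y), True) (Phi_ar A (Phi_two A x y))
    = ar ?xx (x \<otimes> y, False) (tinv A x \<boxtimes> tinv A y) \<bullet> ar ?yx ?xx (inv_arrow A ?P)"
    using arg_cong[OF E, of "\<lambda>h. h \<bullet> ar ?yx ?xx (inv_arrow A ?P)"] i assms by (simp add: cm_assoc)
  have n: "mu (x, False) (y, False) \<bullet> ar ?xx (x \<otimes> y, False) (tinv A x \<boxtimes> tinv A y)
    = (ar (\<Phi> x, True) (x, False) (tinv A x) \<odot> ar (\<Phi> y, True) (y, False) (tinv A y)) \<bullet> mu (\<Phi> x, True) (\<Phi> y, True)"
    using mu_nat[of "(\<Phi> x, True)" "(\<Phi> y, True)" "(x, False)" "(y, False)" "tinv A x" "tinv A y"] assms by simp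
  show ?thesis using True assms E' cm_cong[OF n] by (simp add: sm_def tt_def ae_def pw_def cm_assoc)
qed

lemma su_Phi_zero: "su e \<bullet> ae (\<Phi> \<one>) \<one> (Phi_zero A) e = su (\<not> e) \<bullet> tt \<one> e"
proof (cases e)
  case True
  have "tinv A \<one> = Phi_zero A \<cdot> Phi_ar A (Phi_zero A)" using tinv_unit cmp_ide[OF tinv_hom[OF unit_Ob]] by simp
  then show ?thesis using True by (simp add: su_def tt_def ae_def cm_assoc ar_cm)
next
  case False
  then show ?thesis using cmp_ide[OF Phi_zero_hom] by (simp add: su_def tt_def ae_def cm_assoc ar_cm)
qed

text \<open>For the sign \<open>True\<close> the left side applies \<Phi> to \<open>t\<close>, while
  the right side takes \<open>t\<close> at \<open>\<Phi> x\<close>, so the equation is the axiom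
  \<open>Phi_t\<close>.\<close>

lemma tt_tinv:
  assumes "x \<in> Ob A"
  shows "ae (\<Phi> (\<Phi> x)) x (tinv A x) e = tt x (\<not> e) \<bullet> tt (\<Phi> x) e"
  using assms cmp_ide[OF tinv_hom[OF assms]] cmp_ide[OF tinv_hom[of "\<Phi> x"]] Phi_t[OF assms]
  by (cases e) (simp_all add: tt_def ae_def ar_cm)

text \<open>Under the sign \<open>True\<close> the strand of \<open>y\<close> comes first, and the
  equation says that \<Phi> is braided, with the instances of \<open>Phi_two\<close>
  inverted.\<close>

lemma sm_sigma:
  assumes bs "x \<in> Ob A" "y \<in> Ob A"
  shows "pl e [(x, e)] [(y, e)] = [c, d] \<Longrightarrow> sgm c d \<bullet> sm x y e = sm y x e \<bullet> ae (x \<otimes> y) (y \<otimes> x) (\<sigma> x y) e"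
proof (cases e)
  case False
  assume "pl e [(x, e)] [(y, e)] = [c, d]"
  then have c: "c = (x, False)" "d = (y, False)" using False by (auto simp: pl_def)
  then show ?thesis using False assms by (simp add: sm_def ae_def)
next
  case True
  assume "pl e [(x, e)] [(y, e)] = [c, d]"
  then have c: "c = (y, True)" "d = (x, True)" using True by (auto simp: pl_def)
  let ?p = "(x \<otimes> y, True)" and ?q = "(y \<otimes> x, True)" and ?p' = "(\<Phi> y \<otimes> \<Phi> x, False)" and ?q' = "(\<Phi> x \<otimes> \<Phi> y, False)"
  have b: "Phi_ar A (\<sigma> x y) \<cdot> Phi_two A x y = Phi_two A y x \<cdot> \<sigma> (\<Phi> y) (\<Phi> x)"
    using sigma[OF assms(1)] assms unfolding braiding_def by blast
  have P: "ar ?q' ?q (Phi_two A y x) \<bullet> ar ?p' ?q' (\<sigma> (\<Phi> y) (\<Phi> x)) = ar ?p ?q (Phi_ar A (\<sigma> x y)) \<bullet> ar ?p' ?p (Phi_two A x y)"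
    by (rule ar_sq[OF b[symmetric]]) (use assms in simp_all)
  have "ar ?q ?q' (inv_arrow A (Phi_two A y x)) \<bullet> ar ?p ?q (Phi_ar A (\<sigma> x y)) = ar ?p' ?q' (\<sigma> (\<Phi> y) (\<Phi> x)) \<bullet> ar ?p ?p' (inv_arrow A (Phi_two A x y))"
    by (rule conj_inverse[OF P]) (use assms ar_inv[of "Phi_two A x y" ?p' ?p] ar_inv[of "Phi_two A y x" ?q' ?q] in simp_all)
  then show ?thesis using True assms c cm_cong[OF sgm_simps(9)[OF assms(1), of c d]]
    by (simp add: sm_def ae_def cm_assoc)
qed

end

section \<open>Naturality and duality of the resolving arrows\<close>

context strict_pair begin

declare S.X.simps [simp del]

lemma unit_faithful_left:
  assumes "I [(\<one>, False)] \<odot> f = I [(\<one>, False)] \<odot> g" "arr f" "arr g" "src f = src g" "tgt f = tgt g"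
  shows "f = g"
proof -
  have r: "h = (un \<odot> I (tgt h)) \<bullet> (I [(\<one>, False)] \<odot> h) \<bullet> (uni \<odot> I (src h))" if "arr h" for h
    using that by (simp add: interchange)
  show ?thesis using r[OF assms(2)] r[OF assms(3)] assms by simp
qed

lemma right_cancel:
  assumes "f \<bullet> m = g \<bullet> m" "m \<bullet> k = I (tgt m)" "arr m" "arr k" "src m = tgt k" "arr f" "arr g" "src f = tgt m" "src g = tgt m"
  shows "f = g"
proof -
  have "(f \<bullet> m) \<bullet> k = (g \<bullet> m) \<bullet> k" using assms(1) by simp
  then show ?thesis using assms(2-) by (simp add: cm_assoc)
qed

lemma left_cancel:
  assumes "m \<bullet> f = m \<bullet> g" "k \<bullet> m = I (src m)" "arr m" "arr k" "src k = tgt m" "arr f" "arr g" "tgt f = src m" "tgt g = src m"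
  shows "f = g"
proof -
  have "(k \<bullet> m) \<bullet> f = (k \<bullet> m) \<bullet> g" using assms(1) by (simp add: cm_assoc)
  then show ?thesis using assms(2-) by simp
qed

context assumes bs: bs begin

lemmas fsimps [simp] = sgm_simps[OF bs] S.X_simps[OF bs] S.X_nil[OF bs] S.X_single[OF bs] S.kp_simps[OF bs]

lemma natural_ar: "\<lbrakk>okc c; okc d; f \<in> hom A (ob c) (ob d)\<rbrakk> \<Longrightarrow> S.natural (ar c d f)"
  by (intro S.ntI[OF bs]) (simp_all add: sgm_natL[OF bs] sgm_natR[OF bs])

lemma natural_mu:
  assumes "okc c" "okc d"
  shows "S.natural (mu c d)"
proof -
  have "S.X [c, d] [y] = (sgm c y \<odot> I [d]) \<bullet> (I [c] \<odot> sgm d y)" "S.X [y] [c, d] = (I [c] \<odot> sgm y d) \<bullet> (sgm y c \<odot> I [d])"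
    if "okc y" for y
    using S.X_app1[OF bs, of "[c]" "[d]" "[y]"] S.X_app2[OF bs, of "[y]" "[c]" "[d]"] assms that by simp_all
  then show ?thesis
    using hexL[OF bs assms] hexR[OF bs _ assms] assms by (intro S.ntI[OF bs]) (simp_all add: cm_assoc)
qed

text \<open>A braiding respects units by the hexagon for the product
  \<open>\<one> \<otimes> \<one>\<close>. Together with naturality at a unit isomorphism it gives
  the claim whiskered with a unit strand and composed with invertible arrows, which are
  cancelled.\<close>

lemma sgm_un:
  assumes z: "okc z"
  shows "un \<odot> I [z] = (I [z] \<odot> un) \<bullet> sgm (\<one>, False) z" "I [z] \<odot> un = (un \<odot> I [z]) \<bullet> sgm z (\<one>, False)"
proof -
  let ?o = "(\<one>, False)" and ?oo = "(\<one> \<otimes> \<one>, False)"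
  have l: "(un \<odot> I [?o]) \<bullet> mu ?o ?o = ar ?oo ?o (lun A \<one>)" and r: "(I [?o] \<odot> un) \<bullet> mu ?o ?o = ar ?oo ?o (run A \<one>)"
    using un_lun[of ?o] un_run[of ?o] by simp_all
  have nl: "sgm ?o z \<bullet> (ar ?oo ?o (lun A \<one>) \<odot> I [z]) = (I [z] \<odot> ar ?oo ?o (lun A \<one>)) \<bullet> sgm ?oo z"
    using sgm_natL[OF bs, of ?oo z ?o "lun A \<one>"] z by simp
  have nr: "sgm z ?o \<bullet> (I [z] \<odot> ar ?oo ?o (run A \<one>)) = (ar ?oo ?o (run A \<one>) \<odot> I [z]) \<bullet> sgm z ?oo"
    using sgm_natR[OF bs, of z ?oo ?o "run A \<one>"] z by simp
  have hl: "(sgm ?o z \<odot> I [?o]) \<bullet> (I [?o] \<odot> sgm ?o z) \<bullet> (mu ?o ?o \<odot> I [z]) = (I [z] \<odot> mu ?o ?o) \<bullet> sgm ?oo z"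
    and hr: "(I [?o] \<odot> sgm z ?o) \<bullet> (sgm z ?o \<odot> I [?o]) \<bullet> (I [z] \<odot> mu ?o ?o) = (mu ?o ?o \<odot> I [z]) \<bullet> sgm z ?oo"
    using hexL[OF bs, of ?o ?o z] hexR[OF bs, of z ?o ?o] z by simp_all
  show "un \<odot> I [z] = (I [z] \<odot> un) \<bullet> sgm ?o z"
  proof (rule unit_faithful)
    have s: "(un \<odot> I [z, ?o]) \<bullet> (I [?o] \<odot> sgm ?o z) = sgm ?o z \<bullet> (un \<odot> I [?o, z])"
      using slide0(1)[of un "sgm ?o z" "[?o]" "[]" "[?o, z]" "[z, ?o]"] z by simp
    have "((un \<odot> I [z, ?o]) \<bullet> (I [?o] \<odot> sgm ?o z)) \<bullet> (mu ?o ?o \<odot> I [z]) = sgm ?o z \<bullet> (((un \<odot> I [?o]) \<bullet> mu ?o ?o) \<odot> I [z])"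
      unfolding s using z by (simp add: strict_simps)
    also have "\<dots> = (I [z] \<odot> un \<odot> I [?o]) \<bullet> (I [z] \<odot> mu ?o ?o) \<bullet> sgm ?oo z"
      unfolding l nl unfolding l[symmetric] using z by (simp add: strict_simps)
    also have "\<dots> = (((I [z] \<odot> un \<odot> I [?o]) \<bullet> (sgm ?o z \<odot> I [?o])) \<bullet> (I [?o] \<odot> sgm ?o z)) \<bullet> (mu ?o ?o \<odot> I [z])"
      unfolding hl[symmetric] by (simp only: cm_assoc)
    finally have "(un \<odot> I [z, ?o]) \<bullet> (I [?o] \<odot> sgm ?o z) = ((I [z] \<odot> un \<odot> I [?o]) \<bullet> (sgm ?o z \<odot> I [?o])) \<bullet> (I [?o] \<odot> sgm ?o z)"
      by (rule right_cancel[of _ _ _ "mui ?o ?o \<odot> I [z]"]) (use z in \<open>simp_all add: interchange hz_I\<close>)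
    then have "un \<odot> I [z, ?o] = (I [z] \<odot> un \<odot> I [?o]) \<bullet> (sgm ?o z \<odot> I [?o])"
      by (rule right_cancel[of _ _ _ "I [?o] \<odot> sgmi z ?o"]) (use z in \<open>simp_all add: interchange hz_I\<close>)
    then show "(un \<odot> I [z]) \<odot> I [?o] = ((I [z] \<odot> un) \<bullet> sgm ?o z) \<odot> I [?o]" using z by (simp add: strict_simps)
  qed (use z in simp_all)
  show "I [z] \<odot> un = (un \<odot> I [z]) \<bullet> sgm z ?o"
  proof (rule unit_faithful_left)
    have s: "(I [?o, z] \<odot> un) \<bullet> (sgm z ?o \<odot> I [?o]) = sgm z ?o \<bullet> (I [z, ?o] \<odot> un)"
      using slide0(1)[of "sgm z ?o" un "[z, ?o]" "[?o, z]" "[?o]" "[]"] z by simp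
    have "((I [?o, z] \<odot> un) \<bullet> (sgm z ?o \<odot> I [?o])) \<bullet> (I [z] \<odot> mu ?o ?o) = sgm z ?o \<bullet> (I [z] \<odot> ((I [?o] \<odot> un) \<bullet> mu ?o ?o))"
      unfolding s using z by (simp add: strict_simps)
    also have "\<dots> = (I [?o] \<odot> un \<odot> I [z]) \<bullet> (mu ?o ?o \<odot> I [z]) \<bullet> sgm z ?oo"
      unfolding r nr unfolding r[symmetric] using z by (simp add: strict_simps)
    also have "\<dots> = (((I [?o] \<odot> un \<odot> I [z]) \<bullet> (I [?o] \<odot> sgm z ?o)) \<bullet> (sgm z ?o \<odot> I [?o])) \<bullet> (I [z] \<odot> mu ?o ?o)"
      unfolding hr[symmetric] by (simp only: cm_assoc)
    finally have "(I [?o, z] \<odot> un) \<bullet> (sgm z ?o \<odot> I [?o]) = ((I [?o] \<odot> un \<odot> I [z]) \<bullet> (I [?o] \<odot> sgm z ?o)) \<bullet> (sgm z ?o \<odot> I [?o])"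
      by (rule right_cancel[of _ _ _ "I [z] \<odot> mui ?o ?o"]) (use z in \<open>simp_all add: interchange hz_I\<close>)
    then have "I [?o, z] \<odot> un = (I [?o] \<odot> un \<odot> I [z]) \<bullet> (I [?o] \<odot> sgm z ?o)"
      by (rule right_cancel[of _ _ _ "sgmi ?o z \<odot> I [?o]"]) (use z in \<open>simp_all add: interchange hz_I\<close>)
    then show "I [?o] \<odot> I [z] \<odot> un = I [?o] \<odot> ((un \<odot> I [z]) \<bullet> sgm z ?o)" using z by (simp add: strict_simps)
  qed (use z in simp_all)
qed

lemma natural_un: "S.natural un"
proof (rule S.ntI[OF bs])
  fix y :: "'o \<times> bool" assume y: "okc y"
  have n: "S.X [] [y] = I [y]" by (simp add: S.X.simps)
  show "S.X (tgt un) [y] \<bullet> (un \<odot> I [y]) = (I [y] \<odot> un) \<bullet> S.X (src un) [y]"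
    using sgm_un(1)[OF y] y n by simp
  show "S.X [y] (tgt un) \<bullet> (I [y] \<odot> un) = (un \<odot> I [y]) \<bullet> S.X [y] (src un)"
    using sgm_un(2)[OF y] y by simp
qed simp

lemma natural_sm: "\<lbrakk>x \<in> Ob A; y \<in> Ob A\<rbrakk> \<Longrightarrow> S.natural (sm x y e)"
  by (auto simp: sm_def intro!: natural_mu S.natural_cm[OF bs] natural_ar)

lemma natural_su: "S.natural (su e)"
  by (auto simp: su_def intro!: natural_un S.natural_cm[OF bs] natural_ar)

lemma natural_tt: "x \<in> Ob A \<Longrightarrow> S.natural (tt x e)"
  by (auto simp: tt_def intro!: natural_ar)

context assumes bk: bk begin

lemmas gsimps [simp] = S.K_simps[OF bs bk] S.K_single[OF bs bk] S.K_nil[OF bs bk]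

lemma kap_simps [simp]:
  assumes "okc c"
  shows "arr (kap c)" "src (kap c) = [c]" "tgt (kap c) = [stt c]"
  using S.kp_simps(1-3)[OF bs bk assms] by auto

text \<open>BP2 solved for the twist of two strands: \<open>Phi_two\<close> moves to the other side,
  and each of the two twists receives its comparison \<open>kar\<close>.\<close>

lemma K_mu:
  assumes "okc c" "okc d"
  shows "S.K [c, d] \<bullet> mu c d = (ar (\<Phi> (ob d), False) (stt d) (kar d) \<odot> ar (\<Phi> (ob c), False) (stt c) (kar c)) \<bullet>
    mu (\<Phi> (ob d), False) (\<Phi> (ob c), False) \<bullet>
    ar (\<Phi> (ob c \<otimes> ob d), False) (\<Phi> (ob d) \<otimes> \<Phi> (ob c), False) (inv_arrow A (Phi_two A (ob c) (ob d))) \<bullet> kq (ob c \<otimes> ob d, False)"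
proof -
  let ?c = "(\<Phi> (ob c), False)" and ?d = "(\<Phi> (ob d), False)"
  let ?Jc = "ar ?c (stt c) (kar c)" and ?Jd = "ar ?d (stt d) (kar d)"
  let ?p = "(\<Phi> (ob c \<otimes> ob d), False)" and ?q = "(\<Phi> (ob d) \<otimes> \<Phi> (ob c), False)"
  let ?P = "Phi_two A (ob c) (ob d)"
  have k: "kq (ob c \<otimes> ob d, False) = ar ?q ?p ?P \<bullet> mui ?d ?c \<bullet> (kq d \<odot> I [?c]) \<bullet> sgm ?c d \<bullet> (kq c \<odot> I [d]) \<bullet> mu c d"
    using kq_ten[OF bk assms] unfolding sgm_def by simp
  have i: "ar ?p ?q (inv_arrow A ?P) \<bullet> ar ?q ?p ?P = I [?q]"
    using ar_inv(1)[of ?P ?q ?p] assms by simp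
  have m: "mu ?d ?c \<bullet> mui ?d ?c = I [?d, ?c]" using assms by simp
  have R: "mu ?d ?c \<bullet> ar ?p ?q (inv_arrow A ?P) \<bullet> kq (ob c \<otimes> ob d, False) = (kq d \<odot> I [?c]) \<bullet> sgm ?c d \<bullet> (kq c \<odot> I [d]) \<bullet> mu c d"
    unfolding k using assms bk by (simp add: cm_cong[OF i] cm_cong[OF m])
  have n: "sgm (stt c) d \<bullet> (?Jc \<odot> I [d]) = (I [d] \<odot> ?Jc) \<bullet> sgm ?c d"
    using sgm_natL[OF bs, of ?c d "stt c" "kar c"] assms by simp
  have "S.K [c, d] = (kap d \<odot> I [stt c]) \<bullet> sgm (stt c) d \<bullet> (kap c \<odot> I [d])"
    using S.K_app[OF bs bk, of "[d]" "[c]"] assms by simp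
  also have "\<dots> = (kap d \<odot> I [stt c]) \<bullet> sgm (stt c) d \<bullet> (?Jc \<odot> I [d]) \<bullet> (kq c \<odot> I [d])"
    using assms bk by (simp add: kap_def whisker_right)
  also have "\<dots> = (kap d \<odot> I [stt c]) \<bullet> (I [d] \<odot> ?Jc) \<bullet> sgm ?c d \<bullet> (kq c \<odot> I [d])"
    by (simp only: cm_cong[OF n] cm_assoc)
  also have "\<dots> = ((kap d \<odot> I [stt c]) \<bullet> (I [d] \<odot> ?Jc)) \<bullet> sgm ?c d \<bullet> (kq c \<odot> I [d])"
    by (simp only: cm_assoc)
  also have "(kap d \<odot> I [stt c]) \<bullet> (I [d] \<odot> ?Jc) = (?Jd \<odot> ?Jc) \<bullet> (kq d \<odot> I [?c])"
    using assms bk by (simp add: kap_def interchange)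
  finally have "S.K [c, d] \<bullet> mu c d = (?Jd \<odot> ?Jc) \<bullet> (kq d \<odot> I [?c]) \<bullet> sgm ?c d \<bullet> (kq c \<odot> I [d]) \<bullet> mu c d"
    by (simp only: cm_assoc)
  then show ?thesis unfolding R .
qed

text \<open>For the sign \<open>False\<close> this is BP2, with identities as comparisons. For
  \<open>True\<close> the twist is pulled through the inverse of \<open>Phi_two\<close> by
  naturality of \<kappa>, and the comparisons by \<open>t\<close> are combined by its
  monoidality.\<close>

lemma K_sm:
  assumes o: "x \<in> Ob A" "y \<in> Ob A"
  shows "S.K (tgt (sm x y e)) \<bullet> sm x y e = sm x y (\<not> e) \<bullet> kap (x \<otimes> y, e)"
proof (cases e)
  case False
  let ?p = "(\<Phi> (x \<otimes> y), False)" and ?q = "(\<Phi> y \<otimes> \<Phi> x, False)"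
  have m: "(ar (\<Phi> y, False) (y, True) (ide A (\<Phi> y)) \<odot> ar (\<Phi> x, False) (x, True) (ide A (\<Phi> x))) \<bullet> mu (\<Phi> y, False) (\<Phi> x, False) = mu (y, True) (x, True)"
    using o mu_nat[of "(\<Phi> y, False)" "(\<Phi> x, False)" "(y, True)" "(x, True)" "ide A (\<Phi> y)" "ide A (\<Phi> x)"] ar_ide[of ?q]
    by (simp add: ten_ide)
  have s: "ar ?p ?q (inv_arrow A (Phi_two A x y)) = ar (x \<otimes> y, True) ?q (inv_arrow A (Phi_two A x y)) \<bullet> ar ?p (x \<otimes> y, True) (ide A (\<Phi> (x \<otimes> y)))"
    using o cmp_ide[OF inv_Phi_two(1)[OF o]] by (simp add: ar_cm)
  show ?thesis using K_mu[of "(x, False)" "(y, False)"] o False cm_cong[OF m] s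
    by (simp add: sm_def pl_def kap_def kar_def cm_assoc)
next
  case True
  let ?P = "Phi_two A (\<Phi> y) (\<Phi> x)" and ?Q = "Phi_two A x y"
  let ?yx = "(\<Phi> y \<otimes> \<Phi> x, False)" and ?pyx = "(\<Phi> (\<Phi> y \<otimes> \<Phi> x), False)" and ?xx = "(\<Phi> (\<Phi> x) \<otimes> \<Phi> (\<Phi> y), False)"
  let ?xy = "(x \<otimes> y, True)" and ?pxy = "(\<Phi> (\<Phi> (x \<otimes> y)), False)"
  have n: "(ar (\<Phi> (\<Phi> x), False) (x, False) (tinv A x) \<odot> ar (\<Phi> (\<Phi> y), False) (y, False) (tinv A y)) \<bullet> mu (\<Phi> (\<Phi> x), False) (\<Phi> (\<Phi> y), False)
     = mu (x, False) (y, False) \<bullet> ar ?xx (x \<otimes> y, False) (tinv A x \<boxtimes> tinv A y)"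
    using mu_nat[of "(\<Phi> (\<Phi> x), False)" "(\<Phi> (\<Phi> y), False)" "(x, False)" "(y, False)" "tinv A x" "tinv A y"] o by simp
  have q: "kq ?yx \<bullet> ar ?xy ?yx (inv_arrow A ?Q) = ar ?pxy ?pyx (Phi_ar A (inv_arrow A ?Q)) \<bullet> kq ?xy"
    using kq_nat[OF bk, of ?xy ?yx "inv_arrow A ?Q"] o by simp
  have "tinv A (x \<otimes> y) \<cdot> Phi_ar A ?Q \<cdot> ?P = ide A (x \<otimes> y) \<cdot> (tinv A x \<boxtimes> tinv A y)"
    using tinv_ten[OF o] .
  also have "\<dots> = tinv A x \<boxtimes> tinv A y" using cmp_ide[OF ten_hom[OF tinv_hom tinv_hom]] o by blast
  finally have e: "tinv A (x \<otimes> y) \<cdot> Phi_ar A ?Q \<cdot> ?P = tinv A x \<boxtimes> tinv A y" .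
  have h: "Phi_ar A ?Q \<cdot> ?P \<in> hom A (\<Phi> (\<Phi> x) \<otimes> \<Phi> (\<Phi> y)) (\<Phi> (\<Phi> (x \<otimes> y)))"
    by (rule cmp_hom[OF Phi_two_hom Phi_hom[OF Phi_two_hom]]) (use o in simp_all)
  have E: "ar ?pxy (x \<otimes> y, False) (tinv A (x \<otimes> y)) \<bullet> ar ?pyx ?pxy (Phi_ar A ?Q) \<bullet> ar ?xx ?pyx ?P
    = ar ?xx (x \<otimes> y, False) (tinv A x \<boxtimes> tinv A y)"
    using o e h by (simp add: ar_cm)
  have i: "ar ?xx ?pyx ?P \<bullet> ar ?pyx ?xx (inv_arrow A ?P) = I [?pyx]"
    using ar_inv(2)[of ?P ?xx ?pyx] o by simp
  have "Phi_ar A ?Q \<cdot> Phi_ar A (inv_arrow A ?Q) = ide A (\<Phi> (\<Phi> (x \<otimes> y)))"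
    using Phi_cmp[OF inv_Phi_two(1)[OF o] Phi_two_hom[OF o]] o by (simp add: Phi_ide)
  then have j: "ar ?pyx ?pxy (Phi_ar A ?Q) \<bullet> ar ?pxy ?pyx (Phi_ar A (inv_arrow A ?Q)) = I [?pxy]"
    using o ar_ide[of ?pxy] by (simp add: ar_cm)
  have F: "ar ?xx (x \<otimes> y, False) (tinv A x \<boxtimes> tinv A y) \<bullet> ar ?pyx ?xx (inv_arrow A ?P) \<bullet> ar ?pxy ?pyx (Phi_ar A (inv_arrow A ?Q))
    = ar ?pxy (x \<otimes> y, False) (tinv A (x \<otimes> y))"
    unfolding E[symmetric] using o by (simp add: cm_assoc cm_cong[OF i] j)
  have F': "ar ?xx (x \<otimes> y, False) (tinv A x \<boxtimes> tinv A y) \<bullet> ar ?pyx ?xx (inv_arrow A ?P) \<bullet> ar ?pxy ?pyx (Phi_ar A (inv_arrow A ?Q)) \<bullet> g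
    = ar ?pxy (x \<otimes> y, False) (tinv A (x \<otimes> y)) \<bullet> g" for g
    using cm_cong[OF F, of g] by (simp only: cm_assoc)
  have t: "tgt (sm x y True) = [(y, True), (x, True)]" using o by (simp add: pl_def)
  have "S.K [(y, True), (x, True)] \<bullet> sm x y True
    = (S.K [(y, True), (x, True)] \<bullet> mu (y, True) (x, True)) \<bullet> ar ?xy ?yx (inv_arrow A ?Q)"
    by (simp add: sm_def cm_assoc)
  also have "\<dots> = mu (x, False) (y, False) \<bullet> ar ?xx (x \<otimes> y, False) (tinv A x \<boxtimes> tinv A y) \<bullet> ar ?pyx ?xx (inv_arrow A ?P)
     \<bullet> ar ?pxy ?pyx (Phi_ar A (inv_arrow A ?Q)) \<bullet> kq ?xy"
    using K_mu[of "(y, True)" "(x, True)"] o by (simp add: kar_def cm_assoc q cm_cong[OF n])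
  also have "\<dots> = sm x y False \<bullet> kap ?xy" unfolding F' by (simp add: sm_def kap_def kar_def)
  finally show ?thesis using True t by simp
qed

text \<open>Naturality of \<kappa>, at an identity for the sign \<open>False\<close> and at
  \<open>t\<close> for \<open>True\<close>, where \<open>Phi_t\<close> turns \<Phi> of
  \<open>t\<close> into \<open>t\<close> again.\<close>

lemma K_tt:
  assumes x: "x \<in> Ob A"
  shows "kap (x, \<not> e) \<bullet> tt x e = tt x (\<not> e) \<bullet> kap (\<Phi> x, e)"
proof (cases e)
  case False
  have "kq (x, True) \<bullet> ar (\<Phi> x, False) (x, True) (ide A (\<Phi> x)) = ar (\<Phi> (\<Phi> x), False) (\<Phi> (\<Phi> x), False) (ide A (\<Phi> (\<Phi> x))) \<bullet> kq (\<Phi> x, False)"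
    using kq_nat[OF bk, of "(\<Phi> x, False)" "(x, True)" "ide A (\<Phi> x)"] x by (simp add: Phi_ide)
  moreover have "ar (\<Phi> (\<Phi> x), False) (x, False) (tinv A x) = ar (\<Phi> x, True) (x, False) (tinv A x) \<bullet> ar (\<Phi> (\<Phi> x), False) (\<Phi> x, True) (ide A (\<Phi> (\<Phi> x)))"
    using x cmp_ide[OF tinv_hom[OF x]] by (simp add: ar_cm)
  ultimately show ?thesis using False x bk ar_ide[of "(\<Phi> (\<Phi> x), False)"]
    by (simp add: tt_def kap_def kar_def cm_assoc)
next
  case True
  have "kq (x, False) \<bullet> ar (\<Phi> x, True) (x, False) (tinv A x) = ar (\<Phi> (\<Phi> (\<Phi> x)), False) (\<Phi> x, False) (tinv A (\<Phi> x)) \<bullet> kq (\<Phi> x, True)"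
    using kq_nat[OF bk, of "(\<Phi> x, True)" "(x, False)" "tinv A x"] x Phi_t[OF x] by simp
  then show ?thesis using True x bk cm_assoc ar_ide[of "(\<Phi> x, False)"]
    by (simp add: tt_def kap_def kar_def cm_assoc)
qed

text \<open>The triviality of \<kappa> at the unit is a consequence of BP2: naturality at a unit
  isomorphism and BP2 evaluate the twist of \<open>\<one> \<otimes> \<one>\<close> in two ways. One
  twist cancels, and the rest is the claim whiskered with a unit strand.\<close>

lemma K_su: "un \<bullet> ar (\<Phi> \<one>, False) (\<one>, False) (Phi_zero A) \<bullet> kq (\<one>, False) = un"
proof -
  let ?o = "(\<one>, False)" and ?p = "(\<Phi> \<one>, False)" and ?oo = "(\<one> \<otimes> \<one>, False)"
  \<comment> \<open>\<open>u'\<close> removes a strand \<open>\<Phi> \<one>\<close>. It is natural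
    and therefore moves through the crossing that BP2 brings in.\<close>
  define u' where "u' = un \<bullet> ar ?p ?o (Phi_zero A)"
  have u': "arr u'" "src u' = [?p]" "tgt u' = []" by (simp_all add: u'_def)
  have nu: "S.natural u'" unfolding u'_def by (auto intro!: S.natural_cm[OF bs] natural_un natural_ar)
  have U: "(I [?o] \<odot> u') \<bullet> sgm ?p ?o = u' \<odot> I [?o]"
    using S.natural_D(2)[OF bs nu _ u'(2,3), of "[?o]"] u' by (simp add: S.X.simps(1))
  let ?P = "Phi_two A \<one> \<one>" and ?pp = "(\<Phi> \<one> \<otimes> \<Phi> \<one>, False)" and ?q = "(\<Phi> (\<one> \<otimes> \<one>), False)"
  have k: "kq ?oo = ar ?pp ?q ?P \<bullet> mui ?p ?p \<bullet> (kq ?o \<odot> I [?p]) \<bullet> sgm ?p ?o \<bullet> (kq ?o \<odot> I [?o]) \<bullet> mu ?o ?o"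
    using kq_ten[OF bk, of ?o ?o] unfolding sgm_def by simp
  have l: "(un \<odot> I [?o]) \<bullet> mu ?o ?o = ar ?oo ?o (lun A \<one>)" using un_lun[of ?o] by simp
  have n: "kq ?o \<bullet> ar ?oo ?o (lun A \<one>) = ar ?q ?p (Phi_ar A (lun A \<one>)) \<bullet> kq ?oo"
    using kq_nat[OF bk, of ?oo ?o "lun A \<one>"] by simp
  have L: "ar ?q ?p (Phi_ar A (lun A \<one>)) \<bullet> ar ?pp ?q ?P = ar (\<Phi> \<one> \<otimes> \<one>, False) ?p (run A (\<Phi> \<one>)) \<bullet> ar ?pp (\<Phi> \<one> \<otimes> \<one>, False) (ide A (\<Phi> \<one>) \<boxtimes> Phi_zero A)"
    by (rule ar_sq[OF Phi_lun[OF unit_Ob]]) simp_all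
  have r: "(I [?p] \<odot> un) \<bullet> mu ?p ?o = ar (\<Phi> \<one> \<otimes> \<one>, False) ?p (run A (\<Phi> \<one>))" using un_run[of ?p] by simp
  have m: "(I [?p] \<odot> ar ?p ?o (Phi_zero A)) \<bullet> mu ?p ?p = mu ?p ?o \<bullet> ar ?pp (\<Phi> \<one> \<otimes> \<one>, False) (ide A (\<Phi> \<one>) \<boxtimes> Phi_zero A)"
    using mu_natR[of ?p ?p ?o "Phi_zero A"] by simp
  have i: "mu ?p ?p \<bullet> mui ?p ?p = I [?p, ?p]" by simp
  have L': "ar ?q ?p (Phi_ar A (lun A \<one>)) \<bullet> ar ?pp ?q ?P \<bullet> mui ?p ?p = I [?p] \<odot> u'"
  proof -
    have "ar ?q ?p (Phi_ar A (lun A \<one>)) \<bullet> ar ?pp ?q ?P \<bullet> mui ?p ?p = (I [?p] \<odot> un) \<bullet> (I [?p] \<odot> ar ?p ?o (Phi_zero A)) \<bullet> mu ?p ?p \<bullet> mui ?p ?p"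
      by (simp only: cm_cong[OF L] cm_cong[OF m] cm_cong[OF r] cm_assoc)
    then show ?thesis unfolding i by (simp add: u'_def whisker_left)
  qed
  have L'': "ar ?q ?p (Phi_ar A (lun A \<one>)) \<bullet> ar ?pp ?q ?P \<bullet> mui ?p ?p \<bullet> g = (I [?p] \<odot> u') \<bullet> g" for g
    using cm_cong[OF L', of g] by (simp only: cm_assoc)
  have s: "(I [?p] \<odot> u') \<bullet> (kq ?o \<odot> I [?p]) = kq ?o \<bullet> (I [?o] \<odot> u')"
    using slide0(1)[of "kq ?o" u' "[?o]" "[?p]" "[?p]" "[]"] bk u' by simp
  have "(kq ?o \<bullet> (un \<odot> I [?o])) \<bullet> mu ?o ?o = kq ?o \<bullet> ar ?oo ?o (lun A \<one>)" by (simp only: cm_assoc l)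
  also have "\<dots> = (kq ?o \<bullet> (u' \<odot> I [?o]) \<bullet> (kq ?o \<odot> I [?o])) \<bullet> mu ?o ?o"
    by (simp only: n k cm_assoc L'' cm_cong[OF s] cm_cong[OF U])
  finally have "kq ?o \<bullet> (un \<odot> I [?o]) = kq ?o \<bullet> (u' \<odot> I [?o]) \<bullet> (kq ?o \<odot> I [?o])"
    by (rule mu_epi) (use bk u' in simp_all)
  then have "un \<odot> I [?o] = (u' \<odot> I [?o]) \<bullet> (kq ?o \<odot> I [?o])"
    by (rule left_cancel[of _ _ _ "kqi ?o"]) (use bk u' in simp_all)
  then have "un \<odot> I [?o] = (u' \<bullet> kq ?o) \<odot> I [?o]" using bk u' by (simp add: whisker_right)
  then have "un = u' \<bullet> kq ?o" by (rule unit_faithful) (use bk u' in simp_all)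
  then show ?thesis by (simp add: u'_def cm_assoc)
qed

lemma K_su': "su e = su (\<not> e) \<bullet> kap (\<one>, e)"
proof (cases e)
  case False
  have E: "ar (\<one>, True) (\<one>, False) (Phi_zero A) \<bullet> ar (\<Phi> \<one>, False) (\<one>, True) (ide A (\<Phi> \<one>)) = ar (\<Phi> \<one>, False) (\<one>, False) (Phi_zero A)"
    using cmp_ide[OF Phi_zero_hom] by (simp add: ar_cm)
  show ?thesis using False K_su by (simp add: su_def kap_def kar_def cm_assoc cm_cong[OF E])
next
  case True
  have q: "kq (\<one>, False) \<bullet> ar (\<one>, True) (\<one>, False) (Phi_zero A) = ar (\<Phi> (\<Phi> \<one>), False) (\<Phi> \<one>, False) (Phi_ar A (Phi_zero A)) \<bullet> kq (\<one>, True)"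
    using kq_nat[OF bk, of "(\<one>, True)" "(\<one>, False)" "Phi_zero A"] by simp
  have "tinv A \<one> = Phi_zero A \<cdot> Phi_ar A (Phi_zero A)" using tinv_unit cmp_ide[OF tinv_hom[OF unit_Ob]] by simp
  then have t: "ar (\<Phi> \<one>, False) (\<one>, False) (Phi_zero A) \<bullet> ar (\<Phi> (\<Phi> \<one>), False) (\<Phi> \<one>, False) (Phi_ar A (Phi_zero A)) = ar (\<Phi> (\<Phi> \<one>), False) (\<one>, False) (tinv A \<one>)"
    by (simp add: ar_cm)
  have "un \<bullet> ar (\<one>, True) (\<one>, False) (Phi_zero A)
    = (un \<bullet> ar (\<Phi> \<one>, False) (\<one>, False) (Phi_zero A) \<bullet> kq (\<one>, False)) \<bullet> ar (\<one>, True) (\<one>, False) (Phi_zero A)"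
    by (simp only: K_su)
  also have "\<dots> = un \<bullet> ar (\<Phi> (\<Phi> \<one>), False) (\<one>, False) (tinv A \<one>) \<bullet> kq (\<one>, True)"
    by (simp only: cm_assoc q cm_cong[OF t])
  finally show ?thesis using True by (simp add: su_def kap_def kar_def)
qed

end

lemma dual_sm: "\<lbrakk>x \<in> Ob A; y \<in> Ob A\<rbrakk> \<Longrightarrow> S.dual (sm x y e) (sm x y (\<not> e))"
  using K_sm[of x y e] S.K_single[OF bs] by (auto simp: S.dual_def natural_sm pl_def)

lemma dual_su: "S.dual (su e) (su (\<not> e))"
  using K_su'[of e] S.K_single[OF bs] S.K_nil[OF bs] by (auto simp: S.dual_def natural_su)

lemma dual_tt: "x \<in> Ob A \<Longrightarrow> S.dual (tt x e) (tt x (\<not> e))"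
  using K_tt[of x e] S.K_single[OF bs] by (auto simp: S.dual_def natural_tt)

end
end

section \<open>Words of horizontal composites\<close>

definition sign_word :: "bool \<Rightarrow> nat \<Rightarrow> nat word \<Rightarrow> nat word" where
  "sign_word e n w = (if e then flip_word n w else w)"

lemma set_sign_word: "fst ` set w \<subseteq> {1..<n} \<Longrightarrow> fst ` set (sign_word e n w) \<subseteq> {1..<n}"
  using set_flip by (simp add: sign_word_def)

lemma sign_word_simps [simp]: "sign_word e n [] = []" "sign_word e n (u @ v) = sign_word e n u @ sign_word e n v"
  by (simp_all add: sign_word_def)

lemma flip_flip: "fst ` set w \<subseteq> {1..<n} \<Longrightarrow> flip_word n (flip_word n w) = w"
  by (induction w) auto

lemma sign_word_not: "fst ` set w \<subseteq> {1..<n} \<Longrightarrow> sign_word (\<not> e) n w = flip_word n (sign_word e n w)"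
  by (simp add: sign_word_def flip_flip)

context strict_braided begin
context assumes bs: bs begin

lemmas hsimps [simp] = dsimps[OF bs]

text \<open>In a horizontal composite the inner words act side by side, followed by the cabled outer
  word, whose value is \<open>C\<close>. The existential form leaves \<open>C\<close> abstract,
  since in the absence of a braiding an identity plays its part. If \<open>e\<close> holds, the
  composite stands under \<Phi>: the strands are those of \<open>vs0\<close>, reversed and with
  opposite signs, and the whole word is reflected.\<close>

lemma hor:
  fixes sb :: "'v \<Rightarrow> 'a list"
  assumes cab: "cabled V s cb tb fb" and vs0: "set vs0 \<subseteq> V"
    and sb: "\<And>v. v \<in> V \<Longrightarrow> oks (sb v) \<and> length (sb (s v)) = length (sb v) \<and> fst ` set (wt v) \<subseteq> {1..<length (sb v)} \<and>
      wt (s v) = flip_word (length (sb v)) (wt v) \<and> perm st (sgw (wt v)) (sb v) = tb v"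
    and w: "fst ` set w \<subseteq> {1..<n}" and n: "n = length vs0"
    and ps: "ps = map (\<lambda>v. (length (sb v), wt v)) vs0"
    and U: "U = fst (cable (map fst ps) w) @ juxtapose 0 ps"
    and vs: "vs = (if e then rev (map s vs0) else vs0)" and N: "N = length (concat (map sb vs0))"
    and w': "w' = sgw (sign_word e n w)"
  shows "fst ` set U \<subseteq> {1..<N}"
    "perm st (sgw (sign_word e N U)) (concat (map sb vs)) = concat (map tb (perm s w' vs))"
    "\<exists>C. T C (concat (map tb vs)) (concat (map tb (perm s w' vs))) \<and>
       bw (concat (map sb vs)) (sgw (sign_word e N U)) = C \<bullet> hl (\<lambda>v. bw (sb v) (sgw (wt v))) vs \<and>
       C \<bullet> hl fb vs = hl fb (perm s w' vs) \<bullet> bw (map cb vs) w'"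
proof -
  have sV: "\<And>v. v \<in> V \<Longrightarrow> s v \<in> V" using cabledD(1)[OF bs cab] .
  have V: "set vs \<subseteq> V" using vs vs0 sV by (auto split: if_splits)
  have o: "\<And>v. v \<in> V \<Longrightarrow> wfb (length (sb v)) (sgw (wt v))" using sb by (simp add: wfw_sgw)
  have letter: "length (tb v) = length (sb v)" if "v \<in> V" for v using sb[OF that] length_perm[of st "sgw (wt v)" "sb v"] by simp
  have lc: "length (concat (map f us)) = sum_list (map (length \<circ> f) us)" for f :: "'v \<Rightarrow> 'a list" and us
    by (simp add: length_concat comp_def)
  let ?ws = "map (length \<circ> sb) vs0"
  have ws: "map fst ps = ?ws" "sum_list ?ws = N" "length ?ws = n" using ps N n by (simp_all add: length_concat comp_def)
  note cs = cable_set[OF ws(3) w]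
  have c: "fst ` set (fst (cable ?ws w)) \<subseteq> {1..<N}" using cs ws(2) by simp
  have "fst ` set (juxtapose 0 ps) \<subseteq> {1..<0 + sum_list (map fst ps)}"
    by (rule juxtapose_set) (use sb vs0 ps in auto)
  then have j: "fst ` set (juxtapose 0 ps) \<subseteq> {1..<N}" using ws by simp
  show "fst ` set U \<subseteq> {1..<N}" unfolding U set_append image_Un ws(1) using c j by blast
  let ?L = "concat (map sb vs)" and ?M = "concat (map tb vs)" and ?B = "\<lambda>v. bw (sb v) (sgw (wt v))"
  let ?J = "sgw (sign_word e N (juxtapose 0 ps))" and ?C = "sgw (sign_word e N (fst (cable ?ws w)))"
  have nL: "length ?L = N"
  proof -
    have "sum_list (map (length \<circ> sb) (rev (map s vs0))) = sum_list (map (length \<circ> sb \<circ> s) vs0)"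
      by (simp add: rev_map[symmetric] sum_list_rev)
    also have "map (length \<circ> sb \<circ> s) vs0 = ?ws" using sb vs0 by auto
    finally show ?thesis using ws(2) vs by (simp add: length_concat comp_def)
  qed
  have oL: "oks ?L" using V sb by (force simp: list_all_iff)
  have hB: "T (hl ?B vs) ?L ?M"
    using V sb o by (intro T_hl) (auto simp: T_def)
  have oM: "oks ?M" "length ?M = N"
  proof -
    show "oks ?M" using T_okD[OF hB] by simp
    have m: "map (length \<circ> tb) vs = map (length \<circ> sb) vs" using V letter by auto
    show "length ?M = N" using nL m lc[of _ vs] by metis
  qed
  have Jw: "wfb (length ?L) ?J" and Cw: "wfb (length ?L) ?C"
    unfolding wfw_sgw nL using set_sign_word[OF j] set_sign_word[OF c] by auto
  \<comment> \<open>Under \<Phi> the inner words are reversed in order and reflected one by one; the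
    relation between \<open>wt (s v)\<close> and \<open>wt v\<close> turns this into the same
    formula as without \<Phi>.\<close>
  have J: "bw ?L ?J = hl ?B vs"
  proof (cases e)
    case False
    let ?lws = "map (\<lambda>v. (sb v, wt v)) vs0"
    have l: "\<And>l w. (l, w) \<in> set ?lws \<Longrightarrow> oks l \<and> wfb (length l) (sgw w)" using sb o vs0 by auto
    have e: "map (\<lambda>(l, w). (length l, w)) ?lws = ps" "map fst ?lws = map sb vs0" by (simp_all add: ps comp_def)
    have "bw ([] @ concat (map fst ?lws)) (sgw (juxtapose 0 (map (\<lambda>(l, w). (length l, w)) ?lws)))
      = I [] \<odot> hl (\<lambda>(l, w). bw l (sgw w)) ?lws"
      by (rule bw_juxtapose[OF bs, THEN conjunct2, THEN conjunct1, of ?lws "[]" 0]) (use l in auto)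
    then have "bw (concat (map sb vs0)) (sgw (juxtapose 0 ps)) = I [] \<odot> hl ?B vs0"
      unfolding e by (simp add: hl_map)
    then show ?thesis using False hB by (simp add: sign_word_def vs T_def)
  next
    case True
    have l: "\<And>l w. (l, w) \<in> set (map (\<lambda>v. (sb (s v), wt v)) vs0) \<Longrightarrow> oks l \<and> fst ` set w \<subseteq> {1..<length l}"
    proof -
      fix l w assume "(l, w) \<in> set (map (\<lambda>v. (sb (s v), wt v)) vs0)"
      then obtain v where v: "v \<in> V" "l = sb (s v)" "w = wt v" using vs0 by auto
      show "oks l \<and> fst ` set w \<subseteq> {1..<length l}" using sb[OF v(1)] sb[OF sV[OF v(1)]] v by simp
    qed
    have "map (length \<circ> (\<lambda>v. sb (s v))) vs0 = ?ws" using sb vs0 by auto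
    then have "N = length (concat (map (\<lambda>v. sb (s v)) vs0))" using ws(2) lc[of "\<lambda>v. sb (s v)" vs0] by metis
    then have N': "N = length (concat (map fst (map (\<lambda>v. (sb (s v), wt v)) vs0)))" by (simp add: comp_def)
    have ps': "map (\<lambda>(l, w). (length l, w)) (map (\<lambda>v. (sb (s v), wt v)) vs0) = ps"
      using sb vs0 ps by auto
    have L': "concat (map fst (rev (map (\<lambda>v. (sb (s v), wt v)) vs0))) = ?L"
      using True vs by (simp add: rev_map comp_def)
    have "bw ?L ?J = hl (\<lambda>(l, w). bw l (sgw (flip_word (length l) w))) (rev (map (\<lambda>v. (sb (s v), wt v)) vs0))"
      using bw_flip_juxtapose[OF bs l N'] True unfolding ps' L' by (simp add: sign_word_def)
    also have "\<dots> = hl (\<lambda>v. bw (sb (s v)) (sgw (flip_word (length (sb (s v))) (wt v)))) (rev vs0)"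
      by (simp add: rev_map hl_map)
    also have "\<dots> = hl (\<lambda>v. ?B (s v)) (rev vs0)"
      using sb vs0 by (intro hl_cong) auto
    also have "\<dots> = hl ?B vs" using True vs by (simp add: rev_map hl_map)
    finally show ?thesis .
  qed
  have pJ: "perm st ?J ?L = ?M" using bw_simps(3)[OF bs Jw oL] hB unfolding J T_def by simp
  have Cb: "bw ?M ?C \<bullet> hl fb vs = hl fb (perm s w' vs) \<bullet> bw (map cb vs) w' \<and> perm st ?C ?M = concat (map tb (perm s w' vs))"
  proof -
    let ?w = "sign_word e n w" and ?ws' = "map (length \<circ> tb) vs"
    have "fst ` set ?w \<subseteq> {1..<n}" by (rule set_sign_word[OF w])
    moreover have "length vs = n" using n vs by simp
    ultimately have strict_simps: "wfb (length vs) w'" unfolding w' wfw_sgw by simp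
    note cb = cable_bw[OF bs cab V strict_simps, of "[]" 0 ?ws', unfolded w' mcable_0, simplified]
    \<comment> \<open>Reflecting the cabled word has the same value as cabling the reflected word
      along the reversed widths.\<close>
    have E: "bw ?M ?C = bw ?M (sgw (fst (cable ?ws' ?w))) \<and> perm st ?C ?M = perm st (sgw (fst (cable ?ws' ?w))) ?M"
    proof (cases e)
      case False
      have "?ws' = ?ws" using False vs letter vs0 by auto
      then show ?thesis using False by (simp add: sign_word_def)
    next
      case True
      have "map (length \<circ> tb) (map s vs0) = ?ws" using letter sV sb vs0 by auto
      then have r: "?ws' = rev ?ws" using True vs by (simp only: if_True rev_map[symmetric])
      have "length ?M = sum_list ?ws" "N = sum_list ?ws" using oM ws(2) by simp_all
      note bw_flip_cable[OF bs ws(3) w this(1) oM(1) this(2)]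
      then show ?thesis unfolding r sign_word_def using True by (simp only: if_True)
    qed
    have h: "arr (hl fb vs)" "arr (hl fb (perm s w' vs))" "src (hl fb (perm s w' vs)) = map cb (perm s w' vs)"
      "arr (bw (map cb vs) w')" "tgt (bw (map cb vs) w') = map cb (perm s w' vs)"
    proof -
      have p: "set (perm s w' vs) \<subseteq> V" "map cb (perm s w' vs) = perm st w' (map cb vs)"
        using perm_map[OF strict_simps, of V cb s st] cabledD(1,3)[OF bs cab] V by auto
      show "arr (hl fb vs)" "arr (hl fb (perm s w' vs))" "src (hl fb (perm s w' vs)) = map cb (perm s w' vs)"
        using cabled_hl[OF bs cab V] cabled_hl[OF bs cab p(1)] by auto
      show "arr (bw (map cb vs) w')" "tgt (bw (map cb vs) w') = map cb (perm s w' vs)"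
        using cabled_hl[OF bs cab V] strict_simps p(2) by auto
    qed
    show ?thesis using cb E h by (simp add: w')
  qed
  show pU: "perm st (sgw (sign_word e N U)) ?L = concat (map tb (perm s w' vs))"
    using pJ Cb by (simp add: U ws(1))
  have "bw ?L (sgw (sign_word e N U)) = bw ?M ?C \<bullet> hl ?B vs"
    using bw_append[OF bs Jw Cw oL] pJ J by (simp add: U ws(1))
  moreover have "wfb (length ?M) ?C" using Cw nL oM by simp
  then have "T (bw ?M ?C) ?M (concat (map tb (perm s w' vs)))" using Cb oM by (simp add: T_def)
  ultimately show "\<exists>C. T C ?M (concat (map tb (perm s w' vs))) \<and> bw ?L (sgw (sign_word e N U)) = C \<bullet> hl ?B vs \<and>
       C \<bullet> hl fb vs = hl fb (perm s w' vs) \<bullet> bw (map cb vs) w'"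
    using Cb by blast
qed

end
end

section \<open>Signed strands of a term\<close>

definition flip_sign :: "nat \<times> bool \<Rightarrow> nat \<times> bool" where "flip_sign v = (fst v, \<not> snd v)"

lemma flip_sign_simps [simp]: "fst (flip_sign v) = fst v" "snd (flip_sign v) = (\<not> snd v)" "flip_sign (flip_sign v) = v" "flip_sign (i, e) = (i, \<not> e)"
  by (simp_all add: flip_sign_def)

text \<open>With \<open>e\<close> these are the strands of \<open>APhi s\<close>. Having the sign as
  a parameter turns the clause for \<Phi> into a mere change of that parameter, which suits
  inductions on terms.\<close>

definition strands :: "aterm \<Rightarrow> bool \<Rightarrow> (nat \<times> bool) list" where
  "strands s e = (if e then rev (map flip_sign (astrands s)) else astrands s)"

lemma astrands_Phi: "astrands (APhi s) = rev (map flip_sign (astrands s))"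
  by (simp add: flip_sign_def case_prod_unfold)

lemma map_flip_sign_flip_sign [simp]: "map flip_sign (map flip_sign l) = l"
  by (induction l) auto

lemma strands_simps [simp]: "strands (AVar i) e = [(i, e)]" "strands AOne e = []" "strands (ATen s t) e = (if e then strands t e @ strands s e else strands s e @ strands t e)"
    "strands (APhi s) e = strands s (\<not> e)"
proof -
  show "strands (APhi s) e = strands s (\<not> e)"
    unfolding strands_def astrands_Phi by (simp add: rev_map del: map_map)
qed (auto simp: strands_def)

lemma strands_not: "strands s (\<not> e) = rev (map flip_sign (strands s e))"
  by (simp add: strands_def rev_map del: map_map)

lemma length_strands [simp]: "length (strands s e) = length (avars s)"
proof -
  have "length (astrands s) = length (avars s)" by (induction s) auto
  then show ?thesis by (simp add: strands_def)
qed

lemma fst_strands: "fst ` set (strands s e) = set (avars s)"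
  by (induction s arbitrary: e) (auto simp: image_Un)

lemma strands_subst: "strands (asubst \<theta> s) e = concat (map (\<lambda>v. strands (\<theta> (fst v)) (snd v)) (strands s e))"
  by (induction s arbitrary: e) auto

lemma avars_subst: "avars (asubst \<theta> s) = concat (map (\<lambda>i. avars (\<theta> i)) (avars s))"
  by (induction s) auto

lemma hor_perm:
  assumes V: "\<And>v. v \<in> V \<Longrightarrow> flip_sign v \<in> V \<and> tb (flip_sign v) = rev (map flip_sign (tb v))" and vs0: "set vs0 \<subseteq> V"
    and sb: "\<And>v. v \<in> V \<Longrightarrow> length (sb (flip_sign v)) = length (sb v) \<and> fst ` set (wt v) \<subseteq> {1..<length (sb v)} \<and>
      wt (flip_sign v) = flip_word (length (sb v)) (wt v) \<and> perm flip_sign (sgw (wt v)) (sb v) = tb v"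
    and w: "fst ` set w \<subseteq> {1..<n}" and n: "n = length vs0"
    and ps: "ps = map (\<lambda>v. (length (sb v), wt v)) vs0"
    and U: "U = fst (cable (map fst ps) w) @ juxtapose 0 ps"
    and vs: "vs = (if e then rev (map flip_sign vs0) else vs0)" and N: "N = length (concat (map sb vs0))"
  shows "fst ` set U \<subseteq> {1..<N} \<and>
    perm flip_sign (sgw (sign_word e N U)) (concat (map sb vs)) = concat (map tb (perm flip_sign (sgw (sign_word e n w)) vs))"
proof -
  \<comment> \<open>In the codiscrete model an arrow is the pair of its source and target, so that every equation
    between parallel arrows holds and only the statement on permutations remains.\<close>
  let ?sg = "\<lambda>c d. ([c, d], [d, c])" and ?kp = "\<lambda>c. ([c], [flip_sign c])"
  interpret m: strict_moncat "\<lambda>_. True" "\<lambda>_. True" fst snd "\<lambda>g f. (fst f, snd g)" "\<lambda>l. (l, l)"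
    "\<lambda>f g. (fst f @ fst g, snd f @ snd g)"
    by standard (auto simp: list_all_iff)
  interpret codisc: strict_braided "\<lambda>_. True" "\<lambda>_. True" fst snd "\<lambda>g f. (fst f, snd g)" "\<lambda>l. (l, l)"
    "\<lambda>f g. (fst f @ fst g, snd f @ snd g)" flip_sign ?sg ?sg ?kp ?kp True True
    by standard (auto simp: m.T_def)
  have t: "list_all (\<lambda>_. True) l" for l :: "(nat \<times> bool) list" unfolding list_all_iff by blast
  have X: "fst (codisc.X l m) = l @ m" "snd (codisc.X l m) = m @ l" for l m
    using codisc.X_typ[OF TrueI t t] by blast+
  have K: "fst (codisc.K l) = l" "snd (codisc.K l) = codisc.du l" for l
    using codisc.K_simps(2,3)[OF TrueI TrueI t] .
  have natural: "codisc.natural f" for f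
    unfolding codisc.natural_def by (intro conjI allI impI TrueI prod_eqI) (simp_all only: fst_conv snd_conv X)
  have dual: "codisc.dual f f'" if "fst f' = codisc.du (fst f)" "snd f' = codisc.du (snd f)" for f f'
    unfolding codisc.dual_def by (intro conjI impI natural that prod_eqI) (simp_all only: fst_conv snd_conv K that)
  have d: "flip_sign v \<in> V" "tb (flip_sign v) = codisc.du (tb v)" if "v \<in> V" for v
    using V[OF that] unfolding codisc.du_def by blast+
  have cab: "codisc.cabled V flip_sign (\<lambda>v. v) tb (\<lambda>v. ([v], tb v))"
    unfolding codisc.cabled_def
    by (intro ballI conjI dual) (simp_all only: d fst_conv snd_conv flip_sign_simps codisc.du_def list.map rev.simps append.simps)
  have sb': "list_all (\<lambda>_. True) (sb v) \<and> length (sb (flip_sign v)) = length (sb v) \<and> fst ` set (wt v) \<subseteq> {1..<length (sb v)} \<and>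
      wt (flip_sign v) = flip_word (length (sb v)) (wt v) \<and> perm flip_sign (sgw (wt v)) (sb v) = tb v" if "v \<in> V" for v
    using sb[OF that] t by blast
  show ?thesis using codisc.hor(1,2)[OF TrueI cab vs0 sb' w n ps U vs N HOL.refl] by blast
qed

lemma hor_place:
  assumes "\<And>v. v \<in> set vs \<Longrightarrow> fst v < length \<theta>s"
  shows "place (map (\<lambda>\<theta>. (length (avars (asrc \<theta>)), abraid \<theta>)) \<theta>s) vs =
    map (\<lambda>v. (length (avars (map asrc \<theta>s ! fst v)), sign_word (snd v) (length (avars (map asrc \<theta>s ! fst v))) (abraid (\<theta>s ! fst v)))) vs"
  using assms by (auto simp: place_def sign_word_def split_beta Let_def)

text \<open>Source and target of a presentation force the signed permutation of its word. In the
  symmetric case this takes the place of a hypothesis on braids. Both signs are needed, because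
  horizontal composition places the inner words at strands of either sign.\<close>

lemma avalid_strands:
  "avalid b f \<Longrightarrow> fst ` set (abraid f) \<subseteq> {1..<length (avars (asrc f))} \<and>
     strands (atgt f) e = perm flip_sign (sgw (sign_word e (length (avars (asrc f))) (abraid f))) (strands (asrc f) e)"
proof (induction b f arbitrary: e rule: avalid.induct)
  case (2 b c) then show ?case by (cases c; cases e) (auto simp: sign_word_def swap_strands_def)
next
  case (3 b c) then show ?case by (cases c; cases e) (auto simp: sign_word_def swap_strands_def)
next
  case (4 b g f)
  then have v: "avalid b g" "avalid b f" "asrc g = atgt f" by auto
  note G = 4(1)[OF v(1)] and F = 4(2)[OF v(2)]
  have "length (strands (atgt f) e) = length (strands (asrc f) e)" using F[of e] by (metis length_perm)
  then have l: "length (avars (asrc g)) = length (avars (asrc f))" using v(3) by simp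
  have "strands (atgt f) e = strands (asrc g) e" using v(3) by simp
  then show ?case using F G[of e] l v(3) by (simp add: image_Un)
next
  case (5 b \<eta> \<theta>s)
  then have v: "avalid b \<eta>" "\<And>\<theta>. \<theta> \<in> set \<theta>s \<Longrightarrow> avalid b \<theta>" by auto
  note E = 5(1)[OF v(1)] and Th = 5(2)[OF _ v(2)]
  let ?V = "{v :: nat \<times> bool. fst v < length \<theta>s}" and ?s = "\<lambda>v. strands (map asrc \<theta>s ! fst v) (snd v)" and ?t = "\<lambda>v. strands (map atgt \<theta>s ! fst v) (snd v)"
  let ?wt = "\<lambda>v. sign_word (snd v) (length (avars (map asrc \<theta>s ! fst v))) (abraid (\<theta>s ! fst v))"
  let ?vs0 = "astrands (asrc \<eta>)" and ?ps = "place (map (\<lambda>\<theta>. (length (avars (asrc \<theta>)), abraid \<theta>)) \<theta>s) (astrands (asrc \<eta>))"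
  let ?S = "asrc (AHor \<eta> \<theta>s)"
  have vs0: "set ?vs0 \<subseteq> ?V" 
  proof
    fix v assume "v \<in> set ?vs0"
    then have "fst v \<in> fst ` set (strands (asrc \<eta>) False)" by (simp add: strands_def)
    then have "fst v \<in> set (avars (asrc \<eta>))" unfolding fst_strands .
    then show "v \<in> ?V" using 5(3) by (simp add: linear_def)
  qed
  have n: "length (avars (asrc \<eta>)) = length ?vs0" using length_strands[of "asrc \<eta>" False] by (simp add: strands_def)
  have V: "flip_sign v \<in> ?V \<and> ?t (flip_sign v) = rev (map flip_sign (?t v))" if "v \<in> ?V" for v
    using that strands_not[of "map atgt \<theta>s ! fst v" "snd v"] by simp
  have ps: "?ps = map (\<lambda>v. (length (?s v), ?wt v)) ?vs0"
    using vs0 by (subst hor_place) auto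
  have U: "abraid (AHor \<eta> \<theta>s) = fst (cable (map fst ?ps) (abraid \<eta>)) @ juxtapose 0 ?ps" by (simp add: Let_def)
  have N: "length (avars ?S) = length (concat (map ?s ?vs0))"
    using length_strands[of ?S False] strands_subst[of "\<lambda>i. map asrc \<theta>s ! i" "asrc \<eta>" False] by (simp add: strands_def)
  have sb: "length (?s (flip_sign v)) = length (?s v) \<and> fst ` set (?wt v) \<subseteq> {1..<length (?s v)} \<and>
      ?wt (flip_sign v) = flip_word (length (?s v)) (?wt v) \<and> perm flip_sign (sgw (?wt v)) (?s v) = ?t v" if "v \<in> ?V" for v
  proof -
    have i: "\<theta>s ! fst v \<in> set \<theta>s" "map asrc \<theta>s ! fst v = asrc (\<theta>s ! fst v)" "map atgt \<theta>s ! fst v = atgt (\<theta>s ! fst v)" using that by auto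
    note t = Th[OF i(1) i(1), of "snd v"]
    have r: "fst ` set (abraid (\<theta>s ! fst v)) \<subseteq> {1..<length (avars (map asrc \<theta>s ! fst v))}" using t i by simp
    show ?thesis using t sign_word_not[OF r, of "snd v"] set_sign_word[OF r] i by simp
  qed
  have strands\<eta>: "(if e then rev (map flip_sign ?vs0) else ?vs0) = strands (asrc \<eta>) e" by (simp add: strands_def)
  have w: "fst ` set (abraid \<eta>) \<subseteq> {1..<length (avars (asrc \<eta>))}" using E by simp
  note H = hor_perm[OF V vs0 sb w n ps U strands\<eta>[symmetric] N]
  have "strands (atgt (AHor \<eta> \<theta>s)) e = concat (map ?t (strands (atgt \<eta>) e))" by (simp add: strands_subst)
  also have "\<dots> = perm flip_sign (sgw (sign_word e (length (avars ?S)) (abraid (AHor \<eta> \<theta>s)))) (concat (map ?s (strands (asrc \<eta>) e)))"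
    using H E[of e] by simp
  also have "concat (map ?s (strands (asrc \<eta>) e)) = strands ?S e" by (simp add: strands_subst)
  finally show ?case using conjunct1[OF H] by (rule conjI[rotated])
qed (simp)

lemma fst_perm: "wfw k (length l) w \<Longrightarrow> fst ` set (perm flip_sign w l) = fst ` set l"
proof (induction w)
  case (Cons x w)
  then have "fst x \<in> cgens k (length (perm flip_sign w l))" by simp
  then have "fst ` set (perm_letter flip_sign x (perm flip_sign w l)) = fst ` set (perm flip_sign w l)"
    by (cases rule: cgens_cases) (auto simp: swap_strands_at)
  then show ?case using Cons by simp
qed simp

lemma avalid_avars:
  assumes "avalid b f"
  shows "set (avars (atgt f)) = set (avars (asrc f))" "length (avars (atgt f)) = length (avars (asrc f))"
proof -
  let ?w = "sgw (abraid f)" and ?l = "strands (asrc f) False"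
  have e: "strands (atgt f) False = perm flip_sign ?w ?l" and r: "fst ` set (abraid f) \<subseteq> {1..<length (avars (asrc f))}"
    using avalid_strands[OF assms, of False] by (auto simp: sign_word_def)
  have "wfw True (length ?l) ?w" using r by (simp add: wfw_sgw)
  then have "fst ` set (strands (atgt f) False) = fst ` set ?l" unfolding e by (rule fst_perm)
  then show "set (avars (atgt f)) = set (avars (asrc f))" unfolding fst_strands .
  show "length (avars (atgt f)) = length (avars (asrc f))" using arg_cong[OF e, of length] by simp
qed

section \<open>Structural isomorphisms as words\<close>

lemma aob_cong: "(\<And>i. i \<in> set (avars s) \<Longrightarrow> X i = Y i) \<Longrightarrow> aob A X s = aob A Y s"
  by (induction s) auto

lemma aob_subst: "aob A X (asubst \<theta> s) = aob A (\<lambda>i. aob A X (\<theta> i)) s"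
  by (induction s) auto

lemma juxtapose_Nil: "(\<And>n w. (n, w) \<in> set ps \<Longrightarrow> w = []) \<Longrightarrow> juxtapose k ps = []"
proof (induction ps arbitrary: k)
  case (Cons p ps)
  obtain n w where "p = (n, w)" by (cases p)
  then show ?case using Cons.prems[of n w] Cons.IH[of "k + n"] Cons.prems by auto
qed simp

lemma Monoidal_abraid: "avalid b f \<Longrightarrow> b \<noteq> Braided \<Longrightarrow> abraid f = []"
proof (induction b f rule: avalid.induct)
  case (5 b \<eta> \<theta>s)
  let ?ps = "place (map (\<lambda>\<theta>. (length (avars (asrc \<theta>)), abraid \<theta>)) \<theta>s) (astrands (asrc \<eta>))"
  have s: "fst v < length \<theta>s" if "v \<in> set (astrands (asrc \<eta>))" for v
    using that fst_strands[of "asrc \<eta>" False] 5(3) by (auto simp: strands_def linear_def image_def)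
  have e: "?ps = map (\<lambda>v. (length (avars (map asrc \<theta>s ! fst v)), sign_word (snd v) (length (avars (map asrc \<theta>s ! fst v))) (abraid (\<theta>s ! fst v))))
      (astrands (asrc \<eta>))" by (rule hor_place) (rule s)
  have "w = []" if nw: "(n, w) \<in> set ?ps" for n w
  proof -
    obtain v where v: "v \<in> set (astrands (asrc \<eta>))" "w = sign_word (snd v) (length (avars (map asrc \<theta>s ! fst v))) (abraid (\<theta>s ! fst v))"
      using nw unfolding e by auto
    then have "abraid (\<theta>s ! fst v) = []" using 5 s[OF v(1)] by simp
    then show ?thesis using v by simp
  qed
  then have "juxtapose 0 ?ps = []" using juxtapose_Nil by blast
  moreover have "abraid \<eta> = []" using 5 by simp
  ultimately show ?case by (simp add: Let_def)
qed auto

section \<open>Canonical arrows of terms in \<open>A\<close>\<close>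

context strict_pair begin

definition cl :: "(nat \<Rightarrow> 'o) \<Rightarrow> nat \<times> bool \<Rightarrow> 'o \<times> bool" where "cl X v = (X (fst v), snd v)"

lemma cl_simps [simp]: "cl X (flip_sign v) = stt (cl X v)" "cl X (i, e) = (X i, e)" "fst (cl X v) = X (fst v)"
  by (simp_all add: cl_def flip_sign_def stt_def)

text \<open>The canonical arrow that resolves all tensor products, units and \<open>\<Phi>\<close>'s of a term.\<close>

primrec normal :: "(nat \<Rightarrow> 'o) \<Rightarrow> aterm \<Rightarrow> bool \<Rightarrow> 'e" where
  "normal X (AVar i) e = I [(X i, e)]"
| "normal X AOne e = su e"
| "normal X (ATen s t) e = pw e (normal X s e) (normal X t e) \<bullet> sm (aob A X s) (aob A X t) e"
| "normal X (APhi s) e = normal X s (\<not> e) \<bullet> tt (aob A X s) e"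

definition Xok :: "(nat \<Rightarrow> 'o) \<Rightarrow> aterm \<Rightarrow> bool" where "Xok X s \<longleftrightarrow> (\<forall>i \<in> set (avars s). X i \<in> Ob A)"

lemma Xok_simps [simp]: "Xok X (AVar i) \<longleftrightarrow> X i \<in> Ob A" "Xok X AOne" "Xok X (ATen s t) \<longleftrightarrow> Xok X s \<and> Xok X t"
   "Xok X (APhi s) \<longleftrightarrow> Xok X s"
  by (auto simp: Xok_def)

lemma aob_Ob [simp]: "Xok X s \<Longrightarrow> aob A X s \<in> Ob A"
  by (induction s) auto

lemma normal_typ: "Xok X s \<Longrightarrow> arr (normal X s e) \<and> src (normal X s e) = [(aob A X s, e)] \<and> tgt (normal X s e) = map (cl X) (strands s e)"
  by (induction s arbitrary: e) (auto simp: pl_def)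

lemma normal_simps [simp]:
  assumes "Xok X s"
  shows "arr (normal X s e)" "src (normal X s e) = [(aob A X s, e)]" "tgt (normal X s e) = map (cl X) (strands s e)"
  using normal_typ[OF assms] by auto

lemma normal_cong: "(\<And>i. i \<in> set (avars s) \<Longrightarrow> X i = Y i) \<Longrightarrow> normal X s e = normal Y s e"
proof (induction s arbitrary: e)
  case (ATen s t) then show ?case using aob_cong[of s X Y A] aob_cong[of t X Y A] by simp
next
  case (APhi s) then show ?case using aob_cong[of s X Y A] by simp
qed auto

lemma left_inv_normal: "Xok X s \<Longrightarrow> left_inv (normal X s e)"
  by (induction s arbitrary: e) (auto intro!: left_inv_cm left_inv_pw left_inv_sm left_inv_su left_inv_tt left_inv_I simp: pl_def)

text \<open>Each resolving arrow is dual to the one of opposite sign, and duality is stable under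
  composition and, with the order reversed, under juxtaposition. This is what cabling demands of the
  arrows along which strands are replaced.\<close>

lemma dual_normal: "bs \<Longrightarrow> Xok X s \<Longrightarrow> S.dual (normal X s e) (normal X s (\<not> e))"
proof (induction s arbitrary: e)
  case (AVar i) then show ?case using S.dual_I[of "[(X i, e)]"] by simp
next
  case AOne then show ?case using dual_su[of e] by simp
next
  case (ATen s t)
  have "S.dual (pw e (normal X s e) (normal X t e)) (pw (\<not> e) (normal X s (\<not> e)) (normal X t (\<not> e)))"
  proof -
    have "S.dual (normal X s d) (normal X s (\<not> d))" "S.dual (normal X t d) (normal X t (\<not> d))" for d using ATen by auto
    note S.dual_hz[OF ATen.prems(1) this(1) this(2), of False False] S.dual_hz[OF ATen.prems(1) this(2) this(1), of True True]
    then show ?thesis by (cases e) (simp_all add: pw_def)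
  qed
  then have "S.dual (pw e (normal X s e) (normal X t e) \<bullet> sm (aob A X s) (aob A X t) e)
     (pw (\<not> e) (normal X s (\<not> e)) (normal X t (\<not> e)) \<bullet> sm (aob A X s) (aob A X t) (\<not> e))"
    using ATen dual_sm by (intro S.dual_cm) (auto simp: pl_def)
  then show ?case by simp
next
  case (APhi s)
  have "S.dual (normal X s (\<not> e) \<bullet> tt (aob A X s) e) (normal X s (\<not> \<not> e) \<bullet> tt (aob A X s) (\<not> e))"
    using APhi dual_tt by (intro S.dual_cm APhi.IH) auto
  then show ?case by simp
qed

lemma pw_hl:
  assumes "\<And>v. v \<in> set us \<union> set vs \<Longrightarrow> arr (f v)"
  shows "pw e (hl f us) (hl f vs) = hl f (if e then vs @ us else us @ vs)"
proof -
  have "hl f (us @ vs) = hl f us \<odot> hl f vs" "hl f (vs @ us) = hl f vs \<odot> hl f us"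
    by (rule hl_append; use assms in auto)+
  then show ?thesis by (simp add: pw_def)
qed

lemma hl_typ:
  assumes "\<And>v. v \<in> set vs \<Longrightarrow> arr (f v)"
  shows "arr (hl f vs)" "src (hl f vs) = concat (map (\<lambda>v. src (f v)) vs)" "tgt (hl f vs) = concat (map (\<lambda>v. tgt (f v)) vs)"
  using T_hl[of vs f "\<lambda>v. src (f v)" "\<lambda>v. tgt (f v)"] assms by (auto simp: T_def)

lemma concat_single: "(\<And>v. v \<in> set l \<Longrightarrow> f v = [g v]) \<Longrightarrow> concat (map f l) = map g l"
  by (induction l) auto

lemma in_strands: "v \<in> set (strands s e) \<Longrightarrow> fst v \<in> set (avars s)"
  using fst_strands[of s e] by auto

text \<open>Separates the resolution of a horizontal composite into an outer stage, in which the
  inner terms are opaque, and an inner stage at the strands of the outer term. This is the form in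
  which cabling applies.\<close>

lemma normal_subst:
  "(\<And>i. i \<in> set (avars s) \<Longrightarrow> Xok X (\<theta> i)) \<Longrightarrow>
    normal X (asubst \<theta> s) e = hl (\<lambda>v. normal X (\<theta> (fst v)) (snd v)) (strands s e) \<bullet> normal (\<lambda>i. aob A X (\<theta> i)) s e"
proof (induction s arbitrary: e)
  case (ATen s t)
  let ?H = "\<lambda>s. hl (\<lambda>v. normal X (\<theta> (fst v)) (snd v)) (strands s e)" and ?Y = "\<lambda>i. aob A X (\<theta> i)"
  have a: "arr (normal X (\<theta> (fst v)) (snd v))" if "v \<in> set (strands s e) \<union> set (strands t e)" for v
    using that in_strands ATen.prems by fastforce
  have Y: "Xok ?Y s" "Xok ?Y t" using ATen.prems by (auto simp: Xok_def[of ?Y])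
  have h: "arr (?H s)" "arr (?H t)" "src (?H s) = map (cl ?Y) (strands s e)" "src (?H t) = map (cl ?Y) (strands t e)"
  proof -
    show "arr (?H s)" "arr (?H t)" by (intro hl_typ(1) a; simp)+
    have "concat (map (\<lambda>v. src (normal X (\<theta> (fst v)) (snd v))) (strands s' e)) = map (cl ?Y) (strands s' e)" if "s' \<in> {s, t}" for s'
      using that in_strands[of _ s' e] ATen.prems by (intro concat_single) (fastforce simp: cl_def)
    moreover have "src (?H s) = concat (map (\<lambda>v. src (normal X (\<theta> (fst v)) (snd v))) (strands s e))"
      "src (?H t) = concat (map (\<lambda>v. src (normal X (\<theta> (fst v)) (snd v))) (strands t e))"
      by (intro hl_typ(2) a; simp)+
    ultimately show "src (?H s) = map (cl ?Y) (strands s e)" "src (?H t) = map (cl ?Y) (strands t e)" by simp_all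
  qed
  have "normal X (asubst \<theta> (ATen s t)) e = pw e (?H s \<bullet> normal ?Y s e) (?H t \<bullet> normal ?Y t e) \<bullet> sm (aob A ?Y s) (aob A ?Y t) e"
    using ATen by (simp add: aob_subst)
  also have "\<dots> = pw e (?H s) (?H t) \<bullet> normal ?Y (ATen s t) e"
    using h Y by (simp add: pw_cm cm_assoc)
  also have "pw e (?H s) (?H t) = hl (\<lambda>v. normal X (\<theta> (fst v)) (snd v)) (strands (ATen s t) e)"
    using pw_hl[of "strands s e" "strands t e" "\<lambda>v. normal X (\<theta> (fst v)) (snd v)" e] a by (cases e) auto
  finally show ?case .
qed (auto simp: aob_subst cm_assoc)

lemma aar_hom: "(\<And>i. i \<in> set (avars s) \<Longrightarrow> g i \<in> hom A (X i) (Y i)) \<Longrightarrow> aar A g s \<in> hom A (aob A X s) (aob A Y s)"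
  by (induction s) auto

lemma normal_nat:
  "(\<And>i. i \<in> set (avars s) \<Longrightarrow> g i \<in> hom A (X i) (Y i)) \<Longrightarrow>
    normal Y s e \<bullet> ae (aob A X s) (aob A Y s) (aar A g s) e
      = hl (\<lambda>v. ae (X (fst v)) (Y (fst v)) (g (fst v)) (snd v)) (strands s e) \<bullet> normal X s e"
proof (induction s arbitrary: e)
  case (AVar i)
  then have "g i \<in> hom A (X i) (Y i)" by simp
  then show ?case using homD(4,5) by simp
next
  case AOne
  then show ?case using ae_ide[of \<one>] by simp
next
  case (ATen s t)
  let ?G = "\<lambda>v. ae (X (fst v)) (Y (fst v)) (g (fst v)) (snd v)"
  have g: "X i \<in> Ob A" "Y i \<in> Ob A" "g i \<in> hom A (X i) (Y i)" if "i \<in> set (avars s) \<union> set (avars t)" for i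
  proof -
    show gi: "g i \<in> hom A (X i) (Y i)" using ATen.prems[of i] that by auto
    show "X i \<in> Ob A" "Y i \<in> Ob A" using homD(4,5)[OF gi] .
  qed
  have a: "arr (?G v)" "src (?G v) = [cl X v]" if "v \<in> set (strands s e) \<union> set (strands t e)" for v
    using that in_strands[of v s e] in_strands[of v t e] g[of "fst v"] by (auto simp: cl_def)
  have ok: "Xok X s" "Xok X t" "Xok Y s" "Xok Y t" using g by (auto simp: Xok_def)
  have hs: "aar A g s \<in> hom A (aob A X s) (aob A Y s)" and ht: "aar A g t \<in> hom A (aob A X t) (aob A Y t)"
    using ATen.prems by (auto intro: aar_hom)
  have h: "arr (hl ?G (strands s e))" "arr (hl ?G (strands t e))" "src (hl ?G (strands s e)) = map (cl X) (strands s e)" "src (hl ?G (strands t e)) = map (cl X) (strands t e)"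
  proof -
    show "arr (hl ?G (strands s e))" "arr (hl ?G (strands t e))" by (intro hl_typ(1) a(1); simp)+
    have "concat (map (\<lambda>v. src (?G v)) (strands s e)) = map (cl X) (strands s e)" "concat (map (\<lambda>v. src (?G v)) (strands t e)) = map (cl X) (strands t e)"
      by (intro concat_single a(2); simp)+
    moreover have "src (hl ?G (strands s e)) = concat (map (\<lambda>v. src (?G v)) (strands s e))" "src (hl ?G (strands t e)) = concat (map (\<lambda>v. src (?G v)) (strands t e))"
      by (intro hl_typ(2) a(1); simp)+
    ultimately show "src (hl ?G (strands s e)) = map (cl X) (strands s e)" "src (hl ?G (strands t e)) = map (cl X) (strands t e)" by simp_all
  qed
  have IHs: "normal Y s e \<bullet> ae (aob A X s) (aob A Y s) (aar A g s) e = hl ?G (strands s e) \<bullet> normal X s e"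
    and IHt: "normal Y t e \<bullet> ae (aob A X t) (aob A Y t) (aar A g t) e = hl ?G (strands t e) \<bullet> normal X t e"
    using ATen by auto
  have "normal Y (ATen s t) e \<bullet> ae (aob A X (ATen s t)) (aob A Y (ATen s t)) (aar A g (ATen s t)) e
    = pw e (normal Y s e) (normal Y t e) \<bullet> pw e (ae (aob A X s) (aob A Y s) (aar A g s) e) (ae (aob A X t) (aob A Y t) (aar A g t) e) \<bullet> sm (aob A X s) (aob A X t) e"
    using sm_nat[OF hs ht] by (simp add: cm_assoc)
  also have "\<dots> = (pw e (normal Y s e) (normal Y t e) \<bullet> pw e (ae (aob A X s) (aob A Y s) (aar A g s) e) (ae (aob A X t) (aob A Y t) (aar A g t) e)) \<bullet> sm (aob A X s) (aob A X t) e"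
    by (simp only: cm_assoc)
  also have "pw e (normal Y s e) (normal Y t e) \<bullet> pw e (ae (aob A X s) (aob A Y s) (aar A g s) e) (ae (aob A X t) (aob A Y t) (aar A g t) e)
    = pw e (hl ?G (strands s e) \<bullet> normal X s e) (hl ?G (strands t e) \<bullet> normal X t e)"
    unfolding IHs[symmetric] IHt[symmetric] using ok hs ht by (simp add: pw_cm)
  also have "\<dots> = pw e (hl ?G (strands s e)) (hl ?G (strands t e)) \<bullet> pw e (normal X s e) (normal X t e)"
    using h ok by (simp add: pw_cm)
  also have "pw e (hl ?G (strands s e)) (hl ?G (strands t e)) = hl ?G (strands (ATen s t) e)"
    using pw_hl[of "strands s e" "strands t e" ?G e] a by (cases e) auto
  finally show ?case by (simp add: cm_assoc)
next
  case (APhi s)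
  have hs: "aar A g s \<in> hom A (aob A X s) (aob A Y s)"
    using APhi.prems by (auto intro: aar_hom)
  have IH: "normal Y s (\<not> e) \<bullet> ae (aob A X s) (aob A Y s) (aar A g s) (\<not> e)
      = hl (\<lambda>v. ae (X (fst v)) (Y (fst v)) (g (fst v)) (snd v)) (strands s (\<not> e)) \<bullet> normal X s (\<not> e)"
    using APhi by auto
  show ?case using tt_nat[OF hs, of e] cm_cong[OF IH] by (simp add: cm_assoc)
qed

lemma pw_I_sm [simp]: "x \<in> Ob A \<Longrightarrow> y \<in> Ob A \<Longrightarrow> pw e (I [(x, e)]) (I [(y, e)]) \<bullet> sm x y e = sm x y e"
  by (simp add: pw_def hz_I pl_def)

lemma gen_homs:
  assumes "Xok X (agen_src c)" "c = Sigma \<Longrightarrow> bs"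
  shows "agen_eval A \<sigma> X c \<in> hom A (aob A X (agen_src c)) (aob A X (agen_tgt c))" "iso A (agen_eval A \<sigma> X c)"
    "Xok X (agen_tgt c)"
  using assms by (cases c; simp add: iso_ide)+

text \<open>The canonical arrows absorb every constituent except \<sigma>, which becomes one
  crossing. The word is the same for both signs, since reflection on two strands fixes the only
  generator.\<close>

lemma gen_normal:
  assumes "Xok X (agen_src c)" "c = Sigma \<Longrightarrow> bs"
  shows "normal X (agen_tgt c) e \<bullet> ae (aob A X (agen_src c)) (aob A X (agen_tgt c)) (agen_eval A \<sigma> X c) e
    = S.bw (map (cl X) (strands (agen_src c) e)) (sgw (abraid (AGen c))) \<bullet> normal X (agen_src c) e"
proof (cases c)
  case IdTen
  then show ?thesis using assms by (auto simp: ae_ide pl_def)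
next
  case IdPhi
  then show ?thesis using assms by (simp add: ae_ide)
next
  case Alpha
  then have o: "X 0 \<in> Ob A" "X 1 \<in> Ob A" "X 2 \<in> Ob A" using assms by auto
  then show ?thesis using Alpha sm_asc[of "X 0" "X 1" "X 2" e] by (auto simp: pl_def cm_assoc)
next
  case Lambda
  then show ?thesis using assms sm_unit[of "X 0" e] by (auto simp: pl_def)
next
  case Rho
  then show ?thesis using assms sm_unit[of "X 0" e] by (auto simp: pl_def)
next
  case PhiTwo
  then show ?thesis using assms sm_Phi_two[of "X 0" "X 1" e] by (auto simp: pl_def cm_assoc)
next
  case PhiZero
  then show ?thesis using su_Phi_zero[of e] by simp
next
  case Tee
  then show ?thesis using assms tt_tinv[of "X 0" e] by simp
next
  case Sigma
  then have b: bs and o: "X 0 \<in> Ob A" "X 1 \<in> Ob A" using assms by auto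
  have l: "S.letter [c, d] (Sig (Suc 0), True) = sgm c d" if "fst c \<in> Ob A" "fst d \<in> Ob A" for c d
    using S.letter_Suc0[OF b that, of "[]"] that b by simp
  show ?thesis
  proof (cases e)
    case True
    then show ?thesis using Sigma o b sm_sigma[OF b o, of e "(X 1, e)" "(X 0, e)"] l by (auto simp: pl_def)
  next
    case False
    then show ?thesis using Sigma o b sm_sigma[OF b o, of e "(X 0, e)" "(X 1, e)"] l by (auto simp: pl_def)
  qed
qed

text \<open>A presentation has to be followed under both signs, as it may be put at a strand of
  either sign. The type of the morphism and the admissibility of its target are part of the
  induction, because vertical composition depends on them.\<close>

lemma aeval_normal:
  "avalid b f \<Longrightarrow> (b = Braided \<Longrightarrow> bs) \<Longrightarrow> Xok X (asrc f) \<Longrightarrow>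
    aeval A \<sigma> f X \<in> hom A (aob A X (asrc f)) (aob A X (atgt f)) \<and> Xok X (atgt f) \<and>
    normal X (atgt f) e \<bullet> ae (aob A X (asrc f)) (aob A X (atgt f)) (aeval A \<sigma> f X) e
    = S.bw (map (cl X) (strands (asrc f) e)) (sgw (sign_word e (length (avars (asrc f))) (abraid f))) \<bullet> normal X (asrc f) e"
proof (induction b f arbitrary: X e rule: avalid.induct)
  case (1 b i)
  then show ?case by (auto simp: ae_ide)
next
  case (2 b c)
  have g: "Xok X (agen_src c)" "c = Sigma \<Longrightarrow> bs" using 2 by auto
  have "sign_word e (length (avars (agen_src c))) (abraid (AGen c)) = abraid (AGen c)" by (cases c; cases e) (auto simp: sign_word_def)
  then show ?case using gen_homs[OF g] gen_normal[OF g, of e] by simp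
next
  case (3 b c)
  have s: "set (avars (agen_src c)) = set (avars (agen_tgt c))" by (cases c) auto
  have g: "Xok X (agen_src c)" "c = Sigma \<Longrightarrow> bs" using 3 s by (auto simp: Xok_def)
  let ?x = "aob A X (agen_src c)" and ?y = "aob A X (agen_tgt c)" and ?f = "agen_eval A \<sigma> X c" and ?w = "abraid (AGen c)"
  note h = gen_homs[OF g] and n = gen_normal[OF g, of e]
  have o: "?x \<in> Ob A" "?y \<in> Ob A" using g h by simp_all
  have i: "inv_arrow A ?f \<in> hom A ?y ?x" "?f \<cdot> inv_arrow A ?f = ide A ?y" using inv_arrow_props[OF h(1,2)] by auto
  have w: "sgw (sign_word e (length (avars (agen_tgt c))) (abraid (AGenInv c))) = inv_word (sgw ?w)"
    by (cases c; cases e) (auto simp: sign_word_def)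
  have p: "strands (agen_tgt c) e = perm flip_sign (sgw ?w) (strands (agen_src c) e)"
    using avalid_strands[of Braided "AGen c" e] by (cases c; cases e) (auto simp: sign_word_def)
  let ?l = "map (cl X) (strands (agen_src c) e)"
  have ok: "list_all okc ?l" using g(1) in_strands[of _ "agen_src c" e] by (fastforce simp: list_all_iff Xok_def)
  have ae: "ae ?x ?y ?f e \<bullet> ae ?y ?x (inv_arrow A ?f) e = I [(?y, e)]"
    using i h by (simp add: ae_cm ae_ide)
  show ?case
  proof (cases "c = Sigma")
    case False
    then have w0: "?w = []" by simp
    have "map (cl X) (strands (agen_tgt c) e) = ?l" using p w0 by simp
    then have t: "tgt (normal X (agen_src c) e) = map (cl X) (strands (agen_tgt c) e)" using g by simp
    have "normal X (agen_src c) e \<bullet> ae ?y ?x (inv_arrow A ?f) e = (normal X (agen_tgt c) e \<bullet> ae ?x ?y ?f e) \<bullet> ae ?y ?x (inv_arrow A ?f) e"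
      using n w0 g t by (simp add: cm_assoc)
    also have "\<dots> = normal X (agen_tgt c) e" using ae h by (simp add: cm_assoc)
    finally show ?thesis using i h g w w0 t False by simp
  next
    case True
    then have b: bs using g by simp
    have wf: "wfw bk (length ?l) (sgw ?w)" using True by (simp add: cgens_def)
    have pl: "map (cl X) (strands (agen_tgt c) e) = perm stt (sgw ?w) ?l"
      unfolding p using perm_map[of True "strands (agen_src c) e" "sgw ?w" UNIV "cl X" flip_sign stt] True by (simp add: cgens_def)
    have B: "S.bw (perm stt (sgw ?w) ?l) (inv_word (sgw ?w)) \<bullet> S.bw ?l (sgw ?w) = I ?l"
      using S.bw_inv(1)[OF b wf ok] .
    have "S.bw (perm stt (sgw ?w) ?l) (inv_word (sgw ?w)) \<bullet> normal X (agen_tgt c) e = normal X (agen_src c) e \<bullet> ae ?y ?x (inv_arrow A ?f) e"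
      by (rule conj_inverse[OF n[symmetric]]) (use S.bw_simps[OF b wf ok] B ae h g i o in simp_all)
    then show ?thesis using i h g w pl by simp
  qed
next
  case (4 b g f)
  then have v: "avalid b g" "avalid b f" "asrc g = atgt f" by auto
  have F: "aeval A \<sigma> f X \<in> hom A (aob A X (asrc f)) (aob A X (atgt f))" "Xok X (atgt f)"
    "normal X (atgt f) e \<bullet> ae (aob A X (asrc f)) (aob A X (atgt f)) (aeval A \<sigma> f X) e
    = S.bw (map (cl X) (strands (asrc f) e)) (sgw (sign_word e (length (avars (asrc f))) (abraid f))) \<bullet> normal X (asrc f) e"
    using 4 v by auto
  have G: "aeval A \<sigma> g X \<in> hom A (aob A X (asrc g)) (aob A X (atgt g))" "Xok X (atgt g)"
    "normal X (atgt g) e \<bullet> ae (aob A X (asrc g)) (aob A X (atgt g)) (aeval A \<sigma> g X) e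
    = S.bw (map (cl X) (strands (asrc g) e)) (sgw (sign_word e (length (avars (asrc g))) (abraid g))) \<bullet> normal X (asrc g) e"
    using 4 v F(2) by auto
  let ?l = "map (cl X) (strands (asrc f) e)" and ?n = "length (avars (asrc f))"
  let ?u = "sgw (sign_word e ?n (abraid f))" and ?v = "sgw (sign_word e ?n (abraid g))"
  have n: "length (avars (atgt f)) = ?n" using avalid_avars(2)[OF v(2)] .
  have B: "S.bw ?l (?v @ ?u) = S.bw (map (cl X) (strands (atgt f) e)) ?v \<bullet> S.bw ?l ?u"
  proof (cases bs)
    case True
    have ok: "list_all okc ?l" using 4(5) in_strands[of _ "asrc f" e] by (fastforce simp: list_all_iff Xok_def)
    have r: "fst ` set (abraid f) \<subseteq> {1..<?n}" "fst ` set (abraid g) \<subseteq> {1..<?n}"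
      using avalid_strands[OF v(1), of e] avalid_strands[OF v(2), of e] n v(3) by auto
    then have w: "wfw k (length ?l) ?u" "wfw k (length ?l) ?v" for k using set_sign_word by (simp_all add: wfw_sgw)
    have "map (cl X) (strands (atgt f) e) = perm stt ?u ?l"
      using avalid_strands[OF v(2), of e] perm_map[of True "strands (asrc f) e" ?u UNIV "cl X" flip_sign stt] w(1)[of True] by simp
    then show ?thesis using S.bw_append[OF True w(1) w(2) ok] by simp
  next
    case False
    then have nb: "b \<noteq> Braided" using 4 by auto
    have ok: "list_all okc ?l" using 4(5) in_strands[of _ "asrc f" e] by (fastforce simp: list_all_iff Xok_def)
    have "abraid f = []" "abraid g = []" using Monoidal_abraid[OF _ nb] v by auto
    moreover then have "strands (atgt f) e = strands (asrc f) e" using avalid_strands[OF v(2), of e] by simp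
    ultimately show ?thesis using ok by simp
  qed
  have c: "ae (aob A X (asrc f)) (aob A X (atgt g)) (aeval A \<sigma> g X \<cdot> aeval A \<sigma> f X) e
    = ae (aob A X (asrc g)) (aob A X (atgt g)) (aeval A \<sigma> g X) e \<bullet> ae (aob A X (asrc f)) (aob A X (atgt f)) (aeval A \<sigma> f X) e"
    using F(1) G(1) v(3) by (simp add: ae_cm)
  have "normal X (atgt g) e \<bullet> ae (aob A X (asrc f)) (aob A X (atgt g)) (aeval A \<sigma> g X \<cdot> aeval A \<sigma> f X) e
    = S.bw (map (cl X) (strands (atgt f) e)) ?v \<bullet> normal X (atgt f) e \<bullet> ae (aob A X (asrc f)) (aob A X (atgt f)) (aeval A \<sigma> f X) e"
    unfolding c using cm_cong[OF G(3)] v(3) n by (simp add: cm_assoc)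
  also have "\<dots> = S.bw ?l (?v @ ?u) \<bullet> normal X (asrc f) e"
    unfolding F(3) B by (simp add: cm_assoc)
  finally show ?case using F G v(3) cmp_hom[OF F(1), of "aeval A \<sigma> g X"] by simp
next
  case (5 b \<eta> \<theta>s)
  let ?k = "length \<theta>s" and ?S = "\<lambda>i. map asrc \<theta>s ! i" and ?T = "\<lambda>i. map atgt \<theta>s ! i"
  let ?f = "AHor \<eta> \<theta>s" and ?vs = "strands (asrc \<eta>) e" and ?vz = "astrands (asrc \<eta>)"
  let ?n = "length (avars (asrc \<eta>))" and ?N = "length (avars (asrc (AHor \<eta> \<theta>s)))"
  have v: "avalid b \<eta>" and v\<theta>: "\<And>i. i < ?k \<Longrightarrow> avalid b (\<theta>s ! i)" and lin: "set (avars (asrc \<eta>)) = {..<?k}"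
    using 5(3) by (auto simp: linear_def)
  have v\<eta>t: "set (avars (atgt \<eta>)) = {..<?k}" using avalid_avars(1)[OF v] lin by simp
  have Xs: "Xok X (?S i)" if "i < ?k" for i
    using 5(5) that lin by (auto simp: Xok_def avars_subst)
  define X1 where "X1 i = aob A X (?S i)" for i
  define X2 where "X2 i = map (\<lambda>\<theta>. aob A X (atgt \<theta>)) \<theta>s ! i" for i
  define g where "g i = map (\<lambda>\<theta>. aeval A \<sigma> \<theta> X) \<theta>s ! i" for i
  have Th: "aeval A \<sigma> (\<theta>s ! i) X \<in> hom A (aob A X (asrc (\<theta>s ! i))) (aob A X (atgt (\<theta>s ! i)))" "Xok X (atgt (\<theta>s ! i))"
    "normal X (atgt (\<theta>s ! i)) d \<bullet> ae (aob A X (asrc (\<theta>s ! i))) (aob A X (atgt (\<theta>s ! i))) (aeval A \<sigma> (\<theta>s ! i) X) d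
    = S.bw (map (cl X) (strands (asrc (\<theta>s ! i)) d)) (sgw (sign_word d (length (avars (asrc (\<theta>s ! i)))) (abraid (\<theta>s ! i)))) \<bullet> normal X (asrc (\<theta>s ! i)) d"
    if "i < ?k" for i d
    using 5(2)[OF nth_mem[OF that] v\<theta>[OF that] 5(4), of X d] Xs[OF that] that by simp_all
  have Xt: "Xok X (?T i)" and X2t: "X2 i = aob A X (?T i)" and gi: "g i \<in> hom A (X1 i) (X2 i)"
    and X12: "X1 i \<in> Ob A" "X2 i \<in> Ob A" if "i < ?k" for i
    using Th(1,2)[OF that] Xs[OF that] that by (auto simp: X1_def X2_def g_def)
  have X2\<eta>: "Xok X2 (asrc \<eta>)" using X12 lin by (simp add: Xok_def)
  have E: "aeval A \<sigma> \<eta> X2 \<in> hom A (aob A X2 (asrc \<eta>)) (aob A X2 (atgt \<eta>))" "Xok X2 (atgt \<eta>)"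
    "normal X2 (atgt \<eta>) e \<bullet> ae (aob A X2 (asrc \<eta>)) (aob A X2 (atgt \<eta>)) (aeval A \<sigma> \<eta> X2) e
    = S.bw (map (cl X2) ?vs) (sgw (sign_word e ?n (abraid \<eta>))) \<bullet> normal X2 (asrc \<eta>) e"
    using 5(1)[OF v 5(4) X2\<eta>, of e] by auto
  have r: "aar A g (asrc \<eta>) \<in> hom A (aob A X1 (asrc \<eta>)) (aob A X2 (asrc \<eta>))"
    by (rule aar_hom) (use gi lin in simp)
  have as: "aob A X (asrc ?f) = aob A X1 (asrc \<eta>)" by (simp add: aob_subst X1_def[abs_def])
  have at: "aob A X (atgt ?f) = aob A X2 (atgt \<eta>)"
    using v\<eta>t X2t by (auto simp: aob_subst intro!: aob_cong)
  have ev: "aeval A \<sigma> ?f X = aeval A \<sigma> \<eta> X2 \<cdot> aar A g (asrc \<eta>)"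
    by (simp add: X2_def[abs_def] g_def[abs_def])
  have hom: "aeval A \<sigma> ?f X \<in> hom A (aob A X (asrc ?f)) (aob A X (atgt ?f))"
    unfolding ev as at by (rule cmp_hom[OF r E(1)])
  have okt: "Xok X (atgt ?f)" using Xt v\<eta>t by (auto simp: Xok_def avars_subst)
  let ?FT = "\<lambda>v. normal X (?T (fst v)) (snd v)" and ?FS = "\<lambda>v. normal X (?S (fst v)) (snd v)"
  let ?G = "\<lambda>v. ae (X1 (fst v)) (X2 (fst v)) (g (fst v)) (snd v)"
  have natural: "normal X (atgt ?f) e = hl ?FT (strands (atgt \<eta>) e) \<bullet> normal X2 (atgt \<eta>) e"
  proof -
    have "normal X (atgt ?f) e = hl ?FT (strands (atgt \<eta>) e) \<bullet> normal (\<lambda>i. aob A X (?T i)) (atgt \<eta>) e"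
      unfolding atgt.simps by (rule normal_subst) (use Xt v\<eta>t in simp)
    also have "normal (\<lambda>i. aob A X (?T i)) (atgt \<eta>) e = normal X2 (atgt \<eta>) e"
      by (rule normal_cong) (use X2t v\<eta>t in simp)
    finally show ?thesis .
  qed
  have ns: "normal X (asrc ?f) e = hl ?FS ?vs \<bullet> normal X1 (asrc \<eta>) e"
    unfolding asrc.simps X1_def[abs_def] by (rule normal_subst) (use Xs lin in simp)
  have na: "normal X2 (asrc \<eta>) e \<bullet> ae (aob A X1 (asrc \<eta>)) (aob A X2 (asrc \<eta>)) (aar A g (asrc \<eta>)) e = hl ?G ?vs \<bullet> normal X1 (asrc \<eta>) e"
    by (rule normal_nat) (use gi lin in simp)
  let ?V = "{v :: nat \<times> bool. fst v < ?k}"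
  let ?tb = "\<lambda>v. map (cl X) (strands (?T (fst v)) (snd v))" and ?sb = "\<lambda>v. map (cl X) (strands (?S (fst v)) (snd v))"
  let ?wt = "\<lambda>v. sign_word (snd v) (length (avars (?S (fst v)))) (abraid (\<theta>s ! fst v))"
  let ?w = "sgw (sign_word e ?n (abraid \<eta>))" and ?B = "\<lambda>v. S.bw (?sb v) (sgw (?wt v))"
  let ?u = "sgw (sign_word e ?N (abraid ?f))"
  have V0: "set ?vz \<subseteq> ?V" using in_strands[of _ "asrc \<eta>" False] lin by (auto simp: strands_def)
  have V: "v \<in> ?V" if "v \<in> set ?vs" for v using in_strands[OF that] lin by simp
  have St: "strands (?T (fst v)) (snd v) = perm flip_sign (sgw (?wt v)) (strands (?S (fst v)) (snd v))"
    "fst ` set (abraid (\<theta>s ! fst v)) \<subseteq> {1..<length (avars (?S (fst v)))}" if "v \<in> ?V" for v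
    using avalid_strands[OF v\<theta>, of "fst v" "snd v"] that by auto
  have wt: "fst ` set (?wt v) \<subseteq> {1..<length (?sb v)}" if "v \<in> ?V" for v using set_sign_word[OF St(2)[OF that]] by simp
  have ok: "list_all okc (?sb v)" if "v \<in> ?V" for v
    using Xs[of "fst v"] that in_strands[of _ "?S (fst v)" "snd v"] by (fastforce simp: list_all_iff Xok_def)
  have pt: "perm stt (sgw (?wt v)) (?sb v) = ?tb v" if "v \<in> ?V" for v
  proof -
    have "wfw True (length (strands (?S (fst v)) (snd v))) (sgw (?wt v))" using wt[OF that] by (simp add: wfw_sgw)
    then show ?thesis unfolding St(1)[OF that] using perm_map[of True _ "sgw (?wt v)" UNIV "cl X" flip_sign stt] by simp
  qed
  \<comment> \<open>\<open>C\<close> is the value of the cabled outer word; without a braiding all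
    words are empty and \<open>C\<close> is an identity.\<close>
  obtain C where C: "T C (concat (map ?tb ?vs)) (concat (map ?tb (strands (atgt \<eta>) e)))"
     "S.bw (concat (map ?sb ?vs)) ?u = C \<bullet> hl ?B ?vs"
     "C \<bullet> hl ?FT ?vs = hl ?FT (strands (atgt \<eta>) e) \<bullet> S.bw (map (cl X2) ?vs) ?w"
  proof (cases bs)
    case True
    let ?ps = "place (map (\<lambda>\<theta>. (length (avars (asrc \<theta>)), abraid \<theta>)) \<theta>s) ?vz"
    \<comment> \<open>The outer strands are replaced along the canonical arrows of the inner
      targets.\<close>
    have cab: "S.cabled ?V flip_sign (cl X2) ?tb ?FT"
      unfolding S.cabled_def
    proof (intro ballI conjI)
      fix v assume v: "v \<in> ?V"
      then have o: "Xok X (?T (fst v))" using Xt by simp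
      show "flip_sign v \<in> ?V" "flip_sign (flip_sign v) = v" "cl X2 (flip_sign v) = stt (cl X2 v)" using v by simp_all
      show "?tb (flip_sign v) = S.du (?tb v)" by (simp add: strands_not S.du_def rev_map)
      show "src (?FT v) = [cl X2 v]" "tgt (?FT v) = ?tb v" using o X2t v by (simp_all add: cl_def)
      show "S.dual (?FT v) (?FT (flip_sign v))" using dual_normal[OF True o] by simp
    qed
    have sb: "list_all okc (?sb v) \<and> length (?sb (flip_sign v)) = length (?sb v) \<and> fst ` set (?wt v) \<subseteq> {1..<length (?sb v)} \<and>
      ?wt (flip_sign v) = flip_word (length (?sb v)) (?wt v) \<and> perm stt (sgw (?wt v)) (?sb v) = ?tb v" if "v \<in> ?V" for v
      using ok[OF that] wt[OF that] pt[OF that] sign_word_not[OF St(2)[OF that]] by simp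
    have w: "fst ` set (abraid \<eta>) \<subseteq> {1..<?n}" using avalid_strands[OF v] by blast
    have n: "?n = length ?vz" using length_strands[of "asrc \<eta>" False] by (simp add: strands_def)
    have ps: "?ps = map (\<lambda>v. (length (?sb v), ?wt v)) ?vz"
      using V0 by (subst hor_place) auto
    have U: "abraid ?f = fst (cable (map fst ?ps) (abraid \<eta>)) @ juxtapose 0 ?ps" by (simp add: Let_def)
    have vs: "?vs = (if e then rev (map flip_sign ?vz) else ?vz)" by (simp add: strands_def)
    have N: "?N = length (concat (map ?sb ?vz))"
      using length_strands[of "asrc ?f" False] strands_subst[of ?S "asrc \<eta>" False] by (simp add: strands_def length_concat comp_def)
    have p: "perm flip_sign ?w ?vs = strands (atgt \<eta>) e" using avalid_strands[OF v, of e] by simp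
    show thesis
      using S.hor(3)[OF True cab V0 sb w n ps U vs N HOL.refl] that unfolding p by blast
  next
    case False
    then have nb: "b \<noteq> Braided" using 5(4) by auto
    have n: "abraid ?f = []" "abraid \<eta> = []" "\<And>v. v \<in> ?V \<Longrightarrow> abraid (\<theta>s ! fst v) = []"
      using Monoidal_abraid[OF 5(3) nb] Monoidal_abraid[OF v nb] Monoidal_abraid[OF v\<theta> nb] by auto
    have p: "strands (atgt \<eta>) e = ?vs" using avalid_strands[OF v, of e] n by simp
    have tb: "?tb v = ?sb v" if "v \<in> ?V" for v using St(1)[OF that] n(3)[OF that] by simp
    have m: "map ?tb ?vs = map ?sb ?vs" by (rule map_cong[OF HOL.refl]) (rule tb[OF V])
    have o: "list_all okc (concat (map ?sb ?vs))" using ok V by (force simp: list_all_iff)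
    have o2: "list_all okc (map (cl X2) ?vs)" using X12(2) V by (force simp: list_all_iff)
    have hB: "hl ?B ?vs = I (concat (map ?sb ?vs))"
    proof -
      have "hl ?B ?vs = hl (\<lambda>v. I (?sb v)) ?vs" using n(3) V by (intro hl_cong) auto
      then show ?thesis using ok V hl_I[of ?vs ?sb] by auto
    qed
    have "T (hl ?FT ?vs) (concat (map (\<lambda>v. [cl X2 v]) ?vs)) (concat (map ?tb ?vs))"
      using V Xt X2t by (intro T_hl) (auto simp: T_def cl_def)
    moreover have "concat (map (\<lambda>v. [cl X2 v]) ?vs) = map (cl X2) ?vs" by (rule concat_single) simp
    ultimately have hF: "T (hl ?FT ?vs) (map (cl X2) ?vs) (concat (map ?tb ?vs))" by simp
    show thesis
    proof (rule that[of "I (concat (map ?tb ?vs))"])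
      show "T (I (concat (map ?tb ?vs))) (concat (map ?tb ?vs)) (concat (map ?tb (strands (atgt \<eta>) e)))"
        unfolding p m using o by (rule T_I)
      show "S.bw (concat (map ?sb ?vs)) ?u = I (concat (map ?tb ?vs)) \<bullet> hl ?B ?vs"
        unfolding hB n(1) m using o by simp
      show "I (concat (map ?tb ?vs)) \<bullet> hl ?FT ?vs = hl ?FT (strands (atgt \<eta>) e) \<bullet> S.bw (map (cl X2) ?vs) ?w"
        unfolding p n(2) using hF o2 by (simp add: T_def)
    qed
  qed
  \<comment> \<open>The induction hypotheses for the inner presentations, side by side, each with
    the sign of the strand at which it is placed.\<close>
  have hFG: "hl ?FT ?vs \<bullet> hl ?G ?vs = hl ?B ?vs \<bullet> hl ?FS ?vs"
  proof -
    have tg: "T (?G v) [cl X1 v] [cl X2 v] \<and> T (?FT v) [cl X2 v] (?tb v)" if "v \<in> set ?vs" for v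
      using V[OF that] X12 gi Xt X2t by (simp add: T_def cl_def)
    have ts: "T (?FS v) [cl X1 v] (?sb v) \<and> T (?B v) (?sb v) (?tb v)" if "v \<in> set ?vs" for v
    proof -
      have v: "v \<in> ?V" using V[OF that] .
      have "T (?FS v) [cl X1 v] (?sb v)" using v Xs by (simp add: T_def cl_def X1_def)
      moreover have "T (?B v) (?sb v) (?tb v)"
      proof (cases bs)
        case True
        have "wfw bk (length (?sb v)) (sgw (?wt v))" unfolding wfw_sgw using wt[OF v] .
        then show ?thesis using S.T_bw[OF True _ ok[OF v]] pt[OF v] by metis
      next
        case False
        then have nb: "b \<noteq> Braided" using 5(4) by auto
        have "abraid (\<theta>s ! fst v) = []" using Monoidal_abraid[OF v\<theta> nb] v by simp
        then have w0: "sgw (?wt v) = []" by simp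
        then show ?thesis using ok[OF v] pt[OF v] unfolding w0 by (simp add: T_I)
      qed
      ultimately show ?thesis by blast
    qed
    have "hl ?FT ?vs \<bullet> hl ?G ?vs = hl (\<lambda>v. ?FT v \<bullet> ?G v) ?vs" by (rule hl_cm[OF tg, symmetric])
    also have "\<dots> = hl (\<lambda>v. ?B v \<bullet> ?FS v) ?vs"
    proof (rule hl_cong)
      fix v assume "v \<in> set ?vs"
      then have v: "fst v < ?k" using V by blast
      show "?FT v \<bullet> ?G v = ?B v \<bullet> ?FS v"
        using Th(3)[OF v, of "snd v"] v by (simp add: X1_def X2_def g_def)
    qed
    also have "\<dots> = hl ?B ?vs \<bullet> hl ?FS ?vs" by (rule hl_cm[OF ts])
    finally show ?thesis .
  qed
  have L: "map (cl X) (strands (asrc ?f) e) = concat (map ?sb ?vs)"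
    by (simp add: strands_subst map_concat comp_def)
  have "normal X (atgt ?f) e \<bullet> ae (aob A X (asrc ?f)) (aob A X (atgt ?f)) (aeval A \<sigma> ?f X) e
    = hl ?FT (strands (atgt \<eta>) e) \<bullet> normal X2 (atgt \<eta>) e \<bullet> ae (aob A X2 (asrc \<eta>)) (aob A X2 (atgt \<eta>)) (aeval A \<sigma> \<eta> X2) e
      \<bullet> ae (aob A X1 (asrc \<eta>)) (aob A X2 (asrc \<eta>)) (aar A g (asrc \<eta>)) e"
    unfolding natural ev as at ae_cm[OF r E(1), symmetric] by (simp only: cm_assoc)
  also have "\<dots> = (hl ?FT (strands (atgt \<eta>) e) \<bullet> S.bw (map (cl X2) ?vs) ?w) \<bullet> hl ?G ?vs \<bullet> normal X1 (asrc \<eta>) e"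
    by (simp only: cm_cong[OF E(3)] na cm_assoc)
  also have "\<dots> = C \<bullet> (hl ?FT ?vs \<bullet> hl ?G ?vs) \<bullet> normal X1 (asrc \<eta>) e"
    unfolding C(3)[symmetric] by (simp only: cm_assoc)
  also have "\<dots> = S.bw (concat (map ?sb ?vs)) ?u \<bullet> normal X (asrc ?f) e"
    unfolding hFG ns C(2) by (simp only: cm_assoc)
  finally have "normal X (atgt ?f) e \<bullet> ae (aob A X (asrc ?f)) (aob A X (atgt ?f)) (aeval A \<sigma> ?f X) e
    = S.bw (map (cl X) (strands (asrc ?f) e)) ?u \<bullet> normal X (asrc ?f) e" unfolding L .
  then show ?case using hom okt by blast
qed

end

section \<open>Horizontal composites in the module\<close>

context strict_braided begin
context assumes bs: bs begin

lemmas msimps [simp] = dsimps[OF bs]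

text \<open>The strands \<open>p\<close> of the inner module term lie between the pole and the
  cabled strands, so an outer twist is cabled to a twist behind \<open>m\<close> strands. By BP1 its
  value is a mere whiskering, and so the outer word acts beside the identity of \<open>p'\<close>,
  after \<open>wm\<close> has acted.\<close>

lemma mhor:
  assumes cab: "cabled V s cb tb fb" and vs: "set vs \<subseteq> V"
    and sb: "\<And>v. v \<in> V \<Longrightarrow> oks (sb v) \<and> length (sb (s v)) = length (sb v) \<and> fst ` set (wt v) \<subseteq> {1..<length (sb v)} \<and>
      perm st (sgw (wt v)) (sb v) = tb v"
    and w: "wfb (length vs) w" and p: "oks p" "wfb (length p) wm" "p' = perm st wm p" "m = length p"
    and ps: "ps = map (\<lambda>v. (length (sb v), wt v)) vs"
    and U: "U = fst (mcable m (map fst ps) w) @ wm @ sgw (juxtapose m ps)"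
  shows "wfb (length (p @ concat (map sb vs))) U"
    "perm st U (p @ concat (map sb vs)) = p' @ concat (map tb (perm s w vs))"
    "\<exists>C. T C (p' @ concat (map tb vs)) (p' @ concat (map tb (perm s w vs))) \<and>
       bw (p @ concat (map sb vs)) U = C \<bullet> (bw p wm \<odot> hl (\<lambda>v. bw (sb v) (sgw (wt v))) vs) \<and>
       C \<bullet> (I p' \<odot> hl fb vs) = I p' \<odot> (hl fb (perm s w vs) \<bullet> bw (map cb vs) w)"
proof -
  let ?S = "concat (map sb vs)" and ?M = "concat (map tb vs)" and ?B = "\<lambda>v. bw (sb v) (sgw (wt v))"
  let ?J = "sgw (juxtapose m ps)" and ?lws = "map (\<lambda>v. (sb v, wt v)) vs"
  have o: "\<And>v. v \<in> V \<Longrightarrow> wfb (length (sb v)) (sgw (wt v))" using sb by (simp add: wfw_sgw)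
  have letter: "length (tb v) = length (sb v)" if "v \<in> V" for v using sb[OF that] length_perm[of st "sgw (wt v)" "sb v"] by simp
  have ws: "map fst ps = map (length \<circ> tb) vs" using ps letter vs by auto
  have hB: "T (hl ?B vs) ?S ?M"
    using vs sb o by (intro T_hl) (auto simp: T_def)
  have oS: "oks ?S" "oks ?M" using T_okD[OF hB] by auto
  have l: "\<And>l w. (l, w) \<in> set ?lws \<Longrightarrow> oks l \<and> wfb (length l) (sgw w)" using sb o vs by auto
  have e: "map (\<lambda>(l, w). (length l, w)) ?lws = ps" "map fst ?lws = map sb vs" "map (\<lambda>(l, w). perm st (sgw w) l) ?lws = map tb vs"
    using ps sb vs by auto
  have "wfb (length (p @ concat (map fst ?lws))) (sgw (juxtapose m (map (\<lambda>(l, w). (length l, w)) ?lws))) \<and>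
   bw (p @ concat (map fst ?lws)) (sgw (juxtapose m (map (\<lambda>(l, w). (length l, w)) ?lws))) = I p \<odot> hl (\<lambda>(l, w). bw l (sgw w)) ?lws \<and>
   perm st (sgw (juxtapose m (map (\<lambda>(l, w). (length l, w)) ?lws))) (p @ concat (map fst ?lws)) = p @ concat (map (\<lambda>(l, w). perm st (sgw w) l) ?lws)"
    by (rule bw_juxtapose[OF bs l p(1) p(4)])
  then have J: "wfb (length (p @ ?S)) ?J" "bw (p @ ?S) ?J = I p \<odot> hl ?B vs" "perm st ?J (p @ ?S) = p @ ?M"
    unfolding e by (simp_all add: hl_map)
  have n: "length (p @ ?M) = length (p @ ?S)" using arg_cong[OF J(3), of length] by simp
  note E = bw_ext[OF bs p(2,1) oS(2)]
  have Ew: "wfb (length (p @ ?S)) wm" using wfw_sig_mono[OF p(2)] by simp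
  have p': "oks p'" "length p' = m" using p by auto
  note C = cable_bw[OF bs cab vs w p'(1) p'(2)[symmetric] ws]
  let ?C = "fst (mcable m (map fst ps) w)"
  have n': "length (p' @ ?M) = length (p @ ?S)" using n p by simp
  have Cw: "wfb (length (p @ ?S)) ?C" using C unfolding n' by blast
  have pe: "perm st (wm @ ?J) (p @ ?S) = p' @ ?M" using J(3) E(2) p(3) by simp
  have WJ: "wfb (length (p @ ?S)) (wm @ ?J)" using Ew J(1) by simp
  have oL: "oks (p @ ?S)" using p oS by simp
  have b: "bw (p @ ?S) (wm @ ?J) = bw p wm \<odot> hl ?B vs"
  proof -
    have "bw (p @ ?S) (wm @ ?J) = (bw p wm \<odot> I ?M) \<bullet> (I p \<odot> hl ?B vs)"
      unfolding bw_append[OF bs J(1) Ew oL] J(2,3) E(1) ..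
    also have "\<dots> = bw p wm \<odot> hl ?B vs" using p hB oS by (simp add: interchange T_def)
    finally show ?thesis .
  qed
  have bU: "bw (p @ ?S) U = bw (p' @ ?M) ?C \<bullet> (bw p wm \<odot> hl ?B vs)"
    unfolding U bw_append[OF bs WJ Cw oL] pe b ..
  show "wfb (length (p @ ?S)) U" unfolding U using Cw WJ by simp
  show "perm st U (p @ ?S) = p' @ concat (map tb (perm s w vs))"
    using C pe unfolding U by simp
  have "T (bw (p' @ ?M) ?C) (p' @ ?M) (p' @ concat (map tb (perm s w vs)))"
    using C p' oS unfolding T_def by simp
  then show "\<exists>C. T C (p' @ concat (map tb vs)) (p' @ concat (map tb (perm s w vs))) \<and>
       bw (p @ ?S) U = C \<bullet> (bw p wm \<odot> hl ?B vs) \<and>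
       C \<bullet> (I p' \<odot> hl fb vs) = I p' \<odot> (hl fb (perm s w vs) \<bullet> bw (map cb vs) w)"
    using bU C by blast
qed

end
end

lemma mhor_perm:
  assumes V: "\<And>v. v \<in> V \<Longrightarrow> flip_sign v \<in> V \<and> tb (flip_sign v) = rev (map flip_sign (tb v))" and vs: "set vs \<subseteq> V"
    and sb: "\<And>v. v \<in> V \<Longrightarrow> length (sb (flip_sign v)) = length (sb v) \<and> fst ` set (wt v) \<subseteq> {1..<length (sb v)} \<and>
      perm flip_sign (sgw (wt v)) (sb v) = tb v"
    and w: "wfw k (length vs) w" and p: "wfw k (length p) wm" "p' = perm flip_sign wm p" "m = length p"
    and ps: "ps = map (\<lambda>v. (length (sb v), wt v)) vs"
    and U: "U = fst (mcable m (map fst ps) w) @ wm @ sgw (juxtapose m ps)"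
  shows "wfw k (length (p @ concat (map sb vs))) U \<and>
    perm flip_sign U (p @ concat (map sb vs)) = p' @ concat (map tb (perm flip_sign w vs))"
proof -
  let ?sg = "\<lambda>c d. ([c, d], [d, c])" and ?kp = "\<lambda>c. ([c], [flip_sign c])"
  interpret m: strict_moncat "\<lambda>_. True" "\<lambda>_. True" fst snd "\<lambda>g f. (fst f, snd g)" "\<lambda>l. (l, l)"
    "\<lambda>f g. (fst f @ fst g, snd f @ snd g)"
    by standard (auto simp: list_all_iff)
  interpret codisc: strict_braided "\<lambda>_. True" "\<lambda>_. True" fst snd "\<lambda>g f. (fst f, snd g)" "\<lambda>l. (l, l)"
    "\<lambda>f g. (fst f @ fst g, snd f @ snd g)" flip_sign ?sg ?sg ?kp ?kp True k
    by standard (auto simp: m.T_def)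
  have t: "list_all (\<lambda>_. True) l" for l :: "(nat \<times> bool) list" unfolding list_all_iff by blast
  have X: "fst (codisc.X l m) = l @ m" "snd (codisc.X l m) = m @ l" for l m
    using codisc.X_typ[OF TrueI t t] by blast+
  have K: "fst (codisc.K l) = l" "snd (codisc.K l) = codisc.du l" if k for l
    using codisc.K_simps(2,3)[OF TrueI that t] .
  have natural: "codisc.natural f" for f
    unfolding codisc.natural_def by (intro conjI allI impI TrueI prod_eqI) (simp_all only: fst_conv snd_conv X)
  have dual: "codisc.dual f f'" if "fst f' = codisc.du (fst f)" "snd f' = codisc.du (snd f)" for f f'
    unfolding codisc.dual_def by (intro conjI impI natural that prod_eqI) (simp_all only: fst_conv snd_conv K that)
  have d: "flip_sign v \<in> V" "tb (flip_sign v) = codisc.du (tb v)" if "v \<in> V" for v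
    using V[OF that] unfolding codisc.du_def by blast+
  have cab: "codisc.cabled V flip_sign (\<lambda>v. v) tb (\<lambda>v. ([v], tb v))"
    unfolding codisc.cabled_def
    by (intro ballI conjI dual) (simp_all only: d fst_conv snd_conv flip_sign_simps codisc.du_def list.map rev.simps append.simps)
  have sb': "list_all (\<lambda>_. True) (sb v) \<and> length (sb (flip_sign v)) = length (sb v) \<and> fst ` set (wt v) \<subseteq> {1..<length (sb v)} \<and>
      perm flip_sign (sgw (wt v)) (sb v) = tb v" if "v \<in> V" for v
    using sb[OF that] t by blast
  show ?thesis using codisc.mhor(1,2)[OF TrueI cab vs sb' w t p ps U] by blast
qed

section \<open>Arguments and strands of module terms\<close>

primrec margs :: "mterm \<Rightarrow> aterm list" where
  "margs MVar = []"
| "margs (MAct s t) = margs s @ [t]"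

lemma margs_subst: "margs (msubst a \<theta> s) = margs a @ map (asubst \<theta>) (margs s)"
  by (induction s) auto

lemma strands_False: "strands s False = astrands s"
  by (simp add: strands_def)

lemma mvars_margs: "mvars s = concat (map avars (margs s))"
  by (induction s) auto

lemma length_mstrands [simp]: "length (mstrands s) = length (mvars s)"
  by (induction s) (simp_all add: strands_False[symmetric])

lemma fst_mstrands: "fst ` set (mstrands s) = set (mvars s)"
  by (induction s) (simp_all add: strands_False[symmetric] image_Un fst_strands)

lemma mstrands_subst: "mstrands (msubst a \<theta> s) = mstrands a @ concat (map (\<lambda>v. strands (\<theta> (fst v)) (snd v)) (mstrands s))"
  by (induction s) (auto simp: strands_subst strands_False[symmetric])

lemma mvars_subst: "mvars (msubst a \<theta> s) = mvars a @ concat (map (\<lambda>i. avars (\<theta> i)) (mvars s))"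
  by (induction s) (auto simp: avars_subst)

lemma mvalid_strands:
  "mvalid b f \<Longrightarrow> wfw (b = Braided) (length (mvars (msrc f))) (mbraid f) \<and>
     mstrands (mtgt f) = perm flip_sign (mbraid f) (mstrands (msrc f))"
proof (induction b f rule: mvalid.induct)
  case (2 b c) then show ?case by (cases c) (auto simp: cgens_def)
next
  case (3 b c) then show ?case by (cases c) (auto simp: cgens_def)
next
  case (4 b g f)
  then have v: "mvalid b g" "mvalid b f" "msrc g = mtgt f" by auto
  note G = 4(1)[OF v(1)] and F = 4(2)[OF v(2)]
  have "length (mstrands (mtgt f)) = length (mstrands (msrc f))" using F by (metis length_perm)
  then have l: "length (mvars (mtgt f)) = length (mvars (msrc f))" by simp
  show ?case using F G v(3) l by simp
next
  case (5 b \<eta> \<mu> \<theta>s)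
  then have v: "mvalid b \<eta>" "mvalid b \<mu>" "\<And>\<theta>. \<theta> \<in> set \<theta>s \<Longrightarrow> avalid b \<theta>" by auto
  note E = 5(1)[OF v(1)] and M = 5(2)[OF v(2)]
  let ?V = "{v :: nat \<times> bool. fst v < length \<theta>s}" and ?s = "\<lambda>v. strands (map asrc \<theta>s ! fst v) (snd v)" and ?t = "\<lambda>v. strands (map atgt \<theta>s ! fst v) (snd v)"
  let ?wt = "\<lambda>v. sign_word (snd v) (length (avars (map asrc \<theta>s ! fst v))) (abraid (\<theta>s ! fst v))"
  let ?vs = "mstrands (msrc \<eta>)" and ?ps = "place (map (\<lambda>\<theta>. (length (avars (asrc \<theta>)), abraid \<theta>)) \<theta>s) (mstrands (msrc \<eta>))"
  let ?p = "mstrands (msrc \<mu>)"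
  have vs: "set ?vs \<subseteq> ?V"
  proof
    fix v assume "v \<in> set ?vs"
    then have "fst v \<in> fst ` set (mstrands (msrc \<eta>))" by simp
    then have "fst v \<in> set (mvars (msrc \<eta>))" unfolding fst_mstrands .
    then show "v \<in> ?V" using 5(3) by (simp add: linear_def)
  qed
  have V: "flip_sign v \<in> ?V \<and> ?t (flip_sign v) = rev (map flip_sign (?t v))" if "v \<in> ?V" for v
    using that strands_not[of "map atgt \<theta>s ! fst v" "snd v"] by simp
  have ps: "?ps = map (\<lambda>v. (length (?s v), ?wt v)) ?vs"
    using vs by (subst hor_place) auto
  have sb: "length (?s (flip_sign v)) = length (?s v) \<and> fst ` set (?wt v) \<subseteq> {1..<length (?s v)} \<and> perm flip_sign (sgw (?wt v)) (?s v) = ?t v" if "v \<in> ?V" for v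
  proof -
    have i: "\<theta>s ! fst v \<in> set \<theta>s" "map asrc \<theta>s ! fst v = asrc (\<theta>s ! fst v)" "map atgt \<theta>s ! fst v = atgt (\<theta>s ! fst v)" using that by auto
    note t = avalid_strands[OF v(3)[OF i(1)], of "snd v"]
    have r: "fst ` set (abraid (\<theta>s ! fst v)) \<subseteq> {1..<length (avars (map asrc \<theta>s ! fst v))}" using t i by simp
    show ?thesis using t set_sign_word[OF r] i by simp
  qed
  have w: "wfw (b = Braided) (length ?vs) (mbraid \<eta>)" "wfw (b = Braided) (length ?p) (mbraid \<mu>)" using E M by simp_all
  have m: "length (mvars (msrc \<mu>)) = length ?p" by simp
  have U: "mbraid (MHor \<eta> \<mu> \<theta>s) = fst (mcable (length (mvars (msrc \<mu>))) (map fst ?ps) (mbraid \<eta>)) @ mbraid \<mu> @ sgw (juxtapose (length (mvars (msrc \<mu>))) ?ps)"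
    by (simp add: Let_def sig_sgw del: mcable.simps)
  note H = mhor_perm[OF V vs sb w(1) w(2) conjunct2[OF M] m ps U]
  have s: "mstrands (msrc (MHor \<eta> \<mu> \<theta>s)) = ?p @ concat (map ?s ?vs)" by (simp add: mstrands_subst)
  have "mstrands (mtgt (MHor \<eta> \<mu> \<theta>s)) = mstrands (mtgt \<mu>) @ concat (map ?t (mstrands (mtgt \<eta>)))" by (simp add: mstrands_subst)
  also have "\<dots> = perm flip_sign (mbraid (MHor \<eta> \<mu> \<theta>s)) (mstrands (msrc (MHor \<eta> \<mu> \<theta>s)))"
    using H E unfolding s by (simp del: mbraid.simps)
  finally show ?case using conjunct1[OF H] unfolding s[symmetric] length_mstrands by blast
qed simp

lemma mvalid_mvars:
  assumes "mvalid b f"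
  shows "set (mvars (mtgt f)) = set (mvars (msrc f))" "length (mvars (mtgt f)) = length (mvars (msrc f))"
proof -
  have e: "mstrands (mtgt f) = perm flip_sign (mbraid f) (mstrands (msrc f))" and r: "wfw (b = Braided) (length (mvars (msrc f))) (mbraid f)"
    using mvalid_strands[OF assms] by auto
  have "fst ` set (mstrands (mtgt f)) = fst ` set (mstrands (msrc f))" unfolding e using r by (intro fst_perm) simp
  then show "set (mvars (mtgt f)) = set (mvars (msrc f))" unfolding fst_mstrands .
  show "length (mvars (mtgt f)) = length (mvars (msrc f))" using arg_cong[OF e, of length] by simp
qed

lemma Monoidal_mbraid: "mvalid b f \<Longrightarrow> b \<noteq> Braided \<Longrightarrow> mbraid f = []"
proof (induction b f rule: mvalid.induct)
  case (5 b \<eta> \<mu> \<theta>s)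
  let ?ps = "place (map (\<lambda>\<theta>. (length (avars (asrc \<theta>)), abraid \<theta>)) \<theta>s) (mstrands (msrc \<eta>))"
  have s: "fst v < length \<theta>s" if "v \<in> set (mstrands (msrc \<eta>))" for v
    using that fst_mstrands[of "msrc \<eta>"] 5(3) by (auto simp: linear_def image_def)
  have e: "?ps = map (\<lambda>v. (length (avars (map asrc \<theta>s ! fst v)), sign_word (snd v) (length (avars (map asrc \<theta>s ! fst v))) (abraid (\<theta>s ! fst v))))
      (mstrands (msrc \<eta>))" by (rule hor_place) (rule s)
  have "w = []" if nw: "(n, w) \<in> set ?ps" for n w
  proof -
    obtain v where v: "v \<in> set (mstrands (msrc \<eta>))" "w = sign_word (snd v) (length (avars (map asrc \<theta>s ! fst v))) (abraid (\<theta>s ! fst v))"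
      using nw unfolding e by auto
    then have "abraid (\<theta>s ! fst v) = []" using 5 s[OF v(1)] Monoidal_abraid[of b "\<theta>s ! fst v"] by simp
    then show ?thesis using v by simp
  qed
  then have "juxtapose k ?ps = []" for k using juxtapose_Nil by blast
  moreover have "mbraid \<eta> = []" "mbraid \<mu> = []" using 5 by simp_all
  ultimately show ?case by (simp add: Let_def)
qed auto

section \<open>Canonical arrows of module terms\<close>

context strict_pair begin

text \<open>The arguments before their resolution, each seen as one strand of \<open>A\<close> with
  trivial sign.\<close>

definition mblk :: "(nat \<Rightarrow> 'o) \<Rightarrow> mterm \<Rightarrow> ('o \<times> bool) list" where
  "mblk X s = map (\<lambda>t. (aob A X t, False)) (margs s)"

definition m_normal :: "(nat \<Rightarrow> 'o) \<Rightarrow> mterm \<Rightarrow> 'e" where "m_normal X s = hl (\<lambda>t. normal X t False) (margs s)"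

text \<open>Module associativity leads from two actions to a single one, against the direction of
  \<open>mu\<close>, and is therefore represented by \<open>mui\<close>.\<close>

primrec mgen_arr :: "(nat \<Rightarrow> 'o) \<Rightarrow> mgen \<Rightarrow> 'e" where
  "mgen_arr X IdAct = I [(X 0, False)]"
| "mgen_arr X ModAssoc = mui (X 0, False) (X 1, False)"
| "mgen_arr X ModUnit = un"
| "mgen_arr X Kappa = kq (X 0, False)"

primrec mgen_arr_inv :: "(nat \<Rightarrow> 'o) \<Rightarrow> mgen \<Rightarrow> 'e" where
  "mgen_arr_inv X IdAct = I [(X 0, False)]"
| "mgen_arr_inv X ModAssoc = mu (X 0, False) (X 1, False)"
| "mgen_arr_inv X ModUnit = uni"
| "mgen_arr_inv X Kappa = kqi (X 0, False)"

text \<open>The argument from \<open>M\<close> disappears, since transformations of iterated actions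
  compose horizontally: \<mu> is placed next to the pole, and \<eta>, preceded by the inner
  morphisms of \<open>A\<close>, behind it.\<close>

fun m_arr :: "mpres \<Rightarrow> (nat \<Rightarrow> 'o) \<Rightarrow> 'e" where
  "m_arr MIdId X = I []"
| "m_arr (MGen c) X = mgen_arr X c"
| "m_arr (MGenInv c) X = mgen_arr_inv X c"
| "m_arr (MVert g f) X = m_arr g X \<bullet> m_arr f X"
| "m_arr (MHor \<eta> \<mu> \<theta>s) X = m_arr \<mu> X \<odot> (m_arr \<eta> (\<lambda>i. map (\<lambda>\<theta>. aob A X (atgt \<theta>)) \<theta>s ! i) \<bullet>
     hl (\<lambda>t. ae (aob A (\<lambda>i. aob A X (map asrc \<theta>s ! i)) t) (aob A (\<lambda>i. map (\<lambda>\<theta>. aob A X (atgt \<theta>)) \<theta>s ! i) t)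
        (aar A (\<lambda>i. map (\<lambda>\<theta>. aeval A \<sigma> \<theta> X) \<theta>s ! i) t) False) (margs (msrc \<eta>)))"

definition Mok :: "(nat \<Rightarrow> 'o) \<Rightarrow> mterm \<Rightarrow> bool" where "Mok X s \<longleftrightarrow> (\<forall>i \<in> set (mvars s). X i \<in> Ob A)"

lemma Mok_simps [simp]: "Mok X MVar" "Mok X (MAct s t) \<longleftrightarrow> Mok X s \<and> Xok X t"
  by (auto simp: Mok_def Xok_def)

lemma mblk_simps [simp]: "mblk X MVar = []" "mblk X (MAct s t) = mblk X s @ [(aob A X t, False)]"
    "mblk X (msubst a \<theta> s) = mblk X a @ mblk (\<lambda>i. aob A X (\<theta> i)) s"
  by (simp_all add: mblk_def margs_subst aob_subst)

lemma m_normal_MAct: "Mok X s \<Longrightarrow> Xok X t \<Longrightarrow> m_normal X (MAct s t) = m_normal X s \<odot> normal X t False"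
proof -
  assume a: "Mok X s" "Xok X t"
  have "hl (\<lambda>t. normal X t False) (margs s @ [t]) = hl (\<lambda>t. normal X t False) (margs s) \<odot> hl (\<lambda>t. normal X t False) [t]"
    by (rule hl_append) (use a in \<open>auto simp: Mok_def Xok_def mvars_margs\<close>)
  then show ?thesis using a by (simp add: m_normal_def)
qed

lemma m_normal_T: "Mok X s \<Longrightarrow> T (m_normal X s) (mblk X s) (map (cl X) (mstrands s))"
proof (induction s)
  case MVar then show ?case by (simp add: m_normal_def T_I)
next
  case (MAct s t)
  then show ?case using T_hz[of "m_normal X s" _ _ "normal X t False" "[(aob A X t, False)]" "map (cl X) (astrands t)"]
    by (simp add: m_normal_MAct T_def strands_False)
qed

lemma left_inv_m_normal: "Mok X s \<Longrightarrow> left_inv (m_normal X s)"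
  unfolding m_normal_def by (rule left_inv_hl) (auto simp: Mok_def Xok_def mvars_margs intro!: left_inv_normal)

lemma m_normal_subst:
  "(\<And>i. i \<in> set (mvars s) \<Longrightarrow> Xok X (\<theta> i)) \<Longrightarrow> Mok X a \<Longrightarrow>
    m_normal X (msubst a \<theta> s) = m_normal X a \<odot> (hl (\<lambda>v. normal X (\<theta> (fst v)) (snd v)) (mstrands s) \<bullet> m_normal (\<lambda>i. aob A X (\<theta> i)) s)"
proof (induction s)
  case MVar
  then show ?case using m_normal_T[OF MVar(2)] by (simp add: m_normal_def[of _ MVar] T_def)
next
  case (MAct s t)
  let ?F = "\<lambda>v. normal X (\<theta> (fst v)) (snd v)" and ?Y = "\<lambda>i. aob A X (\<theta> i)"
  have IH: "m_normal X (msubst a \<theta> s) = m_normal X a \<odot> (hl ?F (mstrands s) \<bullet> m_normal ?Y s)" using MAct by auto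
  have ok: "Mok X (msubst a \<theta> s)" "Xok X (asubst \<theta> t)" "Mok ?Y s" "Xok ?Y t" using MAct.prems
    by (auto simp: Mok_def Xok_def[of X "asubst \<theta> t"] Xok_def[of ?Y] mvars_subst avars_subst) (auto simp: Xok_def)
  have Fv: "T (?F v) [cl ?Y v] (map (cl X) (strands (\<theta> (fst v)) (snd v)))" if "fst v \<in> set (mvars (MAct s t))" for v
    using MAct.prems(1)[OF that] by (simp add: T_def cl_def)
  have "T (hl ?F (mstrands s)) (concat (map (\<lambda>v. [cl ?Y v]) (mstrands s))) (concat (map (\<lambda>v. map (cl X) (strands (\<theta> (fst v)) (snd v))) (mstrands s)))"
    by (rule T_hl, rule Fv) (use fst_mstrands[of s] in auto)
  then have h1: "T (hl ?F (mstrands s)) (map (cl ?Y) (mstrands s)) (concat (map (\<lambda>v. map (cl X) (strands (\<theta> (fst v)) (snd v))) (mstrands s)))"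
    using concat_single[of "mstrands s" "\<lambda>v. [cl ?Y v]" "cl ?Y"] by simp
  have "T (hl ?F (strands t False)) (concat (map (\<lambda>v. [cl ?Y v]) (strands t False))) (concat (map (\<lambda>v. map (cl X) (strands (\<theta> (fst v)) (snd v))) (strands t False)))"
    by (rule T_hl, rule Fv) (use in_strands[of _ t False] in auto)
  then have h2: "T (hl ?F (strands t False)) (map (cl ?Y) (strands t False)) (concat (map (\<lambda>v. map (cl X) (strands (\<theta> (fst v)) (snd v))) (strands t False)))"
    using concat_single[of "strands t False" "\<lambda>v. [cl ?Y v]" "cl ?Y"] by simp
  have ap: "hl ?F (mstrands s @ strands t False) = hl ?F (mstrands s) \<odot> hl ?F (strands t False)"
  proof (rule hl_append)
    fix v assume "v \<in> set (mstrands s) \<union> set (strands t False)"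
    then have "fst v \<in> set (mvars (MAct s t))" using in_strands[of v t False] fst_mstrands[of s] by auto
    then show "arr (?F v)" using Fv by (simp add: T_def)
  qed
  have "m_normal X (msubst a \<theta> (MAct s t)) = (m_normal X a \<odot> (hl ?F (mstrands s) \<bullet> m_normal ?Y s)) \<odot> (hl ?F (strands t False) \<bullet> normal ?Y t False)"
    using m_normal_MAct[OF ok(1,2)] normal_subst[of t X \<theta> False] MAct.prems(1) IH by simp
  also have "\<dots> = m_normal X a \<odot> ((hl ?F (mstrands s) \<odot> hl ?F (strands t False)) \<bullet> (m_normal ?Y s \<odot> normal ?Y t False))"
    using h1 h2 m_normal_T[OF ok(3)] ok(4) by (simp add: hz_assoc interchange T_def)
  finally show ?case unfolding ap[symmetric] m_normal_MAct[OF ok(3,4), symmetric] by (simp add: strands_False)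
qed

lemma m_normal_nat:
  "(\<And>i. i \<in> set (mvars s) \<Longrightarrow> g i \<in> hom A (X i) (Y i)) \<Longrightarrow>
    T (hl (\<lambda>t. ae (aob A X t) (aob A Y t) (aar A g t) False) (margs s)) (mblk X s) (mblk Y s) \<and>
    m_normal Y s \<bullet> hl (\<lambda>t. ae (aob A X t) (aob A Y t) (aar A g t) False) (margs s)
      = hl (\<lambda>v. ae (X (fst v)) (Y (fst v)) (g (fst v)) (snd v)) (mstrands s) \<bullet> m_normal X s"
proof (induction s)
  case MVar then show ?case by (simp add: m_normal_def T_I)
next
  case (MAct s t)
  let ?G = "\<lambda>v. ae (X (fst v)) (Y (fst v)) (g (fst v)) (snd v)" and ?H = "\<lambda>t. ae (aob A X t) (aob A Y t) (aar A g t) False"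
  have g: "X i \<in> Ob A" "Y i \<in> Ob A" "g i \<in> hom A (X i) (Y i)" if "i \<in> set (mvars (MAct s t))" for i
  proof -
    show gi: "g i \<in> hom A (X i) (Y i)" using MAct.prems[OF that] .
    show "X i \<in> Ob A" "Y i \<in> Ob A" using homD(4,5)[OF gi] .
  qed
  have ok: "Mok X s" "Xok X t" "Mok Y s" "Xok Y t" using g by (auto simp: Xok_def Mok_def)
  have ht: "aar A g t \<in> hom A (aob A X t) (aob A Y t)" by (rule aar_hom) (use g in simp)
  have IH: "T (hl ?H (margs s)) (mblk X s) (mblk Y s)" "m_normal Y s \<bullet> hl ?H (margs s) = hl ?G (mstrands s) \<bullet> m_normal X s"
    using MAct by auto
  have Gv: "T (?G v) [cl X v] [cl Y v]" if "fst v \<in> set (mvars (MAct s t))" for v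
    using g[OF that] by (simp add: T_def cl_def)
  have "T (hl ?G (mstrands s)) (concat (map (\<lambda>v. [cl X v]) (mstrands s))) (concat (map (\<lambda>v. [cl Y v]) (mstrands s)))"
    by (rule T_hl, rule Gv) (use fst_mstrands[of s] in auto)
  then have h1: "T (hl ?G (mstrands s)) (map (cl X) (mstrands s)) (map (cl Y) (mstrands s))"
    using concat_single[of "mstrands s" "\<lambda>v. [cl X v]" "cl X"] concat_single[of "mstrands s" "\<lambda>v. [cl Y v]" "cl Y"] by simp
  have "T (hl ?G (strands t False)) (concat (map (\<lambda>v. [cl X v]) (strands t False))) (concat (map (\<lambda>v. [cl Y v]) (strands t False)))"
    by (rule T_hl, rule Gv) (use in_strands[of _ t False] in auto)
  then have h2: "T (hl ?G (strands t False)) (map (cl X) (strands t False)) (map (cl Y) (strands t False))"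
    using concat_single[of "strands t False" "\<lambda>v. [cl X v]" "cl X"] concat_single[of "strands t False" "\<lambda>v. [cl Y v]" "cl Y"] by simp
  have apG: "hl ?G (mstrands s @ strands t False) = hl ?G (mstrands s) \<odot> hl ?G (strands t False)"
  proof (rule hl_append)
    fix v assume "v \<in> set (mstrands s) \<union> set (strands t False)"
    then have "fst v \<in> set (mvars (MAct s t))" using in_strands[of v t False] fst_mstrands[of s] by auto
    then show "arr (?G v)" using Gv by (simp add: T_def)
  qed
  have apH: "hl ?H (margs s @ [t]) = hl ?H (margs s) \<odot> ?H t"
  proof -
    have "hl ?H (margs s @ [t]) = hl ?H (margs s) \<odot> hl ?H [t]"
    proof (rule hl_append)
      fix u assume "u \<in> set (margs s) \<union> set [t]"
      then have u: "set (avars u) \<subseteq> set (mvars (MAct s t))" by (auto simp: mvars_margs)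
      have "aar A g u \<in> hom A (aob A X u) (aob A Y u)" by (rule aar_hom) (use g u in blast)
      moreover have "Xok X u" "Xok Y u" using g u by (auto simp: Xok_def)
      ultimately show "arr (?H u)" by simp
    qed
    then show ?thesis using ht ok by simp
  qed
  have t: "normal Y t False \<bullet> ?H t = hl ?G (strands t False) \<bullet> normal X t False"
    by (rule normal_nat) (use g in simp)
  note mX = m_normal_T[OF ok(1)] and mY = m_normal_T[OF ok(3)]
  have "T (hl ?H (margs s) \<odot> ?H t) (mblk X (MAct s t)) (mblk Y (MAct s t))"
    using T_hz[OF IH(1), of "?H t" "[(aob A X t, False)]" "[(aob A Y t, False)]"] ht ok by (simp add: T_def)
  moreover have "m_normal Y (MAct s t) \<bullet> (hl ?H (margs s) \<odot> ?H t) = (m_normal Y s \<bullet> hl ?H (margs s)) \<odot> (normal Y t False \<bullet> ?H t)"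
    using m_normal_MAct[OF ok(3,4)] IH(1) mY ok ht by (simp add: interchange T_def)
  moreover have "\<dots> = (hl ?G (mstrands s) \<odot> hl ?G (strands t False)) \<bullet> m_normal X (MAct s t)"
    unfolding IH(2) t m_normal_MAct[OF ok(1,2)] using h1 h2 mX ok by (simp add: interchange T_def)
  ultimately show ?case using apH apG by (simp add: strands_False)
qed

end

context strict_pair begin

text \<open>Associativity and unit are absorbed by the resolution of products and units; \<kappa>
  followed by the canonical arrow of its target is the twist \<open>kap\<close>.\<close>

lemma mgen_normal:
  assumes "Mok X (mgen_src c)" "c = Kappa \<Longrightarrow> bk"
  shows "T (mgen_arr X c) (mblk X (mgen_src c)) (mblk X (mgen_tgt c))" "T (mgen_arr_inv X c) (mblk X (mgen_tgt c)) (mblk X (mgen_src c))"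
    "mgen_arr X c \<bullet> mgen_arr_inv X c = I (mblk X (mgen_tgt c))" "Mok X (mgen_tgt c)"
    "m_normal X (mgen_tgt c) \<bullet> mgen_arr X c = S.bw (map (cl X) (mstrands (mgen_src c))) (mbraid (MGen c)) \<bullet> m_normal X (mgen_src c)"
proof -
  have "T (mgen_arr X c) (mblk X (mgen_src c)) (mblk X (mgen_tgt c)) \<and> T (mgen_arr_inv X c) (mblk X (mgen_tgt c)) (mblk X (mgen_src c)) \<and>
    mgen_arr X c \<bullet> mgen_arr_inv X c = I (mblk X (mgen_tgt c)) \<and> Mok X (mgen_tgt c) \<and>
    m_normal X (mgen_tgt c) \<bullet> mgen_arr X c = S.bw (map (cl X) (mstrands (mgen_src c))) (mbraid (MGen c)) \<bullet> m_normal X (mgen_src c)"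
  proof (cases c)
    case IdAct
    then show ?thesis using assms by (simp add: T_def m_normal_def)
  next
    case ModAssoc
    then have o: "X 0 \<in> Ob A" "X (Suc 0) \<in> Ob A" using assms by auto
    have m: "pw False (I [(X 0, False)]) (I [(X (Suc 0), False)]) \<bullet> mu (X 0, False) (X (Suc 0), False) = mu (X 0, False) (X (Suc 0), False)"
      using pw_I_sm[OF o, of False] by (simp add: sm_def)
    have "sm (X 0) (X (Suc 0)) False = mu (X 0, False) (X (Suc 0), False)" by (simp add: sm_def)
    then show ?thesis using ModAssoc o m mu_T[of "(X 0, False)" "(X (Suc 0), False)"] by (simp add: m_normal_def T_def hz_I)
  next
    case ModUnit
    then show ?thesis using un_T by (simp add: T_def m_normal_def su_def)
  next
    case Kappa
    then have k: bk and o: "X 0 \<in> Ob A" using assms by auto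
    have "normal X (APhi (AVar 0)) False \<bullet> kq (X 0, False) = kap (X 0, False)"
      using k o kq_T[OF k, of "(X 0, False)"] by (simp add: tt_def kap_def kar_def T_def cm_assoc ae_ide)
    then show ?thesis using Kappa o kq_T[OF k, of "(X 0, False)"] S.kp_simps[OF bk_bs[OF k] k, of "(X 0, False)"]
      by (simp add: T_def m_normal_def)
  qed
  then show "T (mgen_arr X c) (mblk X (mgen_src c)) (mblk X (mgen_tgt c))" "T (mgen_arr_inv X c) (mblk X (mgen_tgt c)) (mblk X (mgen_src c))"
    "mgen_arr X c \<bullet> mgen_arr_inv X c = I (mblk X (mgen_tgt c))" "Mok X (mgen_tgt c)"
    "m_normal X (mgen_tgt c) \<bullet> mgen_arr X c = S.bw (map (cl X) (mstrands (mgen_src c))) (mbraid (MGen c)) \<bullet> m_normal X (mgen_src c)"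
    by auto
qed

lemma Mok_okc: "Mok X s \<Longrightarrow> list_all okc (map (cl X) (mstrands s))"
  using fst_mstrands[of s] by (fastforce simp: list_all_iff Mok_def)

text \<open>The counterpart for \<open>M\<close>, without a sign parameter: an action never stands
  under \<Phi>, so signs arise within the arguments only.\<close>

lemma m_arr_normal:
  "mvalid b f \<Longrightarrow> (b = Braided \<Longrightarrow> bs \<and> bk) \<Longrightarrow> Mok X (msrc f) \<Longrightarrow>
    T (m_arr f X) (mblk X (msrc f)) (mblk X (mtgt f)) \<and> Mok X (mtgt f) \<and>
    m_normal X (mtgt f) \<bullet> m_arr f X = S.bw (map (cl X) (mstrands (msrc f))) (mbraid f) \<bullet> m_normal X (msrc f)"
proof (induction b f arbitrary: X rule: mvalid.induct)
  case (1 b)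
  then show ?case by (simp add: T_I m_normal_def)
next
  case (2 b c)
  have g: "Mok X (mgen_src c)" "c = Kappa \<Longrightarrow> bk" using 2 by auto
  then show ?case using mgen_normal[OF g] by simp
next
  case (3 b c)
  have s: "set (mvars (mgen_src c)) = set (mvars (mgen_tgt c))" by (cases c) auto
  have g: "Mok X (mgen_src c)" "c = Kappa \<Longrightarrow> bk" using 3 s by (auto simp: Mok_def)
  note h = mgen_normal[OF g]
  let ?w = "mbraid (MGen c)" and ?l = "map (cl X) (mstrands (mgen_src c))"
  have w: "mbraid (MGenInv c) = inv_word ?w" by (cases c) auto
  have p: "map (cl X) (mstrands (mgen_tgt c)) = perm stt ?w ?l" by (cases c) auto
  have ok: "list_all okc ?l" by (rule Mok_okc[OF g(1)])
  have B: "S.bw (perm stt ?w ?l) (inv_word ?w) \<bullet> S.bw ?l ?w = I ?l" "T (S.bw ?l ?w) ?l (perm stt ?w ?l)" "list_all okc (perm stt ?w ?l)"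
    "T (S.bw (perm stt ?w ?l) (inv_word ?w)) (perm stt ?w ?l) ?l"
  proof -
    have "S.bw (perm stt ?w ?l) (inv_word ?w) \<bullet> S.bw ?l ?w = I ?l \<and> T (S.bw ?l ?w) ?l (perm stt ?w ?l) \<and> list_all okc (perm stt ?w ?l)
      \<and> T (S.bw (perm stt ?w ?l) (inv_word ?w)) (perm stt ?w ?l) ?l"
    proof (cases "c = Kappa")
      case True
      then have k: bk "X 0 \<in> Ob A" using g by auto
      show ?thesis using True k S.kp_simps[OF bk_bs[OF k(1)] k(1), of "(X 0, False)"] S.kp_simps[OF bk_bs[OF k(1)] k(1), of "(X 0, True)"]
        by (simp add: T_def)
    next
      case False
      then show ?thesis using ok by (simp add: T_I)
    qed
    then show "S.bw (perm stt ?w ?l) (inv_word ?w) \<bullet> S.bw ?l ?w = I ?l" "T (S.bw ?l ?w) ?l (perm stt ?w ?l)" "list_all okc (perm stt ?w ?l)"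
      "T (S.bw (perm stt ?w ?l) (inv_word ?w)) (perm stt ?w ?l) ?l"
      by auto
  qed
  have n: "T (m_normal X (mgen_src c)) (mblk X (mgen_src c)) ?l" "T (m_normal X (mgen_tgt c)) (mblk X (mgen_tgt c)) (perm stt ?w ?l)"
    using m_normal_T[OF g(1)] m_normal_T[OF h(4)] p by auto
  have "S.bw (perm stt ?w ?l) (inv_word ?w) \<bullet> m_normal X (mgen_tgt c) = m_normal X (mgen_src c) \<bullet> mgen_arr_inv X c"
    by (rule conj_inverse[OF h(5)[symmetric]]) (use B n h(1,2,3) in \<open>simp_all add: T_def\<close>)
  then show ?case using h g(1) w p by simp
next
  case (4 b g f)
  then have v: "mvalid b g" "mvalid b f" "msrc g = mtgt f" by auto
  have F: "T (m_arr f X) (mblk X (msrc f)) (mblk X (mtgt f))" "Mok X (mtgt f)"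
    "m_normal X (mtgt f) \<bullet> m_arr f X = S.bw (map (cl X) (mstrands (msrc f))) (mbraid f) \<bullet> m_normal X (msrc f)"
    using 4 v by auto
  have G: "T (m_arr g X) (mblk X (msrc g)) (mblk X (mtgt g))" "Mok X (mtgt g)"
    "m_normal X (mtgt g) \<bullet> m_arr g X = S.bw (map (cl X) (mstrands (msrc g))) (mbraid g) \<bullet> m_normal X (msrc g)"
    using 4 v F(2) by auto
  let ?l = "map (cl X) (mstrands (msrc f))"
  have ok: "list_all okc ?l" by (rule Mok_okc) (use 4 in simp)
  have B: "S.bw ?l (mbraid g @ mbraid f) = S.bw (map (cl X) (mstrands (mtgt f))) (mbraid g) \<bullet> S.bw ?l (mbraid f)"
  proof (cases "b = Braided")
    case True
    then have b: bs bk using 4 by auto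
    have w: "wfw bk (length ?l) (mbraid f)" "wfw bk (length ?l) (mbraid g)"
      using mvalid_strands[OF v(2)] mvalid_strands[OF v(1)] mvalid_mvars(2)[OF v(2)] v(3) True b by simp_all
    have "map (cl X) (mstrands (mtgt f)) = perm stt (mbraid f) ?l"
      using mvalid_strands[OF v(2)] perm_map[of bk "mstrands (msrc f)" "mbraid f" UNIV "cl X" flip_sign stt] w(1) by simp
    then show ?thesis using S.bw_append[OF b(1) w(1) w(2) ok] by simp
  next
    case False
    have "mbraid f = []" "mbraid g = []" using Monoidal_mbraid[OF _ False] v by auto
    moreover then have "mstrands (mtgt f) = mstrands (msrc f)" using mvalid_strands[OF v(2)] by simp
    ultimately show ?thesis using ok by simp
  qed
  have "m_normal X (mtgt g) \<bullet> m_arr g X \<bullet> m_arr f X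
    = S.bw (map (cl X) (mstrands (mtgt f))) (mbraid g) \<bullet> m_normal X (mtgt f) \<bullet> m_arr f X"
    using cm_cong[OF G(3)] v(3) by (simp add: cm_assoc)
  also have "\<dots> = S.bw ?l (mbraid g @ mbraid f) \<bullet> m_normal X (msrc f)"
    unfolding F(3) B by (simp add: cm_assoc)
  finally show ?case using G v(3) T_cm[OF F(1), of "m_arr g X"] by simp
next
  case (5 b \<eta> \<mu> \<theta>s)
  let ?k = "length \<theta>s" and ?S = "\<lambda>i. map asrc \<theta>s ! i" and ?T = "\<lambda>i. map atgt \<theta>s ! i"
  let ?f = "MHor \<eta> \<mu> \<theta>s" and ?vs = "mstrands (msrc \<eta>)" and ?ws = "mstrands (mtgt \<eta>)"
  have v: "mvalid b \<eta>" "mvalid b \<mu>" and v\<theta>: "\<And>i. i < ?k \<Longrightarrow> avalid b (\<theta>s ! i)" and lin: "set (mvars (msrc \<eta>)) = {..<?k}"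
    using 5(3) by (auto simp: linear_def)
  have bb: "b = Braided \<Longrightarrow> bs \<and> bk" "b = Braided \<Longrightarrow> bs" using 5(4) by auto
  have v\<eta>t: "set (mvars (mtgt \<eta>)) = {..<?k}" using mvalid_mvars(1)[OF v(1)] lin by simp
  have Xs: "Xok X (?S i)" if "i < ?k" for i
    using 5(5) that lin by (auto simp: Xok_def Mok_def mvars_subst)
  have Xm: "Mok X (msrc \<mu>)" using 5(5) by (auto simp: Mok_def mvars_subst)
  define X1 where "X1 i = aob A X (?S i)" for i
  define X2 where "X2 i = map (\<lambda>\<theta>. aob A X (atgt \<theta>)) \<theta>s ! i" for i
  define g where "g i = map (\<lambda>\<theta>. aeval A \<sigma> \<theta> X) \<theta>s ! i" for i
  have Th: "aeval A \<sigma> (\<theta>s ! i) X \<in> hom A (aob A X (asrc (\<theta>s ! i))) (aob A X (atgt (\<theta>s ! i)))" "Xok X (atgt (\<theta>s ! i))"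
    "normal X (atgt (\<theta>s ! i)) d \<bullet> ae (aob A X (asrc (\<theta>s ! i))) (aob A X (atgt (\<theta>s ! i))) (aeval A \<sigma> (\<theta>s ! i) X) d
    = S.bw (map (cl X) (strands (asrc (\<theta>s ! i)) d)) (sgw (sign_word d (length (avars (asrc (\<theta>s ! i)))) (abraid (\<theta>s ! i)))) \<bullet> normal X (asrc (\<theta>s ! i)) d"
    if "i < ?k" for i d
    using aeval_normal[OF v\<theta>[OF that] bb(2), of X d] Xs[OF that] that by simp_all
  have Xt: "Xok X (?T i)" and X2t: "X2 i = aob A X (?T i)" and gi: "g i \<in> hom A (X1 i) (X2 i)"
    and X12: "X1 i \<in> Ob A" "X2 i \<in> Ob A" if "i < ?k" for i
    using Th(1,2)[OF that] Xs[OF that] that by (auto simp: X1_def X2_def g_def)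
  have X1\<eta>: "Mok X1 (msrc \<eta>)" and X2\<eta>: "Mok X2 (msrc \<eta>)" using X12 lin by (simp_all add: Mok_def)
  have E: "T (m_arr \<eta> X2) (mblk X2 (msrc \<eta>)) (mblk X2 (mtgt \<eta>))" "Mok X2 (mtgt \<eta>)"
    "m_normal X2 (mtgt \<eta>) \<bullet> m_arr \<eta> X2 = S.bw (map (cl X2) ?vs) (mbraid \<eta>) \<bullet> m_normal X2 (msrc \<eta>)"
    using 5(1)[OF v(1) bb(1) X2\<eta>] by auto
  have U: "T (m_arr \<mu> X) (mblk X (msrc \<mu>)) (mblk X (mtgt \<mu>))" "Mok X (mtgt \<mu>)"
    "m_normal X (mtgt \<mu>) \<bullet> m_arr \<mu> X = S.bw (map (cl X) (mstrands (msrc \<mu>))) (mbraid \<mu>) \<bullet> m_normal X (msrc \<mu>)"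
    using 5(2)[OF v(2) bb(1) Xm] by auto
  let ?R = "hl (\<lambda>t. ae (aob A X1 t) (aob A X2 t) (aar A g t) False) (margs (msrc \<eta>))"
  let ?FT = "\<lambda>v. normal X (?T (fst v)) (snd v)" and ?FS = "\<lambda>v. normal X (?S (fst v)) (snd v)"
  let ?G = "\<lambda>v. ae (X1 (fst v)) (X2 (fst v)) (g (fst v)) (snd v)"
  have ev: "m_arr ?f X = m_arr \<mu> X \<odot> (m_arr \<eta> X2 \<bullet> ?R)"
    by (simp add: X1_def[abs_def] X2_def[abs_def] g_def[abs_def])
  have R: "T ?R (mblk X1 (msrc \<eta>)) (mblk X2 (msrc \<eta>))" "m_normal X2 (msrc \<eta>) \<bullet> ?R = hl ?G ?vs \<bullet> m_normal X1 (msrc \<eta>)"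
    using m_normal_nat[of "msrc \<eta>" g X1 X2] gi lin by auto
  have okt: "Mok X (mtgt ?f)" using Xt v\<eta>t U(2) by (auto simp: Xok_def Mok_def mvars_subst)
  have X2e: "mblk (\<lambda>i. aob A X (?T i)) (mtgt \<eta>) = mblk X2 (mtgt \<eta>)" "m_normal (\<lambda>i. aob A X (?T i)) (mtgt \<eta>) = m_normal X2 (mtgt \<eta>)"
  proof -
    have "aob A (\<lambda>i. aob A X (?T i)) t = aob A X2 t" "normal (\<lambda>i. aob A X (?T i)) t e = normal X2 t e" if "t \<in> set (margs (mtgt \<eta>))" for t e
    proof -
      have "aob A X (?T i) = X2 i" if i: "i \<in> set (avars t)" for i
      proof -
        have "i \<in> set (mvars (mtgt \<eta>))" using i \<open>t \<in> _\<close> by (auto simp: mvars_margs)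
        then have "i < ?k" unfolding v\<eta>t by simp
        then show ?thesis using X2t by simp
      qed
      then show "aob A (\<lambda>i. aob A X (?T i)) t = aob A X2 t" "normal (\<lambda>i. aob A X (?T i)) t e = normal X2 t e"
        by (auto intro: aob_cong normal_cong)
    qed
    then show "mblk (\<lambda>i. aob A X (?T i)) (mtgt \<eta>) = mblk X2 (mtgt \<eta>)" "m_normal (\<lambda>i. aob A X (?T i)) (mtgt \<eta>) = m_normal X2 (mtgt \<eta>)"
      by (auto simp: mblk_def m_normal_def intro: hl_cong)
  qed
  have tyf: "T (m_arr ?f X) (mblk X (msrc ?f)) (mblk X (mtgt ?f))"
    unfolding ev using T_hz[OF U(1) T_cm[OF R(1) E(1)]] X2e(1) by (simp add: X1_def[abs_def])
  have natural: "m_normal X (mtgt ?f) = m_normal X (mtgt \<mu>) \<odot> (hl ?FT ?ws \<bullet> m_normal X2 (mtgt \<eta>))"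
    unfolding mtgt.simps X2e(2)[symmetric] by (rule m_normal_subst) (use Xt v\<eta>t U(2) in simp_all)
  have ns: "m_normal X (msrc ?f) = m_normal X (msrc \<mu>) \<odot> (hl ?FS ?vs \<bullet> m_normal X1 (msrc \<eta>))"
    unfolding msrc.simps X1_def[abs_def] by (rule m_normal_subst) (use Xs lin Xm in simp_all)
  let ?V = "{v :: nat \<times> bool. fst v < ?k}" and ?p = "map (cl X) (mstrands (msrc \<mu>))" and ?p' = "map (cl X) (mstrands (mtgt \<mu>))"
  let ?tb = "\<lambda>v. map (cl X) (strands (?T (fst v)) (snd v))" and ?sb = "\<lambda>v. map (cl X) (strands (?S (fst v)) (snd v))"
  let ?wt = "\<lambda>v. sign_word (snd v) (length (avars (?S (fst v)))) (abraid (\<theta>s ! fst v))"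
  let ?B = "\<lambda>v. S.bw (?sb v) (sgw (?wt v))"
  have V: "v \<in> ?V" if "v \<in> set ?vs" for v
    using that fst_mstrands[of "msrc \<eta>"] lin by (auto simp: set_eq_iff image_iff)
  have St: "strands (?T (fst v)) (snd v) = perm flip_sign (sgw (?wt v)) (strands (?S (fst v)) (snd v))"
    "fst ` set (abraid (\<theta>s ! fst v)) \<subseteq> {1..<length (avars (?S (fst v)))}" if "v \<in> ?V" for v
    using avalid_strands[OF v\<theta>, of "fst v" "snd v"] that by auto
  have wt: "fst ` set (?wt v) \<subseteq> {1..<length (?sb v)}" if "v \<in> ?V" for v using set_sign_word[OF St(2)[OF that]] by simp
  have ok: "list_all okc (?sb v)" if "v \<in> ?V" for v
    using Xs[of "fst v"] that in_strands[of _ "?S (fst v)" "snd v"] by (fastforce simp: list_all_iff Xok_def)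
  have pt: "perm stt (sgw (?wt v)) (?sb v) = ?tb v" if "v \<in> ?V" for v
  proof -
    have "wfw True (length (strands (?S (fst v)) (snd v))) (sgw (?wt v))" using wt[OF that] by (simp add: wfw_sgw)
    then show ?thesis unfolding St(1)[OF that] using perm_map[of True _ "sgw (?wt v)" UNIV "cl X" flip_sign stt] by simp
  qed
  have op: "list_all okc ?p" "list_all okc ?p'" by (rule Mok_okc[OF Xm], rule Mok_okc[OF U(2)])
  have cFT: "concat (map (\<lambda>v. [cl X2 v]) ?vs) = map (cl X2) ?vs" by (rule concat_single) simp
  have "T (hl ?FT ?vs) (concat (map (\<lambda>v. [cl X2 v]) ?vs)) (concat (map ?tb ?vs))"
    using V Xt X2t by (intro T_hl) (auto simp: T_def cl_def)
  then have hF: "T (hl ?FT ?vs) (map (cl X2) ?vs) (concat (map ?tb ?vs))" unfolding cFT .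
  obtain C where C: "T C (?p' @ concat (map ?tb ?vs)) (?p' @ concat (map ?tb ?ws))"
     "S.bw (?p @ concat (map ?sb ?vs)) (mbraid ?f) = C \<bullet> (S.bw ?p (mbraid \<mu>) \<odot> hl ?B ?vs)"
     "C \<bullet> (I ?p' \<odot> hl ?FT ?vs) = I ?p' \<odot> (hl ?FT ?ws \<bullet> S.bw (map (cl X2) ?vs) (mbraid \<eta>))"
     "T (S.bw ?p (mbraid \<mu>)) ?p ?p'" "T (S.bw (map (cl X2) ?vs) (mbraid \<eta>)) (map (cl X2) ?vs) (map (cl X2) ?ws)"
  proof (cases "b = Braided")
    case True
    then have bs: bs and bk: bk using bb by auto
    let ?ps = "place (map (\<lambda>\<theta>. (length (avars (asrc \<theta>)), abraid \<theta>)) \<theta>s) ?vs"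
    have cab: "S.cabled ?V flip_sign (cl X2) ?tb ?FT"
      unfolding S.cabled_def
    proof (intro ballI conjI)
      fix v assume v: "v \<in> ?V"
      then have o: "Xok X (?T (fst v))" using Xt by simp
      show "flip_sign v \<in> ?V" "flip_sign (flip_sign v) = v" "cl X2 (flip_sign v) = stt (cl X2 v)" using v by simp_all
      show "?tb (flip_sign v) = S.du (?tb v)" by (simp add: strands_not S.du_def rev_map)
      show "src (?FT v) = [cl X2 v]" "tgt (?FT v) = ?tb v" using o X2t v by (simp_all add: cl_def)
      show "S.dual (?FT v) (?FT (flip_sign v))" using dual_normal[OF bs o] by simp
    qed
    have sb: "list_all okc (?sb v) \<and> length (?sb (flip_sign v)) = length (?sb v) \<and> fst ` set (?wt v) \<subseteq> {1..<length (?sb v)} \<and>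
      perm stt (sgw (?wt v)) (?sb v) = ?tb v" if "v \<in> ?V" for v
      using ok[OF that] wt[OF that] pt[OF that] by simp
    have V0: "set ?vs \<subseteq> ?V" using V by blast
    have w: "wfw bk (length ?vs) (mbraid \<eta>)" "wfw bk (length ?p) (mbraid \<mu>)"
      using mvalid_strands[OF v(1)] mvalid_strands[OF v(2)] True bk by simp_all
    have p': "?p' = perm stt (mbraid \<mu>) ?p"
      using mvalid_strands[OF v(2)] perm_map[of bk "mstrands (msrc \<mu>)" "mbraid \<mu>" UNIV "cl X" flip_sign stt] w(2) by simp
    have pv: "map (cl X2) ?ws = perm stt (mbraid \<eta>) (map (cl X2) ?vs)" "?ws = perm flip_sign (mbraid \<eta>) ?vs"
      using mvalid_strands[OF v(1)] perm_map[of bk "mstrands (msrc \<eta>)" "mbraid \<eta>" UNIV "cl X2" flip_sign stt] w(1) by simp_all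
    have ps: "?ps = map (\<lambda>v. (length (?sb v), ?wt v)) ?vs"
      using V0 by (subst hor_place) auto
    have m: "length (mvars (msrc \<mu>)) = length ?p" by simp
    have U': "mbraid ?f = fst (mcable (length (mvars (msrc \<mu>))) (map fst ?ps) (mbraid \<eta>)) @ mbraid \<mu> @ sgw (juxtapose (length (mvars (msrc \<mu>))) ?ps)"
      by (simp add: Let_def sig_sgw del: mcable.simps)
    obtain C where c: "T C (?p' @ concat (map ?tb ?vs)) (?p' @ concat (map ?tb ?ws))"
     "S.bw (?p @ concat (map ?sb ?vs)) (mbraid ?f) = C \<bullet> (S.bw ?p (mbraid \<mu>) \<odot> hl ?B ?vs)"
     "C \<bullet> (I ?p' \<odot> hl ?FT ?vs) = I ?p' \<odot> (hl ?FT ?ws \<bullet> S.bw (map (cl X2) ?vs) (mbraid \<eta>))"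
      using S.mhor(3)[OF bs cab V0 sb w(1) op(1) w(2) p' m ps U'] unfolding pv(2)[symmetric] by blast
    have "T (S.bw ?p (mbraid \<mu>)) ?p ?p'" using S.T_bw[OF bs w(2) op(1)] p' by simp
    moreover have "T (S.bw (map (cl X2) ?vs) (mbraid \<eta>)) (map (cl X2) ?vs) (map (cl X2) ?ws)"
      using S.T_bw[OF bs _ T_okD(1)[OF hF]] w(1) pv(1) by simp
    ultimately show thesis using that c by blast
  next
    case nb: False
    have n: "mbraid ?f = []" "mbraid \<eta> = []" "mbraid \<mu> = []" "\<And>v. v \<in> ?V \<Longrightarrow> abraid (\<theta>s ! fst v) = []"
      using Monoidal_mbraid[OF 5(3) nb] Monoidal_mbraid[OF v(1) nb] Monoidal_mbraid[OF v(2) nb] Monoidal_abraid[OF v\<theta> nb] by auto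
    have p: "?ws = ?vs" "?p' = ?p" using mvalid_strands[OF v(1)] mvalid_strands[OF v(2)] n by simp_all
    have tb: "?tb v = ?sb v" if "v \<in> ?V" for v using St(1)[OF that] n(4)[OF that] by simp
    have m: "map ?tb ?vs = map ?sb ?vs" by (rule map_cong[OF HOL.refl]) (rule tb[OF V])
    have o: "list_all okc (concat (map ?sb ?vs))" using ok V by (force simp: list_all_iff)
    have o2: "list_all okc (map (cl X2) ?vs)" using X12(2) V by (force simp: list_all_iff)
    have hB: "hl ?B ?vs = I (concat (map ?sb ?vs))"
    proof -
      have "hl ?B ?vs = hl (\<lambda>v. I (?sb v)) ?vs" using n(4) V by (intro hl_cong) auto
      then show ?thesis using ok V hl_I[of ?vs ?sb] by auto
    qed
    show thesis
    proof (rule that[of "I (?p @ concat (map ?sb ?vs))"])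
      show "T (I (?p @ concat (map ?sb ?vs))) (?p' @ concat (map ?tb ?vs)) (?p' @ concat (map ?tb ?ws))"
        unfolding p m using o op by (intro T_I) simp
      show "S.bw (?p @ concat (map ?sb ?vs)) (mbraid ?f) = I (?p @ concat (map ?sb ?vs)) \<bullet> (S.bw ?p (mbraid \<mu>) \<odot> hl ?B ?vs)"
        unfolding hB n(1,3) using o op by (simp add: hz_I)
      show "I (?p @ concat (map ?sb ?vs)) \<bullet> (I ?p' \<odot> hl ?FT ?vs) = I ?p' \<odot> (hl ?FT ?ws \<bullet> S.bw (map (cl X2) ?vs) (mbraid \<eta>))"
        unfolding p n(2) using hF o2 op m by (simp add: T_def)
      show "T (S.bw ?p (mbraid \<mu>)) ?p ?p'" unfolding n(3) p using op by (simp add: T_I)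
      show "T (S.bw (map (cl X2) ?vs) (mbraid \<eta>)) (map (cl X2) ?vs) (map (cl X2) ?ws)" unfolding n(2) p using o2 by (simp add: T_I)
    qed
  qed
  have tg: "T (?G v) [cl X1 v] [cl X2 v] \<and> T (?FT v) [cl X2 v] (?tb v)" if "v \<in> set ?vs" for v
    using V[OF that] X12 gi Xt X2t by (simp add: T_def cl_def)
  have ts: "T (?FS v) [cl X1 v] (?sb v) \<and> T (?B v) (?sb v) (?tb v)" if "v \<in> set ?vs" for v
  proof -
    have v: "v \<in> ?V" using V[OF that] .
    have "T (?FS v) [cl X1 v] (?sb v)" using v Xs by (simp add: T_def cl_def X1_def)
    moreover have "T (?B v) (?sb v) (?tb v)"
    proof (cases bs)
      case True
      have "wfw bk (length (?sb v)) (sgw (?wt v))" unfolding wfw_sgw using wt[OF v] .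
      then show ?thesis using S.T_bw[OF True _ ok[OF v]] pt[OF v] by metis
    next
      case False
      then have nb: "b \<noteq> Braided" using 5(4) by auto
      have "abraid (\<theta>s ! fst v) = []" using Monoidal_abraid[OF v\<theta> nb] v by simp
      then have w0: "sgw (?wt v) = []" by simp
      then show ?thesis using ok[OF v] pt[OF v] unfolding w0 by (simp add: T_I)
    qed
    ultimately show ?thesis by blast
  qed
  have hFG: "hl ?FT ?vs \<bullet> hl ?G ?vs = hl ?B ?vs \<bullet> hl ?FS ?vs"
  proof -
    have "hl ?FT ?vs \<bullet> hl ?G ?vs = hl (\<lambda>v. ?FT v \<bullet> ?G v) ?vs" by (rule hl_cm[OF tg, symmetric])
    also have "\<dots> = hl (\<lambda>v. ?B v \<bullet> ?FS v) ?vs"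
    proof (rule hl_cong)
      fix v assume "v \<in> set ?vs"
      then have v: "fst v < ?k" using V by blast
      show "?FT v \<bullet> ?G v = ?B v \<bullet> ?FS v"
        using Th(3)[OF v, of "snd v"] v by (simp add: X1_def X2_def g_def)
    qed
    also have "\<dots> = hl ?B ?vs \<bullet> hl ?FS ?vs" by (rule hl_cm[OF ts])
    finally show ?thesis .
  qed
  have hB: "T (hl ?B ?vs) (concat (map ?sb ?vs)) (concat (map ?tb ?vs))" by (rule T_hl) (use ts in blast)
  have "T (hl ?FS ?vs) (concat (map (\<lambda>v. [cl X1 v]) ?vs)) (concat (map ?sb ?vs))" by (rule T_hl) (use ts in blast)
  then have hS: "T (hl ?FS ?vs) (map (cl X1) ?vs) (concat (map ?sb ?vs))"
    using concat_single[of ?vs "\<lambda>v. [cl X1 v]" "cl X1"] by simp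
  have "T (hl ?G ?vs) (concat (map (\<lambda>v. [cl X1 v]) ?vs)) (concat (map (\<lambda>v. [cl X2 v]) ?vs))" by (rule T_hl) (use tg in blast)
  then have hG: "T (hl ?G ?vs) (map (cl X1) ?vs) (map (cl X2) ?vs)"
    using concat_single[of ?vs "\<lambda>v. [cl X1 v]" "cl X1"] cFT by simp
  have Wt: "concat (map ?tb ?ws) = tgt (hl ?FT ?ws)" "arr (hl ?FT ?ws)" "src (hl ?FT ?ws) = map (cl X2) ?ws"
  proof -
    have w: "fst v < ?k" if "v \<in> set ?ws" for v
      using that fst_mstrands[of "mtgt \<eta>"] v\<eta>t by (auto simp: set_eq_iff image_iff)
    have "T (hl ?FT ?ws) (concat (map (\<lambda>v. [cl X2 v]) ?ws)) (concat (map ?tb ?ws))"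
      using w Xt X2t by (intro T_hl) (auto simp: T_def cl_def)
    then show "concat (map ?tb ?ws) = tgt (hl ?FT ?ws)" "arr (hl ?FT ?ws)" "src (hl ?FT ?ws) = map (cl X2) ?ws"
      using concat_single[of ?ws "\<lambda>v. [cl X2 v]" "cl X2"] by (simp_all add: T_def)
  qed
  have L: "map (cl X) (mstrands (msrc ?f)) = ?p @ concat (map ?sb ?vs)"
    by (simp add: mstrands_subst map_concat comp_def)
  note n1 = m_normal_T[OF Xm] and n2 = m_normal_T[OF U(2)] and n3 = m_normal_T[OF X1\<eta>] and n4 = m_normal_T[OF X2\<eta>] and n5 = m_normal_T[OF E(2)]
  note td = T_D[OF n1] T_D[OF n2] T_D[OF n3] T_D[OF n4] T_D[OF n5] T_D[OF hB] T_D[OF hS] T_D[OF hG] T_D[OF hF] Wt(2,3)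
    T_D[OF U(1)] T_D[OF E(1)] T_D[OF R(1)] T_D[OF C(4)] T_D[OF C(5)] op
  \<comment> \<open>The interchange law separates the part next to the pole from the part behind it;
    then \<open>C\<close> exchanges the outer word with the inner canonical arrows.\<close>
  have "m_normal X (mtgt ?f) \<bullet> m_arr ?f X = (m_normal X (mtgt \<mu>) \<bullet> m_arr \<mu> X) \<odot> (hl ?FT ?ws \<bullet> (m_normal X2 (mtgt \<eta>) \<bullet> m_arr \<eta> X2) \<bullet> ?R)"
    unfolding natural ev by (simp add: interchange td cm_assoc)
  also have "(m_normal X2 (mtgt \<eta>) \<bullet> m_arr \<eta> X2) \<bullet> ?R = S.bw (map (cl X2) ?vs) (mbraid \<eta>) \<bullet> hl ?G ?vs \<bullet> m_normal X1 (msrc \<eta>)"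
    unfolding E(3) R(2)[symmetric] by (simp only: cm_assoc)
  also have "(m_normal X (mtgt \<mu>) \<bullet> m_arr \<mu> X) \<odot> (hl ?FT ?ws \<bullet> S.bw (map (cl X2) ?vs) (mbraid \<eta>) \<bullet> hl ?G ?vs \<bullet> m_normal X1 (msrc \<eta>))
     = (I ?p' \<odot> (hl ?FT ?ws \<bullet> S.bw (map (cl X2) ?vs) (mbraid \<eta>))) \<bullet>
       ((S.bw ?p (mbraid \<mu>) \<bullet> m_normal X (msrc \<mu>)) \<odot> (hl ?G ?vs \<bullet> m_normal X1 (msrc \<eta>)))"
    unfolding U(3) by (simp add: interchange td cm_assoc)
  also have "\<dots> = C \<bullet> (I ?p' \<odot> hl ?FT ?vs) \<bullet> ((S.bw ?p (mbraid \<mu>) \<bullet> m_normal X (msrc \<mu>)) \<odot> (hl ?G ?vs \<bullet> m_normal X1 (msrc \<eta>)))"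
    unfolding C(3)[symmetric] by (simp only: cm_assoc)
  also have "(I ?p' \<odot> hl ?FT ?vs) \<bullet> ((S.bw ?p (mbraid \<mu>) \<bullet> m_normal X (msrc \<mu>)) \<odot> (hl ?G ?vs \<bullet> m_normal X1 (msrc \<eta>)))
     = (S.bw ?p (mbraid \<mu>) \<bullet> m_normal X (msrc \<mu>)) \<odot> ((hl ?FT ?vs \<bullet> hl ?G ?vs) \<bullet> m_normal X1 (msrc \<eta>))"
    by (simp add: interchange td cm_assoc)
  also have "\<dots> = (S.bw ?p (mbraid \<mu>) \<odot> hl ?B ?vs) \<bullet> m_normal X (msrc ?f)"
    unfolding hFG ns by (simp add: interchange td cm_assoc)
  also have "C \<bullet> \<dots> = S.bw (map (cl X) (mstrands (msrc ?f))) (mbraid ?f) \<bullet> m_normal X (msrc ?f)"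
    unfolding L C(2) by (simp only: cm_assoc)
  finally show ?case using tyf okt by blast
qed

end

section \<open>Natural transformations of module functors\<close>

context category begin

lemma Ar_hom: "f \<in> Ar C \<longleftrightarrow> f \<in> hom C (dm C f) (cd C f)"
  by (simp add: hom_def)

lemma cmp_simps:
  assumes "f \<in> Ar C" "g \<in> Ar C" "dm C g = cd C f"
  shows "g \<cdot> f \<in> Ar C" "dm C (g \<cdot> f) = dm C f" "cd C (g \<cdot> f) = cd C g"
proof -
  have "g \<cdot> f \<in> hom C (dm C f) (cd C g)" using assms by (intro cmp_hom[of _ _ "cd C f"]) (auto simp: hom_def)
  then show "g \<cdot> f \<in> Ar C" "dm C (g \<cdot> f) = dm C f" "cd C (g \<cdot> f) = cd C g" by (auto simp: hom_def)
qed

lemma cmp_assoc':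
  assumes "f \<in> Ar C" "g \<in> Ar C" "h \<in> Ar C" "dm C g = cd C f" "dm C h = cd C g"
  shows "(h \<cdot> g) \<cdot> f = h \<cdot> g \<cdot> f"
  by (rule cmp_assoc[of f "dm C f" "cd C f" g "cd C g" h "cd C h"]) (use assms in \<open>auto simp: hom_def\<close>)

lemma ide_simps: "X \<in> Ob C \<Longrightarrow> ide C X \<in> Ar C" "X \<in> Ob C \<Longrightarrow> dm C (ide C X) = X" "X \<in> Ob C \<Longrightarrow> cd C (ide C X) = X"
    "f \<in> Ar C \<Longrightarrow> cd C f = X \<Longrightarrow> ide C X \<cdot> f = f" "f \<in> Ar C \<Longrightarrow> dm C f = X \<Longrightarrow> f \<cdot> ide C X = f"
    "f \<in> Ar C \<Longrightarrow> dm C f \<in> Ob C" "f \<in> Ar C \<Longrightarrow> cd C f \<in> Ob C"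
  using ide_hom[of X] cmp_ide[of f "dm C f" "cd C f"] dm_cd[of f] by (auto simp: hom_def)

end

context Z2_monoidal_pair begin

lemmas Msimps [simp] = M.cmp_simps M.cmp_assoc' M.ide_simps

lemma act_simps [simp]:
  "P \<in> Ob M \<Longrightarrow> X \<in> Ob A \<Longrightarrow> P \<triangleleft>\<^bsub>M\<^esub> X \<in> Ob M"
  "P \<in> Ob M \<Longrightarrow> X \<in> Ob A \<Longrightarrow> ide M P \<unlhd>\<^bsub>M\<^esub> ide A X = ide M (P \<triangleleft>\<^bsub>M\<^esub> X)"
  using is_functorD(1,2)[OF act_functor, of "(P, X)"] by (simp_all add: prod_cat_simps)

lemma act_hom: "u \<in> hom M P Q \<Longrightarrow> f \<in> hom A X Y \<Longrightarrow> u \<unlhd>\<^bsub>M\<^esub> f \<in> hom M (P \<triangleleft>\<^bsub>M\<^esub> X) (Q \<triangleleft>\<^bsub>M\<^esub> Y)"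
  using is_functorD(3)[OF act_functor, of "(u, f)" "(P, X)" "(Q, Y)"] by (simp add: hom_prod)

lemma act_Ar [simp]:
  assumes "u \<in> Ar M" "f \<in> hom A X Y"
  shows "u \<unlhd>\<^bsub>M\<^esub> f \<in> Ar M" "dm M (u \<unlhd>\<^bsub>M\<^esub> f) = dm M u \<triangleleft>\<^bsub>M\<^esub> X" "cd M (u \<unlhd>\<^bsub>M\<^esub> f) = cd M u \<triangleleft>\<^bsub>M\<^esub> Y"
  using act_hom[OF M.Ar_hom[THEN iffD1, OF assms(1)] assms(2)] by (auto simp: hom_def)

lemma act_cmp:
  assumes "u \<in> Ar M" "v \<in> Ar M" "dm M v = cd M u" "f \<in> hom A X Y" "g \<in> hom A Y Z"
  shows "(v \<unlhd>\<^bsub>M\<^esub> g) \<cdot>\<^bsub>M\<^esub> (u \<unlhd>\<^bsub>M\<^esub> f) = (v \<cdot>\<^bsub>M\<^esub> u) \<unlhd>\<^bsub>M\<^esub> (g \<cdot> f)"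
  using is_functorD(4)[OF act_functor, of "(u, f)" "(dm M u, X)" "(cd M u, Y)" "(v, g)" "(cd M v, Z)"] assms
  by (simp add: hom_prod prod_cat_simps) (simp add: hom_def)

text \<open>The first strand of the list acts first, so the concatenation of lists corresponds to
  the composition of actions.\<close>

definition act :: "'p \<Rightarrow> ('o \<times> bool) list \<Rightarrow> 'p" where "act Q l = foldl (\<lambda>P c. P \<triangleleft>\<^bsub>M\<^esub> ob c) Q l"

definition actm :: "'b \<Rightarrow> ('o \<times> bool) list \<Rightarrow> 'b" where "actm u l = foldl (\<lambda>u c. u \<unlhd>\<^bsub>M\<^esub> ide A (ob c)) u l"

abbreviation "okl l \<equiv> list_all (\<lambda>c. fst c \<in> Ob A) l"

lemma act_list [simp]: "act Q [] = Q" "act Q (c # l) = act (Q \<triangleleft>\<^bsub>M\<^esub> ob c) l" "act Q (k @ l) = act (act Q k) l"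
   "actm u [] = u" "actm u (c # l) = actm (u \<unlhd>\<^bsub>M\<^esub> ide A (ob c)) l" "actm u (k @ l) = actm (actm u k) l"
  by (simp_all add: act_def actm_def)

lemma act_Ob [simp]: "okl l \<Longrightarrow> Q \<in> Ob M \<Longrightarrow> act Q l \<in> Ob M"
  by (induction l arbitrary: Q) auto

lemma actm_typ: "okl l \<Longrightarrow> u \<in> Ar M \<Longrightarrow> actm u l \<in> Ar M \<and> dm M (actm u l) = act (dm M u) l \<and> cd M (actm u l) = act (cd M u) l"
  by (induction l arbitrary: u) (auto simp: act_Ar[OF _ ide_hom])

lemma actm_simps [simp]:
  assumes "okl l" "u \<in> Ar M"
  shows "actm u l \<in> Ar M" "dm M (actm u l) = act (dm M u) l" "cd M (actm u l) = act (cd M u) l"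
  using actm_typ[OF assms] by auto

lemma actm_ide [simp]: "okl l \<Longrightarrow> Q \<in> Ob M \<Longrightarrow> actm (ide M Q) l = ide M (act Q l)"
  by (induction l arbitrary: Q) auto

lemma actm_cmp: "okl l \<Longrightarrow> u \<in> Ar M \<Longrightarrow> v \<in> Ar M \<Longrightarrow> dm M v = cd M u \<Longrightarrow> actm (v \<cdot>\<^bsub>M\<^esub> u) l = actm v l \<cdot>\<^bsub>M\<^esub> actm u l"
proof (induction l arbitrary: u v)
  case (Cons c l)
  then have c: "ide A (ob c) \<in> hom A (ob c) (ob c)" by simp
  have "actm ((v \<cdot>\<^bsub>M\<^esub> u) \<unlhd>\<^bsub>M\<^esub> (ide A (ob c) \<cdot> ide A (ob c))) l = actm (v \<unlhd>\<^bsub>M\<^esub> ide A (ob c)) l \<cdot>\<^bsub>M\<^esub> actm (u \<unlhd>\<^bsub>M\<^esub> ide A (ob c)) l"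
    unfolding act_cmp[OF Cons.prems(2-4) c c, symmetric] using Cons act_Ar[OF _ c] by simp
  then show ?case using cmp_ide[OF c] by simp
qed simp

text \<open>Natural transformations between iterated actions.  \<open>None\<close> is the absorbing non-arrow, and components
  outside \<open>Ob M\<close> are undefined, so that arrows are determined by their components.\<close>

definition sr :: "(('o \<times> bool) list \<times> ('o \<times> bool) list \<times> ('p \<Rightarrow> 'b)) option \<Rightarrow> ('o \<times> bool) list" where "sr e = fst (the e)"
definition tg :: "(('o \<times> bool) list \<times> ('o \<times> bool) list \<times> ('p \<Rightarrow> 'b)) option \<Rightarrow> ('o \<times> bool) list" where "tg e = fst (snd (the e))"
definition cp :: "(('o \<times> bool) list \<times> ('o \<times> bool) list \<times> ('p \<Rightarrow> 'b)) option \<Rightarrow> 'p \<Rightarrow> 'b" where "cp e = snd (snd (the e))"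

definition vl :: "(('o \<times> bool) list \<times> ('o \<times> bool) list \<times> ('p \<Rightarrow> 'b)) option \<Rightarrow> bool" where
  "vl e \<longleftrightarrow> e \<noteq> None \<and> okl (sr e) \<and> okl (tg e) \<and>
    (\<forall>Q \<in> Ob M. cp e Q \<in> hom M (act Q (sr e)) (act Q (tg e))) \<and>
    (\<forall>u \<in> Ar M. cp e (cd M u) \<cdot>\<^bsub>M\<^esub> actm u (sr e) = actm u (tg e) \<cdot>\<^bsub>M\<^esub> cp e (dm M u)) \<and>
    (\<forall>Q. Q \<notin> Ob M \<longrightarrow> cp e Q = undefined)"

definition mk :: "('o \<times> bool) list \<Rightarrow> ('o \<times> bool) list \<Rightarrow> ('p \<Rightarrow> 'b) \<Rightarrow> (('o \<times> bool) list \<times> ('o \<times> bool) list \<times> ('p \<Rightarrow> 'b)) option" where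
  "mk a b \<phi> = Some (a, b, \<lambda>Q. if Q \<in> Ob M then \<phi> Q else undefined)"

lemma mk_simps [simp]: "sr (mk a b \<phi>) = a" "tg (mk a b \<phi>) = b" "Q \<in> Ob M \<Longrightarrow> cp (mk a b \<phi>) Q = \<phi> Q"
  by (simp_all add: mk_def sr_def tg_def cp_def)

lemma vl_mk:
  assumes "okl a" "okl b" "\<And>Q. Q \<in> Ob M \<Longrightarrow> \<phi> Q \<in> hom M (act Q a) (act Q b)"
    "\<And>u P Q. u \<in> hom M P Q \<Longrightarrow> \<phi> Q \<cdot>\<^bsub>M\<^esub> actm u a = actm u b \<cdot>\<^bsub>M\<^esub> \<phi> P"
  shows "vl (mk a b \<phi>)"
proof -
  have "\<phi> (cd M u) \<cdot>\<^bsub>M\<^esub> actm u a = actm u b \<cdot>\<^bsub>M\<^esub> \<phi> (dm M u)" if "u \<in> Ar M" for u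
    using assms(4) that by (auto simp: M.Ar_hom)
  moreover have "mk a b \<phi> \<noteq> None" "\<And>Q. Q \<notin> Ob M \<Longrightarrow> cp (mk a b \<phi>) Q = undefined" by (simp_all add: mk_def cp_def)
  ultimately show ?thesis using assms(1-3) by (simp add: vl_def)
qed

lemma vl_None [simp]: "\<not> vl None"
  by (simp add: vl_def)

lemma cp_simps [simp]:
  assumes "vl e"
  shows "okl (sr e)" "okl (tg e)" "Q \<in> Ob M \<Longrightarrow> cp e Q \<in> Ar M" "Q \<in> Ob M \<Longrightarrow> dm M (cp e Q) = act Q (sr e)"
    "Q \<in> Ob M \<Longrightarrow> cd M (cp e Q) = act Q (tg e)"
proof -
  show "okl (sr e)" "okl (tg e)" using assms unfolding vl_def by blast+
  have "Q \<in> Ob M \<Longrightarrow> cp e Q \<in> hom M (act Q (sr e)) (act Q (tg e))" using assms unfolding vl_def by blast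
  then show "Q \<in> Ob M \<Longrightarrow> cp e Q \<in> Ar M" "Q \<in> Ob M \<Longrightarrow> dm M (cp e Q) = act Q (sr e)"
    "Q \<in> Ob M \<Longrightarrow> cd M (cp e Q) = act Q (tg e)" by (auto simp: hom_def)
qed

lemma cp_nat: "vl e \<Longrightarrow> u \<in> Ar M \<Longrightarrow> cp e (cd M u) \<cdot>\<^bsub>M\<^esub> actm u (sr e) = actm u (tg e) \<cdot>\<^bsub>M\<^esub> cp e (dm M u)"
  unfolding vl_def by blast

lemma vl_eqI:
  assumes "vl e" "vl e'" "sr e = sr e'" "tg e = tg e'" "\<And>Q. Q \<in> Ob M \<Longrightarrow> cp e Q = cp e' Q"
  shows "e = e'"
proof -
  have u: "cp e Q = undefined" "cp e' Q = undefined" if "Q \<notin> Ob M" for Q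
    using assms(1,2) that unfolding vl_def by blast+
  have "cp e Q = cp e' Q" for Q using assms(5)[of Q] u[of Q] by (cases "Q \<in> Ob M") simp_all
  then have "cp e = cp e'" by (rule ext)
  moreover obtain x y where "e = Some x" "e' = Some y" using assms(1,2) unfolding vl_def not_None_eq by blast
  ultimately show ?thesis using assms(3,4) by (simp add: sr_def tg_def cp_def prod_eq_iff)
qed

definition vc where "vc g f = (if vl g \<and> vl f \<and> sr g = tg f then mk (sr f) (tg g) (\<lambda>Q. cp g Q \<cdot>\<^bsub>M\<^esub> cp f Q) else None)"

text \<open>\<open>f\<close> is next to the object of \<open>M\<close>: its component is whiskered
  by the source of \<open>g\<close>, and \<open>g\<close> is taken at the target of
  \<open>f\<close>. By naturality of \<open>g\<close> the other order gives the same.\<close>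

definition hc where "hc f g = (if vl f \<and> vl g then mk (sr f @ sr g) (tg f @ tg g)
    (\<lambda>Q. cp g (act Q (tg f)) \<cdot>\<^bsub>M\<^esub> actm (cp f Q) (sr g)) else None)"

definition vi where "vi a = mk a a (\<lambda>Q. ide M (act Q a))"

lemma vl_vi [simp]: "okl a \<Longrightarrow> vl (vi a)"
  unfolding vi_def by (intro vl_mk) (auto simp: hom_def)

lemma vi_simps [simp]: "sr (vi a) = a" "tg (vi a) = a" "Q \<in> Ob M \<Longrightarrow> cp (vi a) Q = ide M (act Q a)"
  by (simp_all add: vi_def)

lemma vl_vc [simp]: "vl (vc g f) \<longleftrightarrow> vl g \<and> vl f \<and> sr g = tg f"
proof (cases "vl g \<and> vl f \<and> sr g = tg f")
  case True
  have "vl (mk (sr f) (tg g) (\<lambda>Q. cp g Q \<cdot>\<^bsub>M\<^esub> cp f Q))"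
  proof (rule vl_mk)
    fix u P Q assume "u \<in> hom M P Q"
    then have u: "u \<in> Ar M" "dm M u = P" "cd M u = Q" "P \<in> Ob M" "Q \<in> Ob M" using M.homD by auto
    have "(cp g Q \<cdot>\<^bsub>M\<^esub> cp f Q) \<cdot>\<^bsub>M\<^esub> actm u (sr f) = cp g Q \<cdot>\<^bsub>M\<^esub> (actm u (tg f) \<cdot>\<^bsub>M\<^esub> cp f P)"
      using True u cp_nat[of f u] by simp
    also have "\<dots> = (cp g Q \<cdot>\<^bsub>M\<^esub> actm u (sr g)) \<cdot>\<^bsub>M\<^esub> cp f P"
      using True u by simp
    also have "\<dots> = actm u (tg g) \<cdot>\<^bsub>M\<^esub> cp g P \<cdot>\<^bsub>M\<^esub> cp f P"
      using True u cp_nat[of g u] by simp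
    finally show "(cp g Q \<cdot>\<^bsub>M\<^esub> cp f Q) \<cdot>\<^bsub>M\<^esub> actm u (sr f) = actm u (tg g) \<cdot>\<^bsub>M\<^esub> cp g P \<cdot>\<^bsub>M\<^esub> cp f P" .
  qed (use True in \<open>auto simp: hom_def\<close>)
  then show ?thesis using True by (simp add: vc_def)
next
  case False
  have n: "vc g f = None" unfolding vc_def using False by (rule if_not_P)
  show ?thesis unfolding n using False vl_None by blast
qed

lemma vc_simps [simp]:
  assumes "vl g" "vl f" "sr g = tg f"
  shows "sr (vc g f) = sr f" "tg (vc g f) = tg g" "Q \<in> Ob M \<Longrightarrow> cp (vc g f) Q = cp g Q \<cdot>\<^bsub>M\<^esub> cp f Q"
  using assms by (simp_all add: vc_def)

lemma vl_hc [simp]: "vl (hc f g) \<longleftrightarrow> vl f \<and> vl g"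
proof (cases "vl f \<and> vl g")
  case True
  have "vl (mk (sr f @ sr g) (tg f @ tg g) (\<lambda>Q. cp g (act Q (tg f)) \<cdot>\<^bsub>M\<^esub> actm (cp f Q) (sr g)))"
  proof (rule vl_mk)
    fix u P Q assume "u \<in> hom M P Q"
    then have u: "u \<in> Ar M" "dm M u = P" "cd M u = Q" "P \<in> Ob M" "Q \<in> Ob M" using M.homD by auto
    have "(cp g (act Q (tg f)) \<cdot>\<^bsub>M\<^esub> actm (cp f Q) (sr g)) \<cdot>\<^bsub>M\<^esub> actm u (sr f @ sr g)
      = cp g (act Q (tg f)) \<cdot>\<^bsub>M\<^esub> actm (cp f Q \<cdot>\<^bsub>M\<^esub> actm u (sr f)) (sr g)"
      using True u by (simp add: actm_cmp)
    also have "\<dots> = (cp g (act Q (tg f)) \<cdot>\<^bsub>M\<^esub> actm (actm u (tg f)) (sr g)) \<cdot>\<^bsub>M\<^esub> actm (cp f P) (sr g)"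
      using True u cp_nat[of f u] by (simp add: actm_cmp)
    also have "\<dots> = actm u (tg f @ tg g) \<cdot>\<^bsub>M\<^esub> cp g (act P (tg f)) \<cdot>\<^bsub>M\<^esub> actm (cp f P) (sr g)"
      using True u cp_nat[of g "actm u (tg f)"] by simp
    finally show "(cp g (act Q (tg f)) \<cdot>\<^bsub>M\<^esub> actm (cp f Q) (sr g)) \<cdot>\<^bsub>M\<^esub> actm u (sr f @ sr g)
      = actm u (tg f @ tg g) \<cdot>\<^bsub>M\<^esub> cp g (act P (tg f)) \<cdot>\<^bsub>M\<^esub> actm (cp f P) (sr g)" .
  qed (use True in \<open>auto simp: hom_def\<close>)
  then show ?thesis using True by (simp add: hc_def)
qed (auto simp: hc_def)

lemma hc_simps [simp]:
  assumes "vl f" "vl g"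
  shows "sr (hc f g) = sr f @ sr g" "tg (hc f g) = tg f @ tg g"
    "Q \<in> Ob M \<Longrightarrow> cp (hc f g) Q = cp g (act Q (tg f)) \<cdot>\<^bsub>M\<^esub> actm (cp f Q) (sr g)"
  using assms by (simp_all add: hc_def)

lemma None_vl: "\<not> vl (vc g f) \<Longrightarrow> vc g f = None" "\<not> vl (hc f g) \<Longrightarrow> hc f g = None"
  by (subst vc_def, rule if_not_P, simp only: vl_vc simp_thms) (subst hc_def, rule if_not_P, simp only: vl_hc simp_thms)

text \<open>Associativity holds without side conditions because an ill-typed composite is
  \<open>None\<close> for either bracketing.\<close>

sublocale E: strict_moncat "\<lambda>c. fst c \<in> Ob A" vl sr tg vc vi hc
proof
  show "vc (vc h g) f = vc h (vc g f)" for h g f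
  proof (cases "vl h \<and> vl g \<and> vl f \<and> sr h = tg g \<and> sr g = tg f")
    case True
    then show ?thesis by (intro vl_eqI) auto
  next
    case False
    have "\<not> vl (vc (vc h g) f)"
    proof
      assume v: "vl (vc (vc h g) f)"
      then have "vl h" "vl g" "vl f" "sr h = tg g" "sr (vc h g) = tg f" by simp_all
      then show False using False by simp
    qed
    moreover have "\<not> vl (vc h (vc g f))"
    proof
      assume v: "vl (vc h (vc g f))"
      then have "vl h" "vl g" "vl f" "sr g = tg f" "sr h = tg (vc g f)" by simp_all
      then show False using False by simp
    qed
    ultimately show ?thesis using None_vl(1)[of "vc h g" f] None_vl(1)[of h "vc g f"] by (simp del: vl_vc)
  qed
  show "hc (hc h g) f = hc h (hc g f)" for h g f
  proof (cases "vl h \<and> vl g \<and> vl f")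
    case True
    then show ?thesis by (intro vl_eqI) (auto simp: actm_cmp)
  next
    case False
    then have "\<not> vl (hc (hc h g) f)" "\<not> vl (hc h (hc g f))" by auto
    then show ?thesis using None_vl(2)[of "hc h g" f] None_vl(2)[of h "hc g f"] by (simp del: vl_hc)
  qed
  show "vc (hc g g') (hc f f') = hc (vc g f) (vc g' f')" if a: "vl f" "vl g" "vl f'" "vl g'" "sr g = tg f" "sr g' = tg f'" for f g f' g'
  proof (rule vl_eqI)
    fix Q assume Q: "Q \<in> Ob M"
    \<comment> \<open>Interchange comes down to the naturality of \<open>f'\<close> at a component
      of \<open>g\<close>.\<close>
    have n: "actm (cp g Q) (tg f') \<cdot>\<^bsub>M\<^esub> cp f' (act Q (tg f)) = cp f' (act Q (tg g)) \<cdot>\<^bsub>M\<^esub> actm (cp g Q) (sr f')"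
      using cp_nat[OF a(3), of "cp g Q"] a Q by simp
    have "cp (vc (hc g g') (hc f f')) Q
      = cp g' (act Q (tg g)) \<cdot>\<^bsub>M\<^esub> (actm (cp g Q) (tg f') \<cdot>\<^bsub>M\<^esub> cp f' (act Q (tg f))) \<cdot>\<^bsub>M\<^esub> actm (cp f Q) (sr f')"
      using a Q by simp
    also have "\<dots> = cp (hc (vc g f) (vc g' f')) Q" unfolding n using a Q by (simp add: actm_cmp)
    finally show "cp (vc (hc g g') (hc f f')) Q = cp (hc (vc g f) (vc g' f')) Q" .
  qed (use a in auto)
qed (auto intro!: vl_eqI)

definition mi where "mi e = mk (tg e) (sr e) (\<lambda>Q. inv_arrow M (cp e Q))"

lemma mi:
  assumes "vl e" "\<And>Q. Q \<in> Ob M \<Longrightarrow> iso M (cp e Q)"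
  shows "vl (mi e)" "vc (mi e) e = vi (sr e)" "vc e (mi e) = vi (tg e)" "sr (mi e) = tg e" "tg (mi e) = sr e"
    "Q \<in> Ob M \<Longrightarrow> cp (mi e) Q = inv_arrow M (cp e Q)"
proof -
  have i: "inv_arrow M (cp e Q) \<in> hom M (act Q (tg e)) (act Q (sr e))" "inv_arrow M (cp e Q) \<cdot>\<^bsub>M\<^esub> cp e Q = ide M (act Q (sr e))"
    "cp e Q \<cdot>\<^bsub>M\<^esub> inv_arrow M (cp e Q) = ide M (act Q (tg e))" if "Q \<in> Ob M" for Q
    using M.inv_arrow_props[OF _ assms(2), of Q "act Q (sr e)" "act Q (tg e)"] assms(1) that by (auto simp: hom_def)
  show v: "vl (mi e)" unfolding mi_def
  proof (rule vl_mk)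
    fix u P Q assume "u \<in> hom M P Q"
    then have u: "u \<in> Ar M" "dm M u = P" "cd M u = Q" "P \<in> Ob M" "Q \<in> Ob M" using M.homD by auto
    note j = i(1)[OF u(4), THEN M.homD(1)] i(1)[OF u(4), THEN M.homD(2)] i(1)[OF u(4), THEN M.homD(3)]
      i(1)[OF u(5), THEN M.homD(1)] i(1)[OF u(5), THEN M.homD(2)] i(1)[OF u(5), THEN M.homD(3)]
    have "inv_arrow M (cp e Q) \<cdot>\<^bsub>M\<^esub> actm u (tg e) = inv_arrow M (cp e Q) \<cdot>\<^bsub>M\<^esub> actm u (tg e) \<cdot>\<^bsub>M\<^esub> cp e P \<cdot>\<^bsub>M\<^esub> inv_arrow M (cp e P)"
      using u assms(1) j i(3) by simp
    also have "\<dots> = inv_arrow M (cp e Q) \<cdot>\<^bsub>M\<^esub> (actm u (tg e) \<cdot>\<^bsub>M\<^esub> cp e P) \<cdot>\<^bsub>M\<^esub> inv_arrow M (cp e P)"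
      using u assms(1) j by simp
    also have "actm u (tg e) \<cdot>\<^bsub>M\<^esub> cp e P = cp e Q \<cdot>\<^bsub>M\<^esub> actm u (sr e)"
      using u cp_nat[OF assms(1) u(1)] by simp
    also have "inv_arrow M (cp e Q) \<cdot>\<^bsub>M\<^esub> (cp e Q \<cdot>\<^bsub>M\<^esub> actm u (sr e)) \<cdot>\<^bsub>M\<^esub> inv_arrow M (cp e P)
      = (inv_arrow M (cp e Q) \<cdot>\<^bsub>M\<^esub> cp e Q) \<cdot>\<^bsub>M\<^esub> actm u (sr e) \<cdot>\<^bsub>M\<^esub> inv_arrow M (cp e P)"
      using u assms(1) j by simp
    also have "\<dots> = actm u (sr e) \<cdot>\<^bsub>M\<^esub> inv_arrow M (cp e P)"
      unfolding i(2)[OF u(5)] using u assms(1) j by simp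
    finally show "inv_arrow M (cp e Q) \<cdot>\<^bsub>M\<^esub> actm u (tg e) = actm u (sr e) \<cdot>\<^bsub>M\<^esub> inv_arrow M (cp e P)" .
  qed (use assms(1) i in auto)
  show "sr (mi e) = tg e" "tg (mi e) = sr e" "Q \<in> Ob M \<Longrightarrow> cp (mi e) Q = inv_arrow M (cp e Q)" by (simp_all add: mi_def)
  then show "vc (mi e) e = vi (sr e)" "vc e (mi e) = vi (tg e)" using v assms(1) i
    by (auto intro!: vl_eqI simp: mi_def)
qed

definition xar :: "'o \<times> bool \<Rightarrow> 'o \<times> bool \<Rightarrow> 'a \<Rightarrow> _" where "xar c d f = mk [c] [d] (\<lambda>Q. ide M Q \<unlhd>\<^bsub>M\<^esub> f)"
definition xmui :: "'o \<times> bool \<Rightarrow> 'o \<times> bool \<Rightarrow> _" where "xmui c d = mk [c, d] [(ob c \<otimes> ob d, False)] (\<lambda>Q. mas M Q (ob c) (ob d))"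
definition xun where "xun = mk [(\<one>, False)] [] (mun M)"
definition xkq :: "('p \<Rightarrow> 'o \<Rightarrow> 'b) \<Rightarrow> 'o \<times> bool \<Rightarrow> _" where "xkq \<kappa> c = mk [c] [(\<Phi> (ob c), False)] (\<lambda>Q. \<kappa> Q (ob c))"

lemma ide_act_nat:
  assumes "u \<in> hom M P Q" "f \<in> hom A X Y"
  shows "(ide M Q \<unlhd>\<^bsub>M\<^esub> f) \<cdot>\<^bsub>M\<^esub> (u \<unlhd>\<^bsub>M\<^esub> ide A X) = u \<unlhd>\<^bsub>M\<^esub> f" "(u \<unlhd>\<^bsub>M\<^esub> ide A Y) \<cdot>\<^bsub>M\<^esub> (ide M P \<unlhd>\<^bsub>M\<^esub> f) = u \<unlhd>\<^bsub>M\<^esub> f"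
proof -
  have u: "u \<in> Ar M" "dm M u = P" "cd M u = Q" "P \<in> Ob M" "Q \<in> Ob M" "X \<in> Ob A" "Y \<in> Ob A" using M.homD[OF assms(1)] homD[OF assms(2)] by auto
  show "(ide M Q \<unlhd>\<^bsub>M\<^esub> f) \<cdot>\<^bsub>M\<^esub> (u \<unlhd>\<^bsub>M\<^esub> ide A X) = u \<unlhd>\<^bsub>M\<^esub> f"
    using act_cmp[OF _ _ _ ide_hom assms(2), of u "ide M Q"] cmp_ide[OF assms(2)] u by simp
  show "(u \<unlhd>\<^bsub>M\<^esub> ide A Y) \<cdot>\<^bsub>M\<^esub> (ide M P \<unlhd>\<^bsub>M\<^esub> f) = u \<unlhd>\<^bsub>M\<^esub> f"
    using act_cmp[OF _ _ _ assms(2) ide_hom, of "ide M P" u] cmp_ide[OF assms(2)] u by simp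
qed

lemma xar_T [simp]:
  assumes "fst c \<in> Ob A" "fst d \<in> Ob A" "f \<in> hom A (ob c) (ob d)"
  shows "vl (xar c d f)"
  unfolding xar_def using assms ide_act_nat[OF _ assms(3)] by (intro vl_mk) (auto intro: act_hom[OF M.ide_hom])

lemma xar_simps [simp]: "sr (xar c d f) = [c]" "tg (xar c d f) = [d]" "Q \<in> Ob M \<Longrightarrow> cp (xar c d f) Q = ide M Q \<unlhd>\<^bsub>M\<^esub> f"
  by (simp_all add: xar_def)

lemma mas_props:
  assumes "P \<in> Ob M" "X \<in> Ob A" "Y \<in> Ob A"
  shows "mas M P X Y \<in> hom M (P \<triangleleft>\<^bsub>M\<^esub> X \<triangleleft>\<^bsub>M\<^esub> Y) (P \<triangleleft>\<^bsub>M\<^esub> (X \<otimes> Y))" "iso M (mas M P X Y)"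
  using nat_isoD(1,2)[OF mas_nat_iso, of "(P, X, Y)"] assms by (simp_all add: prod_cat_simps)

lemma mas_Ar [simp]:
  assumes "P \<in> Ob M" "X \<in> Ob A" "Y \<in> Ob A"
  shows "mas M P X Y \<in> Ar M" "dm M (mas M P X Y) = P \<triangleleft>\<^bsub>M\<^esub> X \<triangleleft>\<^bsub>M\<^esub> Y" "cd M (mas M P X Y) = P \<triangleleft>\<^bsub>M\<^esub> (X \<otimes> Y)"
  using mas_props(1)[OF assms] by (auto simp: hom_def)

lemma mas_nat: "u \<in> hom M P P' \<Longrightarrow> f \<in> hom A X X' \<Longrightarrow> g \<in> hom A Y Y' \<Longrightarrow>
    mas M P' X' Y' \<cdot>\<^bsub>M\<^esub> ((u \<unlhd>\<^bsub>M\<^esub> f) \<unlhd>\<^bsub>M\<^esub> g) = (u \<unlhd>\<^bsub>M\<^esub> (f \<boxtimes> g)) \<cdot>\<^bsub>M\<^esub> mas M P X Y"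
  using nat_isoD(3)[OF mas_nat_iso, of "(u, f, g)" "(P, X, Y)" "(P', X', Y')"] by (simp add: hom_prod)

lemma xmui_T [simp]:
  assumes "fst c \<in> Ob A" "fst d \<in> Ob A"
  shows "vl (xmui c d)"
  unfolding xmui_def using assms mas_props(1)
  by (intro vl_mk) (auto simp: ten_ide[symmetric] intro!: mas_nat)

lemma xmui_simps [simp]: "sr (xmui c d) = [c, d]" "tg (xmui c d) = [(ob c \<otimes> ob d, False)]"
    "Q \<in> Ob M \<Longrightarrow> cp (xmui c d) Q = mas M Q (ob c) (ob d)"
  by (simp_all add: xmui_def)

lemma mun_props: "P \<in> Ob M \<Longrightarrow> mun M P \<in> hom M (P \<triangleleft>\<^bsub>M\<^esub> \<one>) P" "P \<in> Ob M \<Longrightarrow> iso M (mun M P)"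
  using nat_isoD(1,2)[OF mun_nat_iso] by auto

lemma mun_Ar [simp]: "P \<in> Ob M \<Longrightarrow> mun M P \<in> Ar M" "P \<in> Ob M \<Longrightarrow> dm M (mun M P) = P \<triangleleft>\<^bsub>M\<^esub> \<one>" "P \<in> Ob M \<Longrightarrow> cd M (mun M P) = P"
  using mun_props(1) by (auto simp: hom_def)

lemma xun_T [simp]: "vl xun"
  unfolding xun_def using mun_props(1) nat_isoD(3)[OF mun_nat_iso] by (intro vl_mk) auto

lemma xun_simps [simp]: "sr xun = [(\<one>, False)]" "tg xun = []" "Q \<in> Ob M \<Longrightarrow> cp xun Q = mun M Q"
  by (simp_all add: xun_def)

end

text \<open>One model for all settings: both flags are off for monoidal pairs and on for braided
  ones, while \<open>bs\<close> without \<open>bk\<close> serves the regular module of a braided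
  category.\<close>

locale pair_model = Z2_monoidal_pair A M
  for A :: "('o, 'a, 'y) inv_moncat_scheme" (structure) and M :: "('p, 'b, 'o, 'a, 'z) modcat_scheme" +
  fixes \<sigma> :: "'o \<Rightarrow> 'o \<Rightarrow> 'a" and \<kappa> :: "'p \<Rightarrow> 'o \<Rightarrow> 'b" and bs bk :: bool
  assumes bk_bs: "bk \<Longrightarrow> bs" and braiding: "bs \<Longrightarrow> braiding A \<sigma>" and pair: "bk \<Longrightarrow> Z2_braided_pair A M \<sigma> \<kappa>"
begin

abbreviation "xmu c d \<equiv> mi (xmui c d)"

lemma xmu [simp]:
  assumes "fst c \<in> Ob A" "fst d \<in> Ob A"
  shows "vl (xmu c d)" "vc (xmu c d) (xmui c d) = vi [c, d]" "vc (xmui c d) (xmu c d) = vi [(ob c \<otimes> ob d, False)]"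
    "sr (xmu c d) = [(ob c \<otimes> ob d, False)]" "tg (xmu c d) = [c, d]" "Q \<in> Ob M \<Longrightarrow> cp (xmu c d) Q = inv_arrow M (mas M Q (ob c) (ob d))"
  using mi[of "xmui c d"] assms mas_props(2) by simp_all

lemma xuni [simp]:
  "vl (mi xun)" "vc (mi xun) xun = vi [(\<one>, False)]" "vc xun (mi xun) = vi []"
    "sr (mi xun) = []" "tg (mi xun) = [(\<one>, False)]" "Q \<in> Ob M \<Longrightarrow> cp (mi xun) Q = inv_arrow M (mun M Q)"
  using mi[of xun] mun_props(2) by simp_all

lemma kappa:
  assumes "bk" "P \<in> Ob M" "X \<in> Ob A"
  shows "\<kappa> P X \<in> hom M (P \<triangleleft>\<^bsub>M\<^esub> X) (P \<triangleleft>\<^bsub>M\<^esub> \<Phi> X)" "iso M (\<kappa> P X)"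
    "u \<in> hom M P Q \<Longrightarrow> f \<in> hom A X Y \<Longrightarrow> \<kappa> Q Y \<cdot>\<^bsub>M\<^esub> (u \<unlhd>\<^bsub>M\<^esub> f) = (u \<unlhd>\<^bsub>M\<^esub> Phi_ar A f) \<cdot>\<^bsub>M\<^esub> \<kappa> P X"
proof -
  note n = Z2_braided_pair.\<kappa>_nat_iso[OF pair[OF assms(1)]]
  show "\<kappa> P X \<in> hom M (P \<triangleleft>\<^bsub>M\<^esub> X) (P \<triangleleft>\<^bsub>M\<^esub> \<Phi> X)" "iso M (\<kappa> P X)"
    using nat_isoD(1,2)[OF n, of "(P, X)"] assms by (simp_all add: prod_cat_simps)
  show "u \<in> hom M P Q \<Longrightarrow> f \<in> hom A X Y \<Longrightarrow> \<kappa> Q Y \<cdot>\<^bsub>M\<^esub> (u \<unlhd>\<^bsub>M\<^esub> f) = (u \<unlhd>\<^bsub>M\<^esub> Phi_ar A f) \<cdot>\<^bsub>M\<^esub> \<kappa> P X"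
    using nat_isoD(3)[OF n, of "(u, f)" "(P, X)" "(Q, Y)"] by (simp add: hom_prod)
qed

lemma xkq_simps [simp]: "sr (xkq \<kappa> c) = [c]" "tg (xkq \<kappa> c) = [(\<Phi> (ob c), False)]" "Q \<in> Ob M \<Longrightarrow> cp (xkq \<kappa> c) Q = \<kappa> Q (ob c)"
  by (simp_all add: xkq_def)

context assumes bk: bk begin

lemma kappa_Ar [simp]:
  assumes "P \<in> Ob M" "X \<in> Ob A"
  shows "\<kappa> P X \<in> Ar M" "dm M (\<kappa> P X) = P \<triangleleft>\<^bsub>M\<^esub> X" "cd M (\<kappa> P X) = P \<triangleleft>\<^bsub>M\<^esub> \<Phi> X"
  using kappa(1)[OF bk assms] by (auto simp: hom_def)

lemma xkq_T [simp]: "fst c \<in> Ob A \<Longrightarrow> vl (xkq \<kappa> c)"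
  unfolding xkq_def using kappa(1)[OF bk] kappa(3)[OF bk _ _ _ ide_hom] M.homD(4) by (intro vl_mk) (auto simp: Phi_ide)

lemma xkqi [simp]:
  assumes "fst c \<in> Ob A"
  shows "vl (mi (xkq \<kappa> c))" "vc (mi (xkq \<kappa> c)) (xkq \<kappa> c) = vi [c]" "vc (xkq \<kappa> c) (mi (xkq \<kappa> c)) = vi [(\<Phi> (ob c), False)]"
    "sr (mi (xkq \<kappa> c)) = [(\<Phi> (ob c), False)]" "tg (mi (xkq \<kappa> c)) = [c]" "Q \<in> Ob M \<Longrightarrow> cp (mi (xkq \<kappa> c)) Q = inv_arrow M (\<kappa> Q (ob c))"
  using mi[of "xkq \<kappa> c"] assms kappa(2)[OF bk] by simp_all

end

lemma xmui_nat:
  assumes "fst c \<in> Ob A" "fst d \<in> Ob A" "fst c' \<in> Ob A" "fst d' \<in> Ob A" "f \<in> hom A (ob c) (ob c')" "g \<in> hom A (ob d) (ob d')"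
  shows "vc (xmui c' d') (hc (xar c c' f) (xar d d' g)) = vc (xar (ob c \<otimes> ob d, False) (ob c' \<otimes> ob d', False) (f \<boxtimes> g)) (xmui c d)"
proof (rule vl_eqI)
  have fg: "f \<boxtimes> g \<in> hom A (ob (ob c \<otimes> ob d, False)) (ob (ob c' \<otimes> ob d', False))" using assms by simp
  show "vl (vc (xmui c' d') (hc (xar c c' f) (xar d d' g)))" "vl (vc (xar (ob c \<otimes> ob d, False) (ob c' \<otimes> ob d', False) (f \<boxtimes> g)) (xmui c d))"
    "sr (vc (xmui c' d') (hc (xar c c' f) (xar d d' g))) = sr (vc (xar (ob c \<otimes> ob d, False) (ob c' \<otimes> ob d', False) (f \<boxtimes> g)) (xmui c d))"
    "tg (vc (xmui c' d') (hc (xar c c' f) (xar d d' g))) = tg (vc (xar (ob c \<otimes> ob d, False) (ob c' \<otimes> ob d', False) (f \<boxtimes> g)) (xmui c d))"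
    using assms fg by simp_all
  fix Q assume Q: "Q \<in> Ob M"
  have h: "ide M Q \<unlhd>\<^bsub>M\<^esub> f \<in> hom M (Q \<triangleleft>\<^bsub>M\<^esub> ob c) (Q \<triangleleft>\<^bsub>M\<^esub> ob c')" by (rule act_hom) (use Q assms in \<open>auto intro: M.ide_hom\<close>)
  have "cp (vc (xmui c' d') (hc (xar c c' f) (xar d d' g))) Q = mas M Q (ob c') (ob d') \<cdot>\<^bsub>M\<^esub> ((ide M (Q \<triangleleft>\<^bsub>M\<^esub> ob c') \<unlhd>\<^bsub>M\<^esub> g) \<cdot>\<^bsub>M\<^esub> ((ide M Q \<unlhd>\<^bsub>M\<^esub> f) \<unlhd>\<^bsub>M\<^esub> ide A (ob d)))"
    using assms Q by simp
  also have "\<dots> = (ide M Q \<unlhd>\<^bsub>M\<^esub> (f \<boxtimes> g)) \<cdot>\<^bsub>M\<^esub> mas M Q (ob c) (ob d)"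
    unfolding ide_act_nat(1)[OF h assms(6)] by (rule mas_nat) (use assms Q in \<open>auto intro: M.ide_hom\<close>)
  finally show "cp (vc (xmui c' d') (hc (xar c c' f) (xar d d' g))) Q = cp (vc (xar (ob c \<otimes> ob d, False) (ob c' \<otimes> ob d', False) (f \<boxtimes> g)) (xmui c d)) Q"
    using assms Q fg by simp
qed

text \<open>The module pentagon, read for transformations of three successive actions.\<close>

lemma xmui_asc:
  assumes "fst c \<in> Ob A" "fst d \<in> Ob A" "fst e \<in> Ob A"
  shows "vc (xmui c (ob d \<otimes> ob e, False)) (hc (vi [c]) (xmui d e)) =
    vc (xar ((ob c \<otimes> ob d) \<otimes> ob e, False) (ob c \<otimes> ob d \<otimes> ob e, False) (asc A (ob c) (ob d) (ob e)))
      (vc (xmui (ob c \<otimes> ob d, False) e) (hc (xmui c d) (vi [e])))"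
proof (rule vl_eqI)
  fix Q assume Q: "Q \<in> Ob M"
  have a: "asc A (ob c) (ob d) (ob e) \<in> hom A (ob ((ob c \<otimes> ob d) \<otimes> ob e, False)) (ob (ob c \<otimes> ob d \<otimes> ob e, False))" using assms by simp
  have h: "ide A (ob e) \<in> hom A (ob e) (ob e)" using assms by simp
  show "cp (vc (xmui c (ob d \<otimes> ob e, False)) (hc (vi [c]) (xmui d e))) Q = cp
   (vc (xar ((ob c \<otimes> ob d) \<otimes> ob e, False) (ob c \<otimes> ob d \<otimes> ob e, False) (asc A (ob c) (ob d) (ob e)))
      (vc (xmui (ob c \<otimes> ob d, False) e) (hc (xmui c d) (vi [e])))) Q"
    using module_pentagon[OF Q, of "ob c" "ob d" "ob e"] assms Q a act_Ar[OF _ h] by simp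
qed (use assms in simp_all)

text \<open>BP1 and BP2 in components. The term of BP1 with \<kappa> at
  \<open>P \<triangleleft> X\<close> is a component of the twist whiskered on the left by a strand;
  in this way an axiom relating \<kappa> at different objects of \<open>M\<close> becomes one about
  a twist away from the pole.\<close>

lemma xkq_behind_ten:
  assumes a: bk "fst c \<in> Ob A" "fst d \<in> Ob A"
  shows "hc (vi [d]) (xkq \<kappa> c) = vc (vc (xmu d (\<Phi> (ob c), False)) (vc (xar (\<Phi> (ob c) \<otimes> ob d, False) (ob d \<otimes> \<Phi> (ob c), False) (\<sigma> (\<Phi> (ob c)) (ob d)))
            (xmui (\<Phi> (ob c), False) d))) (vc (hc (xkq \<kappa> c) (vi [d])) (vc (xmu c d) (vc (xar (ob d \<otimes> ob c, False) (ob c \<otimes> ob d, False) (\<sigma> (ob d) (ob c))) (xmui d c))))"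
   (is "_ = vc ?S (vc _ ?R)")
   "xkq \<kappa> (ob c \<otimes> ob d, False) = vc (xar (\<Phi> (ob d) \<otimes> \<Phi> (ob c), False) (\<Phi> (ob c \<otimes> ob d), False) (Phi_two A (ob c) (ob d)))
          (vc (xmui (\<Phi> (ob d), False) (\<Phi> (ob c), False)) (vc (hc (xkq \<kappa> d) (vi [(\<Phi> (ob c), False)])) (vc (vc (xmu d (\<Phi> (ob c), False)) (vc (xar (\<Phi> (ob c) \<otimes> ob d, False) (ob d \<otimes> \<Phi> (ob c), False) (\<sigma> (\<Phi> (ob c)) (ob d)))
            (xmui (\<Phi> (ob c), False) d))) (vc (hc (xkq \<kappa> c) (vi [d])) (xmu c d)))))"
   (is "_ = vc ?P ?U")
proof -
  note bp = Z2_braided_pair.BP1[OF pair[OF a(1)]] Z2_braided_pair.BP2[OF pair[OF a(1)]]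
  have n: "nat_iso (A \<times>\<^sub>c A) A (\<lambda>(X, Y). X \<otimes> Y) (\<lambda>(f, g). f \<boxtimes> g) (\<lambda>(X, Y). Y \<otimes> X) (\<lambda>(f, g). g \<boxtimes> f) (\<lambda>(X, Y). \<sigma> X Y)"
    by (rule Z2_braided_pair.\<sigma>_nat_iso[OF pair[OF a(1)]])
  have s: "\<sigma> X Y \<in> hom A (X \<otimes> Y) (Y \<otimes> X)" if "X \<in> Ob A" "Y \<in> Ob A" for X Y
    using nat_isoD(1)[OF n, of "(X, Y)"] that by (simp add: prod_cat_simps)
  have inv: "inv_arrow M (mas M Q X Y) \<in> Ar M" "dm M (inv_arrow M (mas M Q X Y)) = Q \<triangleleft>\<^bsub>M\<^esub> (X \<otimes> Y)" "cd M (inv_arrow M (mas M Q X Y)) = Q \<triangleleft>\<^bsub>M\<^esub> X \<triangleleft>\<^bsub>M\<^esub> Y"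
    if "Q \<in> Ob M" "X \<in> Ob A" "Y \<in> Ob A" for Q X Y
    using M.inv_arrow_props(1)[OF mas_props(1,2)[OF that]] by (auto simp: hom_def)
  have sA: "ide M Q \<unlhd>\<^bsub>M\<^esub> \<sigma> X Y \<in> Ar M" "dm M (ide M Q \<unlhd>\<^bsub>M\<^esub> \<sigma> X Y) = Q \<triangleleft>\<^bsub>M\<^esub> (X \<otimes> Y)" "cd M (ide M Q \<unlhd>\<^bsub>M\<^esub> \<sigma> X Y) = Q \<triangleleft>\<^bsub>M\<^esub> (Y \<otimes> X)"
    if "Q \<in> Ob M" "X \<in> Ob A" "Y \<in> Ob A" for Q X Y using act_Ar[OF _ s[OF that(2,3)], of "ide M Q"] that by simp_all
  have kA: "\<kappa> Q X \<unlhd>\<^bsub>M\<^esub> ide A Y \<in> Ar M" "dm M (\<kappa> Q X \<unlhd>\<^bsub>M\<^esub> ide A Y) = Q \<triangleleft>\<^bsub>M\<^esub> X \<triangleleft>\<^bsub>M\<^esub> Y" "cd M (\<kappa> Q X \<unlhd>\<^bsub>M\<^esub> ide A Y) = Q \<triangleleft>\<^bsub>M\<^esub> \<Phi> X \<triangleleft>\<^bsub>M\<^esub> Y"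
    if "Q \<in> Ob M" "X \<in> Ob A" "Y \<in> Ob A" for Q X Y
    using act_Ar[OF kappa_Ar(1)[OF a(1) that(1,2)] ide_hom[OF that(3)]] kappa_Ar[OF a(1) that(1,2)] by simp_all
  note kk = kappa_Ar[OF a(1)] xkq_T[OF a(1)]
  show "hc (vi [d]) (xkq \<kappa> c) = vc ?S (vc (hc (xkq \<kappa> c) (vi [d])) ?R)"
  proof (rule vl_eqI)
    fix Q assume Q: "Q \<in> Ob M"
    show "cp (hc (vi [d]) (xkq \<kappa> c)) Q = cp (vc ?S (vc (hc (xkq \<kappa> c) (vi [d])) ?R)) Q"
      using a Q by (simp add: s kk inv sA kA bp(1)[OF Q, of "ob d" "ob c"])
  qed (use a in \<open>simp_all add: s kk\<close>)
  show "xkq \<kappa> (ob c \<otimes> ob d, False) = vc ?P ?U"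
  proof (rule vl_eqI)
    have p: "Phi_two A (ob c) (ob d) \<in> hom A (\<Phi> (ob d) \<otimes> \<Phi> (ob c)) (\<Phi> (ob c \<otimes> ob d))" using a by simp
    then have P: "vl (xar (\<Phi> (ob d) \<otimes> \<Phi> (ob c), False) (\<Phi> (ob c \<otimes> ob d), False) (Phi_two A (ob c) (ob d)))" using a by simp
    show "vl (xkq \<kappa> (ob c \<otimes> ob d, False))" using a kk by simp
    show "vl (vc ?P ?U)"
     "sr (xkq \<kappa> (ob c \<otimes> ob d, False)) = sr (vc ?P ?U)"
     "tg (xkq \<kappa> (ob c \<otimes> ob d, False)) = tg (vc ?P ?U)"
      using a by (simp_all add: P s kk)
    fix Q assume Q: "Q \<in> Ob M"
    show "cp (xkq \<kappa> (ob c \<otimes> ob d, False)) Q = cp (vc ?P ?U) Q"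
      using a Q by (simp add: P s kk inv sA kA act_Ar[OF _ p, of "ide M Q"] bp(2)[OF Q, of "ob c" "ob d"])
  qed
qed

text \<open>The abstract \<open>mu\<close> is the inverse of the module associativity, so its axioms
  arise by inverting the corresponding squares for \<open>xmui\<close>.\<close>

sublocale X: strict_pair A vl sr tg vc vi hc xar "\<lambda>c d. mi (xmui c d)" xmui xun "mi xun" "xkq \<kappa>" "\<lambda>c. mi (xkq \<kappa> c)" \<sigma> bs bk
proof
  show "E.T (xar c d f) [c] [d]" if "fst c \<in> Ob A" "fst d \<in> Ob A" "f \<in> hom A (ob c) (ob d)" for c d f
    using that by (simp add: E.T_def)
  show "vc (xar c d g) (xar b c f) = xar b d (g \<cdot> f)"
    if a: "fst b \<in> Ob A" "fst c \<in> Ob A" "fst d \<in> Ob A" "f \<in> hom A (ob b) (ob c)" "g \<in> hom A (ob c) (ob d)" for b c d f g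
  proof (rule vl_eqI)
    have "g \<cdot> f \<in> hom A (ob b) (ob d)" by (rule cmp_hom[OF a(4,5)])
    then show "vl (xar b d (g \<cdot> f))" using a by simp
    fix Q assume "Q \<in> Ob M"
    then show "cp (vc (xar c d g) (xar b c f)) Q = cp (xar b d (g \<cdot> f)) Q" using a act_cmp[OF _ _ _ a(4,5), of "ide M Q" "ide M Q"] by simp
  qed (use a in simp_all)
  show "xar c c (ide A (ob c)) = vi [c]" if "fst c \<in> Ob A" for c
    using that by (intro vl_eqI) auto
  show "E.T (xmu c d) [(ob c \<otimes> ob d, False)] [c, d] \<and> E.T (xmui c d) [c, d] [(ob c \<otimes> ob d, False)] \<and>
      vc (xmui c d) (xmu c d) = vi [(ob c \<otimes> ob d, False)] \<and> vc (xmu c d) (xmui c d) = vi [c, d]"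
    if "fst c \<in> Ob A" "fst d \<in> Ob A" for c d using that by (simp add: E.T_def)
  show "vc (xmu c' d') (xar (ob c \<otimes> ob d, False) (ob c' \<otimes> ob d', False) (f \<boxtimes> g)) = vc (hc (xar c c' f) (xar d d' g)) (xmu c d)"
    if a: "fst c \<in> Ob A" "fst d \<in> Ob A" "fst c' \<in> Ob A" "fst d' \<in> Ob A" "f \<in> hom A (ob c) (ob c')" "g \<in> hom A (ob d) (ob d')" for c d c' d' f g
  proof -
    have fg: "f \<boxtimes> g \<in> hom A (ob (ob c \<otimes> ob d, False)) (ob (ob c' \<otimes> ob d', False))" using a by simp
    show ?thesis by (rule E.conj_inverse[OF xmui_nat[OF a]]) (use a fg in simp_all)
  qed
  show "vc (hc (xmu c d) (vi [e])) (xmu (ob c \<otimes> ob d, False) e) = vc (hc (vi [c]) (xmu d e)) (vc (xmu c (ob d \<otimes> ob e, False))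
          (xar ((ob c \<otimes> ob d) \<otimes> ob e, False) (ob c \<otimes> ob d \<otimes> ob e, False) (asc A (ob c) (ob d) (ob e))))"
    if a: "fst c \<in> Ob A" "fst d \<in> Ob A" "fst e \<in> Ob A" for c d e
  proof -
    let ?a = "xar ((ob c \<otimes> ob d) \<otimes> ob e, False) (ob c \<otimes> ob d \<otimes> ob e, False) (asc A (ob c) (ob d) (ob e))"
    let ?Z = "vc (xmui c (ob d \<otimes> ob e, False)) (hc (vi [c]) (xmui d e))" and ?Zi = "vc (hc (vi [c]) (xmu d e)) (xmu c (ob d \<otimes> ob e, False))"
    let ?z = "vc (xmui (ob c \<otimes> ob d, False) e) (hc (xmui c d) (vi [e]))" and ?zi = "vc (hc (xmu c d) (vi [e])) (xmu (ob c \<otimes> ob d, False) e)"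
    have va: "vl ?a" by (rule xar_T) (use a in simp_all)
    have i: "vc ?Zi ?Z = vi [c, d, e]" "vc ?z ?zi = vi [((ob c \<otimes> ob d) \<otimes> ob e, False)]"
    proof -
      have "vc (xmu c (ob d \<otimes> ob e, False)) ?Z = hc (vi [c]) (xmui d e)"
        using E.cm_cong[OF xmu(2)[of c "(ob d \<otimes> ob e, False)"], of "hc (vi [c]) (xmui d e)"] a by simp
      then show "vc ?Zi ?Z = vi [c, d, e]" using a by (simp add: E.cm_assoc E.interchange E.hz_I)
      have "vc (hc (xmui c d) (vi [e])) ?zi = xmu (ob c \<otimes> ob d, False) e"
        using E.cm_cong[of "hc (xmui c d) (vi [e])" "hc (xmu c d) (vi [e])" _ "xmu (ob c \<otimes> ob d, False) e"] a
        by (simp add: E.interchange E.hz_I)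
      then show "vc ?z ?zi = vi [((ob c \<otimes> ob d) \<otimes> ob e, False)]" using a by (simp add: E.cm_assoc)
    qed
    have q: "vc ?Z (vi [c, d, e]) = vc ?a ?z" using xmui_asc[OF a] a by simp
    have "vc ?Zi ?a = vc (vi [c, d, e]) ?zi"
      by (rule E.conj_inverse[OF q]) (use i a va in simp_all)
    then show ?thesis using a by (simp add: E.cm_assoc)
  qed
  show "E.T xun [(\<one>, False)] [] \<and> E.T (mi xun) [] [(\<one>, False)] \<and> vc (mi xun) xun = vi [(\<one>, False)] \<and> vc xun (mi xun) = vi []"
    by (simp add: E.T_def)
  show "vc (hc xun (vi [c])) (xmu (\<one>, False) c) = xar (\<one> \<otimes> ob c, False) c (lun A (ob c))" if a: "fst c \<in> Ob A" for c
  proof -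
    have l: "lun A (ob c) \<in> hom A (ob (\<one> \<otimes> ob c, False)) (ob c)" and i: "ide A (ob c) \<in> hom A (ob c) (ob c)" using a by simp_all
    have "hc xun (vi [c]) = vc (xar (\<one> \<otimes> ob c, False) c (lun A (ob c))) (xmui (\<one>, False) c)"
    proof (rule vl_eqI)
      fix Q assume "Q \<in> Ob M"
      then show "cp (hc xun (vi [c])) Q = cp (vc (xar (\<one> \<otimes> ob c, False) c (lun A (ob c))) (xmui (\<one>, False) c)) Q"
        using module_triangle[of Q "ob c"] a l act_Ar[OF _ i] by simp
    qed (use a l in simp_all)
    then show ?thesis using a l by (simp add: E.cm_assoc)
  qed
  show "bk \<Longrightarrow> bs" "bs \<Longrightarrow> braiding A \<sigma>" by (rule bk_bs, simp) (rule braiding, simp)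
  show "E.T (xkq \<kappa> c) [c] [(\<Phi> (ob c), False)] \<and> E.T (mi (xkq \<kappa> c)) [(\<Phi> (ob c), False)] [c] \<and>
      vc (mi (xkq \<kappa> c)) (xkq \<kappa> c) = vi [c] \<and> vc (xkq \<kappa> c) (mi (xkq \<kappa> c)) = vi [(\<Phi> (ob c), False)]" if "bk" "fst c \<in> Ob A" for c
    using xkqi[OF that] xkq_T[OF that] by (simp add: E.T_def)
  show "vc (xkq \<kappa> d) (xar c d f) = vc (xar (\<Phi> (ob c), False) (\<Phi> (ob d), False) (Phi_ar A f)) (xkq \<kappa> c)"
    if a: bk "fst c \<in> Ob A" "fst d \<in> Ob A" "f \<in> hom A (ob c) (ob d)" for c d f
  proof (rule vl_eqI)
    have p: "Phi_ar A f \<in> hom A (ob (\<Phi> (ob c), False)) (ob (\<Phi> (ob d), False))" using a by simp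
    show "vl (vc (xkq \<kappa> d) (xar c d f))" "vl (vc (xar (\<Phi> (ob c), False) (\<Phi> (ob d), False) (Phi_ar A f)) (xkq \<kappa> c))"
     "sr (vc (xkq \<kappa> d) (xar c d f)) = sr (vc (xar (\<Phi> (ob c), False) (\<Phi> (ob d), False) (Phi_ar A f)) (xkq \<kappa> c))"
     "tg (vc (xkq \<kappa> d) (xar c d f)) = tg (vc (xar (\<Phi> (ob c), False) (\<Phi> (ob d), False) (Phi_ar A f)) (xkq \<kappa> c))"
      using a p xkq_T[OF a(1)] by simp_all
    fix Q assume "Q \<in> Ob M"
    then show "cp (vc (xkq \<kappa> d) (xar c d f)) Q = cp (vc (xar (\<Phi> (ob c), False) (\<Phi> (ob d), False) (Phi_ar A f)) (xkq \<kappa> c)) Q"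
      using a p xkq_T[OF a(1)] kappa(3)[OF a(1) _ _ M.ide_hom a(4), of Q] by simp
  qed
  show "hc (vi [d]) (xkq \<kappa> c) = vc (vc (xmu d (\<Phi> (ob c), False)) (vc (xar (\<Phi> (ob c) \<otimes> ob d, False) (ob d \<otimes> \<Phi> (ob c), False) (\<sigma> (\<Phi> (ob c)) (ob d)))
            (xmui (\<Phi> (ob c), False) d))) (vc (hc (xkq \<kappa> c) (vi [d])) (vc (xmu c d) (vc (xar (ob d \<otimes> ob c, False) (ob c \<otimes> ob d, False) (\<sigma> (ob d) (ob c))) (xmui d c))))"
    if "bk" "fst c \<in> Ob A" "fst d \<in> Ob A" for c d by (rule xkq_behind_ten(1)[OF that])
  show "xkq \<kappa> (ob c \<otimes> ob d, False) = vc (xar (\<Phi> (ob d) \<otimes> \<Phi> (ob c), False) (\<Phi> (ob c \<otimes> ob d), False) (Phi_two A (ob c) (ob d)))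
          (vc (xmui (\<Phi> (ob d), False) (\<Phi> (ob c), False)) (vc (hc (xkq \<kappa> d) (vi [(\<Phi> (ob c), False)])) (vc (vc (xmu d (\<Phi> (ob c), False)) (vc (xar (\<Phi> (ob c) \<otimes> ob d, False) (ob d \<otimes> \<Phi> (ob c), False) (\<sigma> (\<Phi> (ob c)) (ob d)))
            (xmui (\<Phi> (ob c), False) d))) (vc (hc (xkq \<kappa> c) (vi [d])) (xmu c d)))))"
    if "bk" "fst c \<in> Ob A" "fst d \<in> Ob A" for c d by (rule xkq_behind_ten(2)[OF that])
qed

end

section \<open>Symmetric pairs\<close>

context strict_braided begin

context
  fixes f :: "nat \<times> bool \<Rightarrow> 'a"
  assumes bs: bs and sg_sym: "\<And>c d. ok c \<Longrightarrow> ok d \<Longrightarrow> sg d c \<bullet> sg c d = I [c, d]"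
    and kp_sym: "\<And>c. bk \<Longrightarrow> ok c \<Longrightarrow> kp (st c) \<bullet> kp c = I [c]"
    and f_flip_sign: "\<And>v. f (flip_sign v) = st (f v)"
begin

lemmas ysimps [simp] = sg_simps[OF bs] kp_simps[OF bs]

text \<open>By symmetry a letter and its inverse have the same value, so that exponents in words can
  be ignored.\<close>

lemma sgi_eq: "ok c \<Longrightarrow> ok d \<Longrightarrow> sgi c d = sg c d"
  using cm_cong[OF sg_simps(7)[OF bs], of d c "sg c d"] sg_sym[of c d] by (simp add: sg_sym)

lemma kpi_eq: "bk \<Longrightarrow> ok c \<Longrightarrow> kpi c = kp c"
  using cm_cong[OF kp_simps(7)[OF bs], of "st c" "kp c"] kp_sym[of c] by (simp add: kp_sym)

text \<open>The strands are sorted by insertion, the smallest index first, after \<open>unsg\<close> has removed their signs.\<close>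

fun insert_arr :: "nat \<times> bool \<Rightarrow> (nat \<times> bool) list \<Rightarrow> 'b" where
  "insert_arr v [] = I [f v]"
| "insert_arr v (x # l) = (if fst v \<le> fst x then I (map f (v # x # l)) else (I [f x] \<odot> insert_arr v l) \<bullet> (sg (f v) (f x) \<odot> I (map f l)))"

primrec sort_arr :: "(nat \<times> bool) list \<Rightarrow> 'b" where
  "sort_arr [] = I []"
| "sort_arr (v # l) = insert_arr v (sort_key fst l) \<bullet> (I [f v] \<odot> sort_arr l)"

abbreviation "okf l \<equiv> list_all (\<lambda>v. ok (f v)) l"

lemma okf [simp]: "oks (map f l) = okf l"
  by (simp add: list_all_iff)

lemma okf_sort [simp]: "okf (insort_key fst v l) = (ok (f v) \<and> okf l)" "okf (sort_key fst l) = okf l"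
  by (simp_all add: list_all_iff set_insort_key)

lemma insert_arr_typ: "ok (f v) \<Longrightarrow> okf l \<Longrightarrow> left_inv (insert_arr v l) \<and> src (insert_arr v l) = map f (v # l) \<and> tgt (insert_arr v l) = map f (insort_key fst v l)"
proof (induction l)
  case (Cons x l)
  have "left_inv (sg (f v) (f x))" using Cons sg_sym[of "f v" "f x"] unfolding left_inv_def by (auto simp: T_def intro!: exI[of _ "sg (f x) (f v)"])
  then show ?case using Cons by (auto simp: left_inv_def[of "insert_arr v l"] intro!: left_inv_cm left_inv_hz left_inv_I)
qed (simp add: left_inv_I)

lemma insert_arr_simps [simp]:
  assumes "ok (f v)" "okf l"
  shows "arr (insert_arr v l)" "src (insert_arr v l) = f v # map f l" "tgt (insert_arr v l) = map f (insort_key fst v l)"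
  using insert_arr_typ[OF assms] by (auto simp: left_inv_def)

lemma sort_arr_typ: "okf l \<Longrightarrow> left_inv (sort_arr l) \<and> src (sort_arr l) = map f l \<and> tgt (sort_arr l) = map f (sort_key fst l)"
proof (induction l)
  case (Cons v l)
  then have "arr (sort_arr l)" by (simp add: left_inv_def)
  then show ?case using Cons insert_arr_typ[of v "sort_key fst l"] by (auto intro!: left_inv_cm left_inv_hz left_inv_I)
qed (simp add: left_inv_I)

lemma sort_arr_simps [simp]:
  assumes "okf l"
  shows "arr (sort_arr l)" "src (sort_arr l) = map f l" "tgt (sort_arr l) = map f (sort_key fst l)"
  using sort_arr_typ[OF assms] by (auto simp: left_inv_def)

text \<open>As long as the head \<open>x\<close> precedes both strands, the Yang-Baxter equation
  carries their crossing past it. Where an insertion stops, the symmetry of the crossing settles the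
  rest.\<close>

lemma insert_arr_swap:
  assumes "fst u < fst v" "ok (f u)" "ok (f v)"
  shows "okf l \<Longrightarrow> insert_arr u (insort_key fst v l) \<bullet> (I [f u] \<odot> insert_arr v l)
    = insert_arr v (insort_key fst u l) \<bullet> (I [f v] \<odot> insert_arr u l) \<bullet> (sg (f u) (f v) \<odot> I (map f l))"
proof (induction l)
  case Nil
  then show ?case using assms by (simp add: hz_I hz_I2 sg_sym)
next
  case (Cons x l)
  have s: "(sg (f v) (f u) \<odot> I (map f (x # l))) \<bullet> (sg (f u) (f v) \<odot> I (map f (x # l))) = I (f u # f v # map f (x # l))"
    using Cons assms by (simp add: interchange sg_sym hz_I)
  consider "fst v \<le> fst x" | "fst u \<le> fst x" "fst x < fst v" | "fst x < fst u" by linarith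
  then show ?case
  proof cases
    case 1
    then show ?thesis using Cons.prems assms s by (simp add: hz_I hz_I2)
  next
    case 2
    then show ?thesis using Cons.prems assms s by (simp add: hz_I hz_I2 cm_assoc)
  next
    case 3
    let ?x = "f x" and ?u = "f u" and ?v = "f v" and ?L = "I (map f l)"
    have o: "ok ?x" "ok ?u" "ok ?v" "okf l" using Cons.prems assms by simp_all
    \<comment> \<open>If \<open>x\<close> precedes both strands, their crossings with
      \<open>x\<close> can be done first, before both are inserted into \<open>l\<close>.\<close>
    have e: "insert_arr a (insort_key fst b (x # l)) \<bullet> (I [f a] \<odot> insert_arr b (x # l))
       = (I [?x] \<odot> (insert_arr a (insort_key fst b l) \<bullet> (I [f a] \<odot> insert_arr b l))) \<bullet> (((sg (f a) ?x \<odot> I [f b]) \<bullet> (I [f a] \<odot> sg (f b) ?x)) \<odot> ?L)"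
      if "fst x < fst a" "fst x < fst b" "ok (f a)" "ok (f b)" for a b
    proof -
      have "(sg (f a) ?x \<odot> I (map f (insort_key fst b l))) \<bullet> (I [f a] \<odot> I [?x] \<odot> insert_arr b l)
        = (I [?x] \<odot> I [f a] \<odot> insert_arr b l) \<bullet> (sg (f a) ?x \<odot> I [f b] \<odot> ?L)"
        using that o interchange[of "sg (f a) ?x" "I [?x, f a]" "I [f b] \<odot> ?L" "insert_arr b l"] interchange[of "I [f a, ?x]" "sg (f a) ?x" "insert_arr b l" "I (map f (insort_key fst b l))"]
        by (simp add: hz_assoc[symmetric] hz_I)
      from cm_cong[OF this, of "I [f a] \<odot> sg (f b) ?x \<odot> ?L"] show ?thesis
        using that o by (simp add: whisker_left whisker_right hz_assoc cm_assoc)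
    qed
    have yb: "((sg ?v ?x \<odot> I [?u]) \<bullet> (I [?v] \<odot> sg ?u ?x)) \<bullet> (sg ?u ?v \<odot> I [?x])
      = (I [?x] \<odot> sg ?u ?v) \<bullet> (sg ?u ?x \<odot> I [?v]) \<bullet> (I [?u] \<odot> sg ?v ?x)"
      using yang_baxter[OF bs o(2,3,1)] by (simp add: cm_assoc)
    have xu: "fst x < fst v" using 3 assms by simp
    have "insert_arr v (insort_key fst u (x # l)) \<bullet> (I [?v] \<odot> insert_arr u (x # l)) \<bullet> (sg ?u ?v \<odot> I (map f (x # l)))
      = (I [?x] \<odot> (insert_arr v (insort_key fst u l) \<bullet> (I [?v] \<odot> insert_arr u l))) \<bullet> ((((sg ?v ?x \<odot> I [?u]) \<bullet> (I [?v] \<odot> sg ?u ?x)) \<bullet> (sg ?u ?v \<odot> I [?x])) \<odot> ?L)"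
    proof -
      have c: "sg ?u ?v \<odot> I (map f (x # l)) = (sg ?u ?v \<odot> I [?x]) \<odot> ?L" using o by (simp add: hz_assoc hz_I)
      show ?thesis unfolding cm_assoc[symmetric] e[OF xu 3 o(3,2)] c using o by (simp add: cm_assoc whisker_right)
    qed
    also have "\<dots> = (I [?x] \<odot> (insert_arr v (insort_key fst u l) \<bullet> (I [?v] \<odot> insert_arr u l) \<bullet> (sg ?u ?v \<odot> ?L))) \<bullet> (((sg ?u ?x \<odot> I [?v]) \<bullet> (I [?u] \<odot> sg ?v ?x)) \<odot> ?L)"
      unfolding yb using o by (simp add: cm_assoc whisker_left whisker_right hz_assoc)
    also have "\<dots> = insert_arr u (insort_key fst v (x # l)) \<bullet> (I [?u] \<odot> insert_arr v (x # l))"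
      unfolding Cons.IH[OF o(4), symmetric] e[OF 3 xu o(2,3)] by simp
    finally show ?thesis by simp
  qed
qed

text \<open>The indices have to differ because sorting keeps the order of strands with equal index
  and could not absorb their crossing. Behind a common prefix the claim is whiskered; at the front
  it reduces to \<open>insert_arr_swap\<close>.\<close>

lemma sort_arr_swap:
  assumes "fst c \<noteq> fst d"
  shows "okf (p @ c # d # r) \<Longrightarrow> sort_key fst (p @ d # c # r) = sort_key fst (p @ c # d # r) \<and>
    sort_arr (p @ d # c # r) \<bullet> (I (map f p) \<odot> sg (f c) (f d) \<odot> I (map f r)) = sort_arr (p @ c # d # r)"
proof (induction p)
  case Nil
  then have o: "ok (f c)" "ok (f d)" "okf r" by simp_all
  let ?R = "sort_key fst r" and ?c = "f c" and ?d = "f d"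
  have s: "insert_arr d (insort_key fst c ?R) \<bullet> (I [?d] \<odot> insert_arr c ?R) \<bullet> (sg ?c ?d \<odot> I (map f ?R)) = insert_arr c (insort_key fst d ?R) \<bullet> (I [?c] \<odot> insert_arr d ?R)"
  proof (cases "fst c < fst d")
    case True
    show ?thesis using insert_arr_swap[OF True o(1,2), of ?R] o by simp
  next
    case False
    then have dc: "fst d < fst c" using assms by simp
    have "(sg ?d ?c \<odot> I (map f ?R)) \<bullet> (sg ?c ?d \<odot> I (map f ?R)) = I (?c # ?d # map f ?R)"
      using o by (simp add: interchange sg_sym hz_I)
    then show ?thesis using cm_cong[OF insert_arr_swap[OF dc o(2,1), of ?R], of "sg ?c ?d \<odot> I (map f ?R)"] o
      by (simp add: cm_assoc)
  qed
  have i: "(I [?d, ?c] \<odot> sort_arr r) \<bullet> (sg ?c ?d \<odot> I (map f r)) = sg ?c ?d \<odot> sort_arr r" "(sg ?c ?d \<odot> I (map f ?R)) \<bullet> (I [?c, ?d] \<odot> sort_arr r) = sg ?c ?d \<odot> sort_arr r"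
    using o by (simp_all add: interchange)
  have "sort_arr (d # c # r) \<bullet> (sg ?c ?d \<odot> I (map f r)) = insert_arr d (insort_key fst c ?R) \<bullet> (I [?d] \<odot> insert_arr c ?R) \<bullet> (sg ?c ?d \<odot> sort_arr r)"
    using o by (simp add: whisker_left cm_assoc hz_I2 i)
  also have "\<dots> = (insert_arr d (insort_key fst c ?R) \<bullet> (I [?d] \<odot> insert_arr c ?R) \<bullet> (sg ?c ?d \<odot> I (map f ?R))) \<bullet> (I [?c, ?d] \<odot> sort_arr r)"
    by (simp add: cm_assoc i)
  also have "\<dots> = sort_arr (c # d # r)"
    unfolding s using o hz_assoc[of "I [?c]" "I [?d]" "sort_arr r"] by (simp add: whisker_left cm_assoc hz_I)
  finally show ?case using o insort_key_left_comm[of fst c d ?R, OF assms] by simp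
next
  case (Cons v p)
  let ?m = "I (map f p) \<odot> sg (f c) (f d) \<odot> I (map f r)"
  have o: "ok (f v)" "okf p" "ok (f c)" "ok (f d)" "okf r" using Cons.prems by simp_all
  have IH: "sort_key fst (p @ d # c # r) = sort_key fst (p @ c # d # r)" "sort_arr (p @ d # c # r) \<bullet> ?m = sort_arr (p @ c # d # r)"
    using Cons by simp_all
  have "sort_arr (v # p @ d # c # r) \<bullet> (I [f v] \<odot> ?m) = insert_arr v (sort_key fst (p @ d # c # r)) \<bullet> (I [f v] \<odot> (sort_arr (p @ d # c # r) \<bullet> ?m))"
    using o by (simp add: whisker_left cm_assoc del: sort_key_simps)
  also have "\<dots> = sort_arr (v # p @ c # d # r)" unfolding IH by simp
  finally show ?case using o IH(1) by (simp add: hz_assoc[symmetric] hz_I)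
qed

text \<open>In the absence of twists no word changes a sign, and the signs are kept; otherwise a
  sign \<open>True\<close> is removed by one twist.\<close>

definition unsign :: "nat \<times> bool \<Rightarrow> nat \<times> bool" where "unsign v = (if bk then (fst v, False) else v)"
definition unsg :: "nat \<times> bool \<Rightarrow> 'b" where "unsg v = (if bk \<and> snd v then kp (f v) else I [f v])"

lemma f_unsign: "f (unsign v) = (if bk \<and> snd v then st (f v) else f v)"
  using f_flip_sign[of v] by (cases v) (auto simp: unsign_def flip_sign_def)

lemma unsg_simps [simp]:
  assumes "ok (f v)"
  shows "arr (unsg v)" "src (unsg v) = [f v]" "tgt (unsg v) = [f (unsign v)]" "ok (f (unsign v))"
  using assms by (auto simp: unsg_def f_unsign)

text \<open>Symmetry allows the crossings in BP1 to be moved to the other side, which lets a twist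
  slide through a crossing on either strand. These are the facts \<open>A\<close> and
  \<open>B\<close>.\<close>

lemma unsg_sg:
  assumes "ok (f c)" "ok (f d)"
  shows "(unsg d \<odot> unsg c) \<bullet> sg (f c) (f d) = sg (f (unsign c)) (f (unsign d)) \<bullet> (unsg c \<odot> unsg d)"
proof -
  have A: "(I [d] \<odot> kp c) \<bullet> sg c d = sg (st c) d \<bullet> (kp c \<odot> I [d])" if "ok c" "ok d" bk for c d
    using that kp_behind[OF that(3,1,2)] by (simp add: cm_assoc sg_sym)
  have B: "(kp d \<odot> I [c]) \<bullet> sg c d = sg c (st d) \<bullet> (I [c] \<odot> kp d)" if "ok c" "ok d" bk for c d
  proof -
    have "sg c (st d) \<bullet> sg (st d) c = I [st d, c]" using that by (simp add: sg_sym)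
    from cm_cong[OF this, of "(kp d \<odot> I [c]) \<bullet> sg c d"] show ?thesis
      using that kp_behind[OF that(3,2,1)] by simp
  qed
  show ?thesis
  proof (cases "bk \<and> snd c \<and> snd d")
    case True
    then have k: bk "unsg c = kp (f c)" "unsg d = kp (f d)" "f (unsign c) = st (f c)" "f (unsign d) = st (f d)"
      unfolding unsg_def f_unsign by simp_all
    have "(kp (f d) \<odot> kp (f c)) \<bullet> sg (f c) (f d) = (kp (f d) \<odot> I [st (f c)]) \<bullet> (I [f d] \<odot> kp (f c)) \<bullet> sg (f c) (f d)"
      using assms k(1) by (simp add: cm_assoc[symmetric] interchange)
    also have "\<dots> = ((kp (f d) \<odot> I [st (f c)]) \<bullet> sg (st (f c)) (f d)) \<bullet> (kp (f c) \<odot> I [f d])"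
      unfolding A[OF assms k(1)] by (simp only: cm_assoc)
    also have "\<dots> = sg (st (f c)) (st (f d)) \<bullet> (kp (f c) \<odot> kp (f d))"
      using B[of "st (f c)" "f d"] assms k(1) by (simp add: cm_assoc interchange)
    finally show ?thesis unfolding k .
  next
    case False
    then show ?thesis using A[OF assms] B[OF assms] assms by (auto simp: unsg_def f_unsign hz_I)
  qed
qed

text \<open>Removes the signs, then sorts. As this absorbs every letter and can be cancelled on the
  left, it makes the value of a word a function of the strands at its two ends.\<close>

definition nrm :: "(nat \<times> bool) list \<Rightarrow> 'b" where "nrm l = sort_arr (map unsign l) \<bullet> hl unsg l"

lemma hl_unsg: "okf l \<Longrightarrow> left_inv (hl unsg l) \<and> src (hl unsg l) = map f l \<and> tgt (hl unsg l) = map f (map unsign l)"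
proof (induction l)
  case (Cons v l)
  have "left_inv (unsg v)"
  proof (cases "bk \<and> snd v")
    case True
    have u: "unsg v = kp (f v)" using True unfolding unsg_def by simp
    show ?thesis using True Cons.prems kp_sym[of "f v"] unfolding u left_inv_def by (auto simp: T_def intro!: exI[of _ "kp (st (f v))"])
  next
    case False
    then show ?thesis using Cons.prems by (auto simp: unsg_def intro: left_inv_I)
  qed
  then show ?case using Cons by (auto simp: left_inv_def[of "hl unsg l"] intro!: left_inv_hz)
qed (simp add: left_inv_I)

lemma hl_unsg_simps [simp]:
  assumes "okf l"
  shows "arr (hl unsg l)" "src (hl unsg l) = map f l" "tgt (hl unsg l) = map f (map unsign l)" "okf (map unsign l)"
proof -
  show "okf (map unsign l)" using assms by (simp add: list_all_iff)
qed (use hl_unsg[OF assms] in \<open>auto simp: left_inv_def\<close>)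

lemma nrm_letter:
  assumes "fst x \<in> cgens bk (length l)" "okf l" "distinct (map fst l)"
  shows "nrm (perm_letter flip_sign x l) \<bullet> letter (map f l) x = nrm l \<and> okf (perm_letter flip_sign x l) \<and> distinct (map fst (perm_letter flip_sign x l))"
  using assms(1)
proof (cases rule: cgens_cases)
  case (Sig p c d r b)
  have o: "okf p" "ok (f c)" "ok (f d)" "okf r" using assms(2) Sig by auto
  let ?h = "hl unsg"
  have ap: "?h (p @ a # b # r) = ?h p \<odot> (unsg a \<odot> unsg b) \<odot> ?h r" if "ok (f a)" "ok (f b)" for a b
  proof -
    have "?h (p @ a # b # r) = ?h p \<odot> ?h (a # b # r)"
    proof (rule hl_append)
      fix v assume "v \<in> set p \<union> set (a # b # r)"
      then have "ok (f v)" using that o by (auto simp: list_all_iff)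
      then show "arr (unsg v)" by simp
    qed
    then show ?thesis using that o by (simp add: hz_assoc)
  qed
  have l: "letter (map f l) x = I (map f p) \<odot> sg (f c) (f d) \<odot> I (map f r)"
    using Sig o letter_at[of _ "map f p" "f c" "f d" "map f r" b] sgi_eq by simp
  have ne: "fst (unsign c) \<noteq> fst (unsign d)" using assms(3) Sig by (auto simp: unsign_def)
  have "?h (p @ d # c # r) \<bullet> letter (map f l) x = (I (map f (map unsign p)) \<odot> sg (f (unsign c)) (f (unsign d)) \<odot> I (map f (map unsign r))) \<bullet> ?h (p @ c # d # r)"
    unfolding l ap[OF o(3,2)] ap[OF o(2,3)] using o by (simp add: interchange unsg_sg del: map_map)
  then have "nrm (p @ d # c # r) \<bullet> letter (map f l) x = (sort_arr (map unsign p @ unsign d # unsign c # map unsign r) \<bullet>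
     (I (map f (map unsign p)) \<odot> sg (f (unsign c)) (f (unsign d)) \<odot> I (map f (map unsign r)))) \<bullet> ?h (p @ c # d # r)"
    by (simp add: nrm_def cm_assoc)
  also have "\<dots> = nrm (p @ c # d # r)"
    using sort_arr_swap[OF ne, of "map unsign p" "map unsign r"] o by (simp add: nrm_def del: map_map)
  finally show ?thesis using Sig o assms(3) by (auto simp: swap_strands_at)
next
  case (Kap c r b)
  have o: "ok (f c)" "okf r" using assms(2) Kap by auto
  have l: "letter (map f l) x = kp (f c) \<odot> I (map f r)" using Kap o kpi_eq by simp
  have u: "unsg (flip_sign c) \<bullet> kp (f c) = unsg c" "unsign (flip_sign c) = unsign c" "ok (f (flip_sign c))" "src (unsg (flip_sign c)) = [st (f c)]"
    using Kap o kp_sym[of "f c"] unfolding unsg_def unsign_def by (auto simp: f_flip_sign)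
  have "hl unsg (flip_sign c # r) \<bullet> letter (map f l) x = hl unsg (c # r)"
    unfolding l using u o kp_simps(1-3)[OF bs Kap(1) o(1)] by (simp add: interchange)
  then show ?thesis using Kap(2,3) o u assms(3) by (simp add: nrm_def cm_assoc)
qed

lemma nrm_bw:
  "wfb (length l) w \<Longrightarrow> okf l \<Longrightarrow> distinct (map fst l) \<Longrightarrow>
    nrm (perm flip_sign w l) \<bullet> bw (map f l) w = nrm l \<and> okf (perm flip_sign w l) \<and> distinct (map fst (perm flip_sign w l)) \<and> map f (perm flip_sign w l) = perm st w (map f l)"
proof (induction w)
  case Nil
  then show ?case by (simp add: nrm_def cm_assoc)
next
  case (Cons x w)
  then have IH: "nrm (perm flip_sign w l) \<bullet> bw (map f l) w = nrm l" "okf (perm flip_sign w l)" "distinct (map fst (perm flip_sign w l))" "map f (perm flip_sign w l) = perm st w (map f l)"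
    by auto
  have x: "fst x \<in> cgens bk (length (perm flip_sign w l))" using Cons.prems by simp
  note L = nrm_letter[OF x IH(2,3)]
  have "nrm (perm_letter flip_sign x (perm flip_sign w l)) \<bullet> letter (perm st w (map f l)) x \<bullet> bw (map f l) w = nrm l"
    using cm_cong[OF conjunct1[OF L], of "bw (map f l) w"] IH(1,4) by simp
  moreover have "map f (perm flip_sign (x # w) l) = perm st (x # w) (map f l)"
    using perm_map[of bk l "x # w" UNIV f flip_sign st] Cons.prems(1) f_flip_sign by simp
  ultimately show ?case using L by simp
qed

text \<open>Followed by the normalising arrow of their common target, both words yield the
  normalising arrow of \<open>l\<close>; that arrow is cancelled.\<close>

lemma symmetric_bw:
  assumes "wfb (length l) u" "wfb (length l) v" "okf l" "distinct (map fst l)" "perm flip_sign u l = perm flip_sign v l"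
  shows "bw (map f l) u = bw (map f l) v"
proof -
  note U = nrm_bw[OF assms(1,3,4)] and V = nrm_bw[OF assms(2,3,4)]
  let ?m = "perm flip_sign u l"
  have o: "okf ?m" "okf (map unsign ?m)" using U hl_unsg_simps(4) by blast+
  have n: "left_inv (nrm ?m)" "src (nrm ?m) = map f ?m" unfolding nrm_def
    using sort_arr_typ[OF o(2)] hl_unsg[OF o(1)] o by (auto intro: left_inv_cm)
  have t: "T (bw (map f l) u) (map f l) (map f ?m)" "T (bw (map f l) v) (map f l) (map f ?m)"
    using T_bw[OF bs, of "map f l" u] T_bw[OF bs, of "map f l" v] assms U V by simp_all
  show ?thesis using left_inv_cancel[OF n(1), of "bw (map f l) u" "bw (map f l) v"] n(2) t U V assms(5) by (simp add: T_def)
qed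

end
end

section \<open>Group elements, words and distinct strands\<close>

lemma word_eq_sgw: "word_eq G R u v \<Longrightarrow> word_eq (Sig ` G) (map_prod sgw sgw ` R) (sgw u) (sgw v)"
proof (induction rule: word_eq.induct)
  case (refl w)
  then show ?case by (intro word_eq.refl) (auto simp: sgw_def)
next
  case (cancel x b)
  then show ?case using word_eq.cancel[of "Sig x" "Sig ` G" _ b] by simp
next
  case (rel u v)
  then show ?case by (intro word_eq.rel) force
qed (auto intro: word_eq.intros)

text \<open>Reflexivity is available for words over \<open>G\<close>, so \<open>v\<close> lies in
  its own class, and hence in that of \<open>u\<close>.\<close>

lemma group_elem_eq: "group_elem G R u = group_elem G R v \<Longrightarrow> set v \<subseteq> G \<times> UNIV \<Longrightarrow> word_eq G R u v"
  using word_eq.refl[of v G R] by (auto simp: group_elem_def)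

lemma linear_length: "linear n xs \<Longrightarrow> length xs = n"
  using distinct_card[of xs] by (simp add: linear_def)

lemma distinct_fst:
  assumes "fst ` set l = set xs" "length l = length xs" "distinct xs"
  shows "distinct (map fst l)"
  by (rule card_distinct) (use assms distinct_card[of xs] in simp)

lemma distinct_astrands: "distinct (avars s) \<Longrightarrow> distinct (map fst (astrands s))"
  by (rule distinct_fst) (use fst_strands[of s False] length_strands[of s False] in \<open>simp_all add: strands_False\<close>)

lemma distinct_mstrands: "distinct (mvars s) \<Longrightarrow> distinct (map fst (mstrands s))"
  by (rule distinct_fst) (simp_all add: fst_mstrands)

section \<open>Coherence in the abstract model\<close>

context strict_pair begin

text \<open>The condition on \<kappa> is imposed only where twists are present, so that the regular
  module of a symmetric category is covered.\<close>

definition symm where "symm \<longleftrightarrow> (\<forall>X \<in> Ob A. \<forall>Y \<in> Ob A. \<sigma> Y X \<cdot> \<sigma> X Y = ide A (X \<otimes> Y)) \<and>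
   (bk \<longrightarrow> (\<forall>c. okc c \<longrightarrow> ar (\<Phi> (\<Phi> (ob c)), False) c (tinv A (ob c)) \<bullet> kq (\<Phi> (ob c), False) \<bullet> kq c = I [c]))"

lemma sgm_symm:
  assumes bs symm "okc c" "okc d"
  shows "sgm d c \<bullet> sgm c d = I [c, d]"
proof -
  let ?s = "ar (ob c \<otimes> ob d, False) (ob d \<otimes> ob c, False) (\<sigma> (ob c) (ob d))" and ?t = "ar (ob d \<otimes> ob c, False) (ob c \<otimes> ob d, False) (\<sigma> (ob d) (ob c))"
  have h: "\<sigma> (ob c) (ob d) \<in> hom A (ob c \<otimes> ob d) (ob d \<otimes> ob c)" "\<sigma> (ob d) (ob c) \<in> hom A (ob d \<otimes> ob c) (ob c \<otimes> ob d)"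
    using sigma_hom[OF assms(1)] assms by simp_all
  have "?t \<bullet> ?s = I [(ob c \<otimes> ob d, False)]"
    using assms h ar_ide[of "(ob c \<otimes> ob d, False)"] by (simp add: ar_cm symm_def)
  from cm_cong[OF this, of "mui c d"] have "?t \<bullet> ?s \<bullet> mui c d = mui c d" using assms by simp
  then show ?thesis using cm_cong[OF mu_simps(7)[OF assms(4,3)], of "?s \<bullet> mui c d"] assms h
    by (simp add: sgm_def cm_assoc)
qed

text \<open>One of the two comparisons \<open>kar\<close> is moved through \<kappa> by naturality.
  Their composite is then \<open>t\<close> for either sign, by \<open>Phi_t\<close> if the strand
  carries \<Phi>.\<close>

lemma kap_symm:
  assumes bk symm and c: "okc c"
  shows "kap (stt c) \<bullet> kap c = I [c]"
proof -
  let ?p = "(\<Phi> (ob c), False)" and ?q = "(\<Phi> (ob (stt c)), False)" and ?pp = "(\<Phi> (\<Phi> (ob c)), False)"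
  have k: "kar c \<in> hom A (ob ?p) (ob (stt c))" "Phi_ar A (kar c) \<in> hom A (ob ?pp) (ob ?q)" "kar (stt c) \<in> hom A (ob ?q) (ob c)"
    using kar_hom[of c] kar_hom[of "stt c"] c by simp_all
  have t: "kar (stt c) \<cdot> Phi_ar A (kar c) = tinv A (ob c)"
  proof (cases "snd c")
    case True
    then have "tinv A (\<Phi> (fst c)) \<in> hom A (\<Phi> (\<Phi> (\<Phi> (fst c)))) (\<Phi> (fst c))" using c by simp
    from cmp_ide[OF this] show ?thesis using c True by (simp add: kar_def ob_def stt_def Phi_t)
  next
    case False
    then have "tinv A (fst c) \<in> hom A (\<Phi> (\<Phi> (fst c))) (fst c)" using c by simp
    from cmp_ide[OF this] show ?thesis using c False by (simp add: kar_def ob_def stt_def Phi_ide)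
  qed
  have n: "kq (stt c) \<bullet> ar ?p (stt c) (kar c) = ar ?pp ?q (Phi_ar A (kar c)) \<bullet> kq ?p"
    using kq_nat[OF assms(1), of ?p "stt c" "kar c"] c k by simp
  have "kap (stt c) \<bullet> kap c = ar ?q c (kar (stt c)) \<bullet> (kq (stt c) \<bullet> ar ?p (stt c) (kar c)) \<bullet> kq c"
    by (simp add: kap_def cm_assoc)
  also have "\<dots> = (ar ?q c (kar (stt c)) \<bullet> ar ?pp ?q (Phi_ar A (kar c))) \<bullet> kq ?p \<bullet> kq c"
    unfolding n by (simp only: cm_assoc)
  also have "ar ?q c (kar (stt c)) \<bullet> ar ?pp ?q (Phi_ar A (kar c)) = ar ?pp c (tinv A (ob c))"
    using ar_cm[of ?pp ?q c "Phi_ar A (kar c)" "kar (stt c)"] c k t by simp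
  finally show ?thesis using assms unfolding symm_def by simp
qed

lemma symmetric_words:
  assumes bs symm "wfw bk (length l) u" "wfw bk (length l) v" "\<And>i. i \<in> fst ` set l \<Longrightarrow> X i \<in> Ob A" "distinct (map fst l)" "perm flip_sign u l = perm flip_sign v l"
  shows "S.bw (map (cl X) l) u = S.bw (map (cl X) l) v"
proof (rule S.symmetric_bw[OF assms(1) _ _ _ assms(3,4) _ assms(6,7)])
  show "list_all (\<lambda>v. okc (cl X v)) l" using assms(5) by (auto simp: list_all_iff)
qed (use sgm_symm[OF assms(1,2)] kap_symm[OF _ assms(2)] in simp_all)

text \<open>Cancelling the canonical arrow of the target gives equality of the images under
  \<open>ar\<close>; that \<open>ar\<close> is faithful must come from a concrete model.\<close>

lemma a_coherent:
  assumes f: "a_structural b n f S T'" and g: "a_structural b n g S T'" and b: "b = Braided \<Longrightarrow> bs" and X: "Xok X S"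
    and c: "b \<noteq> Braided \<or> underlying_braid n f = underlying_braid n g \<or> symm"
  shows "ar (aob A X S, False) (aob A X T', False) (aeval A \<sigma> f X) = ar (aob A X S, False) (aob A X T', False) (aeval A \<sigma> g X)"
    "aeval A \<sigma> f X \<in> hom A (aob A X S) (aob A X T')"
proof -
  let ?l = "map (cl X) (astrands S)"
  have v: "avalid b f" "asrc f = S" "atgt f = T'" "avalid b g" "asrc g = S" "atgt g = T'" and l: "linear n (avars S)"
    using f g by (simp_all add: a_structural_def)
  have n: "length (astrands S) = n" using length_strands[of S False] linear_length[OF l] by (simp add: strands_False)
  have ok: "list_all okc ?l" using X in_strands[of _ S False] by (fastforce simp: list_all_iff Xok_def strands_False)
  note flip_sign = avalid_strands[OF v(1), of False, unfolded v] and sg = avalid_strands[OF v(4), of False, unfolded v]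
  have W: "fst ` set (abraid f) \<subseteq> {1..<n}" "fst ` set (abraid g) \<subseteq> {1..<n}" using flip_sign sg linear_length[OF l] by simp_all
  have w: "S.bw ?l (sgw (abraid f)) = S.bw ?l (sgw (abraid g))"
  proof (cases "b = Braided")
    case False
    then show ?thesis using Monoidal_abraid[OF v(1)] Monoidal_abraid[OF v(4)] by simp
  next
    case True
    then have bs: bs using b by simp
    show ?thesis
    proof (cases symm)
      case True
      show ?thesis
      proof (rule symmetric_words[OF bs True])
        show "distinct (map fst (astrands S))" using l by (intro distinct_astrands) (simp add: linear_def)
        show "perm flip_sign (sgw (abraid f)) (astrands S) = perm flip_sign (sgw (abraid g)) (astrands S)"
          using flip_sign sg by (simp add: sign_word_def strands_False)
        show "X i \<in> Ob A" if "i \<in> fst ` set (astrands S)" for i using that X fst_strands[of S False] by (simp add: strands_False Xok_def)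
      qed (use W n in \<open>simp_all add: wfw_sgw\<close>)
    next
      case False
      then have e: "word_eq {1..<n} (braid_rels n) (abraid f) (abraid g)"
        using c \<open>b = Braided\<close> W(2) unfolding underlying_braid_def braid_def by (intro group_elem_eq) auto
      have "wfw bk n (sgw (abraid f)) \<and> wfw bk n (sgw (abraid g)) \<and> (\<forall>l. length l = n \<and> list_all okc l \<longrightarrow>
          S.bw l (sgw (abraid f)) = S.bw l (sgw (abraid g)) \<and> perm stt (sgw (abraid f)) l = perm stt (sgw (abraid g)) l)"
        by (rule S.word_eq_bw[OF bs word_eq_sgw[OF e]]) (use S.braid_rels_bw[OF bs] in \<open>auto simp: cgens_def\<close>)
      then show ?thesis using ok n by simp
    qed
  qed
  have F: "aeval A \<sigma> f X \<in> hom A (aob A X S) (aob A X T')" "Xok X T'"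
    "normal X T' False \<bullet> ae (aob A X S) (aob A X T') (aeval A \<sigma> f X) False = S.bw ?l (sgw (abraid f)) \<bullet> normal X S False"
    using aeval_normal[OF v(1) b, of X False] v X by (simp_all add: sign_word_def strands_False)
  have G: "aeval A \<sigma> g X \<in> hom A (aob A X S) (aob A X T')"
    "normal X T' False \<bullet> ae (aob A X S) (aob A X T') (aeval A \<sigma> g X) False = S.bw ?l (sgw (abraid g)) \<bullet> normal X S False"
    using aeval_normal[OF v(4) b, of X False] v X by (simp_all add: sign_word_def strands_False)
  show "aeval A \<sigma> f X \<in> hom A (aob A X S) (aob A X T')" by (rule F(1))
  have "ae (aob A X S) (aob A X T') (aeval A \<sigma> f X) False = ae (aob A X S) (aob A X T') (aeval A \<sigma> g X) False"
    by (rule left_inv_cancel[OF left_inv_normal[OF F(2), of False]]) (use F G w X in simp_all)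
  then show "ar (aob A X S, False) (aob A X T', False) (aeval A \<sigma> f X) = ar (aob A X S, False) (aob A X T', False) (aeval A \<sigma> g X)"
    by (simp add: ae_def)
qed

lemma m_coherent:
  assumes f: "m_structural b n f S T'" and g: "m_structural b n g S T'" and b: "b = Braided \<Longrightarrow> bs \<and> bk" and X: "Mok X S"
    and c: "b \<noteq> Braided \<or> underlying_cyl_braid n f = underlying_cyl_braid n g \<or> symm"
  shows "m_arr f X = m_arr g X"
proof -
  let ?l = "map (cl X) (mstrands S)"
  have v: "mvalid b f" "msrc f = S" "mtgt f = T'" "mvalid b g" "msrc g = S" "mtgt g = T'" and l: "linear n (mvars S)"
    using f g by (simp_all add: m_structural_def)
  have n: "length (mstrands S) = n" using linear_length[OF l] by simp
  have ok: "list_all okc ?l" by (rule Mok_okc[OF X])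
  note flip_sign = mvalid_strands[OF v(1), unfolded v] and sg = mvalid_strands[OF v(4), unfolded v]
  have w: "S.bw ?l (mbraid f) = S.bw ?l (mbraid g)"
  proof (cases "b = Braided")
    case False
    then show ?thesis using Monoidal_mbraid[OF v(1)] Monoidal_mbraid[OF v(4)] by simp
  next
    case True
    then have bs: bs and bk: bk using b by auto
    have W: "wfw bk n (mbraid f)" "wfw bk n (mbraid g)" using flip_sign sg linear_length[OF l] True bk by simp_all
    show ?thesis
    proof (cases symm)
      case True
      show ?thesis
      proof (rule symmetric_words[OF bs True])
        show "distinct (map fst (mstrands S))" using l by (intro distinct_mstrands) (simp add: linear_def)
        show "perm flip_sign (mbraid f) (mstrands S) = perm flip_sign (mbraid g) (mstrands S)" using flip_sign sg by simp
        show "X i \<in> Ob A" if "i \<in> fst ` set (mstrands S)" for i using that X unfolding fst_mstrands Mok_def by blast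
      qed (use W n in simp_all)
    next
      case ns: False
      show ?thesis
      \<comment> \<open>For \<open>n = 0\<close> the generator \<open>Kap\<close> has no strand on
        which it could be evaluated, but then both words are empty.\<close>
      proof (cases "n = 0")
        case True
        then show ?thesis using W wfw_Kap_nil by metis
      next
        case False
        have "set (mbraid g) \<subseteq> insert Kap (Sig ` {1..<n}) \<times> UNIV"
          using W(2) unfolding wfw_def cgens_def by (fastforce split: if_splits)
        then have e: "word_eq (insert Kap (Sig ` {1..<n})) (cyl_rels n) (mbraid f) (mbraid g)"
          using c ns \<open>b = Braided\<close> unfolding underlying_cyl_braid_def cyl_braid_def by (intro group_elem_eq) auto
        have "wfw bk n (mbraid f) \<and> wfw bk n (mbraid g) \<and> (\<forall>l. length l = n \<and> list_all okc l \<longrightarrow>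
            S.bw l (mbraid f) = S.bw l (mbraid g) \<and> perm stt (mbraid f) l = perm stt (mbraid g) l)"
        proof (rule S.word_eq_bw[OF bs e])
          show "wfw bk n u \<and> wfw bk n v \<and> (\<forall>l. length l = n \<and> list_all okc l \<longrightarrow> S.bw l u = S.bw l v \<and> perm stt u l = perm stt v l)"
            if "(u, v) \<in> cyl_rels n" for u v using S.cyl_rels_bw[OF bs that bk] False by blast
          show "insert Kap (Sig ` {1..<n}) \<subseteq> cgens bk n" using False bk by (auto simp: cgens_def)
        qed
        then show ?thesis using ok n by simp
      qed
    qed
  qed
  note F = m_arr_normal[OF v(1) b, of X, unfolded v] and G = m_arr_normal[OF v(4) b, of X, unfolded v]
  have T': "Mok X T'" using F X by blast
  show ?thesis
    by (rule left_inv_cancel[OF left_inv_m_normal[OF T']]) (use F G w X m_normal_T[OF T'] in \<open>simp_all add: T_def\<close>)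
qed

end

section \<open>Components of the abstract arrows\<close>

context pair_model begin

lemma act_mblk: "act P (X.mblk Y s) = mob A M P Y s"
  by (induction s) simp_all

text \<open>\<open>mar\<close> applies \<open>u\<close> and all morphisms of \<open>A\<close> at
  once, whereas the model first whiskers \<open>u\<close> and then acts by the morphisms on the
  blocks. Functoriality of the action reconciles the two.\<close>

lemma mar_eq:
  "(\<And>i. i \<in> set (mvars s) \<Longrightarrow> g i \<in> hom A (Y i) (Z i)) \<Longrightarrow> u \<in> hom M P Q \<Longrightarrow>
    cp (E.hl (\<lambda>t. X.ae (aob A Y t) (aob A Z t) (aar A g t) False) (margs s)) Q \<cdot>\<^bsub>M\<^esub> actm u (X.mblk Y s) = mar A M u g s"
proof (induction s)
  case MVar
  then show ?case using M.homD[OF MVar(2)] by (simp add: X.mblk_def)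
next
  case (MAct s t)
  let ?H = "\<lambda>t. X.ae (aob A Y t) (aob A Z t) (aar A g t) False"
  have u: "u \<in> Ar M" "dm M u = P" "cd M u = Q" "P \<in> Ob M" "Q \<in> Ob M" using M.homD[OF MAct.prems(2)] by auto
  have ty: "E.T (E.hl ?H (margs s)) (X.mblk Y s) (X.mblk Z s)" by (rule conjunct1[OF X.m_normal_nat]) (use MAct in simp)
  have g: "aar A g t \<in> hom A (aob A Y t) (aob A Z t)" by (rule X.aar_hom) (use MAct in simp)
  have o: "okl (X.mblk Y s)" "aob A Y t \<in> Ob A" "aob A Z t \<in> Ob A" using E.T_okD(1)[OF ty] homD(4,5)[OF g] by auto
  have h: "?H t = xar (aob A Y t, False) (aob A Z t, False) (aar A g t)" "vl (?H t)" using g o by (simp_all add: X.ae_def)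
  have ap: "E.hl ?H (margs (MAct s t)) = hc (E.hl ?H (margs s)) (?H t)"
  proof -
    have "E.hl ?H (margs s @ [t]) = hc (E.hl ?H (margs s)) (E.hl ?H [t])"
    proof (rule E.hl_append)
      fix r assume "r \<in> set (margs s) \<union> set [t]"
      then have r: "set (avars r) \<subseteq> set (mvars (MAct s t))" by (auto simp: mvars_margs)
      have "aar A g r \<in> hom A (aob A Y r) (aob A Z r)" by (rule X.aar_hom) (use MAct.prems(1) r in blast)
      then show "vl (?H r)" using homD(4,5) by simp
    qed
    then show ?thesis using h(2) by simp
  qed
  have IH: "cp (E.hl ?H (margs s)) Q \<cdot>\<^bsub>M\<^esub> actm u (X.mblk Y s) = mar A M u g s" using MAct by simp
  have k: "cp (E.hl ?H (margs s)) Q \<in> Ar M" "dm M (cp (E.hl ?H (margs s)) Q) = act Q (X.mblk Y s)" "cd M (cp (E.hl ?H (margs s)) Q) = act Q (X.mblk Z s)"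
    using ty u by (simp_all add: E.T_def)
  have i: "ide A (aob A Y t) \<in> hom A (aob A Y t) (aob A Y t)" using o by simp
  have oz: "act Q (X.mblk Z s) \<in> Ob M" using u E.T_okD(2)[OF ty] by simp
  have "cp (E.hl ?H (margs (MAct s t))) Q \<cdot>\<^bsub>M\<^esub> actm u (X.mblk Y (MAct s t))
    = (ide M (act Q (X.mblk Z s)) \<unlhd>\<^bsub>M\<^esub> aar A g t) \<cdot>\<^bsub>M\<^esub> ((cp (E.hl ?H (margs s)) Q \<unlhd>\<^bsub>M\<^esub> ide A (aob A Y t)) \<cdot>\<^bsub>M\<^esub> (actm u (X.mblk Y s) \<unlhd>\<^bsub>M\<^esub> ide A (aob A Y t)))"
    unfolding ap using ty h u o k oz act_Ar[OF _ g] act_Ar[OF _ i] by (simp add: E.T_def)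
  also have "(cp (E.hl ?H (margs s)) Q \<unlhd>\<^bsub>M\<^esub> ide A (aob A Y t)) \<cdot>\<^bsub>M\<^esub> (actm u (X.mblk Y s) \<unlhd>\<^bsub>M\<^esub> ide A (aob A Y t)) = mar A M u g s \<unlhd>\<^bsub>M\<^esub> ide A (aob A Y t)"
    using act_cmp[OF _ _ _ i i, of "actm u (X.mblk Y s)" "cp (E.hl ?H (margs s)) Q"] u k o IH cmp_ide[OF i] by simp
  also have "(ide M (act Q (X.mblk Z s)) \<unlhd>\<^bsub>M\<^esub> aar A g t) \<cdot>\<^bsub>M\<^esub> (mar A M u g s \<unlhd>\<^bsub>M\<^esub> ide A (aob A Y t)) = mar A M u g (MAct s t)"
  proof -
    have "mar A M u g s \<in> hom M (act P (X.mblk Y s)) (act Q (X.mblk Z s))" unfolding IH[symmetric] using u k o by (simp add: hom_def)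
    from ide_act_nat(1)[OF this g] show ?thesis by simp
  qed
  finally show ?case .
qed

text \<open>Connects the model with the semantics of presentations: an equation between the abstract
  arrows can be read off at every object of \<open>M\<close>.\<close>

lemma cp_m_arr:
  "mvalid b f \<Longrightarrow> (b = Braided \<Longrightarrow> bs \<and> bk) \<Longrightarrow> P \<in> Ob M \<Longrightarrow> X.Mok Y (msrc f) \<Longrightarrow>
    cp (X.m_arr f Y) P = meval A M \<sigma> \<kappa> f P Y"
proof (induction b f arbitrary: P Y rule: mvalid.induct)
  case (1 b)
  then show ?case by simp
next
  case (2 b c)
  then show ?case by (cases c) auto
next
  case (3 b c)
  then show ?case by (cases c) (auto simp: M.inv_ide)
next
  case (4 b g f)
  then have v: "mvalid b g" "mvalid b f" "msrc g = mtgt f" by auto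
  have m: "X.Mok Y (msrc f)" using 4 by simp
  have F: "E.T (X.m_arr f Y) (X.mblk Y (msrc f)) (X.mblk Y (mtgt f))" "X.Mok Y (mtgt f)" using X.m_arr_normal[OF v(2) 4(4) m] by auto
  have G: "E.T (X.m_arr g Y) (X.mblk Y (msrc g)) (X.mblk Y (mtgt g))" using X.m_arr_normal[OF v(1) 4(4)] F(2) v(3) by auto
  show ?case using F G v 4 by (simp add: E.T_def)
next
  case (5 b \<eta> \<mu> \<theta>s)
  let ?k = "length \<theta>s" and ?S = "\<lambda>i. map asrc \<theta>s ! i"
  have v: "mvalid b \<eta>" "mvalid b \<mu>" and v\<theta>: "\<And>i. i < ?k \<Longrightarrow> avalid b (\<theta>s ! i)" and lin: "set (mvars (msrc \<eta>)) = {..<?k}"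
    using 5(3) by (auto simp: linear_def)
  have bb: "b = Braided \<Longrightarrow> bs" using 5(4) by auto
  have Xs: "X.Xok Y (?S i)" if "i < ?k" for i
    using 5(6) that lin by (auto simp: X.Xok_def X.Mok_def mvars_subst)
  have Xm: "X.Mok Y (msrc \<mu>)" using 5(6) by (auto simp: X.Mok_def mvars_subst)
  define Y1 where "Y1 i = aob A Y (?S i)" for i
  define Y2 where "Y2 i = map (\<lambda>\<theta>. aob A Y (atgt \<theta>)) \<theta>s ! i" for i
  define g where "g i = map (\<lambda>\<theta>. aeval A \<sigma> \<theta> Y) \<theta>s ! i" for i
  have Th: "aeval A \<sigma> (\<theta>s ! i) Y \<in> hom A (aob A Y (asrc (\<theta>s ! i))) (aob A Y (atgt (\<theta>s ! i)))"
    if "i < ?k" for i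
    using X.aeval_normal[OF v\<theta>[OF that] bb, of Y] Xs[OF that] that by simp
  have gi: "g i \<in> hom A (Y1 i) (Y2 i)" if "i \<in> set (mvars (msrc \<eta>))" for i
    using Th that lin by (simp add: Y1_def Y2_def g_def)
  have Y2\<eta>: "X.Mok Y2 (msrc \<eta>)" using homD(5)[OF gi] by (simp add: X.Mok_def)
  have U: "E.T (X.m_arr \<mu> Y) (X.mblk Y (msrc \<mu>)) (X.mblk Y (mtgt \<mu>))" using X.m_arr_normal[OF v(2) 5(4) Xm] by blast
  have H: "E.T (X.m_arr \<eta> Y2) (X.mblk Y2 (msrc \<eta>)) (X.mblk Y2 (mtgt \<eta>))" using X.m_arr_normal[OF v(1) 5(4) Y2\<eta>] by blast
  let ?R = "E.hl (\<lambda>t. X.ae (aob A Y1 t) (aob A Y2 t) (aar A g t) False) (margs (msrc \<eta>))"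
  have R: "E.T ?R (X.mblk Y1 (msrc \<eta>)) (X.mblk Y2 (msrc \<eta>))" using X.m_normal_nat[of "msrc \<eta>" g Y1 Y2, OF gi] by blast
  let ?Q = "act P (X.mblk Y (mtgt \<mu>))"
  have Q: "?Q \<in> Ob M" using 5(5) E.T_okD(2)[OF U] by simp
  have u: "cp (X.m_arr \<mu> Y) P \<in> hom M (act P (X.mblk Y (msrc \<mu>))) ?Q" using U 5(5) by (simp add: E.T_def hom_def)
  have uo: "okl (X.mblk Y1 (msrc \<eta>))" using E.T_okD(1)[OF R] .
  have "cp (X.m_arr (MHor \<eta> \<mu> \<theta>s) Y) P = cp (X.m_arr \<eta> Y2) ?Q \<cdot>\<^bsub>M\<^esub> (cp ?R ?Q \<cdot>\<^bsub>M\<^esub> actm (cp (X.m_arr \<mu> Y) P) (X.mblk Y1 (msrc \<eta>)))"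
  proof -
    have "X.m_arr (MHor \<eta> \<mu> \<theta>s) Y = hc (X.m_arr \<mu> Y) (vc (X.m_arr \<eta> Y2) ?R)"
      by (simp add: Y1_def[abs_def] Y2_def[abs_def] g_def[abs_def])
    then show ?thesis using U H R Q 5(5) uo by (simp add: E.T_def)
  qed
  also have "cp ?R ?Q \<cdot>\<^bsub>M\<^esub> actm (cp (X.m_arr \<mu> Y) P) (X.mblk Y1 (msrc \<eta>)) = mar A M (cp (X.m_arr \<mu> Y) P) g (msrc \<eta>)"
    by (rule mar_eq[OF _ u]) (rule gi)
  also have "cp (X.m_arr \<eta> Y2) ?Q = meval A M \<sigma> \<kappa> \<eta> (mob A M P Y (mtgt \<mu>)) Y2"
    using 5(1)[OF v(1) 5(4) Q Y2\<eta>] by (simp add: act_mblk)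
  also have "cp (X.m_arr \<mu> Y) P = meval A M \<sigma> \<kappa> \<mu> P Y" by (rule 5(2)[OF v(2) 5(4,5) Xm])
  finally show ?case by (simp add: Y2_def[abs_def] g_def[abs_def])
qed

lemma m_equal:
  assumes "m_structural b n f S T" "m_structural b n g S T" "b = Braided \<Longrightarrow> bs \<and> bk"
    "b \<noteq> Braided \<or> underlying_cyl_braid n f = underlying_cyl_braid n g \<or> X.symm"
  shows "m_equal A M \<sigma> \<kappa> n f g"
  unfolding m_equal_def
proof (intro allI impI)
  fix P Y assume a: "P \<in> Ob M \<and> (\<forall>i<n. Y i \<in> Ob A)"
  then have Y: "X.Mok Y S" using assms(1) by (simp add: X.Mok_def m_structural_def linear_def)
  have v: "mvalid b f" "msrc f = S" "mvalid b g" "msrc g = S" using assms(1,2) by (simp_all add: m_structural_def)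
  show "meval A M \<sigma> \<kappa> f P Y = meval A M \<sigma> \<kappa> g P Y"
    using X.m_coherent[OF assms(1,2,3) Y assms(4)] cp_m_arr[OF v(1) assms(3), of P Y] cp_m_arr[OF v(3) assms(3), of P Y] a Y v by simp
qed

end

section \<open>Coherence\<close>

text \<open>The regular module, on which \<open>A\<close> acts faithfully.\<close>

definition reg :: "('o, 'a, 'y) inv_moncat_scheme \<Rightarrow> ('o, 'a, 'o, 'a) modcat" where
  "reg A = \<lparr>Ob = Ob A, Ar = Ar A, dm = dm A, cd = cd A, ide = ide A, cmp = cmp A,
     act_ob = ten_ob A, act_ar = ten_ar A, mas = asc A, mun = run A, pt = unit A\<rparr>"

lemma reg_simps [simp]:
  "Ob (reg A) = Ob A" "Ar (reg A) = Ar A" "dm (reg A) = dm A" "cd (reg A) = cd A" "ide (reg A) = ide A" "cmp (reg A) = cmp A"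
  "act_ob (reg A) = ten_ob A" "act_ar (reg A) = ten_ar A" "mas (reg A) = asc A" "mun (reg A) = run A" "pt (reg A) = unit A"
  by (simp_all add: reg_def)

lemma reg_hom [simp]: "hom (reg A) = hom A" "iso (reg A) = iso A" "reg A \<times>\<^sub>c C = A \<times>\<^sub>c C"
  by (simp_all add: hom_def iso_def inverse_arrows_def prod_cat_def fun_eq_iff)

lemma reg_functor [simp]: "is_functor C (reg A) Fo Fa = is_functor C A Fo Fa"
    "nat_iso C (reg A) Fo Fa Go Ga \<eta> = nat_iso C A Fo Fa Go Ga \<eta>" "nat_iso (reg A) D Go' Ga' Ho Ha \<theta> = nat_iso A D Go' Ga' Ho Ha \<theta>"
  by (simp_all add: is_functor_def nat_iso_def)

lemma reg_pair:
  assumes "anti_involution A"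
  shows "Z2_monoidal_pair A (reg A)"
proof -
  interpret anti_involution A by (rule assms)
  show ?thesis
  proof
    show "f \<in> Ar (reg A) \<Longrightarrow> dm (reg A) f \<in> Ob (reg A) \<and> cd (reg A) f \<in> Ob (reg A)" for f using dm_cd by simp
  qed (use ide_hom cmp_hom cmp_ide cmp_assoc ten_functor asc_nat_iso run_nat_iso pentagon triangle unit_ob in simp_all)
qed

lemma a_equal:
  assumes A: "anti_involution A" and b: "b = Braided \<Longrightarrow> braiding A \<sigma>"
    and f: "a_structural b n f S T" and g: "a_structural b n g S T"
    and c: "b \<noteq> Braided \<or> underlying_braid n f = underlying_braid n g \<or>
      (\<forall>X \<in> Ob A. \<forall>Y \<in> Ob A. \<sigma> Y X \<cdot>\<^bsub>A\<^esub> \<sigma> X Y = ide A (X \<otimes>\<^bsub>A\<^esub> Y))"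
  shows "a_equal A \<sigma> n f g"
  unfolding a_equal_def
proof (intro allI impI)
  interpret anti_involution A by (rule A)
  interpret R: Z2_monoidal_pair A "reg A" by (rule reg_pair[OF A])
  \<comment> \<open>No twist is given on the regular module, so twists are switched off and a dummy
    stands for \<kappa>.\<close>
  interpret R: pair_model A "reg A" \<sigma> "\<lambda>_ _. undefined" "b = Braided" False
    by unfold_locales (use b in simp_all)
  fix X assume "\<forall>i<n. X i \<in> Ob A"
  then have X: "R.X.Xok X S" using f by (simp add: R.X.Xok_def a_structural_def linear_def)
  have c': "b \<noteq> Braided \<or> underlying_braid n f = underlying_braid n g \<or> R.X.symm" using c by (auto simp: R.X.symm_def)
  let ?f = "aeval A \<sigma> f X" and ?g = "aeval A \<sigma> g X" and ?x = "aob A X S" and ?y = "aob A X T"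
  note F = R.X.a_coherent[OF f g _ X c'] and G = R.X.a_coherent(2)[OF g g _ X]
  have h: "?f \<in> hom A ?x ?y" "?g \<in> hom A ?x ?y" using F(2) G by auto
  then have o: "?x \<in> Ob A" "?y \<in> Ob A" using homD by auto
  \<comment> \<open>The component at the unit is whiskering with the unit object. Since
    \<open>lun\<close> is natural and invertible, the morphism can be recovered from it, so
    \<open>A\<close> acts faithfully on itself.\<close>
  have "ide A \<one>\<^bsub>A\<^esub> \<boxtimes>\<^bsub>A\<^esub> ?f = ide A \<one>\<^bsub>A\<^esub> \<boxtimes>\<^bsub>A\<^esub> ?g"
    using arg_cong[OF F(1), of "\<lambda>e. R.cp e \<one>\<^bsub>A\<^esub>"] by simp
  then have e: "?f \<cdot>\<^bsub>A\<^esub> lun A ?x = ?g \<cdot>\<^bsub>A\<^esub> lun A ?x"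
    using nat_isoD(3)[OF lun_nat_iso h(1)] nat_isoD(3)[OF lun_nat_iso h(2)] by simp
  have i: "inv_arrow A (lun A ?x) \<in> hom A ?x (\<one>\<^bsub>A\<^esub> \<otimes>\<^bsub>A\<^esub> ?x)" "lun A ?x \<cdot>\<^bsub>A\<^esub> inv_arrow A (lun A ?x) = ide A ?x"
    using inv_arrow_props[OF lun_hom lun_iso] o by auto
  have "k = (k \<cdot>\<^bsub>A\<^esub> lun A ?x) \<cdot>\<^bsub>A\<^esub> inv_arrow A (lun A ?x)" if "k \<in> hom A ?x ?y" for k
    using cmp_assoc[OF i(1) lun_hom[OF o(1)] that] i(2) cmp_ide[OF that] by simp
  from this[OF h(1)] this[OF h(2)] show "?f = ?g" unfolding e by simp
qed

lemma (in Z2_braided_pair) braided: "braiding A \<sigma>"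
  unfolding braiding_def using \<sigma>_nat_iso hexagon1 hexagon2 Phi_braided by blast

theorem theorem1p9:
  fixes A :: "('o, 'a) inv_moncat" and M :: "('p, 'b, 'o, 'a) modcat"
    and \<sigma> :: "'o \<Rightarrow> 'o \<Rightarrow> 'a" and \<kappa> :: "'p \<Rightarrow> 'o \<Rightarrow> 'b"
  shows
   "(Z2_monoidal_pair A M \<longrightarrow>
       (\<forall>n f g S T. a_structural Monoidal n f S T \<and> a_structural Monoidal n g S T
          \<longrightarrow> a_equal A \<sigma> n f g) \<and>
       (\<forall>n f g S T. m_structural Monoidal n f S T \<and> m_structural Monoidal n g S T
          \<longrightarrow> m_equal A M \<sigma> \<kappa> n f g))
    \<and>
    (Z2_braided_pair A M \<sigma> \<kappa> \<longrightarrow>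
       (\<forall>n f g S T. a_structural Braided n f S T \<and> a_structural Braided n g S T
          \<and> underlying_braid n f = underlying_braid n g
          \<longrightarrow> a_equal A \<sigma> n f g) \<and>
       (\<forall>n f g S T. m_structural Braided n f S T \<and> m_structural Braided n g S T
          \<and> underlying_cyl_braid n f = underlying_cyl_braid n g
          \<longrightarrow> m_equal A M \<sigma> \<kappa> n f g))
    \<and>
    (Z2_symmetric_pair A M \<sigma> \<kappa> \<longrightarrow>
       (\<forall>n f g S T. a_structural Braided n f S T \<and> a_structural Braided n g S T
          \<longrightarrow> a_equal A \<sigma> n f g) \<and>
       (\<forall>n f g S T. m_structural Braided n f S T \<and> m_structural Braided n g S T
          \<longrightarrow> m_equal A M \<sigma> \<kappa> n f g))"
proof (intro conjI impI)
  assume "Z2_monoidal_pair A M"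
  then interpret Z2_monoidal_pair A M .
  \<comment> \<open>Here \<sigma> and \<kappa> are arbitrary functions; with both flags off, nothing
    is required of them.\<close>
  interpret P: pair_model A M \<sigma> \<kappa> False False by unfold_locales simp_all
  show "\<forall>n f g S T. a_structural Monoidal n f S T \<and> a_structural Monoidal n g S T \<longrightarrow> a_equal A \<sigma> n f g"
    using a_equal[OF anti_involution_axioms] by blast
  show "\<forall>n f g S T. m_structural Monoidal n f S T \<and> m_structural Monoidal n g S T \<longrightarrow> m_equal A M \<sigma> \<kappa> n f g"
    using P.m_equal by blast
next
  assume p: "Z2_braided_pair A M \<sigma> \<kappa>"
  then interpret Z2_braided_pair A M \<sigma> \<kappa> .
  interpret P: pair_model A M \<sigma> \<kappa> True True by unfold_locales (use p braided in simp_all)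
  show "\<forall>n f g S T. a_structural Braided n f S T \<and> a_structural Braided n g S T
          \<and> underlying_braid n f = underlying_braid n g \<longrightarrow> a_equal A \<sigma> n f g"
    using a_equal[OF anti_involution_axioms braided] by blast
  show "\<forall>n f g S T. m_structural Braided n f S T \<and> m_structural Braided n g S T
          \<and> underlying_cyl_braid n f = underlying_cyl_braid n g \<longrightarrow> m_equal A M \<sigma> \<kappa> n f g"
    using P.m_equal by blast
next
  assume "Z2_symmetric_pair A M \<sigma> \<kappa>"
  then interpret Z2_symmetric_pair A M \<sigma> \<kappa> .
  have p: "Z2_braided_pair A M \<sigma> \<kappa>" by unfold_locales
  interpret P: pair_model A M \<sigma> \<kappa> True True by unfold_locales (use p braided in simp_all)
  \<comment> \<open>Symmetry of the braiding supplies the third alternative in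
    \<open>a_equal\<close>, in place of equal braids.\<close>
  show "\<forall>n f g S T. a_structural Braided n f S T \<and> a_structural Braided n g S T \<longrightarrow> a_equal A \<sigma> n f g"
    using a_equal[OF anti_involution_axioms braided] \<sigma>_symmetric by blast
  \<comment> \<open>The symmetry axiom for \<kappa> as an equation of transformations, which is the
    part of \<open>P.X.symm\<close> that concerns twists.\<close>
  have "vc (xar (\<Phi>\<^bsub>A\<^esub> (\<Phi>\<^bsub>A\<^esub> (ob c)), False) c (tinv A (ob c))) (vc (xkq \<kappa> (\<Phi>\<^bsub>A\<^esub> (ob c), False)) (xkq \<kappa> c)) = vi [c]" if "fst c \<in> Ob A" for c
  proof (rule vl_eqI)
    have t: "tinv A (ob c) \<in> hom A (ob (\<Phi>\<^bsub>A\<^esub> (\<Phi>\<^bsub>A\<^esub> (ob c)), False)) (ob c)" using that by simp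
    show "vl (vc (xar (\<Phi>\<^bsub>A\<^esub> (\<Phi>\<^bsub>A\<^esub> (ob c)), False) c (tinv A (ob c))) (vc (xkq \<kappa> (\<Phi>\<^bsub>A\<^esub> (ob c), False)) (xkq \<kappa> c)))" "vl (vi [c])"
      "sr (vc (xar (\<Phi>\<^bsub>A\<^esub> (\<Phi>\<^bsub>A\<^esub> (ob c)), False) c (tinv A (ob c))) (vc (xkq \<kappa> (\<Phi>\<^bsub>A\<^esub> (ob c), False)) (xkq \<kappa> c))) = sr (vi [c])"
      "tg (vc (xar (\<Phi>\<^bsub>A\<^esub> (\<Phi>\<^bsub>A\<^esub> (ob c)), False) c (tinv A (ob c))) (vc (xkq \<kappa> (\<Phi>\<^bsub>A\<^esub> (ob c), False)) (xkq \<kappa> c))) = tg (vi [c])"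
      using that t by simp_all
    fix Q assume "Q \<in> Ob M"
    then show "cp (vc (xar (\<Phi>\<^bsub>A\<^esub> (\<Phi>\<^bsub>A\<^esub> (ob c)), False) c (tinv A (ob c))) (vc (xkq \<kappa> (\<Phi>\<^bsub>A\<^esub> (ob c), False)) (xkq \<kappa> c))) Q = cp (vi [c]) Q"
      using that t \<kappa>_symmetric[of Q "ob c"] by simp
  qed
  then have "P.X.symm" unfolding P.X.symm_def using \<sigma>_symmetric by blast
  then show "\<forall>n f g S T. m_structural Braided n f S T \<and> m_structural Braided n g S T \<longrightarrow> m_equal A M \<sigma> \<kappa> n f g"
    using P.m_equal by blast
qed

end
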